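(* Let $m,p,n$ be positive integers with $p\mid m$ and $m$ even, let $k\subseteq\mathbb C$ be a subfield containing the $m$-th roots of unity, $G=G(m,p,n)$, $W=\mu(G(m,p,n))$, and let $\underline c=\{\underline c_1,\underline c_\zeta:\zeta\in C_{m/p}\setminus\{1\}\}$ be $k$-valued parameters and $c=-\underline c$. The cocycle twist of the restricted rational Cherednik algebra $\overline H_c(G)$ by the cocycle $\mathcal F$ is isomorphic, as a $k$-algebra, to $\overline{\underline H}_{\underline c}(W)$. This algebra has triangular decomposition $$\overline{\underline H}_{\underline c}(W)\cong S_{-1}(V)/I_W\otimes kW\otimes S_{-1}(V^* )/I_W'=\underline S_W\otimes kW\otimes\underline S_W'$$ into the group algebra of $W$ and two noncommutative coinvariant algebras.
   Context: $C_r$ is the group of $r$-th roots of unity. $G(m,p,n)$ (resp. $\mu(G(m,p,n))$) is the group of $n\times n$ monomial matrices whose non-zero entries are $m$-th roots of unity and whose product of non-zero entries (resp. determinant) is an $\frac mp$-th root of unity. They act on $V=k^n$ with basis $x_1,\dots,x_n$, and on $V^*$ with dual basis $y_1,\dots,y_n$. For $i\ne j$: $s_{ij}^{(\epsilon)}$ sends $x_i\mapsto\epsilon^{-1}x_j$, $x_j\mapsto\epsilon x_i$; $\sigma_{ij}^{(\epsilon)}$ sends $x_i\mapsto\epsilon^{-1}x_j$, $x_j\mapsto-\epsilon x_i$; $t_i^{(\epsilon)}$ sends $x_i\mapsto\epsilon x_i$; each fixes the other basis vectors. $t_i=t_i^{(-1)}$. $H_{0,c}(G)$ is the unital $k$-algebra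 generated by $x_i,y_i$ and $kG$ with relations (for $i\neq j$, $g\in G$) $x_ix_j=x_jx_i$, $y_iy_j=y_jy_i$, $gx_i=g(x_i)g$, $gy_i=g(y_i)g$, $y_ix_j-x_jy_i=c_1\sum_{\epsilon\in C_m}\epsilon s_{ij}^{(\epsilon)}$, $y_ix_i-x_iy_i=-c_1\sum_{j\neq i}\sum_{\epsilon\in C_m}s_{ij}^{(\epsilon)}-\sum_{\zeta\in C_{m/p}\setminus\{1\}}c_\zeta t_i^{(\zeta)}$. $\underline H_{0,\underline c}(W)$ is the unital $k$-algebra generated by $x_i,y_i$ and $kW$ with relations (for $i\neq j$, $g\in W$) $x_ix_j=-x_jx_i$, $y_iy_j=-y_jy_i$, $gx_i=g(x_i)g$, $gy_i=g(y_i)g$, $y_ix_j+x_jy_i=\underline c_1\sum_{\epsilon\in C_m}\epsilon\sigma_{ij}^{(\epsilon)}$, $y_ix_i-x_iy_i=\underline c_1\sum_{j\neq i}\sum_{\epsilon\in C_m}\sigma_{ij}^{(\epsilon)}+\sum_{\zeta\in C_{m/p}\setminus\{1\}}\underline c_\zeta t_i^{(\zeta)}$. $\overline H_c(G)=H_{0,c}(G)/(I,I')$, where $I$ (resp. $I'$) is the ideal of $S(V)$ (resp. $S(V^* )$) generated by homogeneous $G$-invariants of positive degree, and $(I,I')$ is the two-sided ideal generated by both. $\overline{\underline H}_{\underline c}(W)=\underline H_{0,\underline c}(W)/(I_W,I_W')$, where $S_{-1}(V)$, $S_{-1}(V^* )$ are the algebras generated by the $x_i$ (resp. $y_i$) with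 $x_ix_j=-x_jx_i$ (resp. $y_iy_j=-y_jy_i$) for $i\ne j$, and $I_W\subseteq S_{-1}(V)$, $I_W'\subseteq S_{-1}(V^* )$ are the two-sided ideals generated by homogeneous $W$-invariants of positive degree. $\underline S_W=S_{-1}(V)/I_W$ and $\underline S_W'=S_{-1}(V^* )/I_W'$. Triangular decomposition means that multiplication gives a $k$-linear isomorphism from the tensor product of the three subalgebras onto the algebra. $T=\langle t_1,\dots,t_n\rangle\cong(C_2)^n$ acts on $H_{0,c}(G)$ by algebra automorphisms, $t_i\rhd g=t_igt_i$ for $g\in G$, $t_i\rhd x_j=(-1)^{\delta_{ij}}x_j$, $t_i\rhd y_j=(-1)^{\delta_{ij}}y_j$, and this induces an action on $\overline H_c(G)$. $\mathcal F=\mathcal F^{-1}=\prod_{1\le j<i\le n}\frac12(1\otimes1+t_i\otimes1+1\otimes t_j-t_i\otimes t_j)\in kT\otimes kT$. The cocycle twist of a $kT$-module algebra $(A,m)$ by $\mathcal F$ is the space $A$ with product $m\circ(\mathcal F^{-1}\rhd)$. *)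

theory Defs
  imports
    "HOL-Library.Poly_Mapping"
    "HOL-Algebra.QuotRing"
    "HOL-Algebra.Subrings"
    "HOL-Algebra.Generated_Groups"
    "HOL-Algebra.Algebraic_Closure_Type"
    "Jordan_Normal_Form.Determinant"
begin

hide_const (open) Multiset.mult Polynomial.smult

section \<open>Algebras over a subfield of the complex numbers\<close>

text \<open>A subfield \<open>K\<close> of the complex numbers is a set of complex numbers; \<open>scalars K\<close> is the
  corresponding ring record. Modules and unital associative algebras over \<open>K\<close> are records of type
  \<^typ>\<open>(complex, 'a) module\<close>.\<close>

definition scalars :: "complex set \<Rightarrow> complex ring" where
  "scalars K = ring_of_type_algebra\<lparr>carrier := K\<rparr>"

locale assoc_algebra = Module.module R M + ring M for R (structure) and M (structure) +
  assumes smult_mult_left: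
      "\<lbrakk>a \<in> carrier R; x \<in> carrier M; y \<in> carrier M\<rbrakk> \<Longrightarrow>
        (a \<odot>\<^bsub>M\<^esub> x) \<otimes>\<^bsub>M\<^esub> y = a \<odot>\<^bsub>M\<^esub> (x \<otimes>\<^bsub>M\<^esub> y)"
    and smult_mult_right:
      "\<lbrakk>a \<in> carrier R; x \<in> carrier M; y \<in> carrier M\<rbrakk> \<Longrightarrow>
        x \<otimes>\<^bsub>M\<^esub> (a \<odot>\<^bsub>M\<^esub> y) = a \<odot>\<^bsub>M\<^esub> (x \<otimes>\<^bsub>M\<^esub> y)"

definition algebra_hom ::
  "complex set \<Rightarrow> (complex, 'a) module \<Rightarrow> (complex, 'b) module \<Rightarrow> ('a \<Rightarrow> 'b) set" where
  "algebra_hom K A B =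
     {f \<in> Ring.ring_hom A B. \<forall>c\<in>K. \<forall>a\<in>carrier A. f (c \<odot>\<^bsub>A\<^esub> a) = c \<odot>\<^bsub>B\<^esub> f a}"

definition algebra_iso ::
  "complex set \<Rightarrow> (complex, 'a) module \<Rightarrow> (complex, 'b) module \<Rightarrow> ('a \<Rightarrow> 'b) set" where
  "algebra_iso K A B = {f \<in> algebra_hom K A B. bij_betw f (carrier A) (carrier B)}"

definition linear_iso ::
  "complex set \<Rightarrow> (complex, 'a) module \<Rightarrow> (complex, 'b) module \<Rightarrow> ('a \<Rightarrow> 'b) set" where
  "linear_iso K M N =
     {f. bij_betw f (carrier M) (carrier N)
       \<and> (\<forall>x\<in>carrier M. \<forall>y\<in>carrier M. f (x \<oplus>\<^bsub>M\<^esub> y) = f x \<oplus>\<^bsub>N\<^esub> f y)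
       \<and> (\<forall>c\<in>K. \<forall>x\<in>carrier M. f (c \<odot>\<^bsub>M\<^esub> x) = c \<odot>\<^bsub>N\<^esub> f x)}"

text \<open>The quotient \<^const>\<open>FactRing\<close>, with the induced scalar multiplication. It is also used for
  quotients of plain modules, where the multiplicative part carries no information.\<close>

definition quotient_algebra :: "(complex, 'a) module \<Rightarrow> 'a set \<Rightarrow> (complex, 'a set) module" where
  "quotient_algebra A I =
     \<lparr>carrier = carrier (A Quot I), mult = mult (A Quot I), one = one (A Quot I),
      zero = zero (A Quot I), add = add (A Quot I),
      smult = (\<lambda>c C. \<Union>a\<in>C. I +>\<^bsub>A\<^esub> (c \<odot>\<^bsub>A\<^esub> a))\<rparr>"

text \<open>The map from a quotient of \<open>A'\<close> to the quotient of \<open>A\<close> by \<open>I\<close> induced by \<open>f: A' \<rightarrow> A\<close>, for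
  \<open>f\<close> sending the ideal that is divided out in \<open>A'\<close> into \<open>I\<close>.\<close>

definition induced_map :: "(complex, 'b) module \<Rightarrow> 'b set \<Rightarrow> ('a \<Rightarrow> 'b) \<Rightarrow> 'a set \<Rightarrow> 'b set" where
  "induced_map A I f C = (\<Union>a\<in>C. I +>\<^bsub>A\<^esub> f a)"


subsection \<open>Monoid algebras, free algebras and presentations\<close>

definition free_module :: "complex set \<Rightarrow> 's set \<Rightarrow> (complex, 's \<Rightarrow>\<^sub>0 complex) module" where
  "free_module K S =
     \<lparr>carrier = {f. Poly_Mapping.keys f \<subseteq> S \<and> (\<forall>s. Poly_Mapping.lookup f s \<in> K)},
      mult = undefined, one = undefined, zero = 0, add = (+),
      smult = (\<lambda>c. Poly_Mapping.map (\<lambda>z. c * z))\<rparr>"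

definition monoid_algebra :: "complex set \<Rightarrow> 's monoid \<Rightarrow> (complex, 's \<Rightarrow>\<^sub>0 complex) module" where
  "monoid_algebra K M =
     (free_module K (carrier M))
      \<lparr>mult := (\<lambda>f g. \<Sum>u\<in>Poly_Mapping.keys f. \<Sum>v\<in>Poly_Mapping.keys g.
                 Poly_Mapping.single (u \<otimes>\<^bsub>M\<^esub> v) (Poly_Mapping.lookup f u * Poly_Mapping.lookup g v)),
       one := Poly_Mapping.single \<one>\<^bsub>M\<^esub> 1\<rparr>"

definition free_monoid :: "'g set \<Rightarrow> 'g list monoid" where
  "free_monoid A = \<lparr>carrier = lists A, mult = (@), one = []\<rparr>"

definition free_algebra :: "complex set \<Rightarrow> 'g set \<Rightarrow> (complex, 'g list \<Rightarrow>\<^sub>0 complex) module" where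
  "free_algebra K A = monoid_algebra K (free_monoid A)"

text \<open>The endomorphism of the free algebra given on generators by \<open>\<phi>\<close>.\<close>

definition free_endo ::
  "complex set \<Rightarrow> 'g set \<Rightarrow> ('g \<Rightarrow> ('g list \<Rightarrow>\<^sub>0 complex))
    \<Rightarrow> ('g list \<Rightarrow>\<^sub>0 complex) \<Rightarrow> ('g list \<Rightarrow>\<^sub>0 complex)" where
  "free_endo K A \<phi> f =
     (let F = free_algebra K A in
      \<Sum>w\<in>Poly_Mapping.keys f. Poly_Mapping.lookup f w \<odot>\<^bsub>F\<^esub> foldr (\<lambda>a u. \<phi> a \<otimes>\<^bsub>F\<^esub> u) w \<one>\<^bsub>F\<^esub>)"

definition relation_ideal ::
  "complex set \<Rightarrow> 'g set \<Rightarrow> ('g list \<Rightarrow>\<^sub>0 complex) set \<Rightarrow> ('g list \<Rightarrow>\<^sub>0 complex) set" where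
  "relation_ideal K A R = genideal (free_algebra K A) R"

definition presented_algebra ::
  "complex set \<Rightarrow> 'g set \<Rightarrow> ('g list \<Rightarrow>\<^sub>0 complex) set
    \<Rightarrow> (complex, ('g list \<Rightarrow>\<^sub>0 complex) set) module" where
  "presented_algebra K A R = quotient_algebra (free_algebra K A) (relation_ideal K A R)"


subsection \<open>Tensor products and triangular decompositions\<close>

definition tensor_relations ::
  "complex set \<Rightarrow> (complex, 'a) module \<Rightarrow> (complex, 'b) module \<Rightarrow> ('a \<times> 'b \<Rightarrow>\<^sub>0 complex) set" where
  "tensor_relations K M N =
     {Poly_Mapping.single (a \<oplus>\<^bsub>M\<^esub> a', b) 1 - Poly_Mapping.single (a, b) 1
        - Poly_Mapping.single (a', b) 1 | a a' b.
        a \<in> carrier M \<and> a' \<in> carrier M \<and> b \<in> carrier N}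
   \<union> {Poly_Mapping.single (a, b \<oplus>\<^bsub>N\<^esub> b') 1 - Poly_Mapping.single (a, b) 1
        - Poly_Mapping.single (a, b') 1 | a b b'.
        a \<in> carrier M \<and> b \<in> carrier N \<and> b' \<in> carrier N}
   \<union> {Poly_Mapping.single (c \<odot>\<^bsub>M\<^esub> a, b) 1 - Poly_Mapping.single (a, b) c | a b c.
        a \<in> carrier M \<and> b \<in> carrier N \<and> c \<in> K}
   \<union> {Poly_Mapping.single (a, c \<odot>\<^bsub>N\<^esub> b) 1 - Poly_Mapping.single (a, b) c | a b c.
        a \<in> carrier M \<and> b \<in> carrier N \<and> c \<in> K}"

definition tensor_submodule ::
  "complex set \<Rightarrow> (complex, 'a) module \<Rightarrow> (complex, 'b) module \<Rightarrow> ('a \<times> 'b \<Rightarrow>\<^sub>0 complex) set" where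
  "tensor_submodule K M N =
     \<Inter>{U. submodule U (scalars K) (free_module K (carrier M \<times> carrier N))
          \<and> tensor_relations K M N \<subseteq> U}"

text \<open>As a \<open>K\<close>-module only: its multiplicative part is meaningless.\<close>

definition tensor ::
  "complex set \<Rightarrow> (complex, 'a) module \<Rightarrow> (complex, 'b) module
    \<Rightarrow> (complex, ('a \<times> 'b \<Rightarrow>\<^sub>0 complex) set) module" where
  "tensor K M N = quotient_algebra (free_module K (carrier M \<times> carrier N)) (tensor_submodule K M N)"

definition pure_tensor ::
  "complex set \<Rightarrow> (complex, 'a) module \<Rightarrow> (complex, 'b) module \<Rightarrow> 'a \<Rightarrow> 'b
    \<Rightarrow> ('a \<times> 'b \<Rightarrow>\<^sub>0 complex) set" where
  "pure_tensor K M N a b =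
     tensor_submodule K M N +>\<^bsub>free_module K (carrier M \<times> carrier N)\<^esub> Poly_Mapping.single (a, b) 1"

definition triangular_decomposition ::
  "complex set \<Rightarrow> (complex, 'h) module
    \<Rightarrow> (complex, 'a) module \<Rightarrow> (complex, 'b) module \<Rightarrow> (complex, 'c) module
    \<Rightarrow> ('a \<Rightarrow> 'h) \<Rightarrow> ('b \<Rightarrow> 'h) \<Rightarrow> ('c \<Rightarrow> 'h) \<Rightarrow> bool" where
  "triangular_decomposition K H A B C \<alpha> \<beta> \<gamma> \<longleftrightarrow>
     \<alpha> \<in> algebra_hom K A H \<and> inj_on \<alpha> (carrier A) \<and>
     \<beta> \<in> algebra_hom K B H \<and> inj_on \<beta> (carrier B) \<and>
     \<gamma> \<in> algebra_hom K C H \<and> inj_on \<gamma> (carrier C) \<and>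
     (\<exists>\<mu> \<in> linear_iso K (tensor K (tensor K A B) C) H.
        \<forall>a\<in>carrier A. \<forall>b\<in>carrier B. \<forall>c\<in>carrier C.
          \<mu> (pure_tensor K (tensor K A B) C (pure_tensor K A B a b) c)
            = \<alpha> a \<otimes>\<^bsub>H\<^esub> \<beta> b \<otimes>\<^bsub>H\<^esub> \<gamma> c)"


section \<open>The groups \<open>G(m,p,n)\<close>, \<open>\<mu>(G(m,p,n))\<close> and \<open>T\<close>\<close>

definition unity_roots :: "nat \<Rightarrow> complex set" where
  "unity_roots r = {z. z ^ r = 1}"

text \<open>Rows, columns and the generators \<open>x\<^sub>i\<close>, \<open>y\<^sub>i\<close> are numbered from \<open>0\<close> to \<open>n - 1\<close>. A matrix \<open>g\<close>
  acts on \<open>V\<close> on the left: \<open>g(x\<^sub>j) = \<Sum>\<^sub>i g\<^sub>i\<^sub>j x\<^sub>i\<close>.\<close>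

definition monomial_mat :: "nat \<Rightarrow> complex mat \<Rightarrow> bool" where
  "monomial_mat n g \<longleftrightarrow> g \<in> carrier_mat n n
     \<and> (\<forall>i<n. \<exists>!j. j < n \<and> g $$ (i, j) \<noteq> 0)
     \<and> (\<forall>j<n. \<exists>!i. i < n \<and> g $$ (i, j) \<noteq> 0)"

definition nonzero_positions :: "nat \<Rightarrow> complex mat \<Rightarrow> (nat \<times> nat) set" where
  "nonzero_positions n g = {(i, j). i < n \<and> j < n \<and> g $$ (i, j) \<noteq> 0}"

definition G_group :: "nat \<Rightarrow> nat \<Rightarrow> nat \<Rightarrow> complex mat monoid" where
  "G_group m p n =
     \<lparr>carrier = {g. monomial_mat n g
                  \<and> (\<forall>ij\<in>nonzero_positions n g. g $$ ij \<in> unity_roots m)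
                  \<and> (\<Prod>ij\<in>nonzero_positions n g. g $$ ij) \<in> unity_roots (m div p)},
      mult = (*), one = 1\<^sub>m n\<rparr>"

definition mu_G_group :: "nat \<Rightarrow> nat \<Rightarrow> nat \<Rightarrow> complex mat monoid" where
  "mu_G_group m p n =
     \<lparr>carrier = {g. monomial_mat n g
                  \<and> (\<forall>ij\<in>nonzero_positions n g. g $$ ij \<in> unity_roots m)
                  \<and> det g \<in> unity_roots (m div p)},
      mult = (*), one = 1\<^sub>m n\<rparr>"

text \<open>\<open>x\<^sub>i \<mapsto> a x\<^sub>j\<close>, \<open>x\<^sub>j \<mapsto> b x\<^sub>i\<close>, all other basis vectors fixed (for \<open>i \<noteq> j\<close>).\<close>

definition swap_mat :: "nat \<Rightarrow> nat \<Rightarrow> nat \<Rightarrow> complex \<Rightarrow> complex \<Rightarrow> complex mat" where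
  "swap_mat n i j a b =
     mat n n (\<lambda>(r, s). if s = i then (if r = j then a else 0)
                       else if s = j then (if r = i then b else 0)
                       else if r = s then 1 else 0)"

definition s_mat :: "nat \<Rightarrow> nat \<Rightarrow> nat \<Rightarrow> complex \<Rightarrow> complex mat" where
  "s_mat n i j \<epsilon> = swap_mat n i j (inverse \<epsilon>) \<epsilon>"

definition sigma_mat :: "nat \<Rightarrow> nat \<Rightarrow> nat \<Rightarrow> complex \<Rightarrow> complex mat" where
  "sigma_mat n i j \<epsilon> = swap_mat n i j (inverse \<epsilon>) (- \<epsilon>)"

definition t_mat :: "nat \<Rightarrow> nat \<Rightarrow> complex \<Rightarrow> complex mat" where
  "t_mat n i \<epsilon> = mat n n (\<lambda>(r, s). if r = s then (if r = i then \<epsilon> else 1) else 0)"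

text \<open>\<open>T\<close> is generated inside \<open>G(2,1,n)\<close>, the group of all signed permutation matrices.\<close>

definition T_group :: "nat \<Rightarrow> complex mat monoid" where
  "T_group n = (G_group 2 1 n)
     \<lparr>carrier := generate (G_group 2 1 n) ((\<lambda>i. t_mat n i (- 1)) ` {..<n})\<rparr>"


section \<open>Rational Cherednik algebras at \<open>t = 0\<close> and their braided analogues\<close>

datatype gen = Xg nat | Yg nat | Gr "complex mat"

type_synonym falg = "gen list \<Rightarrow>\<^sub>0 complex"

text \<open>\<open>g(x\<^sub>i)\<close>, \<open>g(y\<^sub>i)\<close> (dual action) and \<open>g h g\<inverse>\<close>, for \<open>g\<close> in the group \<open>\<Gamma>\<close>. For
  \<open>\<Gamma> = T\<close> and \<open>g = t\<^sub>i\<close> this is the action \<open>t\<^sub>i \<rhd>\<close> on generators, because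
  \<open>t\<^sub>i(x\<^sub>j) = (-1)\<^bsup>\<delta>\<^esup> x\<^sub>j\<close> and \<open>t\<^sub>i(y\<^sub>j) = (-1)\<^bsup>\<delta>\<^esup> y\<^sub>j\<close>.\<close>

definition gen_action :: "nat \<Rightarrow> complex mat monoid \<Rightarrow> complex mat \<Rightarrow> gen \<Rightarrow> falg" where
  "gen_action n \<Gamma> g a =
     (case a of
        Xg i \<Rightarrow> (\<Sum>j<n. Poly_Mapping.single [Xg j] (g $$ (j, i)))
      | Yg i \<Rightarrow> (\<Sum>j<n. Poly_Mapping.single [Yg j] ((inv\<^bsub>\<Gamma>\<^esub> g) $$ (i, j)))
      | Gr h \<Rightarrow> Poly_Mapping.single [Gr (g * h * inv\<^bsub>\<Gamma>\<^esub> g)] 1)"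


subsection \<open>\<open>S(V)\<close>, \<open>S\<^sub>-\<^sub>1(V)\<close> and coinvariant algebras\<close>

text \<open>The algebra generated by \<open>v 0, \<dots>, v (n - 1)\<close> with \<open>v i v j = q v j v i\<close> for \<open>i \<noteq> j\<close>:
  for \<open>v = Xg\<close> it is \<open>S(V)\<close> if \<open>q = 1\<close> and \<open>S\<^sub>-\<^sub>1(V)\<close> if \<open>q = -1\<close>; for \<open>v = Yg\<close> replace \<open>V\<close> by its dual.\<close>

definition S_gens :: "nat \<Rightarrow> (nat \<Rightarrow> gen) \<Rightarrow> gen set" where
  "S_gens n v = v ` {..<n}"

definition S_rels :: "nat \<Rightarrow> complex \<Rightarrow> (nat \<Rightarrow> gen) \<Rightarrow> falg set" where
  "S_rels n q v =
     {Poly_Mapping.single [v i, v j] 1 - Poly_Mapping.single [v j, v i] q | i j.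
        i < n \<and> j < n \<and> i \<noteq> j}"

definition S_ideal :: "complex set \<Rightarrow> nat \<Rightarrow> complex \<Rightarrow> (nat \<Rightarrow> gen) \<Rightarrow> falg set" where
  "S_ideal K n q v = relation_ideal K (S_gens n v) (S_rels n q v)"

definition S_alg :: "complex set \<Rightarrow> nat \<Rightarrow> complex \<Rightarrow> (nat \<Rightarrow> gen) \<Rightarrow> (complex, falg set) module" where
  "S_alg K n q v = presented_algebra K (S_gens n v) (S_rels n q v)"

definition S_action ::
  "complex set \<Rightarrow> nat \<Rightarrow> complex mat monoid \<Rightarrow> complex \<Rightarrow> (nat \<Rightarrow> gen)
    \<Rightarrow> complex mat \<Rightarrow> falg set \<Rightarrow> falg set" where
  "S_action K n \<Gamma> q v g =
     induced_map (free_algebra K (S_gens n v)) (S_ideal K n q v)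
       (free_endo K (S_gens n v) (gen_action n \<Gamma> g))"

text \<open>An element of the graded algebra \<^const>\<open>S_alg\<close> is homogeneous of degree \<open>d\<close> iff it is
  represented by a linear combination of words of length \<open>d\<close>.\<close>

definition invariant_ideal ::
  "complex set \<Rightarrow> nat \<Rightarrow> complex mat monoid \<Rightarrow> complex \<Rightarrow> (nat \<Rightarrow> gen) \<Rightarrow> falg set set" where
  "invariant_ideal K n \<Gamma> q v = genideal (S_alg K n q v)
     {C \<in> carrier (S_alg K n q v).
        (\<exists>d>0. \<exists>f\<in>C. \<forall>w\<in>Poly_Mapping.keys f. length w = d)
        \<and> (\<forall>g\<in>carrier \<Gamma>. S_action K n \<Gamma> q v g C = C)}"

definition coinvariant_algebra ::
  "complex set \<Rightarrow> nat \<Rightarrow> complex mat monoid \<Rightarrow> complex \<Rightarrow> (nat \<Rightarrow> gen)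
    \<Rightarrow> (complex, falg set set) module" where
  "coinvariant_algebra K n \<Gamma> q v = quotient_algebra (S_alg K n q v) (invariant_ideal K n \<Gamma> q v)"

definition coinvariant_class ::
  "complex set \<Rightarrow> nat \<Rightarrow> complex mat monoid \<Rightarrow> complex \<Rightarrow> (nat \<Rightarrow> gen) \<Rightarrow> nat \<Rightarrow> falg set set" where
  "coinvariant_class K n \<Gamma> q v i =
     invariant_ideal K n \<Gamma> q v +>\<^bsub>S_alg K n q v\<^esub>
       (S_ideal K n q v +>\<^bsub>free_algebra K (S_gens n v)\<^esub> Poly_Mapping.single [v i] 1)"


subsection \<open>The algebras \<open>H\<close> and their restricted quotients\<close>

text \<open>The relations of both families of algebras, with \<open>q = 1\<close> for \<open>H\<^sub>0\<^sub>,\<^sub>c(G)\<close> and \<open>q = -1\<close> for its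
  braided analogue; \<open>\<kappa> i j\<close> is the right-hand side of the relation between \<open>y\<^sub>i\<close> and \<open>x\<^sub>j\<close>. The
  group algebra enters through the generators \<^term>\<open>Gr g\<close> and the relations of the second and third lines.\<close>

definition H_gens :: "nat \<Rightarrow> complex mat monoid \<Rightarrow> gen set" where
  "H_gens n \<Gamma> = Xg ` {..<n} \<union> Yg ` {..<n} \<union> Gr ` carrier \<Gamma>"

definition H_rels ::
  "complex set \<Rightarrow> nat \<Rightarrow> complex mat monoid \<Rightarrow> complex \<Rightarrow> (nat \<Rightarrow> nat \<Rightarrow> falg) \<Rightarrow> falg set" where
  "H_rels K n \<Gamma> q \<kappa> =
     S_rels n q Xg \<union> S_rels n q Yg
   \<union> {Poly_Mapping.single [Gr \<one>\<^bsub>\<Gamma>\<^esub>] 1 - Poly_Mapping.single [] 1}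
   \<union> {Poly_Mapping.single [Gr g, Gr h] 1 - Poly_Mapping.single [Gr (g \<otimes>\<^bsub>\<Gamma>\<^esub> h)] 1 | g h.
        g \<in> carrier \<Gamma> \<and> h \<in> carrier \<Gamma>}
   \<union> {Poly_Mapping.single [Gr g, v i] 1
        - gen_action n \<Gamma> g (v i) \<otimes>\<^bsub>free_algebra K (H_gens n \<Gamma>)\<^esub> Poly_Mapping.single [Gr g] 1
        | g v i. g \<in> carrier \<Gamma> \<and> v \<in> {Xg, Yg} \<and> i < n}
   \<union> {Poly_Mapping.single [Yg i, Xg j] 1 - Poly_Mapping.single [Xg j, Yg i] (if i = j then 1 else q)
        - \<kappa> i j | i j. i < n \<and> j < n}"

definition H_ideal ::
  "complex set \<Rightarrow> nat \<Rightarrow> complex mat monoid \<Rightarrow> complex \<Rightarrow> (nat \<Rightarrow> nat \<Rightarrow> falg) \<Rightarrow> falg set" where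
  "H_ideal K n \<Gamma> q \<kappa> = relation_ideal K (H_gens n \<Gamma>) (H_rels K n \<Gamma> q \<kappa>)"

definition H_alg ::
  "complex set \<Rightarrow> nat \<Rightarrow> complex mat monoid \<Rightarrow> complex \<Rightarrow> (nat \<Rightarrow> nat \<Rightarrow> falg)
    \<Rightarrow> (complex, falg set) module" where
  "H_alg K n \<Gamma> q \<kappa> = presented_algebra K (H_gens n \<Gamma>) (H_rels K n \<Gamma> q \<kappa>)"

text \<open>The two-sided ideal generated by the images of the two invariant ideals under the canonical
  maps from the \<^const>\<open>S_alg\<close> to \<^const>\<open>H_alg\<close>.\<close>

definition restricted_ideal ::
  "complex set \<Rightarrow> nat \<Rightarrow> complex mat monoid \<Rightarrow> complex \<Rightarrow> (nat \<Rightarrow> nat \<Rightarrow> falg) \<Rightarrow> falg set set" where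
  "restricted_ideal K n \<Gamma> q \<kappa> = genideal (H_alg K n \<Gamma> q \<kappa>)
     (induced_map (free_algebra K (H_gens n \<Gamma>)) (H_ideal K n \<Gamma> q \<kappa>) id `
        (invariant_ideal K n \<Gamma> q Xg \<union> invariant_ideal K n \<Gamma> q Yg))"

definition restricted_alg ::
  "complex set \<Rightarrow> nat \<Rightarrow> complex mat monoid \<Rightarrow> complex \<Rightarrow> (nat \<Rightarrow> nat \<Rightarrow> falg)
    \<Rightarrow> (complex, falg set set) module" where
  "restricted_alg K n \<Gamma> q \<kappa> = quotient_algebra (H_alg K n \<Gamma> q \<kappa>) (restricted_ideal K n \<Gamma> q \<kappa>)"

definition restricted_class ::
  "complex set \<Rightarrow> nat \<Rightarrow> complex mat monoid \<Rightarrow> complex \<Rightarrow> (nat \<Rightarrow> nat \<Rightarrow> falg)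
    \<Rightarrow> gen \<Rightarrow> falg set set" where
  "restricted_class K n \<Gamma> q \<kappa> a =
     restricted_ideal K n \<Gamma> q \<kappa> +>\<^bsub>H_alg K n \<Gamma> q \<kappa>\<^esub>
       (H_ideal K n \<Gamma> q \<kappa> +>\<^bsub>free_algebra K (H_gens n \<Gamma>)\<^esub> Poly_Mapping.single [a] 1)"

definition T_action ::
  "complex set \<Rightarrow> nat \<Rightarrow> complex mat monoid \<Rightarrow> complex \<Rightarrow> (nat \<Rightarrow> nat \<Rightarrow> falg)
    \<Rightarrow> complex mat \<Rightarrow> falg set set \<Rightarrow> falg set set" where
  "T_action K n \<Gamma> q \<kappa> t =
     induced_map (H_alg K n \<Gamma> q \<kappa>) (restricted_ideal K n \<Gamma> q \<kappa>)
       (induced_map (free_algebra K (H_gens n \<Gamma>)) (H_ideal K n \<Gamma> q \<kappa>)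
         (free_endo K (H_gens n \<Gamma>) (gen_action n (T_group n) t)))"

definition kappa_G ::
  "nat \<Rightarrow> nat \<Rightarrow> nat \<Rightarrow> complex \<Rightarrow> (complex \<Rightarrow> complex) \<Rightarrow> nat \<Rightarrow> nat \<Rightarrow> falg" where
  "kappa_G m p n c\<^sub>1 c i j =
     (if i = j
      then - (\<Sum>l\<in>{..<n} - {i}. \<Sum>\<epsilon>\<in>unity_roots m. Poly_Mapping.single [Gr (s_mat n i l \<epsilon>)] c\<^sub>1)
           - (\<Sum>\<zeta>\<in>unity_roots (m div p) - {1}. Poly_Mapping.single [Gr (t_mat n i \<zeta>)] (c \<zeta>))
      else \<Sum>\<epsilon>\<in>unity_roots m. Poly_Mapping.single [Gr (s_mat n i j \<epsilon>)] (c\<^sub>1 * \<epsilon>))"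

definition kappa_W ::
  "nat \<Rightarrow> nat \<Rightarrow> nat \<Rightarrow> complex \<Rightarrow> (complex \<Rightarrow> complex) \<Rightarrow> nat \<Rightarrow> nat \<Rightarrow> falg" where
  "kappa_W m p n c\<^sub>1 c i j =
     (if i = j
      then (\<Sum>l\<in>{..<n} - {i}. \<Sum>\<epsilon>\<in>unity_roots m. Poly_Mapping.single [Gr (sigma_mat n i l \<epsilon>)] c\<^sub>1)
           + (\<Sum>\<zeta>\<in>unity_roots (m div p) - {1}. Poly_Mapping.single [Gr (t_mat n i \<zeta>)] (c \<zeta>))
      else \<Sum>\<epsilon>\<in>unity_roots m. Poly_Mapping.single [Gr (sigma_mat n i j \<epsilon>)] (c\<^sub>1 * \<epsilon>))"


section \<open>The cocycle twist\<close>

text \<open>The algebra \<open>kT \<otimes> kT\<close> is taken in the form of the group algebra of \<open>T \<times> T\<close>, with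
  \<open>s \<otimes> t\<close> being the basis element \<open>(s, t)\<close>.\<close>

definition kT_kT :: "complex set \<Rightarrow> nat \<Rightarrow> (complex, complex mat \<times> complex mat \<Rightarrow>\<^sub>0 complex) module" where
  "kT_kT K n = monoid_algebra K (T_group n \<times>\<times> T_group n)"

definition cocycle_F :: "complex set \<Rightarrow> nat \<Rightarrow> (complex mat \<times> complex mat \<Rightarrow>\<^sub>0 complex)" where
  "cocycle_F K n =
     finprod (kT_kT K n)
       (\<lambda>(i, j). Poly_Mapping.single (1\<^sub>m n, 1\<^sub>m n) (1/2)
              + Poly_Mapping.single (t_mat n i (- 1), 1\<^sub>m n) (1/2)
              + Poly_Mapping.single (1\<^sub>m n, t_mat n j (- 1)) (1/2)
              - Poly_Mapping.single (t_mat n i (- 1), t_mat n j (- 1)) (1/2))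
       {(i, j). j < i \<and> i < n}"

text \<open>The product \<open>m \<circ> (\<F>\<inverse> \<rhd>)\<close>: if \<open>\<F>\<inverse> = \<Sum> f\<^sub>s\<^sub>,\<^sub>t s \<otimes> t\<close>, the new product of \<open>a\<close> and \<open>b\<close> is
  \<open>\<Sum> f\<^sub>s\<^sub>,\<^sub>t (s \<rhd> a)(t \<rhd> b)\<close>. The unit is unchanged, as \<open>\<F>\<close> is counital.\<close>

definition cocycle_twist ::
  "complex set \<Rightarrow> nat \<Rightarrow> (complex mat \<times> complex mat \<Rightarrow>\<^sub>0 complex)
    \<Rightarrow> (complex mat \<Rightarrow> 'a \<Rightarrow> 'a) \<Rightarrow> (complex, 'a) module \<Rightarrow> (complex, 'a) module" where
  "cocycle_twist K n F act A =
     (let F' = inv\<^bsub>kT_kT K n\<^esub> F in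
      A\<lparr>mult := \<lambda>a b. \<Oplus>\<^bsub>A\<^esub>st\<in>Poly_Mapping.keys F'.
           Poly_Mapping.lookup F' st \<odot>\<^bsub>A\<^esub> (act (fst st) a \<otimes>\<^bsub>A\<^esub> act (snd st) b)\<rparr>)"

end

theory Submission imports Defs begin

text \<open>
 The two kinds of algebras are treated at once: the parameter \<open>q\<close> is \<open>1\<close> for \<open>G\<close> and its rational Cherednik algebra,
 and \<open>-1\<close> for \<open>W\<close> and its braided Cherednik algebra. All computations take place in free algebras, where the
 restricted algebra is the quotient by the ideal \<open>J q\<close> generated by the relations and the invariants.

 The twist. Characters of \<open>T\<close> are subsets of \<open>{..<n}\<close>, and \<open>\<F>\<close> evaluates at a pair \<open>(L, N)\<close> of them to the sign \<open>bs L N\<close>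
 given by the parity of the number of pairs \<open>j < i\<close> with \<open>i \<in> L\<close>, \<open>j \<in> N\<close> (\<open>ev_cocycle_F\<close>). So the twisted product multiplies the components
 of weights \<open>L\<close> and \<open>N\<close> with the additional sign \<open>bs L N\<close> (\<open>star\<close>). The isomorphism \<open>Psi\<close> fixes the \<open>x\<^sub>i\<close> and \<open>y\<^sub>i\<close>, and sends
 \<open>g\<close> to \<open>theta g\<close>, the sum of the elements \<open>coc g Z \<cdot> g e\<^sub>Z\<close> over the characters \<open>Z\<close>, with \<open>e\<^sub>Z\<close> the idempotent of \<open>kT\<close> of the
 character \<open>Z\<close>. The signs \<open>coc\<close> satisfy two identities: \<open>coc_comp\<close> makes \<open>theta\<close> multiplicative for the twisted product,
 and \<open>coc_step\<close> makes it compatible with the action on the \<open>x\<^sub>i\<close> and \<open>y\<^sub>i\<close>. Moreover \<open>theta\<close> interchanges the reflections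
 \<open>s\<^sub>i\<^sub>j\<close> and \<open>\<sigma>\<^sub>i\<^sub>j\<close> (\<open>theta_refl\<close>), hence \<open>Psi\<close> maps relations to relations. It maps invariants to invariants (\<open>Psi_Inv\<close>): as
 the \<open>t\<^sub>i t\<^sub>l\<close> belong to both groups, an invariant has components of weights \<open>{}\<close> and \<open>{..<n}\<close> only, where the signs are
 \<open>1\<close> and the sign of the permutation, which is the difference between the product of the entries and the determinant.
 Finally \<open>Psi\<close> is its own inverse.

 The triangular decomposition. Normal ordering shows that the words \<open>x\<dots> g y\<dots>\<close> span. For independence, the braided
 algebra acts on the space of these words, where \<open>y\<^sub>i\<close> is defined by moving it to the right; by the Jacobi identities
 this induces an action on \<open>S\<^sub>-\<^sub>1(V) \<otimes> kW \<otimes> S\<^sub>-\<^sub>1(V\<^sup>*)\<close> (\<open>act_H_ideal\<close>). It remains to see that the ideal of the invariants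
 is no larger than expected, that is, that \<open>y\<^sub>i f\<close> is the product of an invariant and \<open>y\<^sub>i\<close> if \<open>f\<close> is an invariant. In general
 \<open>y\<^sub>i f = \<eta>\<^sub>i(f) y\<^sub>i + \<Sum>\<^sub>r DD\<^sub>r(f) r\<close>, where \<open>\<eta>\<^sub>i\<close> changes the sign of the \<open>x\<^sub>j\<close> with \<open>j \<noteq> i\<close> and \<open>DD\<^sub>r\<close> is a braided divided difference:
 \<open>zr DD\<^sub>r(f) = \<eta>\<^sub>i(f) vr - vr r(f)\<close> with \<open>vr\<close> linear and \<open>zr\<close> a combination of squares (\<open>zr_DD\<close>). If \<open>f\<close> is invariant then
 \<open>r(f) = f\<close>, and \<open>\<eta>\<^sub>i(f) = \<eta>\<^sub>l(f)\<close> because \<open>t\<^sub>i t\<^sub>l \<in> W\<close>; therefore \<open>vr f = \<eta>\<^sub>i(f) vr\<close>, so \<open>zr DD\<^sub>r(f) = 0\<close>, and \<open>DD\<^sub>r(f) = 0\<close> since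
 \<open>zr\<close> is not a zero divisor (\<open>zr_regular\<close>). The argument for the invariants in the \<open>y\<^sub>i\<close> is the mirror image.
\<close>

alias single = Poly_Mapping.single
alias lookup = Poly_Mapping.lookup
alias keys = Poly_Mapping.keys

text \<open>\<open>sgn1 q\<close> says that \<open>q\<close> selects one of the two families of algebras, and \<open>XY v\<close> that \<open>v\<close> names the generators
 of \<open>V\<close> or of its dual. Elements of the type \<open>nalg\<close> are polynomials in unnamed generators with the indices \<open>i\<close>.\<close>

abbreviation sgn1 :: "complex => bool" where "sgn1 q \<equiv> q = 1 \<or> q = -1"
abbreviation PP :: "nat => nat set set" where "PP n \<equiv> Pow {..<n}"
abbreviation XY :: "(nat => gen) => bool" where "XY v \<equiv> v : {Xg, Yg}"
type_synonym nalg = "nat list \<Rightarrow>\<^sub>0 complex"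

text \<open>With concatenation as addition of exponents, the finitely supported functions on words become the free
 algebra as an instance of the type class of rings.\<close>

instantiation list :: (type) monoid_add
begin
definition zero_list :: "'a list" where zero_list_eq [simp]: "0 = []"
definition plus_list :: "'a list => 'a list => 'a list" where plus_list_eq [simp]: "xs + ys = xs @ ys"
instance by standard simp_all
end

lemma single_Nil_one: "single [] (1::complex) = 1"
 using single_one[where ?'a = "'a list" and ?'b = complex] by simp

lemma mult_words [simp]: "single u (a::complex) * single v b = single (u @ v) (a * b)"
 by (simp add: mult_single)

definition smul :: "complex => ('a \<Rightarrow>\<^sub>0 complex) => ('a \<Rightarrow>\<^sub>0 complex)" where
 "smul c = Poly_Mapping.map (%z. c * z)"

lemma lookup_smul [simp]: "lookup (smul c f) w = c * lookup f w"
 by (simp add: smul_def Poly_Mapping.map.rep_eq when_def)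

lemma smul_simps [simp]:
 "smul c 0 = 0" "smul 0 f = 0" "smul 1 f = f" "smul a (smul b f) = smul (a * b) f"
 "smul c (single w d) = single w (c * d)"
 by (auto intro!: poly_mapping_eqI simp: lookup_single when_def)

lemma smul_add: "smul c (f + g) = smul c f + smul c g"
 and smul_diff: "smul c (f - g) = smul c f - smul c g"
 and smul_minus: "smul c (- f) = - smul c f"
 and smul_add_left: "smul (a + b) f = smul a f + smul b f"
 and smul_diff_left: "smul (a - b) f = smul a f - smul b f"
 and smul_minus_left: "smul (- a) f = - smul a f"
 by (auto intro!: poly_mapping_eqI simp: lookup_add lookup_minus algebra_simps)

lemma smul_sum: "smul c (\<Sum>i\<in>I. f i) = (\<Sum>i\<in>I. smul c (f i))"
 by (induction I rule: infinite_finite_induct) (simp_all add: smul_add)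

lemma smul_sum_left: "smul (\<Sum>i\<in>I. c i) f = (\<Sum>i\<in>I. smul (c i) f)"
 by (induction I rule: infinite_finite_induct) (simp_all add: smul_add_left)

lemma keys_smul: "keys (smul c f) \<subseteq> keys f"
 by (auto simp: in_keys_iff)

text \<open>The linear extension of a map given on the basis.\<close>

definition lin :: "('a => ('b \<Rightarrow>\<^sub>0 complex)) => ('a \<Rightarrow>\<^sub>0 complex) => ('b \<Rightarrow>\<^sub>0 complex)" where
 "lin \<phi> f = (\<Sum>w\<in>keys f. smul (lookup f w) (\<phi> w))"

lemma lin_superset:
 assumes "finite S" "keys f \<subseteq> S"
 shows "lin \<phi> f = (\<Sum>w\<in>S. smul (lookup f w) (\<phi> w))"
 unfolding lin_def using assms
 by (intro sum.mono_neutral_left) (auto simp: in_keys_iff)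

lemma sum_single_lookup: "(\<Sum>w\<in>keys f. single w (lookup f w)) = (f :: 'a \<Rightarrow>\<^sub>0 complex)"
 by (rule poly_mapping_eqI) (auto simp: lookup_sum lookup_single when_def in_keys_iff sum.delta)

lemma lin_0 [simp]: "lin \<phi> 0 = 0"
 by (simp add: lin_def)

lemma lin_add: "lin \<phi> (f + g) = lin \<phi> f + lin \<phi> g"
proof -
 let ?S = "keys f \<union> keys g"
 have "keys (f + g) \<subseteq> ?S" by (rule Poly_Mapping.keys_add)
 then show ?thesis
  by (simp add: lin_superset[of ?S] lookup_add smul_add_left sum.distrib)
qed

lemma lin_smul: "lin \<phi> (smul c f) = smul c (lin \<phi> f)"
 using keys_smul[of c f] by (simp add: lin_superset[of "keys f"] smul_sum)

lemma lin_single [simp]: "lin \<phi> (single w c) = smul c (\<phi> w)"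
 by (cases "c = 0") (simp_all add: lin_def)

lemma lin_diff: "lin \<phi> (f - g) = lin \<phi> f - lin \<phi> g"
 using lin_add[of \<phi> "f - g" g] by simp

lemma lin_minus: "lin \<phi> (- f) = - lin \<phi> f"
 using lin_diff[of \<phi> 0 f] by simp

lemma lin_sum: "lin \<phi> (\<Sum>i\<in>I. f i) = (\<Sum>i\<in>I. lin \<phi> (f i))"
 by (induction I rule: infinite_finite_induct) (simp_all add: lin_add)

lemmas lin_simps = lin_add lin_smul lin_diff lin_minus lin_sum

lemma lin_cong: "(\<And>w. w : keys f ==> \<phi> w = \<psi> w) ==> lin \<phi> f = lin \<psi> f"
 by (simp add: lin_def)

lemma lin_lin: "lin \<phi> (lin \<psi> f) = lin (%w. lin \<phi> (\<psi> w)) f"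
 by (simp add: lin_def[of \<psi>] lin_sum lin_smul) (simp add: lin_def)

lemma lin_words [simp]: "lin (%w. single w 1) f = f"
 by (simp add: lin_def sum_single_lookup)

lemma lin_fun_add: "lin (%w. \<phi> w + \<psi> w) f = lin \<phi> f + lin \<psi> f"
 by (simp add: lin_def smul_add sum.distrib)

lemma lin_fun_diff: "lin (%w. \<phi> w - \<psi> w) f = lin \<phi> f - lin \<psi> f"
 by (simp add: lin_def smul_diff sum_subtractf)

lemma lin_fun_smul: "lin (%w. smul c (\<phi> w)) f = smul c (lin \<phi> f)"
 by (simp add: lin_def smul_sum mult.commute)

lemma lin_fun_0 [simp]: "lin (%w. 0) f = 0"
 by (simp add: lin_def)

lemma smul_mult_left: "smul c f * g = smul c (f * g)" for f g :: "'a list \<Rightarrow>\<^sub>0 complex"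
proof -
 have "smul c f = single [] c * f" for f :: "'a list \<Rightarrow>\<^sub>0 complex"
 proof -
  have "f = (\<Sum>w\<in>keys f. single w (lookup f w))" by (simp add: sum_single_lookup)
  then have "single [] c * f = (\<Sum>w\<in>keys f. single w (c * lookup f w))"
   by (metis (no_types, lifting) sum_distrib_left mult_words append_Nil sum.cong)
  also have "\<dots> = smul c (\<Sum>w\<in>keys f. single w (lookup f w))" by (simp add: smul_sum)
  finally show ?thesis by (simp add: sum_single_lookup)
 qed
 then show ?thesis by (simp add: mult.assoc)
qed

lemma smul_mult_right: "f * smul c g = smul c (f * g)" for f g :: "'a list \<Rightarrow>\<^sub>0 complex"
proof -
 have comm: "single [] c * h = h * single [] c" for h :: "'a list \<Rightarrow>\<^sub>0 complex"
 proof -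
  have "single [] c * (\<Sum>w\<in>keys h. single w (lookup h w)) = (\<Sum>w\<in>keys h. single w (lookup h w)) * single [] c"
   by (simp add: sum_distrib_left sum_distrib_right mult.commute)
  then show ?thesis unfolding sum_single_lookup .
 qed
 have *: "smul c h = single [] c * h" for h :: "'a list \<Rightarrow>\<^sub>0 complex"
  using smul_mult_left[of c 1 h] by (simp flip: single_Nil_one) (simp add: single_Nil_one)
 show ?thesis unfolding * by (metis comm mult.assoc)
qed

lemma lin_mult_left: "lin \<phi> f * g = lin (%u. \<phi> u * g) f" for g :: "'b list \<Rightarrow>\<^sub>0 complex"
 by (simp add: lin_def sum_distrib_right smul_mult_left)

lemma lin_mult_right: "g * lin \<phi> f = lin (%u. g * \<phi> u) f" for g :: "'b list \<Rightarrow>\<^sub>0 complex"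
 by (simp add: lin_def sum_distrib_left smul_mult_right)

lemma mult_lin: "f * g = lin (%u. lin (%v. single (u @ v) 1) g) f" for f g :: "'a list \<Rightarrow>\<^sub>0 complex"
proof -
 have "f * g = lin (%w. single w 1) f * lin (%w. single w 1) g" by simp
 also have "\<dots> = lin (%u. lin (%v. single (u @ v) 1) g) f"
  unfolding lin_mult_left unfolding lin_mult_right mult_words by simp
 finally show ?thesis .
qed

lemma lin_hom:
 fixes \<phi> :: "'a list => ('b list \<Rightarrow>\<^sub>0 complex)"
 assumes "\<And>u v. \<phi> (u @ v) = \<phi> u * \<phi> v"
 shows "lin \<phi> (f * g) = lin \<phi> f * lin \<phi> g"
 by (subst mult_lin, subst lin_mult_left, subst lin_mult_right) (simp add: lin_lin assms)

section \<open>Coefficients in a subfield\<close>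

definition FM :: "complex set => 's set => ('s \<Rightarrow>\<^sub>0 complex) set" where
 "FM K S = {f. keys f \<subseteq> S & (\<forall>w. lookup f w : K)}"

abbreviation FA :: "complex set => 'g set => ('g list \<Rightarrow>\<^sub>0 complex) set" where
 "FA K A \<equiv> FM K (lists A)"

locale subK =
 fixes K :: "complex set"
 assumes subfield_K: "subfield K (ring_of_type_algebra :: complex ring)"
begin

lemma scalars_field: "field (scalars K)"
 using ring.subfield_iff(2)[OF ring_from_type_algebra subfield_K]
 by (simp add: scalars_def)

lemma scalars_sel [simp]:
 "carrier (scalars K) = K" "\<zero>\<^bsub>scalars K\<^esub> = 0" "\<one>\<^bsub>scalars K\<^esub> = 1"
 "x \<oplus>\<^bsub>scalars K\<^esub> y = x + y" "x \<otimes>\<^bsub>scalars K\<^esub> y = x * y"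
 by (simp_all add: scalars_def ring_of_type_algebra_def)

lemma K_0 [simp, intro]: "0 : K"
 using field.is_ring[OF scalars_field] ring.ring_simprules(2)[of "scalars K"] by simp

lemma K_1 [simp, intro]: "1 : K"
 using field.is_ring[OF scalars_field] ring.ring_simprules(6)[of "scalars K"] by simp

lemma K_add [intro]: "a : K ==> b : K ==> a + b : K"
 using field.is_ring[OF scalars_field] ring.ring_simprules(1)[of "scalars K" a b] by simp

lemma K_mult [intro]: "a : K ==> b : K ==> a * b : K"
 using field.is_ring[OF scalars_field] ring.ring_simprules(5)[of "scalars K" a b] by simp

lemma K_minus [intro]: "a : K ==> - a : K"
proof -
 assume a: "a : K"
 interpret R: field "scalars K" by (rule scalars_field)
 have "\<ominus>\<^bsub>scalars K\<^esub> a : K" "a + (\<ominus>\<^bsub>scalars K\<^esub> a) = 0"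
  using R.a_inv_closed[of a] R.r_neg[of a] a by simp_all
 then show "- a : K" by (metis add_eq_0_iff)
qed

lemma K_diff [intro]: "a : K ==> b : K ==> a - b : K"
 using K_add[OF _ K_minus, of a b] by simp

lemma K_inverse [intro]: "a : K ==> inverse a : K"
proof (cases "a = 0")
 case False
 assume a: "a : K"
 interpret R: field "scalars K" by (rule scalars_field)
 have "a : Units (scalars K)" using R.field_Units a False by simp
 then have "inv\<^bsub>scalars K\<^esub> a : K" "a * (inv\<^bsub>scalars K\<^esub> a) = 1"
  using R.Units_inv_closed[of a] R.Units_r_inv[of a] by simp_all
 then show "inverse a : K" by (metis inverse_unique)
qed simp

lemma K_divide [intro]: "a : K ==> b : K ==> a / b : K"
 by (metis K_inverse K_mult divide_inverse)

lemma K_power [intro]: "a : K ==> a ^ j : K"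
 by (induction j) auto

lemma K_of_nat [simp, intro]: "of_nat j : K"
 by (induction j) (auto intro: K_add)

lemma K_numeral [simp, intro]: "numeral j : K"
 using K_of_nat[of "numeral j"] by simp

lemma K_sum [intro]: "(\<And>i. i : I ==> f i : K) ==> sum f I : K"
 by (induction I rule: infinite_finite_induct) auto

lemma K_prod [intro]: "(\<And>i. i : I ==> f i : K) ==> prod f I : K"
 by (induction I rule: infinite_finite_induct) auto

lemma FM_0 [simp, intro]: "0 : FM K S"
 by (simp add: FM_def)

lemma FM_add [intro]: "f : FM K S ==> g : FM K S ==> f + g : FM K S"
 using Poly_Mapping.keys_add[of f g] by (auto simp: FM_def lookup_add)

lemma FM_smul [intro]: "c : K ==> f : FM K S ==> smul c f : FM K S"
 using keys_smul[of c f] by (auto simp: FM_def)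

lemma FM_minus [intro]: "f : FM K S ==> - f : FM K S"
 by (auto simp: FM_def)

lemma FM_diff [intro]: "f : FM K S ==> g : FM K S ==> f - g : FM K S"
 using FM_add[OF _ FM_minus, of f S g] by simp

lemma FM_sum [intro]: "(\<And>i. i : I ==> f i : FM K S) ==> sum f I : FM K S"
 by (induction I rule: infinite_finite_induct) auto

lemma FM_single [intro]: "w : S ==> c : K ==> single w c : FM K S"
 by (auto simp: FM_def lookup_single when_def)

lemma FM_lin [intro]:
 assumes "f : FM K S" "\<And>w. w : S ==> \<phi> w : FM K T"
 shows "lin \<phi> f : FM K T"
 unfolding lin_def using assms by (intro FM_sum FM_smul) (auto simp: FM_def)

lemma FA_mult [intro]: "f : FA K A ==> g : FA K A ==> f * g : FA K A"
 unfolding mult_lin by (intro FM_lin[where S = "lists A"] FM_single) auto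

lemma FA_1 [simp, intro]: "1 : FA K A"
 unfolding single_Nil_one[symmetric] by auto

lemma FM_mono: "S \<subseteq> T ==> FM K S \<subseteq> FM K T"
 by (auto simp: FM_def)

lemma FM_induct [consumes 1, case_names zero add single]:
 assumes "f : FM K S" "P 0" "\<And>a b. a : FM K S ==> b : FM K S ==> P a ==> P b ==> P (a + b)"
  "\<And>w c. w : S ==> c : K ==> P (single w c)"
 shows "P f"
proof -
 have "P (\<Sum>w\<in>I. single w (lookup f w)) & (\<Sum>w\<in>I. single w (lookup f w)) : FM K S" if "I \<subseteq> keys f" for I
  using finite_subset[OF that finite_keys] that
 proof (induction I rule: finite_induct)
  case (insert x F)
  then have "x : S" "lookup f x : K" using assms(1) by (auto simp: FM_def)
  then show ?case using insert assms(3)[of "single x (lookup f x)" "\<Sum>w\<in>F. single w (lookup f w)"] assms(4) by auto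
 qed (use assms in auto)
 from this[OF order_refl] show ?thesis by (simp add: sum_single_lookup)
qed

end

section \<open>Quotients of algebras\<close>

lemma idealI_closed:
 assumes "ring A" "U \<subseteq> carrier A" "\<zero>\<^bsub>A\<^esub> : U"
  and add: "\<And>a b. a : U ==> b : U ==> a \<oplus>\<^bsub>A\<^esub> b : U"
  and left: "\<And>a x. a : U ==> x : carrier A ==> x \<otimes>\<^bsub>A\<^esub> a : U"
  and right: "\<And>a x. a : U ==> x : carrier A ==> a \<otimes>\<^bsub>A\<^esub> x : U"
 shows "ideal U A"
proof (rule idealI[OF assms(1)])
 interpret A: ring A by fact
 show "subgroup U (add_monoid A)"
 proof (rule subgroup.intro)
  fix x assume x: "x : U"
  then have "\<ominus>\<^bsub>A\<^esub> x = (\<ominus>\<^bsub>A\<^esub> \<one>\<^bsub>A\<^esub>) \<otimes>\<^bsub>A\<^esub> x" using assms(2) by (auto simp: A.l_minus)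
  then show "inv\<^bsub>add_monoid A\<^esub> x : U"
   using left[OF x, of "\<ominus>\<^bsub>A\<^esub> \<one>\<^bsub>A\<^esub>"] by (simp add: a_inv_def[symmetric])
 qed (use assms in auto)
qed (use left right in auto)

inductive_set gspan :: "complex set => ('a \<Rightarrow>\<^sub>0 complex) set => ('a \<Rightarrow>\<^sub>0 complex) set"
 for K :: "complex set" and B :: "('a \<Rightarrow>\<^sub>0 complex) set" where
 gspan_0: "0 : gspan K B"
| gspan_base: "c : K ==> b : B ==> smul c b : gspan K B"
| gspan_add: "x : gspan K B ==> y : gspan K B ==> x + y : gspan K B"

text \<open>\<open>is_quotient K A I B \<pi>\<close>: the map \<open>\<pi>\<close> presents the algebra \<open>B\<close> as the quotient of \<open>A\<close> by \<open>I\<close>.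
 All algebras of the theorem are quotients of free algebras in several steps; this notion allows to
 compute with representatives in the free algebra only.\<close>

definition is_quotient ::
 "complex set => (complex, 'a) module => 'a set => (complex, 'b) module => ('a => 'b) => bool" where
 "is_quotient K A I B \<pi> \<longleftrightarrow>
  assoc_algebra (scalars K) B & \<pi> : algebra_hom K A B & \<pi> ` carrier A = carrier B
  & {a : carrier A. \<pi> a = \<zero>\<^bsub>B\<^esub>} = I"

context subK
begin

lemma free_algebra_sel [simp]:
 "carrier (free_algebra K A) = FA K A" "\<one>\<^bsub>free_algebra K A\<^esub> = 1" "\<zero>\<^bsub>free_algebra K A\<^esub> = 0"
 "add (free_algebra K A) = (+)" "smult (free_algebra K A) = smul" "mult (free_algebra K A) = (*)"
proof -
 show "mult (free_algebra K A) = (*)"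
  unfolding fun_eq_iff mult_lin by (simp add: free_algebra_def monoid_algebra_def free_monoid_def lin_def smul_sum mult.commute)
qed (auto simp: free_algebra_def monoid_algebra_def free_monoid_def free_module_def FM_def
   smul_def[abs_def] single_Nil_one)

lemma free_endo_eq: "free_endo K A \<phi> = lin (%w. prod_list (map \<phi> w))"
proof -
 have "foldr (%a u. \<phi> a * u) w 1 = prod_list (map \<phi> w)" for w
  by (induction w) simp_all
 then show ?thesis by (simp add: free_endo_def lin_def fun_eq_iff)
qed

lemma gspan_base1: "b : B ==> b : gspan K B"
 using gspan_base[of 1 K b B] by simp

lemma gspan_smul: "x : gspan K B ==> c : K ==> smul c x : gspan K B"
 by (induction rule: gspan.induct) (auto simp: smul_add intro: gspan.intros)

lemma gspan_minus: "x : gspan K B ==> - x : gspan K B"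
 using gspan_smul[where x = x and c = "-1"] by (simp add: smul_minus_left K_minus)

lemma gspan_diff: "x : gspan K B ==> y : gspan K B ==> x - y : gspan K B"
 by (metis gspan_add gspan_minus diff_conv_add_uminus)

lemma gspan_sum: "(\<And>i. i : I ==> f i : gspan K B) ==> sum f I : gspan K B"
 by (induction I rule: infinite_finite_induct) (auto intro: gspan.intros)

lemma gspan_lin:
 "(\<And>w. w : S ==> \<phi> w : gspan K B) ==> f : FM K S ==> lin \<phi> f : gspan K B"
 unfolding lin_def by (intro gspan_sum gspan_smul) (auto simp: FM_def)

lemma gspan_image:
 assumes "x : gspan K B" "\<And>b. b : B ==> lin \<phi> b : gspan K B'"
 shows "lin \<phi> x : gspan K B'"
 using assms(1) by induction (auto simp: lin_add lin_smul intro: gspan.intros gspan_smul assms(2))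

lemma gspan_FM: "B \<subseteq> FM K S ==> gspan K B \<subseteq> FM K S"
proof
 fix x assume "B \<subseteq> FM K S" "x : gspan K B"
 from this(2,1) show "x : FM K S" by induction auto
qed

lemma assoc_algebra_image:
 assumes A: "assoc_algebra (scalars K) A" and surj: "\<pi> ` carrier A = carrier B"
  and add: "\<And>a b. a : carrier A ==> b : carrier A ==> \<pi> (a \<oplus>\<^bsub>A\<^esub> b) = \<pi> a \<oplus>\<^bsub>B\<^esub> \<pi> b"
  and mult: "\<And>a b. a : carrier A ==> b : carrier A ==> \<pi> (a \<otimes>\<^bsub>A\<^esub> b) = \<pi> a \<otimes>\<^bsub>B\<^esub> \<pi> b"
  and one: "\<pi> \<one>\<^bsub>A\<^esub> = \<one>\<^bsub>B\<^esub>" and zero: "\<pi> \<zero>\<^bsub>A\<^esub> = \<zero>\<^bsub>B\<^esub>"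
  and smult: "\<And>c a. c : K ==> a : carrier A ==> \<pi> (c \<odot>\<^bsub>A\<^esub> a) = c \<odot>\<^bsub>B\<^esub> \<pi> a"
 shows "assoc_algebra (scalars K) B"
proof -
 interpret A: assoc_algebra "scalars K" A by fact
 have carr: "x : carrier B \<longleftrightarrow> (\<exists>a\<in>carrier A. x = \<pi> a)" for x using surj by auto
 note rev = add[symmetric] mult[symmetric] one[symmetric] zero[symmetric] smult[symmetric]
 have [intro]: "a : carrier A ==> \<pi> a : carrier B" for a using surj by auto
 have ag: "abelian_group B"
 proof (rule abelian_groupI)
  fix x assume "x : carrier B"
  then obtain a where a: "a : carrier A" "x = \<pi> a" using carr by auto
  have "\<pi> (\<ominus>\<^bsub>A\<^esub> a) \<oplus>\<^bsub>B\<^esub> x = \<zero>\<^bsub>B\<^esub>" using a by (simp add: rev A.l_neg)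
  moreover have "\<pi> (\<ominus>\<^bsub>A\<^esub> a) : carrier B" using a by auto
  ultimately show "\<exists>y\<in>carrier B. y \<oplus>\<^bsub>B\<^esub> x = \<zero>\<^bsub>B\<^esub>" by blast
 qed (unfold carr, auto simp: rev A.a_ac)
 have mon: "Group.monoid B"
  by (rule monoidI; unfold carr) (auto simp: rev A.m_assoc)
 have ring: "ring B"
  by (rule ringI[OF ag mon]; unfold carr) (auto simp: rev A.l_distr A.r_distr)
 have mod: "Module.module (scalars K) B"
 proof (rule moduleI[OF _ ag])
  show "cring (scalars K)" by (rule fieldE(1)[OF scalars_field])
 qed (unfold carr, auto simp: rev A.smult_l_distr[simplified] A.smult_r_distr[simplified]
    A.smult_assoc1[simplified] A.smult_closed[simplified] A.smult_one[simplified] K_add K_mult)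
 show ?thesis
  by (intro assoc_algebra.intro[OF mod ring] assoc_algebra_axioms.intro; unfold carr)
   (auto simp: rev A.smult_mult_left[simplified] A.smult_mult_right[simplified] A.smult_closed[simplified])
qed

lemma free_algebra_assoc_algebra: "assoc_algebra (scalars K) (free_algebra K A)"
proof -
 have ag: "abelian_group (free_algebra K A)"
 proof (rule abelian_groupI)
  fix x assume x: "x : carrier (free_algebra K A)"
  show "\<exists>y\<in>carrier (free_algebra K A). y \<oplus>\<^bsub>free_algebra K A\<^esub> x = \<zero>\<^bsub>free_algebra K A\<^esub>"
   using x by (intro bexI[of _ "- x"]) auto
 qed (auto simp: add.assoc add.commute)
 have mon: "Group.monoid (free_algebra K A)"
  by (rule monoidI) (auto simp: mult.assoc)
 have ring: "ring (free_algebra K A)"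
  by (rule ringI[OF ag mon]) (auto simp: distrib_left distrib_right)
 have mod: "Module.module (scalars K) (free_algebra K A)"
 proof (rule moduleI[OF _ ag])
  show "cring (scalars K)" by (rule fieldE(1)[OF scalars_field])
 qed (auto simp: smul_add smul_add_left)
 show ?thesis
  by (intro assoc_algebra.intro[OF mod ring] assoc_algebra_axioms.intro)
   (auto simp: smul_mult_left smul_mult_right)
qed

lemma ring_free_algebra: "ring (free_algebra K A)"
 using free_algebra_assoc_algebra assoc_algebra_def by blast

lemma quotient_is_quotient:
 assumes A: "assoc_algebra (scalars K) A" and I: "ideal I A"
 shows "is_quotient K A I (quotient_algebra A I) (%a. I +>\<^bsub>A\<^esub> a)"
proof -
 interpret A: assoc_algebra "scalars K" A by fact
 interpret I: ideal I A by fact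
 let ?B = "quotient_algebra A I"
 let ?p = "%a. I +>\<^bsub>A\<^esub> a"
 have sel: "carrier ?B = a_rcosets\<^bsub>A\<^esub> I" "\<And>x y. x \<otimes>\<^bsub>?B\<^esub> y = rcoset_mult A I x y" "\<one>\<^bsub>?B\<^esub> = I +>\<^bsub>A\<^esub> \<one>\<^bsub>A\<^esub>"
  "\<zero>\<^bsub>?B\<^esub> = I" "\<And>x y. x \<oplus>\<^bsub>?B\<^esub> y = x <+>\<^bsub>A\<^esub> y"
  "\<And>c C. c \<odot>\<^bsub>?B\<^esub> C = (\<Union>a\<in>C. I +>\<^bsub>A\<^esub> (c \<odot>\<^bsub>A\<^esub> a))"
  by (simp_all add: quotient_algebra_def FactRing_def)
 have surj: "?p ` carrier A = carrier ?B"
  unfolding sel A_RCOSETS_def' by auto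
 have eq: "?p a = ?p b \<longleftrightarrow> a \<ominus>\<^bsub>A\<^esub> b : I" if "a : carrier A" "b : carrier A" for a b
  using A.quotient_eq_iff_same_a_r_cos[OF I that] by simp
 have add: "?p (a \<oplus>\<^bsub>A\<^esub> b) = ?p a \<oplus>\<^bsub>?B\<^esub> ?p b" if "a : carrier A" "b : carrier A" for a b
  using I.a_rcos_sum[OF that] by (simp add: sel)
 have mult: "?p (a \<otimes>\<^bsub>A\<^esub> b) = ?p a \<otimes>\<^bsub>?B\<^esub> ?p b" if "a : carrier A" "b : carrier A" for a b
  using I.rcoset_mult_add[OF that] by (simp add: sel)
 have zero: "?p \<zero>\<^bsub>A\<^esub> = \<zero>\<^bsub>?B\<^esub>"
  using A.a_coset_add_zero[OF I.a_subset] by (simp add: sel)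
 have smult: "?p (c \<odot>\<^bsub>A\<^esub> a) = c \<odot>\<^bsub>?B\<^esub> ?p a" if c: "c : K" and a: "a : carrier A" for c a
 proof -
  have I_smult: "c \<odot>\<^bsub>A\<^esub> h : I" if "h : I" for h
  proof -
   have "c \<odot>\<^bsub>A\<^esub> h = (c \<odot>\<^bsub>A\<^esub> \<one>\<^bsub>A\<^esub>) \<otimes>\<^bsub>A\<^esub> h"
    using A.smult_mult_left[simplified, OF c A.one_closed, of h] that I.Icarr by simp
   then show ?thesis using I.I_l_closed[OF that, of "c \<odot>\<^bsub>A\<^esub> \<one>\<^bsub>A\<^esub>"] c A.smult_closed by simp
  qed
  have "?p (c \<odot>\<^bsub>A\<^esub> b) = ?p (c \<odot>\<^bsub>A\<^esub> a)" if b: "b : ?p a" for b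
  proof -
   obtain h where h: "h : I" "b = h \<oplus>\<^bsub>A\<^esub> a" using b by (auto simp: a_r_coset_def')
   have hc: "h : carrier A" using h I.Icarr by auto
   have "c \<odot>\<^bsub>A\<^esub> b = c \<odot>\<^bsub>A\<^esub> h \<oplus>\<^bsub>A\<^esub> c \<odot>\<^bsub>A\<^esub> a"
    using A.smult_r_distr[simplified, OF c hc a] h by simp
   then have "?p (c \<odot>\<^bsub>A\<^esub> b) = ?p (c \<odot>\<^bsub>A\<^esub> h) \<oplus>\<^bsub>?B\<^esub> ?p (c \<odot>\<^bsub>A\<^esub> a)"
    using add[of "c \<odot>\<^bsub>A\<^esub> h" "c \<odot>\<^bsub>A\<^esub> a"] A.smult_closed c a hc by simp
   also have "?p (c \<odot>\<^bsub>A\<^esub> h) = ?p \<zero>\<^bsub>A\<^esub>"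
    using eq[of "c \<odot>\<^bsub>A\<^esub> h" "\<zero>\<^bsub>A\<^esub>"] I_smult[OF h(1)] A.smult_closed c hc by (simp add: a_minus_def)
   also have "?p \<zero>\<^bsub>A\<^esub> \<oplus>\<^bsub>?B\<^esub> ?p (c \<odot>\<^bsub>A\<^esub> a) = ?p (c \<odot>\<^bsub>A\<^esub> a)"
    using add[of "\<zero>\<^bsub>A\<^esub>" "c \<odot>\<^bsub>A\<^esub> a"] A.smult_closed c a by simp
   finally show ?thesis .
  qed
  moreover have "a : ?p a" using I.a_rcos_self[OF a] .
  ultimately show ?thesis unfolding sel by blast
 qed
 have alg: "assoc_algebra (scalars K) ?B"
  by (rule assoc_algebra_image[OF A surj add mult _ zero smult]) (simp_all add: sel)
 have "?p : algebra_hom K A ?B"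
  unfolding algebra_hom_def using surj
  by (auto intro!: ring_hom_memI simp: add mult smult sel(3))
 moreover have "?p a = \<zero>\<^bsub>?B\<^esub> \<longleftrightarrow> a : I" if "a : carrier A" for a
  using eq[OF that A.zero_closed] zero that by (simp add: a_minus_def)
 then have "{a : carrier A. ?p a = \<zero>\<^bsub>?B\<^esub>} = I" using I.Icarr by blast
 ultimately show ?thesis using alg surj unfolding is_quotient_def by blast
qed

lemma is_quotientD:
 assumes "is_quotient K A I B \<pi>"
 shows "assoc_algebra (scalars K) B"
  "\<And>a. a : carrier A ==> \<pi> a : carrier B" "\<And>x. x : carrier B ==> \<exists>a\<in>carrier A. x = \<pi> a"
  "\<And>a b. a : carrier A ==> b : carrier A ==> \<pi> (a \<oplus>\<^bsub>A\<^esub> b) = \<pi> a \<oplus>\<^bsub>B\<^esub> \<pi> b"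
  "\<And>a b. a : carrier A ==> b : carrier A ==> \<pi> (a \<otimes>\<^bsub>A\<^esub> b) = \<pi> a \<otimes>\<^bsub>B\<^esub> \<pi> b"
  "\<pi> \<one>\<^bsub>A\<^esub> = \<one>\<^bsub>B\<^esub>"
  "\<And>c a. c : K ==> a : carrier A ==> \<pi> (c \<odot>\<^bsub>A\<^esub> a) = c \<odot>\<^bsub>B\<^esub> \<pi> a"
  "\<And>a. a : carrier A ==> \<pi> a = \<zero>\<^bsub>B\<^esub> \<longleftrightarrow> a : I" "I \<subseteq> carrier A"
 using assms unfolding is_quotient_def algebra_hom_def by (auto dest: ring_hom_add ring_hom_mult ring_hom_one)

lemma is_quotient_eq:
 assumes Q: "is_quotient K A I B \<pi>" and A: "assoc_algebra (scalars K) A"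
  and ab: "a : carrier A" "b : carrier A"
 shows "\<pi> a = \<pi> b \<longleftrightarrow> a \<ominus>\<^bsub>A\<^esub> b : I"
proof -
 interpret A: assoc_algebra "scalars K" A by fact
 interpret B: assoc_algebra "scalars K" B using is_quotientD(1)[OF Q] .
 note D = is_quotientD[OF Q]
 have zero: "\<pi> \<zero>\<^bsub>A\<^esub> = \<zero>\<^bsub>B\<^esub>"
  using D(4)[of "\<zero>\<^bsub>A\<^esub>" "\<zero>\<^bsub>A\<^esub>"] D(2)[of "\<zero>\<^bsub>A\<^esub>"] by (metis A.l_zero A.zero_closed B.add.l_cancel_one')
 have neg: "\<pi> (\<ominus>\<^bsub>A\<^esub> b) = \<ominus>\<^bsub>B\<^esub> \<pi> b"
  using D(4)[of "\<ominus>\<^bsub>A\<^esub> b" b] zero ab D(2) A.l_neg[of b] B.minus_equality[of "\<pi> (\<ominus>\<^bsub>A\<^esub> b)" "\<pi> b"] by simp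
 have "\<pi> (a \<ominus>\<^bsub>A\<^esub> b) = \<pi> a \<ominus>\<^bsub>B\<^esub> \<pi> b"
  using D(4)[of a "\<ominus>\<^bsub>A\<^esub> b"] neg ab by (simp add: a_minus_def)
 then show ?thesis
  using D(8)[of "a \<ominus>\<^bsub>A\<^esub> b"] ab D(2) by simp
qed

lemma is_quotient_zero:
 assumes Q: "is_quotient K A I B \<pi>" and A: "assoc_algebra (scalars K) A"
 shows "\<pi> \<zero>\<^bsub>A\<^esub> = \<zero>\<^bsub>B\<^esub>"
proof -
 interpret A: assoc_algebra "scalars K" A by fact
 interpret B: assoc_algebra "scalars K" B using is_quotientD(1)[OF Q] .
 show ?thesis
  using is_quotientD(4)[OF Q, of "\<zero>\<^bsub>A\<^esub>" "\<zero>\<^bsub>A\<^esub>"] is_quotientD(2)[OF Q, of "\<zero>\<^bsub>A\<^esub>"]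
  by (metis A.l_zero A.zero_closed B.add.l_cancel_one')
qed

text \<open>Imposing relations in two steps is the same as imposing them at once.\<close>

text \<open>The restricted algebras are quotients of quotients; this presents them by relations in the free algebra.\<close>

lemma two_stage_quotient:
 assumes Q1: "is_quotient K A (genideal A R) B p" and A: "assoc_algebra (scalars K) A"
  and R: "R \<subseteq> carrier A" and Q: "Q \<subseteq> carrier A" and J: "J = genideal B (p ` Q)"
 shows "is_quotient K A (genideal A (R \<union> Q)) (quotient_algebra B J) (%a. J +>\<^bsub>B\<^esub> p a)"
proof -
 interpret A: assoc_algebra "scalars K" A by fact
 note D = is_quotientD[OF Q1]
 interpret B: assoc_algebra "scalars K" B by (rule D(1))
 have pQ: "p ` Q \<subseteq> carrier B" using D(2) Q by auto
 have idJ: "ideal J B" unfolding J by (rule B.genideal_ideal[OF pQ])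
 interpret J: ideal J B by fact
 let ?U = "genideal A (R \<union> Q)"
 have RQ: "R \<union> Q \<subseteq> carrier A" using R Q by auto
 interpret U: ideal ?U A by (rule A.genideal_ideal[OF RQ])
 note QJ = quotient_is_quotient[OF D(1) idJ]
 note E = is_quotientD[OF QJ]
 have ker: "{a : carrier A. p a : J} = ?U"
 proof
  have "ideal {a : carrier A. p a : J} A"
  proof (rule idealI_closed[OF A.ring_axioms])
   show "\<zero>\<^bsub>A\<^esub> : {a : carrier A. p a : J}"
    using is_quotient_zero[OF Q1 A] J.zero_closed by simp
  qed (auto simp: D J.I_l_closed J.I_r_closed)
  moreover have "R \<union> Q \<subseteq> {a : carrier A. p a : J}"
  proof -
   have "p r : J" if "r : R" for r
   proof -
    have "p r = \<zero>\<^bsub>B\<^esub>" using D(8)[of r] A.genideal_self[OF R] R that by auto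
    then show ?thesis using J.zero_closed by simp
   qed
   moreover have "p r : J" if "r : Q" for r
    unfolding J using B.genideal_self[OF pQ] that by auto
   ultimately show ?thesis using R Q by auto
  qed
  ultimately show "?U \<subseteq> {a : carrier A. p a : J}" by (rule A.genideal_minimal)
  have "ideal (p ` ?U) B"
  proof (rule idealI_closed[OF B.ring_axioms])
   show "p ` ?U \<subseteq> carrier B" using D(2) U.Icarr by auto
   show "\<zero>\<^bsub>B\<^esub> : p ` ?U"
    using is_quotient_zero[OF Q1 A] U.zero_closed by (metis imageI)
   show "a \<oplus>\<^bsub>B\<^esub> b : p ` ?U" if ab: "a : p ` ?U" "b : p ` ?U" for a b
   proof -
    obtain u v where uv: "u : ?U" "v : ?U" "a = p u" "b = p v" using ab by auto
    then have "a \<oplus>\<^bsub>B\<^esub> b = p (u \<oplus>\<^bsub>A\<^esub> v)" using D(4) U.Icarr by simp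
    then show ?thesis using uv U.a_closed by auto
   qed
   show "x \<otimes>\<^bsub>B\<^esub> a : p ` ?U" "a \<otimes>\<^bsub>B\<^esub> x : p ` ?U" if ax: "a : p ` ?U" "x : carrier B" for a x
   proof -
    obtain u v where uv: "u : ?U" "v : carrier A" "a = p u" "x = p v" using ax D(3)[of x] by auto
    then have "x \<otimes>\<^bsub>B\<^esub> a = p (v \<otimes>\<^bsub>A\<^esub> u)" "a \<otimes>\<^bsub>B\<^esub> x = p (u \<otimes>\<^bsub>A\<^esub> v)" using D(5) U.Icarr by simp_all
    then show "x \<otimes>\<^bsub>B\<^esub> a : p ` ?U" "a \<otimes>\<^bsub>B\<^esub> x : p ` ?U" using uv U.I_l_closed U.I_r_closed by auto
   qed
  qed
  moreover have "p ` Q \<subseteq> p ` ?U" using A.genideal_self[OF RQ] by auto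
  ultimately have JU: "J \<subseteq> p ` ?U" unfolding J by (rule B.genideal_minimal)
  have RU: "genideal A R \<subseteq> ?U"
   using A.genideal_self[OF RQ] by (intro A.genideal_minimal[OF U.ideal_axioms]) auto
  show "{a : carrier A. p a : J} \<subseteq> ?U"
  proof safe
   fix a assume a: "a : carrier A" "p a : J"
   then obtain u where u: "u : ?U" "p a = p u" using JU by auto
   then have "a \<ominus>\<^bsub>A\<^esub> u : ?U" using is_quotient_eq[OF Q1 A a(1), of u] U.Icarr RU by auto
   then have "(a \<ominus>\<^bsub>A\<^esub> u) \<oplus>\<^bsub>A\<^esub> u : ?U" using u U.a_closed by auto
   then show "a : ?U" using a u U.Icarr[OF u(1)] by (simp add: a_minus_def A.a_assoc A.l_neg)
  qed
 qed
 have hom: "(%a. J +>\<^bsub>B\<^esub> p a) : algebra_hom K A (quotient_algebra B J)"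
  unfolding algebra_hom_def by (auto intro!: ring_hom_memI simp: D E)
 have surj: "(%a. J +>\<^bsub>B\<^esub> p a) ` carrier A = carrier (quotient_algebra B J)"
  using D(2,3) E(2,3) by (auto simp: image_iff) metis
 have "{a : carrier A. J +>\<^bsub>B\<^esub> p a = \<zero>\<^bsub>quotient_algebra B J\<^esub>} = {a : carrier A. p a : J}"
  using E(8) D(2) by blast
 then show ?thesis
  unfolding is_quotient_def using E(1) hom surj ker by blast
qed

lemma ideal_preimage:
 assumes QS: "is_quotient K A I S s" and QH: "is_quotient K B I' H p"
  and A: "assoc_algebra (scalars K) A" and B: "assoc_algebra (scalars K) B"
  and sub: "carrier A \<subseteq> carrier B" and zero: "\<zero>\<^bsub>A\<^esub> = \<zero>\<^bsub>B\<^esub>"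
  and add: "add A = add B" and mult: "mult A = mult B"
  and ind: "\<And>a. a : carrier A ==> ind (s a) = p a" and G: "ideal G H"
 shows "ideal {C : carrier S. ind C : G} S"
proof -
 note E = is_quotientD[OF QS] and D = is_quotientD[OF QH]
 interpret A: assoc_algebra "scalars K" A by fact
 interpret S: assoc_algebra "scalars K" S by (rule E(1))
 interpret G: ideal G H by (rule G)
 have carr: "a : carrier A ==> a : carrier B" for a using sub by blast
 have rep: "\<exists>a\<in>carrier A. C = s a & p a : G" if "C : {C : carrier S. ind C : G}" for C
  using E(3)[of C] ind that by auto
 have memb: "s a : {C : carrier S. ind C : G}" if "a : carrier A" "p a : G" for a
  using E(2)[of a] ind that by auto
 show ?thesis
 proof (rule idealI_closed[OF S.ring_axioms])
  have "p \<zero>\<^bsub>A\<^esub> : G" unfolding zero is_quotient_zero[OF QH B] by (rule additive_subgroup.zero_closed[OF ideal.axioms(1)[OF G]])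
  from memb[OF A.zero_closed this] show "\<zero>\<^bsub>S\<^esub> : {C : carrier S. ind C : G}"
   unfolding is_quotient_zero[OF QS A] .
  show "x \<oplus>\<^bsub>S\<^esub> y : {C : carrier S. ind C : G}" if x: "x : {C : carrier S. ind C : G}" and y: "y : {C : carrier S. ind C : G}" for x y
  proof -
   obtain a where a: "a : carrier A" "x = s a" "p a : G" using rep[OF x] by blast
   obtain b where b: "b : carrier A" "y = s b" "p b : G" using rep[OF y] by blast
   have "p (a \<oplus>\<^bsub>A\<^esub> b) : G" unfolding add using D(4)[of a b] carr a b additive_subgroup.a_closed[OF ideal.axioms(1)[OF G]] by simp
   from memb[OF A.a_closed[OF a(1) b(1)] this] show ?thesis unfolding a b E(4)[OF a(1) b(1)] .
  qed
  show "y \<otimes>\<^bsub>S\<^esub> x : {C : carrier S. ind C : G}" "x \<otimes>\<^bsub>S\<^esub> y : {C : carrier S. ind C : G}"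
   if x: "x : {C : carrier S. ind C : G}" and y: "y : carrier S" for x y
  proof -
   obtain a where a: "a : carrier A" "x = s a" "p a : G" using rep[OF x] by blast
   obtain b where b: "b : carrier A" "y = s b" using E(3)[OF y] by blast
   have "p (a \<otimes>\<^bsub>A\<^esub> b) : G" "p (b \<otimes>\<^bsub>A\<^esub> a) : G"
    unfolding mult using D(2)[of b] D(5)[of a b] D(5)[of b a] carr a b G.I_l_closed G.I_r_closed by simp_all
   note prods = memb[OF A.m_closed[OF a(1) b(1)] this(1), unfolded E(5)[OF a(1) b(1)]]
    memb[OF A.m_closed[OF b(1) a(1)] this(2), unfolded E(5)[OF b(1) a(1)]]
   show "y \<otimes>\<^bsub>S\<^esub> x : {C : carrier S. ind C : G}" unfolding a b by (rule prods(2))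
   show "x \<otimes>\<^bsub>S\<^esub> y : {C : carrier S. ind C : G}" unfolding a b by (rule prods(1))
  qed
 qed blast
qed

lemma relation_ideal_eq_gspan:
 assumes R: "R \<subseteq> FA K A"
 shows "relation_ideal K A R = gspan K {single u 1 * r * single v 1 | u r v. u : lists A & r : R & v : lists A}"
  (is "_ = gspan K ?B")
proof
 interpret F: ring "free_algebra K A" by (rule ring_free_algebra)
 have R': "R \<subseteq> carrier (free_algebra K A)" using R by simp
 interpret I: ideal "relation_ideal K A R" "free_algebra K A"
  unfolding relation_ideal_def by (rule F.genideal_ideal[OF R'])
 have BFA: "?B \<subseteq> FA K A" using R by (auto intro!: FA_mult)
 have gFA: "gspan K ?B \<subseteq> FA K A" by (rule gspan_FM[OF BFA])
 have left: "x * a : gspan K ?B" if "a : gspan K ?B" "x : FA K A" for a x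
  using that
 proof (induction arbitrary: rule: gspan.induct)
  case (gspan_base c b)
  then obtain u r v where b: "b = single u 1 * r * single v 1" "u : lists A" "r : R" "v : lists A" by auto
  have "lin (%w. single (w @ u) 1 * r * single v 1) x : gspan K ?B"
   using b gspan_base by (intro gspan_lin[where S = "lists A"] gspan_base1) fastforce+
  moreover have "lin (%w. single (w @ u) 1 * r * single v 1) x = x * b"
  proof -
   have "x * b = lin (%w. single w 1) x * b" by simp
   also have "\<dots> = lin (%w. single w 1 * b) x" by (rule lin_mult_left)
   also have "(%w. single w 1 * b) = (%w. single (w @ u) 1 * r * single v 1)"
    unfolding b(1) by (simp add: mult.assoc[symmetric])
   finally show ?thesis ..
  qed
  ultimately show ?case using gspan_base by (simp add: smul_mult_right gspan_smul)
 qed (auto simp: distrib_left intro: gspan.intros)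
 have right: "a * x : gspan K ?B" if "a : gspan K ?B" "x : FA K A" for a x
  using that
 proof (induction arbitrary: rule: gspan.induct)
  case (gspan_base c b)
  then obtain u r v where b: "b = single u 1 * r * single v 1" "u : lists A" "r : R" "v : lists A" by auto
  have "lin (%w. single u 1 * r * single (v @ w) 1) x : gspan K ?B"
   using b gspan_base by (intro gspan_lin[where S = "lists A"] gspan_base1) fastforce+
  moreover have "lin (%w. single u 1 * r * single (v @ w) 1) x = b * x"
  proof -
   have "b * x = b * lin (%w. single w 1) x" by simp
   also have "\<dots> = lin (%w. b * single w 1) x" by (rule lin_mult_right)
   also have "(%w. b * single w 1) = (%w. single u 1 * r * single (v @ w) 1)"
    unfolding b(1) by (simp add: mult.assoc)
   finally show ?thesis ..
  qed
  ultimately show ?case using gspan_base by (simp add: smul_mult_left gspan_smul)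
 qed (auto simp: distrib_right intro: gspan.intros)
 have "ideal (gspan K ?B) (free_algebra K A)"
  by (rule idealI_closed[OF ring_free_algebra]) (use gFA left right in \<open>auto intro: gspan.intros\<close>)
 moreover have "R \<subseteq> gspan K ?B"
 proof
  fix r assume "r : R"
  then have "single [] 1 * r * single [] 1 : ?B" by blast
  from gspan_base1[OF this] show "r : gspan K ?B" unfolding single_Nil_one by simp
 qed
 ultimately show "relation_ideal K A R \<subseteq> gspan K ?B"
  unfolding relation_ideal_def by (rule F.genideal_minimal)
 have RI: "R \<subseteq> relation_ideal K A R"
  unfolding relation_ideal_def by (rule F.genideal_self[OF R'])
 show "gspan K ?B \<subseteq> relation_ideal K A R"
 proof
  fix x assume "x : gspan K ?B"
  then show "x : relation_ideal K A R"
  proof induction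
   case (gspan_base c b)
   then obtain u r v where b: "b = single u 1 * r * single v 1" "u : lists A" "r : R" "v : lists A" by auto
   have r: "r : relation_ideal K A R" using RI b by auto
   have "single u c * r : relation_ideal K A R"
    using I.I_l_closed[OF r, of "single u c"] b gspan_base by auto
   from I.I_r_closed[OF this, of "single v 1"] have "single u c * r * single v 1 : relation_ideal K A R"
    using b by auto
   moreover have "smul c b = single u c * r * single v 1"
    unfolding b by (simp add: smul_mult_left[symmetric])
   ultimately show ?case by simp
  qed (use I.zero_closed I.a_closed in auto)
 qed
qed

lemma presented_is_quotient:
 assumes R: "R \<subseteq> FA K A"
 shows "is_quotient K (free_algebra K A) (relation_ideal K A R) (presented_algebra K A R)
     (%f. relation_ideal K A R +>\<^bsub>free_algebra K A\<^esub> f)"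
proof -
 have "ideal (relation_ideal K A R) (free_algebra K A)"
  unfolding relation_ideal_def using R by (intro ring.genideal_ideal[OF ring_free_algebra]) simp
 then show ?thesis
  unfolding presented_algebra_def by (rule quotient_is_quotient[OF free_algebra_assoc_algebra])
qed

end

section \<open>Signs\<close>

text \<open>Subsets of \<open>{..<n}\<close> index both the elements of \<open>T\<close> (the signs to be changed) and its characters; \<open>chi\<close> is the
 pairing between the two, and \<open>bs\<close> the bicharacter given by the cocycle.\<close>

definition chi :: "nat => nat set => nat set => complex" where
 "chi n L Z = (\<Prod>i<n. if i : L & i : Z then -1 else 1)"

definition bs :: "nat => nat set => nat set => complex" where
 "bs n L N = (\<Prod>i<n. \<Prod>j<n. if j < i & i : L & j : N then -1 else 1)"

text \<open>The sign of the inversions of \<open>\<pi>\<close> between elements of \<open>Z\<close>.\<close>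

definition inv_sign :: "nat => (nat => nat) => nat set => complex" where
 "inv_sign n \<pi> Z = (\<Prod>i<n. \<Prod>j<n. if j < i & \<pi> i < \<pi> j & i : Z & j : Z then -1 else 1)"

text \<open>\<open>par u\<close> is the weight of a word with letters \<open>u\<close>. The sign \<open>eps u\<close> counts the inversions of \<open>u\<close>; it is the
 factor by which the product of the letters changes under the twist.\<close>

primrec par :: "nat list => nat set" where
 "par [] = {}"
| "par (i # u) = sym_diff {i} (par u)"

primrec eps :: "nat => nat list => complex" where
 "eps n [] = 1"
| "eps n (i # u) = bs n {i} (par u) * eps n u"

text \<open>The first argument of \<open>bs\<close> is the weight of \<open>g e\<^sub>Z\<close> if \<open>g\<close> has the permutation \<open>\<pi>\<close>. The second factor is the
 correction that makes \<open>coc_step\<close> and \<open>coc_comp\<close> hold.\<close>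

definition coc :: "nat => (nat => nat) => nat set => complex" where
 "coc n \<pi> Z = bs n (sym_diff (\<pi> ` Z) Z) Z * inv_sign n \<pi> Z"

lemma prod_single: "i < n ==> (\<Prod>j<n. if j = i then c else 1) = (c :: complex)" for i n :: nat
 by simp

lemma chi_sym_diff:
 "chi n (sym_diff L N) Z = chi n L Z * chi n N Z" "chi n Z (sym_diff L N) = chi n Z L * chi n Z N"
 unfolding chi_def prod.distrib[symmetric] by (auto intro!: prod.cong)

lemma chi_commute: "chi n L N = chi n N L"
 unfolding chi_def by (auto intro!: prod.cong)

lemma chi_square [simp]: "chi n L N * chi n L N = 1"
 unfolding chi_def prod.distrib[symmetric] by (auto intro!: prod.neutral)

lemma chi_empty [simp]: "chi n {} Z = 1" "chi n Z {} = 1"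
 by (simp_all add: chi_def)

lemma chi_singleton: "i < n ==> chi n {i} Z = (if i : Z then -1 else 1)"
proof -
 assume i: "i < n"
 have "chi n {i} Z = (\<Prod>j<n. if j = i then (if i : Z then -1 else 1) else 1)"
  unfolding chi_def by (intro prod.cong refl) auto
 also have "\<dots> = (if i : Z then -1 else 1)" by (rule prod_single[OF i])
 finally show ?thesis .
qed

lemma chi_cases: "chi n L Z = 1 \<or> chi n L Z = -1"
 using chi_square[of n L Z] by (metis square_eq_1_iff)

lemma chi_orthogonal:
 assumes "L \<subseteq> {..<n}"
 shows "(\<Sum>Z\<in>PP n. chi n L Z) = (if L = {} then 2 ^ n else 0)"
proof (cases "L = {}")
 case True
 then show ?thesis by (simp add: card_Pow)
next
 case False
 then obtain i where i: "i : L" "i < n" using assms by auto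
 let ?S = "\<Sum>Z\<in>PP n. chi n L Z"
 have "?S = (\<Sum>Z\<in>PP n. chi n L (sym_diff Z {i}))"
  by (rule sum.reindex_bij_witness[where i = "%Z. sym_diff Z {i}" and j = "%Z. sym_diff Z {i}"])
   (use i in \<open>auto intro!: arg_cong[where f = "chi n L"]\<close>)
 also have "\<dots> = - ?S"
  using i by (simp only: chi_sym_diff chi_commute[of n L "{i}"] chi_singleton) (simp add: sum_negf)
 finally show ?thesis using False by simp
qed

lemma chi_orthogonal2:
 assumes "L \<subseteq> {..<n}" "N \<subseteq> {..<n}"
 shows "(\<Sum>Z\<in>PP n. chi n L Z * chi n N Z) = (if L = N then 2 ^ n else 0)"
proof -
 have "sym_diff L N \<subseteq> {..<n}" "(sym_diff L N = {}) = (L = N)" using assms by auto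
 then show ?thesis using chi_orthogonal[of "sym_diff L N" n] by (simp only: chi_sym_diff)
qed

lemma bs_sym_diff:
 "bs n (sym_diff L N) Z = bs n L Z * bs n N Z" "bs n Z (sym_diff L N) = bs n Z L * bs n Z N"
 unfolding bs_def prod.distrib[symmetric] by (auto intro!: prod.cong)

lemma bs_square [simp]: "bs n L N * bs n L N = 1"
 unfolding bs_def prod.distrib[symmetric] by (auto intro!: prod.neutral)

lemma bs_square' [simp]: "bs n L N * (bs n L N * x) = x"
 by (simp flip: mult.assoc)

lemma bs_empty [simp]: "bs n {} Z = 1" "bs n Z {} = 1"
 by (simp_all add: bs_def)

lemma bs_cases: "bs n L Z = 1 \<or> bs n L Z = -1"
 using bs_square[of n L Z] by (metis square_eq_1_iff)

lemma bs_singleton_left: "i < n ==> bs n {i} Z = (\<Prod>j<n. if j < i & j : Z then -1 else 1)"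
proof -
 assume i: "i < n"
 have "bs n {i} Z = (\<Prod>k<n. if k = i then (\<Prod>j<n. if j < i & j : Z then -1 else 1) else 1)"
  unfolding bs_def
 proof (intro prod.cong refl)
  fix k show "(\<Prod>j<n. if j < k & k : {i} & j : Z then -1 else 1)
   = (if k = i then (\<Prod>j<n. if j < i & j : Z then -1 else 1) else (1::complex))"
   by (cases "k = i") simp_all
 qed
 also have "\<dots> = (\<Prod>j<n. if j < i & j : Z then -1 else 1)" by (rule prod_single[OF i])
 finally show ?thesis .
qed

lemma bs_singletons: "i < n ==> j < n ==> bs n {i} {j} = (if j < i then -1 else 1)"
proof -
 assume i: "i < n" "j < n"
 have "bs n {i} {j} = (\<Prod>k<n. if k = j then (if j < i then -1 else 1) else 1)"
  unfolding bs_singleton_left[OF i(1)] by (intro prod.cong refl) auto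
 also have "\<dots> = (if j < i then -1 else 1)" by (rule prod_single[OF i(2)])
 finally show ?thesis .
qed

lemma inv_sign_square: "inv_sign n \<pi> Z * inv_sign n \<pi> Z = 1"
 unfolding inv_sign_def prod.distrib[symmetric] by (auto intro!: prod.neutral)

lemma inv_sign_empty [simp]: "inv_sign n \<pi> {} = 1"
 by (simp add: inv_sign_def)

lemma bs_image_left:
 assumes "\<pi> permutes {..<n}" "i < n"
 shows "bs n {\<pi> i} (\<pi> ` Z) = (\<Prod>j<n. if \<pi> j < \<pi> i & j : Z then -1 else 1)"
proof -
 have pi: "\<pi> i < n" using assms permutes_in_image[of \<pi> "{..<n}" i] by simp
 have inj: "inj \<pi>" using assms permutes_inj by blast
 have "bs n {\<pi> i} (\<pi> ` Z) = (\<Prod>j\<in>\<pi> ` {..<n}. if j < \<pi> i & j : \<pi> ` Z then -1 else 1)"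
  using bs_singleton_left[OF pi] permutes_image[OF assms(1)] by simp
 also have "\<dots> = (\<Prod>j<n. if \<pi> j < \<pi> i & \<pi> j : \<pi> ` Z then -1 else 1)"
  by (subst prod.reindex) (use inj in \<open>auto simp: inj_on_def inj_def\<close>)
 finally show ?thesis using inj by (simp add: inj_image_mem_iff)
qed

lemma inv_sign_step:
 assumes "\<pi> permutes {..<n}" "i < n"
 shows "inv_sign n \<pi> (sym_diff Z {i}) = inv_sign n \<pi> Z * bs n {\<pi> i} (\<pi> ` Z) * bs n {i} Z"
proof -
 have inj: "\<pi> a = \<pi> b \<longleftrightarrow> a = b" for a b using assms permutes_inj by (metis injD)
 define k1 where "k1 b = (if b < i & \<pi> i < \<pi> b & b : Z then -1 else 1 :: complex)" for b
 define k2 where "k2 a = (if i < a & \<pi> a < \<pi> i & a : Z then -1 else 1 :: complex)" for a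
 have "inv_sign n \<pi> (sym_diff Z {i}) * inv_sign n \<pi> Z
  = (\<Prod>a<n. \<Prod>b<n. (if a = i then k1 b else 1) * (if b = i then k2 a else 1))"
  unfolding inv_sign_def prod.distrib[symmetric] k1_def k2_def
  by (intro prod.cong refl) auto
 also have "\<dots> = (\<Prod>a<n. (if a = i then \<Prod>b<n. k1 b else 1) * k2 a)"
 proof (intro prod.cong refl)
  fix a
  show "(\<Prod>b<n. (if a = i then k1 b else 1) * (if b = i then k2 a else 1)) = (if a = i then \<Prod>b<n. k1 b else 1) * k2 a"
   using assms(2) by (cases "a = i") (simp_all add: prod.distrib)
 qed
 also have "\<dots> = (\<Prod>a<n. if a = i then \<Prod>b<n. k1 b else 1) * (\<Prod>a<n. k2 a)"
  by (rule prod.distrib)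
 also have "\<dots> = (\<Prod>j<n. k1 j * k2 j)"
  using assms(2) by (simp add: prod.distrib)
 also have "\<dots> = bs n {\<pi> i} (\<pi> ` Z) * bs n {i} Z"
  unfolding bs_image_left[OF assms] bs_singleton_left[OF assms(2)] prod.distrib[symmetric]
  by (intro prod.cong refl) (auto simp: k1_def k2_def inj not_less le_less)
 finally have *: "inv_sign n \<pi> (sym_diff Z {i}) * inv_sign n \<pi> Z = bs n {\<pi> i} (\<pi> ` Z) * bs n {i} Z" .
 have "inv_sign n \<pi> (sym_diff Z {i}) = inv_sign n \<pi> (sym_diff Z {i}) * inv_sign n \<pi> Z * inv_sign n \<pi> Z"
  by (simp add: mult.assoc inv_sign_square)
 then show ?thesis unfolding * by (simp add: mult_ac)
qed

lemma image_sym_diff: "inj \<pi> ==> \<pi> ` sym_diff L N = sym_diff (\<pi> ` L) (\<pi> ` N)"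
 by (simp add: image_Un image_set_diff)

lemma par_map: "inj \<pi> ==> par (map \<pi> u) = \<pi> ` par u"
 by (induction u) (simp_all add: image_Un image_set_diff)

lemma par_append: "par (u @ v) = sym_diff (par u) (par v)"
 by (induction u) auto

lemma par_subset: "set u \<subseteq> {..<n} ==> par u \<subseteq> {..<n}"
 by (induction u) auto

lemma par_distinct: "distinct u ==> par u = set u"
 by (induction u) auto

lemma eps_square: "eps n u * eps n u = 1"
 by (induction u) (simp_all add: mult.assoc mult.left_commute)

lemma eps_square' [simp]: "eps n u * (eps n u * x) = x"
 using eps_square[of n u] by (simp flip: mult.assoc)

text \<open>Applying a permutation to the letters of a word changes its number of inversions modulo \<open>2\<close> by an amount that
 only depends on the letters occurring an odd number of times.\<close>

lemma eps_map:
 assumes "\<pi> permutes {..<n}" "set u \<subseteq> {..<n}"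
 shows "eps n (map \<pi> u) * eps n u = inv_sign n \<pi> (par u)"
 using assms(2)
proof (induction u)
 case (Cons i u)
 have inj: "inj \<pi>" using assms permutes_inj by blast
 have "sym_diff {i} (par u) = sym_diff (par u) {i}" by auto
 then have "inv_sign n \<pi> (par (i # u)) = inv_sign n \<pi> (par u) * bs n {\<pi> i} (\<pi> ` par u) * bs n {i} (par u)"
  using inv_sign_step[OF assms(1), of i "par u"] Cons.prems by simp
 also have "\<dots> = eps n (map \<pi> (i # u)) * eps n (i # u)"
  using Cons by (simp add: par_map[OF inj] mult_ac)
 finally show ?case ..
qed simp

lemma eps_swap:
 assumes "i ~= j" "i < n" "j < n"
 shows "eps n (u @ i # j # v) = - eps n (u @ j # i # v)"
proof (induction u)
 case Nil
 then show ?case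
  using assms bs_singletons[of i n j] bs_singletons[of j n i]
  by (auto simp: bs_sym_diff)
next
 case (Cons a u)
 have "sym_diff {i} (sym_diff {j} (par v)) = sym_diff {j} (sym_diff {i} (par v))" by auto
 then have "par (u @ i # j # v) = par (u @ j # i # v)" by (simp add: par_append)
 with Cons show ?case by simp
qed

lemma inv_sign_comp:
 assumes "\<pi> permutes {..<n}" "\<rho> permutes {..<n}" "Z \<subseteq> {..<n}"
 shows "inv_sign n (\<pi> \<circ> \<rho>) Z = inv_sign n \<pi> (\<rho> ` Z) * inv_sign n \<rho> Z"
proof -
 define u where "u = sorted_list_of_set Z"
 have fin: "finite Z" using assms(3) finite_subset by blast
 have u: "par u = Z" "set u \<subseteq> {..<n}" using fin assms(3) by (simp_all add: u_def par_distinct)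
 have ru: "set (map \<rho> u) \<subseteq> {..<n}" using u permutes_in_image[OF assms(2)] by auto
 have inj: "inj \<rho>" using assms permutes_inj by blast
 have "inv_sign n \<pi> (\<rho> ` Z) * inv_sign n \<rho> Z
   = eps n (map \<pi> (map \<rho> u)) * eps n (map \<rho> u) * (eps n (map \<rho> u) * eps n u)"
  using eps_map[OF assms(1) ru] eps_map[OF assms(2) u(2)] u(1) par_map[OF inj] by simp
 also have "\<dots> = eps n (map (\<pi> \<circ> \<rho>) u) * eps n u"
  by (simp add: mult.assoc)
 also have "\<dots> = inv_sign n (\<pi> \<circ> \<rho>) Z"
  using eps_map[OF permutes_compose[OF assms(2,1)] u(2)] u(1) by simp
 finally show ?thesis ..
qed

lemma coc_square: "coc n \<pi> Z * coc n \<pi> Z = 1"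
 using inv_sign_square[of n \<pi> Z] by (simp add: coc_def mult_ac)

lemma coc_empty [simp]: "coc n \<pi> {} = 1"
 by (simp add: coc_def)

text \<open>Adding a letter to the character: this describes how a group element moves past \<open>x\<^sub>i\<close> or \<open>y\<^sub>i\<close>.\<close>

lemma coc_step:
 assumes "\<pi> permutes {..<n}" "i < n"
 shows "coc n \<pi> (sym_diff Z {i}) = coc n \<pi> Z * bs n {\<pi> i} (sym_diff (\<pi> ` Z) Z)
  * bs n (sym_diff (sym_diff (\<pi> ` Z) Z) (sym_diff {\<pi> i} {i})) {i}"
proof -
 have inj: "inj \<pi>" using assms permutes_inj by blast
 have im: "\<pi> ` sym_diff Z {i} = sym_diff (\<pi> ` Z) {\<pi> i}"
  using image_sym_diff[OF inj, of Z "{i}"] by simp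
 show ?thesis
  unfolding coc_def im inv_sign_step[OF assms] bs_sym_diff by (simp add: mult_ac)
qed

text \<open>This is the statement that the cocycle defining the twist becomes a coboundary on the action groupoid of the
 symmetric group on subsets.\<close>

lemma coc_comp:
 assumes "\<pi> permutes {..<n}" "\<rho> permutes {..<n}" "Z \<subseteq> {..<n}"
 shows "coc n (\<pi> \<circ> \<rho>) Z = coc n \<pi> (\<rho> ` Z) * coc n \<rho> Z
  * bs n (sym_diff (\<pi> ` \<rho> ` Z) (\<rho> ` Z)) (sym_diff (\<rho> ` Z) Z)"
 unfolding coc_def inv_sign_comp[OF assms] bs_sym_diff image_comp[symmetric] by (simp add: mult_ac)

lemma coc_id [simp]: "coc n id Z = 1"
 by (auto simp: coc_def inv_sign_def intro!: prod.neutral)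

lemma subset_induct_sym_diff [consumes 1, case_names empty step]:
 assumes "Z \<subseteq> {..<n::nat}" "P {}" "\<And>Z i. Z \<subseteq> {..<n} ==> i < n ==> P Z ==> P (sym_diff Z {i})"
 shows "P Z"
proof -
 have "finite Z" using assms(1) finite_subset by blast
 from this assms(1) show ?thesis
 proof (induction Z)
  case (insert i F)
  then have "insert i F = sym_diff F {i}" by auto
  then show ?case using assms(3)[of F i] insert by auto
 qed (rule assms)
qed

text \<open>For a transposition the sign is a character of \<open>T\<close> in \<open>Z\<close>, so twisting by it only multiplies a reflection by
 some \<open>t\<^sub>j\<close>.\<close>

lemma coc_transpose:
 assumes "j < i" "i < n" "Z \<subseteq> {..<n}"
 shows "coc n (transpose i j) Z = chi n {j} Z"
 using assms(3)
proof (induction Z rule: subset_induct_sym_diff)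
 case (step Z a)
 let ?\<pi> = "transpose i j"
 have perm: "?\<pi> permutes {..<n}" using assms by (intro permutes_swap_id) auto
 have "sym_diff (?\<pi> ` Z) Z = (if (i : Z) = (j : Z) then {} else sym_diff {i} {j})"
  using assms by (auto simp: transpose_def image_iff split: if_splits) 
 then have sd: "sym_diff (?\<pi> ` Z) Z = {} \<or> sym_diff (?\<pi> ` Z) Z = sym_diff {i} {j}" by metis
 have "coc n ?\<pi> (sym_diff Z {a}) = chi n {j} Z * (if a = j then -1 else 1)"
 proof -
  consider "a ~= i" "a ~= j" | "a = i" | "a = j" by blast
  then have "bs n {?\<pi> a} (sym_diff (?\<pi> ` Z) Z)
   * bs n (sym_diff (sym_diff (?\<pi> ` Z) Z) (sym_diff {?\<pi> a} {a})) {a} = (if a = j then -1 else 1)"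
  proof cases
   case 1
   then show ?thesis using sd 1 step assms by (elim disjE) (simp_all only: bs_sym_diff bs_empty transpose_apply_other, auto simp: bs_singletons)
  next
   case 2
   then show ?thesis using sd assms by (elim disjE) (simp_all only: bs_sym_diff bs_empty transpose_apply_first, auto simp: bs_singletons)
  next
   case 3
   then show ?thesis using sd assms by (elim disjE) (simp_all only: bs_sym_diff bs_empty transpose_apply_second, auto simp: bs_singletons)
  qed
  then show ?thesis using coc_step[OF perm, of a Z] step by (simp add: mult.assoc)
 qed
 also have "\<dots> = chi n {j} (sym_diff Z {a})"
  using assms step by (simp only: chi_sym_diff chi_singleton) auto
 finally show ?case .
qed simp

lemma coc_full:
 assumes "\<pi> permutes {..<n}"
 shows "coc n \<pi> {..<n} = of_int (sign \<pi>)"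
 using assms finite_lessThan
proof (induction rule: permutes_induct)
 case id
 then show ?case using coc_id[of n "{..<n}"] by (simp add: id_def)
next
 case (swap a b p)
 have tr: "transpose a b permutes {..<n}" using swap by (intro permutes_swap_id) auto
 have "coc n (transpose a b) {..<n} = -1"
 proof (cases "a < b")
  case True
  then show ?thesis using coc_transpose[of a b n "{..<n}"] swap by (simp add: transpose_commute chi_singleton)
 next
  case False
  then show ?thesis using coc_transpose[of b a n "{..<n}"] swap by (simp add: chi_singleton)
 qed
 then have "coc n (transpose a b \<circ> p) {..<n} = - coc n p {..<n}"
  using coc_comp[OF tr \<open>p permutes {..<n}\<close> order_refl] permutes_image[OF \<open>p permutes {..<n}\<close>] permutes_image[OF tr]
  by simp
 moreover have "sign (transpose a b \<circ> p) = - sign p"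
  using swap permutes_imp_permutation[OF finite_lessThan] tr by (simp add: sign_compose sign_swap_id)
 ultimately show ?case using swap by (simp add: o_def)
qed

lemma coc_complement:
 assumes "\<pi> permutes {..<n}" "Z \<subseteq> {..<n}"
 shows "coc n \<pi> ({..<n} - Z) = of_int (sign \<pi>) * coc n \<pi> Z"
 using assms(2)
proof (induction Z rule: subset_induct_sym_diff)
 case empty
 show ?case using coc_full[OF assms(1)] by simp
next
 case (step Z i)
 have inj: "inj \<pi>" using assms permutes_inj by blast
 have e: "{..<n} - sym_diff Z {i} = sym_diff ({..<n} - Z) {i}" using step by auto
 have "\<pi> ` ({..<n} - Z) = {..<n} - \<pi> ` Z"
  using image_set_diff[OF inj] permutes_image[OF assms(1)] by simp
 moreover have "\<pi> ` Z \<subseteq> {..<n}" using step permutes_in_image[OF assms(1)] by auto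
 ultimately have s: "sym_diff (\<pi> ` ({..<n} - Z)) ({..<n} - Z) = sym_diff (\<pi> ` Z) Z" using step by auto
 show ?case unfolding e coc_step[OF assms(1) step(2)] s step(3) by (simp add: mult_ac)
qed

section \<open>Monomial matrices\<close>

text \<open>The monomial matrix with entry \<open>d j\<close> in column \<open>j\<close> and row \<open>\<pi> j\<close>; \<open>pm\<close> and \<open>dm\<close> recover these data, with
 \<open>pm\<close> extended by the identity in order to be a permutation of all natural numbers.\<close>

definition mm :: "nat => (nat => nat) => (nat => complex) => complex mat" where
 "mm n \<pi> d = mat n n (%(r, s). if r = \<pi> s then d s else 0)"

definition tm :: "nat => nat set => complex mat" where
 "tm n Z = mm n id (%j. if j : Z then -1 else 1)"

definition pm :: "nat => complex mat => nat => nat" where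
 "pm n g j = (if j < n then THE i. i < n & g $$ (i, j) ~= 0 else j)"

definition dm :: "nat => complex mat => nat => complex" where
 "dm n g j = g $$ (pm n g j, j)"

lemma mm_carrier [simp]: "mm n \<pi> d : carrier_mat n n"
 by (simp add: mm_def)

lemma tm_carrier [simp]: "tm n Z : carrier_mat n n"
 by (simp add: tm_def)

lemma mm_index: "r < n ==> s < n ==> mm n \<pi> d $$ (r, s) = (if r = \<pi> s then d s else 0)"
 by (simp add: mm_def)

lemma mm_cong: "(\<And>j. j < n ==> \<pi> j = \<rho> j) ==> (\<And>j. j < n ==> d j = e j) ==> mm n \<pi> d = mm n \<rho> e"
 by (rule eq_matI) (auto simp: mm_def)

lemma mm_mult:
 assumes "\<rho> permutes {..<n}"
 shows "mm n \<pi> d * mm n \<rho> e = mm n (\<pi> \<circ> \<rho>) (%j. d (\<rho> j) * e j)"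
proof (rule eq_matI)
 fix r s assume "r < dim_row (mm n (\<pi> \<circ> \<rho>) (%j. d (\<rho> j) * e j))" "s < dim_col (mm n (\<pi> \<circ> \<rho>) (%j. d (\<rho> j) * e j))"
 then have rs: "r < n" "s < n" by (auto simp: mm_def)
 have rho: "\<rho> s < n" using permutes_in_image[OF assms, of s] rs by simp
 have "(mm n \<pi> d * mm n \<rho> e) $$ (r, s) = (\<Sum>k = 0..<n. mm n \<pi> d $$ (r, k) * mm n \<rho> e $$ (k, s))"
  using rs by (simp add: scalar_prod_def mm_def)
 also have "\<dots> = (\<Sum>k = 0..<n. if k = \<rho> s then (if r = \<pi> (\<rho> s) then d (\<rho> s) * e s else 0) else 0)"
  using rs by (intro sum.cong) (auto simp: mm_index)
 also have "\<dots> = mm n (\<pi> \<circ> \<rho>) (%j. d (\<rho> j) * e j) $$ (r, s)"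
  using rs rho by (simp add: mm_index)
 finally show "(mm n \<pi> d * mm n \<rho> e) $$ (r, s) = mm n (\<pi> \<circ> \<rho>) (%j. d (\<rho> j) * e j) $$ (r, s)" .
qed (simp_all add: mm_def)

lemma mm_one: "1\<^sub>m n = mm n id (%_. 1)"
 by (rule eq_matI) (auto simp: mm_def)

lemma pm_mm [simp]:
 assumes "\<pi> permutes {..<n}" "\<forall>j<n. d j ~= 0"
 shows "pm n (mm n \<pi> d) = \<pi>"
proof
 fix j
 show "pm n (mm n \<pi> d) j = \<pi> j"
 proof (cases "j < n")
  case True
  then have "\<pi> j < n" using permutes_in_image[OF assms(1), of j] by simp
  then have "(THE i. i < n & mm n \<pi> d $$ (i, j) ~= 0) = \<pi> j"
   using assms(2) True by (intro the_equality) (auto simp: mm_index split: if_splits)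
  then show ?thesis using True by (simp add: pm_def)
 next
  case False
  then show ?thesis using permutes_not_in[OF assms(1), of j] by (simp add: pm_def)
 qed
qed

lemma dm_mm:
 assumes "\<pi> permutes {..<n}" "\<forall>j<n. d j ~= 0" "j < n"
 shows "dm n (mm n \<pi> d) j = d j"
 using permutes_in_image[OF assms(1), of j] assms by (simp add: dm_def mm_index)

lemma mm_inj:
 assumes "mm n \<pi> d = mm n \<rho> e" "\<pi> permutes {..<n}" "\<rho> permutes {..<n}"
  "\<forall>j<n. d j ~= 0" "\<forall>j<n. e j ~= 0"
 shows "\<pi> = \<rho>" "\<And>j. j < n ==> d j = e j"
proof -
 show "\<pi> = \<rho>" using pm_mm[OF assms(2,4)] pm_mm[OF assms(3,5)] assms(1) by simp
 show "d j = e j" if "j < n" for j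
  using dm_mm[OF assms(2,4) that] dm_mm[OF assms(3,5) that] assms(1) by simp
qed

lemma monomial_mat_iff:
 "monomial_mat n g \<longleftrightarrow> (\<exists>\<pi> d. \<pi> permutes {..<n} & (\<forall>j<n. d j ~= 0) & g = mm n \<pi> d)"
proof
 assume g: "monomial_mat n g"
 then have carr: "g : carrier_mat n n" and row: "\<And>i. i < n ==> \<exists>!j. j < n & g $$ (i, j) ~= 0"
  and col: "\<And>j. j < n ==> \<exists>!i. i < n & g $$ (i, j) ~= 0" by (auto simp: monomial_mat_def)
 have pj: "pm n g j < n" "g $$ (pm n g j, j) ~= 0" if "j < n" for j
  using theI'[OF col[OF that]] that by (auto simp: pm_def)
 have uniq: "i = pm n g j" if "i < n" "j < n" "g $$ (i, j) ~= 0" for i j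
  using col[OF that(2)] that pj[OF that(2)] by blast
 have "pm n g permutes {..<n}"
 proof (rule bij_imp_permutes)
  have "inj_on (pm n g) {..<n}"
  proof (rule inj_onI)
   fix a b assume ab: "a : {..<n}" "b : {..<n}" "pm n g a = pm n g b"
   then show "a = b" using row[of "pm n g a"] pj[of a] pj[of b] by (metis lessThan_iff)
  qed
  moreover have "pm n g ` {..<n} \<subseteq> {..<n}" using pj by auto
  ultimately show "bij_betw (pm n g) {..<n} {..<n}"
   by (simp add: bij_betw_def endo_inj_surj)
 qed (simp add: pm_def)
 moreover have "g = mm n (pm n g) (dm n g)"
  using carr uniq by (intro eq_matI) (auto simp: mm_def dm_def)
 ultimately show "\<exists>\<pi> d. \<pi> permutes {..<n} & (\<forall>j<n. d j ~= 0) & g = mm n \<pi> d"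
  using pj by (metis dm_def)
next
 assume "\<exists>\<pi> d. \<pi> permutes {..<n} & (\<forall>j<n. d j ~= 0) & g = mm n \<pi> d"
 then obtain \<pi> d where g: "\<pi> permutes {..<n}" "\<forall>j<n. d j ~= 0" "g = mm n \<pi> d" by auto
 have lt: "\<pi> j < n" if "j < n" for j using permutes_in_image[OF g(1), of j] that by simp
 have "\<exists>!j. j < n & g $$ (i, j) ~= 0" if i: "i < n" for i
 proof -
  obtain j where j: "j < n" "\<pi> j = i"
   using permutes_image[OF g(1)] i by (metis imageE lessThan_iff)
  show ?thesis
  proof (rule ex1I[of _ j])
   fix j' assume "j' < n & g $$ (i, j') ~= 0"
   then have "\<pi> j' = \<pi> j" using i j g(3) by (auto simp: mm_index split: if_splits)
   then show "j' = j" using permutes_inj[OF g(1)] by (metis injD)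
  qed (use i j g in \<open>auto simp: mm_index\<close>)
 qed
 moreover have "\<exists>!i. i < n & g $$ (i, j) ~= 0" if j: "j < n" for j
  using g j lt[OF j] by (intro ex1I[of _ "\<pi> j"]) (auto simp: mm_index split: if_splits)
 ultimately show "monomial_mat n g" using g(3) by (auto simp: monomial_mat_def)
qed

lemma nonzero_positions_mm:
 assumes "\<pi> permutes {..<n}" "\<forall>j<n. d j ~= 0"
 shows "nonzero_positions n (mm n \<pi> d) = (%j. (\<pi> j, j)) ` {..<n}"
 using permutes_in_image[OF assms(1)] assms
 by (auto simp: nonzero_positions_def mm_index split: if_splits)

lemma prod_positions_mm:
 assumes "\<pi> permutes {..<n}" "\<forall>j<n. d j ~= 0"
 shows "(\<Prod>ij\<in>nonzero_positions n (mm n \<pi> d). mm n \<pi> d $$ ij) = (\<Prod>j<n. d j)"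
proof -
 have "(\<Prod>ij\<in>nonzero_positions n (mm n \<pi> d). mm n \<pi> d $$ ij) = (\<Prod>ij\<in>(%j. (\<pi> j, j)) ` {..<n}. mm n \<pi> d $$ ij)"
  using nonzero_positions_mm[OF assms] by simp
 also have "\<dots> = (\<Prod>j<n. mm n \<pi> d $$ (\<pi> j, j))"
  by (subst prod.reindex) (auto simp: inj_on_def)
 also have "\<dots> = (\<Prod>j<n. d j)"
  using permutes_in_image[OF assms(1)] by (intro prod.cong) (auto simp: mm_index)
 finally show ?thesis .
qed

lemma det_mm:
 assumes "\<pi> permutes {..<n}"
 shows "det (mm n \<pi> d) = of_int (sign \<pi>) * (\<Prod>j<n. d j)"
proof -
 have S: "{0..<n} = {..<n}" by auto
 have inv: "inv_into UNIV \<pi> permutes {..<n}" using permutes_inv[OF assms] .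
 have zero: "(\<Prod>i<n. mm n \<pi> d $$ (i, p i)) = 0" if p: "p permutes {..<n}" "p ~= inv_into UNIV \<pi>" for p
 proof -
  obtain i where i2: "p i ~= inv_into UNIV \<pi> i"
   using p(2) by (auto simp: fun_eq_iff)
  have "i < n"
  proof (rule ccontr)
   assume "\<not> i < n"
   then show False using i2 permutes_not_in[OF p(1), of i] permutes_not_in[OF inv, of i] by simp
  qed
  note i = this i2
  have "i ~= \<pi> (p i)" using i(2) permutes_inverses(2)[OF assms, of "p i"] by auto
  moreover have "p i < n" using permutes_in_image[OF p(1), of i] i by simp
  ultimately have "mm n \<pi> d $$ (i, p i) = 0" using i by (simp add: mm_index)
  then show ?thesis using i by (intro prod_zero) auto
 qed
 have "det (mm n \<pi> d) = (\<Sum>p | p permutes {..<n}. signof p * (\<Prod>i<n. mm n \<pi> d $$ (i, p i)))"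
  unfolding det_def'[OF mm_carrier] S by simp
 also have "\<dots> = (\<Sum>p | p permutes {..<n}. if p = inv_into UNIV \<pi> then signof p * (\<Prod>i<n. mm n \<pi> d $$ (i, p i)) else 0)"
  using zero by (intro sum.cong) auto
 also have "\<dots> = signof (inv_into UNIV \<pi>) * (\<Prod>i<n. mm n \<pi> d $$ (i, inv_into UNIV \<pi> i))"
  using inv finite_permutations[of "{..<n}"] by (subst sum.delta) auto
 also have "(\<Prod>i<n. mm n \<pi> d $$ (i, inv_into UNIV \<pi> i)) = (\<Prod>i<n. d (inv_into UNIV \<pi> i))"
  using permutes_in_image[OF inv] permutes_inverses(1)[OF assms] by (intro prod.cong) (auto simp: mm_index)
 also have "\<dots> = (\<Prod>j<n. d j)"
  using prod.permute[OF inv, of d] by (simp add: o_def)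
 also have "signof (inv_into UNIV \<pi>) = (of_int (sign \<pi>) :: complex)"
  using sign_inverse[OF permutes_imp_permutation[OF finite_lessThan assms]] by (simp add: sign_def)
 finally show ?thesis .
qed

lemma tm_mult: "tm n Z * tm n Y = tm n (sym_diff Z Y)"
 unfolding tm_def by (subst mm_mult[OF permutes_id]) (auto intro!: mm_cong)

lemma tm_empty: "tm n {} = 1\<^sub>m n"
 by (simp add: tm_def mm_one)

lemma tm_inj: "tm n Z = tm n Y ==> Z \<subseteq> {..<n} ==> Y \<subseteq> {..<n} ==> Z = Y"
proof -
 assume eq: "tm n Z = tm n Y" and sub: "Z \<subseteq> {..<n}" "Y \<subseteq> {..<n}"
 have "j : Z \<longleftrightarrow> j : Y" if "j < n" for j
 proof -
  have "(if j : Z then -1 else 1 :: complex) = (if j : Y then -1 else 1)"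
   by (rule mm_inj(2)[OF eq[unfolded tm_def] permutes_id permutes_id _ _ that]) auto
  then show ?thesis by (auto split: if_splits)
 qed
 then show "Z = Y" using sub by auto
qed

lemma t_mat_eq: "t_mat n i \<zeta> = mm n id (%j. if j = i then \<zeta> else 1)"
 by (rule eq_matI) (auto simp: t_mat_def mm_def)

lemma t_mat_tm: "t_mat n i (- 1) = tm n {i}"
 by (simp add: t_mat_eq tm_def)

lemma swap_mat_eq:
 assumes "i < n" "j < n" "i ~= j"
 shows "swap_mat n i j a b = mm n (transpose i j) (%k. if k = i then a else if k = j then b else 1)"
 by (rule eq_matI) (use assms in \<open>auto simp: swap_mat_def mm_def transpose_def\<close>)

section \<open>Both families of groups and algebras at once\<close>

text \<open>Membership in either group asks that \<open>sgq q \<pi>\<close> times the product of the entries be an \<open>m/p\<close>-th root of unity.\<close>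

definition sgq :: "complex => (nat => nat) => complex" where
 "sgq q \<pi> = (if q = 1 then 1 else of_int (sign \<pi>))"

definition Gq :: "complex => nat => nat => nat => complex mat monoid" where
 "Gq q m p n = (if q = 1 then G_group m p n else mu_G_group m p n)"

definition refl_mat :: "complex => nat => nat => nat => complex => complex mat" where
 "refl_mat q n i j \<epsilon> = swap_mat n i j (inverse \<epsilon>) (q * \<epsilon>)"

text \<open>The commutator of \<open>y\<^sub>i\<close> and \<open>x\<^sub>j\<close>, with the parameters of the two algebras already related by \<open>c \<mapsto> -c\<close>.\<close>

definition kq ::
 "complex => nat => nat => nat => complex => (complex => complex) => nat => nat => falg" where
 "kq q m p n c\<^sub>1 c i j =
  (if i = j
   then (\<Sum>l\<in>{..<n} - {i}. \<Sum>\<epsilon>\<in>unity_roots m. single [Gr (refl_mat q n i l \<epsilon>)] c\<^sub>1)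
     + (\<Sum>\<zeta>\<in>unity_roots (m div p) - {1}. single [Gr (t_mat n i \<zeta>)] (c \<zeta>))
   else \<Sum>\<epsilon>\<in>unity_roots m. single [Gr (refl_mat q n i j \<epsilon>)] (- q * c\<^sub>1 * \<epsilon>))"

lemma kappa_G_eq: "kappa_G m p n (- c\<^sub>1) (%\<zeta>. - c \<zeta>) = kq 1 m p n c\<^sub>1 c"
 by (simp add: fun_eq_iff kappa_G_def kq_def refl_mat_def s_mat_def single_uminus sum_negf)

lemma kappa_W_eq: "kappa_W m p n c\<^sub>1 c = kq (-1) m p n c\<^sub>1 c"
 by (simp add: fun_eq_iff kappa_W_def kq_def refl_mat_def sigma_mat_def)

text \<open>On the dual space the entries of a monomial matrix are replaced by their inverses.\<close>

definition cv :: "(nat => gen) => complex => complex" where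
 "cv v d = (if v = Xg then d else inverse d)"

lemma cv_simps [simp]: "cv v 1 = 1" "cv v (-1) = -1" "cv v (a * b) = cv v a * cv v b" "cv v a = 0 \<longleftrightarrow> a = 0"
 "cv Xg a = a" "cv Yg a = inverse a"
 by (auto simp: cv_def fun_eq_iff)

lemma unity_roots_mult: "a : unity_roots r ==> b : unity_roots r ==> a * b : unity_roots r"
 by (simp add: unity_roots_def power_mult_distrib)

lemma unity_roots_inverse: "a : unity_roots r ==> inverse a : unity_roots r"
 by (simp add: unity_roots_def power_inverse)

lemma unity_roots_1 [simp]: "1 : unity_roots r"
 by (simp add: unity_roots_def)

lemma unity_roots_nonzero: "0 < r ==> a : unity_roots r ==> a ~= 0"
 by (auto simp: unity_roots_def power_0_left)

lemma unity_roots_prod: "(\<And>i. i : I ==> f i : unity_roots r) ==> prod f I : unity_roots r"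
 by (induction I rule: infinite_finite_induct) (auto intro: unity_roots_mult)

locale cher = subK K for K +
 fixes m p n :: nat and c\<^sub>1 :: complex and c :: "complex => complex"
 assumes m_pos: "0 < m" and p_pos: "0 < p" and p_dvd: "p dvd m" and m_even: "even m"
  and roots_K: "unity_roots m \<subseteq> K" and c1_K: "c\<^sub>1 : K"
  and c_K: "\<And>\<zeta>. \<zeta> : unity_roots (m div p) - {1} ==> c \<zeta> : K"
begin

abbreviation \<Gamma> :: "complex => complex mat monoid" where "\<Gamma> q \<equiv> Gq q m p n"
abbreviation \<kappa> :: "complex => nat => nat => falg" where "\<kappa> q \<equiv> kq q m p n c\<^sub>1 c"
abbreviation CG :: "complex => complex mat set" where "CG q \<equiv> carrier (\<Gamma> q)"
abbreviation Um :: "complex set" where "Um \<equiv> unity_roots m"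
abbreviation Up :: "complex set" where "Up \<equiv> unity_roots (m div p)"
abbreviation HR :: "complex => falg set" where "HR q \<equiv> H_rels K n (\<Gamma> q) q (\<kappa> q)"
abbreviation HI :: "complex => falg set" where "HI q \<equiv> H_ideal K n (\<Gamma> q) q (\<kappa> q)"
abbreviation FS :: "(nat => gen) => falg set" where "FS v \<equiv> FA K (S_gens n v)"
abbreviation FH :: "complex => falg set" where "FH q \<equiv> FA K (H_gens n (\<Gamma> q))"
abbreviation AS :: "(nat => gen) => (complex, falg) module" where "AS v \<equiv> free_algebra K (S_gens n v)"
abbreviation AH :: "complex => (complex, falg) module" where "AH q \<equiv> free_algebra K (H_gens n (\<Gamma> q))"

lemma mp_pos: "0 < m div p"
 using m_pos p_pos p_dvd by (auto simp: dvd_def)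

lemma roots_mono: "Up \<subseteq> Um"
proof
 fix x assume "x : Up"
 moreover obtain k where "m = p * k" using p_dvd by (auto simp: dvd_def)
 ultimately show "x : Um"
  using p_pos by (simp add: unity_roots_def mult.commute[of p] power_mult)
qed

lemma minus_1_root: "-1 : Um"
 using m_even by (simp add: unity_roots_def)

lemma uminus_root: "a : Um ==> - a : Um"
 using unity_roots_mult[OF minus_1_root] by simp

lemma finite_roots [simp]: "finite (Um)" "finite (Up)"
 unfolding unity_roots_def using m_pos mp_pos by (intro finite_roots_unity; simp)+

lemma root_nonzero: "a : Um ==> a ~= 0"
 using unity_roots_nonzero[OF m_pos] .

lemma Gamma_iff:
 assumes "sgn1 q"
 shows "g : CG q \<longleftrightarrow> (\<exists>\<pi> d. \<pi> permutes {..<n} & (\<forall>j<n. d j : Um)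
  & sgq q \<pi> * (\<Prod>j<n. d j) : Up & g = mm n \<pi> d)"
proof
 assume g: "g : CG q"
 then have "monomial_mat n g" using assms by (auto simp: Gq_def G_group_def mu_G_group_def)
 then obtain \<pi> d where pd: "\<pi> permutes {..<n}" "\<forall>j<n. d j ~= 0" "g = mm n \<pi> d"
  unfolding monomial_mat_iff by auto
 have "\<forall>ij\<in>(%j. (\<pi> j, j)) ` {..<n}. g $$ ij : Um"
  using g assms nonzero_positions_mm[OF pd(1,2)] pd(3) by (auto simp: Gq_def G_group_def mu_G_group_def split: if_splits)
 then have d: "\<forall>j<n. d j : Um" using pd(3) permutes_in_image[OF pd(1)] by (auto simp: mm_index)
 have "sgq q \<pi> * (\<Prod>j<n. d j) : Up"
  using g assms prod_positions_mm[OF pd(1,2)] det_mm[OF pd(1)] pd(3)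
  by (auto simp: Gq_def G_group_def mu_G_group_def sgq_def split: if_splits)
 with pd d show "\<exists>\<pi> d. \<pi> permutes {..<n} & (\<forall>j<n. d j : Um)
  & sgq q \<pi> * (\<Prod>j<n. d j) : Up & g = mm n \<pi> d" by blast
next
 assume "\<exists>\<pi> d. \<pi> permutes {..<n} & (\<forall>j<n. d j : Um)
  & sgq q \<pi> * (\<Prod>j<n. d j) : Up & g = mm n \<pi> d"
 then obtain \<pi> d where pd: "\<pi> permutes {..<n}" "\<forall>j<n. d j : Um"
  "sgq q \<pi> * (\<Prod>j<n. d j) : Up" "g = mm n \<pi> d" by blast
 have nz: "\<forall>j<n. d j ~= 0" using pd(2) root_nonzero by auto
 have "\<forall>ij\<in>nonzero_positions n g. g $$ ij : Um"
  using nonzero_positions_mm[OF pd(1) nz] pd permutes_in_image[OF pd(1)] by (auto simp: mm_index)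
 then show "g : CG q"
  using pd nz assms prod_positions_mm[OF pd(1) nz] det_mm[OF pd(1), of d] monomial_mat_iff[of n g]
  by (auto simp: Gq_def G_group_def mu_G_group_def sgq_def split: if_splits)
qed

lemma Gamma_mult_one: "mult (\<Gamma> q) = (*)" "\<one>\<^bsub>\<Gamma> q\<^esub> = 1\<^sub>m n"
 by (simp_all add: Gq_def G_group_def mu_G_group_def)

lemma GammaD:
 assumes "sgn1 q" "g : CG q"
 shows "pm n g permutes {..<n}" "\<And>j. j < n ==> dm n g j : Um"
  "sgq q (pm n g) * (\<Prod>j<n. dm n g j) : Up" "g = mm n (pm n g) (dm n g)"
  "\<And>j. j < n ==> dm n g j ~= 0" "\<And>j. j < n ==> pm n g j < n" "g : carrier_mat n n"
proof -
 obtain \<pi> d where pd: "\<pi> permutes {..<n}" "\<forall>j<n. d j : Um"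
  "sgq q \<pi> * (\<Prod>j<n. d j) : Up" "g = mm n \<pi> d" using assms Gamma_iff by blast
 have nz: "\<forall>j<n. d j ~= 0" using pd(2) root_nonzero by auto
 have pmg: "pm n g = \<pi>" using pd(4) pm_mm[OF pd(1) nz] by simp
 have dmg: "\<And>j. j < n ==> dm n g j = d j" using pd(4) dm_mm[OF pd(1) nz] by simp
 show "pm n g permutes {..<n}" unfolding pmg by (rule pd(1))
 show "\<And>j. j < n ==> dm n g j : Um" "\<And>j. j < n ==> dm n g j ~= 0"
  using dmg pd(2) nz by auto
 show "\<And>j. j < n ==> pm n g j < n" unfolding pmg using permutes_in_image[OF pd(1)] by auto
 show "g : carrier_mat n n" using pd(4) by simp
 show "sgq q (pm n g) * (\<Prod>j<n. dm n g j) : Up" unfolding pmg using pd(3) dmg by simp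
 have "g = mm n \<pi> d" by (rule pd(4))
 also have "\<dots> = mm n (pm n g) (dm n g)" unfolding pmg using dmg by (intro mm_cong) auto
 finally show "g = mm n (pm n g) (dm n g)" .
qed

lemma sgq_comp: "\<pi> permutes {..<n} ==> \<rho> permutes {..<n} ==> sgq q (\<pi> \<circ> \<rho>) = sgq q \<pi> * sgq q \<rho>"
 using permutes_imp_permutation[OF finite_lessThan] by (simp add: sgq_def sign_compose)

lemma Gamma_mm:
 assumes "sgn1 q" "\<pi> permutes {..<n}" "\<And>j. j < n ==> d j : Um"
  "sgq q \<pi> * (\<Prod>j<n. d j) : Up"
 shows "mm n \<pi> d : CG q"
 using assms Gamma_iff by blast

lemma pm_dm_mult:
 assumes "sgn1 q" "sgn1 q'" "g : CG q" "h : carrier (\<Gamma> q')"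
 shows "pm n (g * h) = pm n g \<circ> pm n h" "j < n ==> dm n (g * h) j = dm n g (pm n h j) * dm n h j"
proof -
 note G = GammaD[OF assms(1,3)] and H = GammaD[OF assms(2,4)]
 have gh: "g * h = mm n (pm n g \<circ> pm n h) (%j. dm n g (pm n h j) * dm n h j)"
  using mm_mult[OF H(1), of "pm n g" "dm n g" "dm n h"] G(4) H(4) by simp
 have nz: "\<forall>j<n. dm n g (pm n h j) * dm n h j ~= 0" using G(5) H(5,6) by auto
 note perm = permutes_compose[OF H(1) G(1)]
 show "pm n (g * h) = pm n g \<circ> pm n h" unfolding gh by (rule pm_mm[OF perm nz])
 show "j < n ==> dm n (g * h) j = dm n g (pm n h j) * dm n h j" unfolding gh by (rule dm_mm[OF perm nz])
qed

definition ginv :: "complex mat => complex mat" where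
 "ginv g = mm n (inv_into UNIV (pm n g)) (%j. inverse (dm n g (inv_into UNIV (pm n g) j)))"

lemma Gamma_closed:
 assumes q: "sgn1 q" and g: "g : CG q"
 shows "h : CG q ==> g * h : CG q" "1\<^sub>m n : CG q" "ginv g : CG q"
  "ginv g * g = 1\<^sub>m n"
proof -
 note G = GammaD[OF q g]
 show "g * h : CG q" if "h : CG q"
 proof -
  note H = GammaD[OF q that]
  have gh: "g * h = mm n (pm n g \<circ> pm n h) (%j. dm n g (pm n h j) * dm n h j)"
   using mm_mult[OF H(1), of "pm n g" "dm n g" "dm n h"] G(4) H(4) by simp
  have "(\<Prod>j<n. dm n g (pm n h j)) = (\<Prod>j<n. dm n g j)"
   using prod.permute[OF H(1), of "dm n g"] by (simp add: o_def)
  then have "sgq q (pm n g \<circ> pm n h) * (\<Prod>j<n. dm n g (pm n h j) * dm n h j)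
   = (sgq q (pm n g) * (\<Prod>j<n. dm n g j)) * (sgq q (pm n h) * (\<Prod>j<n. dm n h j))"
   by (simp add: prod.distrib sgq_comp[OF G(1) H(1)] mult_ac)
  then show ?thesis
   unfolding gh using G(2,3) H(2,3,6)
   by (intro Gamma_mm[OF q permutes_compose[OF H(1) G(1)]]) (auto intro!: unity_roots_mult)
 qed
 show "1\<^sub>m n : CG q"
  unfolding mm_one by (rule Gamma_mm[OF q permutes_id]) (simp_all add: sgq_def)
 note inv = permutes_inv[OF G(1)]
 have lt: "inv_into UNIV (pm n g) j < n" if "j < n" for j using permutes_in_image[OF inv, of j] that by simp
 have "(\<Prod>j<n. dm n g (inv_into UNIV (pm n g) j)) = (\<Prod>j<n. dm n g j)"
  using prod.permute[OF inv, of "dm n g"] by (simp add: o_def)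
 then have "sgq q (inv_into UNIV (pm n g)) * (\<Prod>j<n. inverse (dm n g (inv_into UNIV (pm n g) j)))
  = inverse (sgq q (pm n g) * (\<Prod>j<n. dm n g j))"
  using sign_inverse[OF permutes_imp_permutation[OF finite_lessThan G(1)]]
  prod_inversef[of "%j. dm n g (inv_into UNIV (pm n g) j)" "{..<n}"]
  by (simp add: o_def sgq_def sign_def)
 then show "ginv g : CG q"
  unfolding ginv_def using G(2) unity_roots_inverse[OF G(3)] lt by (intro Gamma_mm[OF q inv]) (auto intro!: unity_roots_inverse)
 have "ginv g * g = ginv g * mm n (pm n g) (dm n g)"
  by (rule arg_cong[where f = "%x. ginv g * x", OF G(4)])
 also have "\<dots> = mm n (inv_into UNIV (pm n g) \<circ> pm n g)
   (%j. inverse (dm n g (inv_into UNIV (pm n g) (pm n g j))) * dm n g j)"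
  unfolding ginv_def by (rule mm_mult[OF G(1)])
 also have "\<dots> = 1\<^sub>m n"
  unfolding mm_one using permutes_inverses[OF G(1)] G(5) by (intro mm_cong) auto
 finally show "ginv g * g = 1\<^sub>m n" .
qed

lemma Gamma_nonempty: "sgn1 q ==> 1\<^sub>m n : CG q"
 unfolding mm_one by (rule Gamma_mm[OF _ permutes_id]) (simp_all add: sgq_def)

lemma Gamma_group:
 assumes q: "sgn1 q"
 shows "group (\<Gamma> q)"
proof (rule groupI)
 fix x y z assume "x : CG q" "y : CG q" "z : CG q"
 then show "x \<otimes>\<^bsub>\<Gamma> q\<^esub> y \<otimes>\<^bsub>\<Gamma> q\<^esub> z = x \<otimes>\<^bsub>\<Gamma> q\<^esub> (y \<otimes>\<^bsub>\<Gamma> q\<^esub> z)"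
  unfolding Gamma_mult_one using GammaD(7)[OF q] assoc_mult_mat by metis
next
 fix x assume x: "x : CG q"
 show "\<one>\<^bsub>\<Gamma> q\<^esub> \<otimes>\<^bsub>\<Gamma> q\<^esub> x = x" using GammaD(7)[OF q x] by (simp add: Gamma_mult_one)
 show "\<exists>y\<in>CG q. y \<otimes>\<^bsub>\<Gamma> q\<^esub> x = \<one>\<^bsub>\<Gamma> q\<^esub>"
  using Gamma_closed(3,4)[OF q x] by (auto simp: Gamma_mult_one)
qed (use Gamma_closed[OF q] Gamma_nonempty[OF q] in \<open>auto simp: Gamma_mult_one\<close>)

lemma Gamma_inv: "sgn1 q ==> g : CG q ==> inv\<^bsub>\<Gamma> q\<^esub> g = ginv g"
 using group.inv_equality[OF Gamma_group, of q "ginv g" g] Gamma_closed[of q g] by (simp add: Gamma_mult_one)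

lemma sum_single_index:
 "i < n ==> (\<And>j. j < n ==> j ~= i ==> f j = 0) ==> (\<Sum>j<n. f j) = (f i :: 'b::comm_monoid_add)"
 by (subst sum.remove[of _ i]) (auto intro!: sum.neutral)

lemma gen_action_v:
 assumes q: "sgn1 q" and g: "g : CG q" and v: "XY v" and i: "i < n"
 shows "gen_action n (\<Gamma> q) g (v i) = single [v (pm n g i)] (cv v (dm n g i))"
proof -
 note G = GammaD[OF q g]
 have pi: "pm n g i < n" using G(6) i by simp
 have gind: "g $$ (j, i) = (if j = pm n g i then dm n g i else 0)" if "j < n" for j
  using G(4) mm_index[OF that i, of "pm n g" "dm n g"] by simp
 have iind: "ginv g $$ (i, j) = (if j = pm n g i then inverse (dm n g i) else 0)" if "j < n" for j
  using permutes_inverses[OF G(1)] mm_index[OF i that] by (auto simp: ginv_def)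
 have "gen_action n (\<Gamma> q) g (Xg i) = single [Xg (pm n g i)] (dm n g i)"
  unfolding gen_action_def gen.case
  by (subst sum_single_index[OF pi]) (auto simp: gind pi)
 moreover have "gen_action n (\<Gamma> q) g (Yg i) = single [Yg (pm n g i)] (inverse (dm n g i))"
  unfolding gen_action_def gen.case Gamma_inv[OF q g]
  by (subst sum_single_index[OF pi]) (auto simp: iind pi)
 ultimately show ?thesis using v by auto
qed

lemma refl_mat_Gamma:
 assumes q: "sgn1 q" and "i < n" "l < n" "i ~= l" "\<epsilon> : Um"
 shows "refl_mat q n i l \<epsilon> = mm n (transpose i l) (%k. if k = i then inverse \<epsilon> else if k = l then q * \<epsilon> else 1)"
  "refl_mat q n i l \<epsilon> : CG q"
proof -
 let ?d = "%k. if k = i then inverse \<epsilon> else if k = l then q * \<epsilon> else 1"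
 show eq: "refl_mat q n i l \<epsilon> = mm n (transpose i l) ?d"
  unfolding refl_mat_def using assms by (simp add: swap_mat_eq)
 have "(\<Prod>k<n. ?d k) = (\<Prod>k<n. (if k = i then inverse \<epsilon> else 1) * (if k = l then q * \<epsilon> else 1))"
  using assms by (intro prod.cong) auto
 also have "\<dots> = inverse \<epsilon> * (q * \<epsilon>)" using assms by (simp add: prod.distrib)
 also have "\<dots> = q" using root_nonzero[OF assms(5)] by simp
 finally have "sgq q (transpose i l) * (\<Prod>k<n. ?d k) = 1"
  using q assms by (auto simp: sgq_def sign_swap_id)
 then show "refl_mat q n i l \<epsilon> : CG q"
  unfolding eq using assms
  by (intro Gamma_mm[OF q permutes_swap_id]) (auto intro: unity_roots_inverse uminus_root)
qed

lemma t_mat_Gamma: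
 assumes q: "sgn1 q" and "i < n" "\<zeta> : Up"
 shows "t_mat n i \<zeta> : CG q"
 unfolding t_mat_eq using assms roots_mono
 by (intro Gamma_mm[OF q permutes_id]) (auto simp: sgq_def)

lemma kappa_FA:
 assumes q: "sgn1 q" and "i < n" "j < n"
 shows "\<kappa> q i j : FA K (Gr ` CG q)"
proof -
 have "- q * c\<^sub>1 * \<epsilon> : K" if "\<epsilon> : Um" for \<epsilon>
  using q c1_K roots_K that by (auto intro!: K_minus K_mult)
 then show ?thesis
  unfolding kq_def using assms refl_mat_Gamma(2)[OF q] t_mat_Gamma[OF q] c1_K c_K
  by (auto intro!: FM_sum FM_add FM_single)
qed

abbreviation Hg :: "complex => gen set" where "Hg q \<equiv> H_gens n (\<Gamma> q)"
abbreviation Sg :: "(nat => gen) => gen set" where "Sg v \<equiv> S_gens n v"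
abbreviation SI :: "complex => (nat => gen) => falg set" where "SI q v \<equiv> S_ideal K n q v"

lemma Sg_Hg: "XY v ==> Sg v \<subseteq> Hg q"
 by (auto simp: S_gens_def H_gens_def)

lemma FA_Sg_Hg: "XY v ==> f : FS v ==> f : FH q"
 using FM_mono[OF lists_mono[OF Sg_Hg]] by blast

lemma FA_Gr_Hg: "f : FA K (Gr ` CG q) ==> f : FH q"
 using FM_mono[OF lists_mono[of "Gr ` CG q" "Hg q"]] by (auto simp: H_gens_def)

lemma lists_Sg: "w : lists (Sg v) \<longleftrightarrow> (\<exists>u\<in>lists {..<n}. w = map v u)"
 by (simp add: S_gens_def lists_image image_iff)

lemma S_rels_FA: "sgn1 q ==> S_rels n q v \<subseteq> FS v"
 by (auto simp: S_rels_def S_gens_def intro!: FM_diff FM_single K_minus)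

lemma S_ideal_eq:
 assumes "sgn1 q"
 shows "SI q v = gspan K {single (map v (a @ [i, j] @ b)) 1 - single (map v (a @ [j, i] @ b)) q | a b i j.
  a : lists {..<n} & b : lists {..<n} & i < n & j < n & i ~= j}" (is "_ = gspan K ?B")
proof -
 have "{single u 1 * r * single w 1 | u r w. u : lists (Sg v) & r : S_rels n q v & w : lists (Sg v)} = ?B"
 proof (rule subset_antisym; rule subsetI)
  fix x assume "x : {single u 1 * r * single w 1 | u r w. u : lists (Sg v) & r : S_rels n q v & w : lists (Sg v)}"
  then obtain a b i j where "x = single (map v a) 1 * (single [v i, v j] 1 - single [v j, v i] q) * single (map v b) 1"
   "a : lists {..<n}" "b : lists {..<n}" "i < n" "j < n" "i ~= j"
   by (auto simp: lists_Sg S_rels_def)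
  then show "x : ?B"
   by (auto simp: left_diff_distrib right_diff_distrib)
 next
  fix x assume "x : ?B"
  then obtain a b i j where x: "x = single (map v (a @ [i, j] @ b)) 1 - single (map v (a @ [j, i] @ b)) q"
   "a : lists {..<n}" "b : lists {..<n}" "i < n" "j < n" "i ~= j" by blast
  then have "x = single (map v a) 1 * (single [v i, v j] 1 - single [v j, v i] q) * single (map v b) 1"
   by (simp add: left_diff_distrib right_diff_distrib)
  moreover have "single [v i, v j] 1 - single [v j, v i] q : S_rels n q v"
   using x by (auto simp: S_rels_def)
  moreover have "map v a : lists (Sg v)" "map v b : lists (Sg v)" unfolding lists_Sg using x by blast+
  ultimately show "x : {single u 1 * r * single w 1 | u r w. u : lists (Sg v) & r : S_rels n q v & w : lists (Sg v)}"
   by blast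
 qed
 then show ?thesis
  unfolding S_ideal_def using relation_ideal_eq_gspan[OF S_rels_FA[OF assms]] by simp
qed

definition wcoef :: "(nat => gen) => complex mat => nat list => complex" where
 "wcoef v g u = (\<Prod>i\<leftarrow>u. cv v (dm n g i))"

lemma wcoef_simps [simp]:
 "wcoef v g [] = 1" "wcoef v g (i # u) = cv v (dm n g i) * wcoef v g u" "wcoef v g (u @ w) = wcoef v g u * wcoef v g w"
 by (simp_all add: wcoef_def)

definition vact :: "complex => complex mat => falg => falg" where
 "vact q g = lin (%w. prod_list (map (gen_action n (\<Gamma> q) g) w))"

lemma vact_word:
 assumes "sgn1 q" "g : CG q" "XY v" "u : lists {..<n}"
 shows "vact q g (single (map v u) a) = single (map v (map (pm n g) u)) (a * wcoef v g u)"
proof -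
 have "prod_list (map (gen_action n (\<Gamma> q) g) (map v u)) = single (map v (map (pm n g) u)) (wcoef v g u)"
  using assms(4)
 proof (induction u)
  case (Cons i u)
  then show ?case using gen_action_v[OF assms(1,2,3), of i] by simp
 qed (simp add: single_Nil_one)
 then show ?thesis by (simp add: vact_def)
qed

lemma wcoef_K: "sgn1 q ==> g : CG q ==> u : lists {..<n} ==> wcoef v g u : K"
 by (induction u) (use GammaD(2)[of q g] roots_K in \<open>auto simp: cv_def\<close>)

lemma vact_FA:
 assumes "sgn1 q" "g : CG q" "XY v" "f : FS v"
 shows "vact q g f : FS v"
proof -
 have "prod_list (map (gen_action n (\<Gamma> q) g) w) : FS v" if w: "w : lists (Sg v)" for w
 proof -
  obtain u where u: "u : lists {..<n}" "w = map v u" using w lists_Sg by blast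
  have "map (pm n g) u : lists {..<n}" using u GammaD(6)[OF assms(1,2)] by auto
  then have "map v (map (pm n g) u) : lists (Sg v)" unfolding lists_Sg by blast
  then have "single (map v (map (pm n g) u)) (wcoef v g u) : FS v"
   using wcoef_K[OF assms(1,2) u(1)] by blast
  then show ?thesis using vact_word[OF assms(1,2,3) u(1), of 1] u by (simp add: vact_def)
 qed
 then show ?thesis unfolding vact_def using assms(4) by (intro FM_lin)
qed

lemma vact_S_ideal:
 assumes "sgn1 q" "g : CG q" "XY v" "f : SI q v"
 shows "vact q g f : SI q v"
proof -
 note G = GammaD[OF assms(1,2)]
 have lt: "map (pm n g) u : lists {..<n}" if "u : lists {..<n}" for u using that G(6) by auto
 show ?thesis
  using assms(4) unfolding S_ideal_eq[OF assms(1)] vact_def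
 proof (rule gspan_image, fold vact_def)
  fix r assume "r : {single (map v (a @ [i, j] @ b)) 1 - single (map v (a @ [j, i] @ b)) q | a b i j.
  a : lists {..<n} & b : lists {..<n} & i < n & j < n & i ~= j}"
  then obtain a b i j where r: "r = single (map v (a @ [i, j] @ b)) 1 - single (map v (a @ [j, i] @ b)) q"
   "a : lists {..<n}" "b : lists {..<n}" "i < n" "j < n" "i ~= j" by blast
  have w: "a @ [i, j] @ b : lists {..<n}" "a @ [j, i] @ b : lists {..<n}" using r by auto
  have "vact q g r = vact q g (single (map v (a @ [i, j] @ b)) 1) - vact q g (single (map v (a @ [j, i] @ b)) q)"
   unfolding r vact_def lin_diff ..
  also have "\<dots> = smul (wcoef v g (a @ [i, j] @ b))
   (single (map v (map (pm n g) a @ [pm n g i, pm n g j] @ map (pm n g) b)) 1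
   - single (map v (map (pm n g) a @ [pm n g j, pm n g i] @ map (pm n g) b)) q)"
   unfolding vact_word[OF assms(1,2,3) w(1)] vact_word[OF assms(1,2,3) w(2)] by (simp add: smul_diff mult_ac)
  also have "\<dots> : gspan K {single (map v (a @ [i, j] @ b)) 1 - single (map v (a @ [j, i] @ b)) q | a b i j.
  a : lists {..<n} & b : lists {..<n} & i < n & j < n & i ~= j}"
  proof (rule gspan_base)
   show "wcoef v g (a @ [i, j] @ b) : K" by (rule wcoef_K[OF assms(1,2) w(1)])
   have "pm n g i ~= pm n g j" using r permutes_inj[OF G(1)] by (metis injD)
   moreover have "pm n g i < n" "pm n g j < n" using G(6) r by auto
   ultimately show "single (map v (map (pm n g) a @ [pm n g i, pm n g j] @ map (pm n g) b)) 1
   - single (map v (map (pm n g) a @ [pm n g j, pm n g i] @ map (pm n g) b)) q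
   : {single (map v (a @ [i, j] @ b)) 1 - single (map v (a @ [j, i] @ b)) q | a b i j.
     a : lists {..<n} & b : lists {..<n} & i < n & j < n & i ~= j}"
    using lt[OF r(2)] lt[OF r(3)] by blast
  qed
  finally show "vact q g r : gspan K {single (map v (a @ [i, j] @ b)) 1 - single (map v (a @ [j, i] @ b)) q | a b i j.
  a : lists {..<n} & b : lists {..<n} & i < n & j < n & i ~= j}" .
 qed
qed

section \<open>Presentations of the coinvariant algebras and of the restricted algebras\<close>

text \<open>Representatives in the free algebra of the homogeneous invariants of positive degree.\<close>

definition Inv :: "complex => (nat => gen) => falg set" where
 "Inv q v = {f : FS v. (\<exists>d>0. \<forall>w\<in>keys f. length w = d)
  & (\<forall>g\<in>CG q. vact q g f - f : SI q v)}"

text \<open>\<open>clS\<close> and \<open>clH\<close> are the quotient maps from the free algebras onto the coinvariant algebra and the restricted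
 algebra; they pass through the two quotients of the definitions, and have the kernels \<open>JS\<close> and \<open>J\<close>.\<close>

definition JS :: "complex => (nat => gen) => falg set" where
 "JS q v = relation_ideal K (Sg v) (S_rels n q v \<union> Inv q v)"

definition J :: "complex => falg set" where
 "J q = relation_ideal K (Hg q) (HR q \<union> (Inv q Xg \<union> Inv q Yg))"

definition clS :: "complex => (nat => gen) => falg => falg set set" where
 "clS q v f = invariant_ideal K n (\<Gamma> q) q v +>\<^bsub>S_alg K n q v\<^esub> (SI q v +>\<^bsub>AS v\<^esub> f)"

definition clH :: "complex => falg => falg set set" where
 "clH q f = restricted_ideal K n (\<Gamma> q) q (\<kappa> q) +>\<^bsub>H_alg K n (\<Gamma> q) q (\<kappa> q)\<^esub>
   (HI q +>\<^bsub>AH q\<^esub> f)"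

lemma coset_iff: "x : I +>\<^bsub>free_algebra K A\<^esub> f \<longleftrightarrow> x - f : I"
proof -
 have "x : I +>\<^bsub>free_algebra K A\<^esub> f \<longleftrightarrow> (\<exists>h\<in>I. x = h + f)" by (auto simp: a_r_coset_def')
 also have "\<dots> \<longleftrightarrow> x - f : I" by (metis add_diff_cancel diff_add_cancel)
 finally show ?thesis .
qed

lemma S_alg_quotient:
 assumes "sgn1 q"
 shows "is_quotient K (AS v) (genideal (AS v) (S_rels n q v)) (S_alg K n q v)
  (%f. SI q v +>\<^bsub>AS v\<^esub> f)"
 using presented_is_quotient[OF S_rels_FA[OF assms]]
 by (simp add: S_alg_def S_ideal_def relation_ideal_def)

lemma S_coset_eq:
 assumes "sgn1 q" "f : FS v" "h : FS v"
 shows "SI q v +>\<^bsub>AS v\<^esub> f = SI q v +>\<^bsub>AS v\<^esub> h \<longleftrightarrow> f - h : SI q v"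
proof -
 interpret F: ring "AS v" by (rule ring_free_algebra)
 have "f \<ominus>\<^bsub>AS v\<^esub> h = f - h"
 proof -
  have "\<ominus>\<^bsub>AS v\<^esub> h = - h"
   by (rule F.minus_equality) (use assms in auto)
  then show ?thesis by (simp add: a_minus_def)
 qed
 then show ?thesis
  using is_quotient_eq[OF S_alg_quotient[OF assms(1), of v] free_algebra_assoc_algebra, of f h] assms
  by (simp add: S_ideal_def relation_ideal_def)
qed

lemma S_ideal_FA: "sgn1 q ==> SI q v \<subseteq> FS v"
 using is_quotientD(9)[OF S_alg_quotient, of q v] by (simp add: S_ideal_def relation_ideal_def)

lemma S_ideal_add: "sgn1 q ==> a : SI q v ==> b : SI q v ==> a + b : SI q v"
 unfolding S_ideal_eq by (rule gspan_add)

lemma S_ideal_0: "sgn1 q ==> 0 : SI q v"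
 unfolding S_ideal_eq by (rule gspan_0)

lemma Inv_FA: "Inv q v \<subseteq> FS v"
 by (auto simp: Inv_def)

lemma Inv_Hg: "Inv q Xg \<union> Inv q Yg \<subseteq> FH q" "f : Inv q Xg \<union> Inv q Yg ==> f : FH q"
 using Inv_FA FA_Sg_Hg by blast+

lemma S_action_eq:
 assumes q: "sgn1 q" and v: "XY v" and g: "g : CG q" and f: "f : FS v"
 shows "S_action K n (\<Gamma> q) q v g (SI q v +>\<^bsub>AS v\<^esub> f) = SI q v +>\<^bsub>AS v\<^esub> (vact q g f)"
proof -
 have endo: "free_endo K (Sg v) (gen_action n (\<Gamma> q) g) = vact q g"
  by (simp add: free_endo_eq vact_def)
 have "SI q v +>\<^bsub>AS v\<^esub> vact q g a = SI q v +>\<^bsub>AS v\<^esub> vact q g f"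
  if "a : SI q v +>\<^bsub>AS v\<^esub> f" for a
 proof -
  have af: "a - f : SI q v" using that coset_iff by blast
  then have "a - f + f : FS v" using f S_ideal_FA[OF q] by blast
  then have a: "a : FS v" by simp
  have "vact q g a - vact q g f = vact q g (a - f)" by (simp add: vact_def lin_diff)
  also have "\<dots> : SI q v" by (rule vact_S_ideal[OF q g v af])
  finally show ?thesis using S_coset_eq[OF q] vact_FA[OF q g v] a f by blast
 qed
 moreover have "f : SI q v +>\<^bsub>AS v\<^esub> f" by (simp add: coset_iff S_ideal_0[OF q])
 ultimately show ?thesis unfolding S_action_def induced_map_def endo by blast
qed

lemma invariant_ideal_eq:
 assumes q: "sgn1 q" and v: "XY v"
 shows "invariant_ideal K n (\<Gamma> q) q v = genideal (S_alg K n q v) ((%f. SI q v +>\<^bsub>AS v\<^esub> f) ` Inv q v)"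
proof -
 let ?p = "%f. SI q v +>\<^bsub>AS v\<^esub> f"
 note D = is_quotientD[OF S_alg_quotient[OF q, of v]]
 have "{C : carrier (S_alg K n q v). (\<exists>d>0. \<exists>f\<in>C. \<forall>w\<in>keys f. length w = d)
   & (\<forall>g\<in>CG q. S_action K n (\<Gamma> q) q v g C = C)} = ?p ` Inv q v" (is "?L = _")
 proof (rule subset_antisym; rule subsetI)
  fix C assume C: "C : ?L"
  then obtain d f where df: "d > 0" "f : C" "\<forall>w\<in>keys f. length w = d" by blast
  obtain f0 where f0: "f0 : FS v" "C = ?p f0" using C D(3)[of C] by auto
  have ff0: "f - f0 : SI q v" using df f0 coset_iff by blast
  then have "f - f0 + f0 : FS v" using f0 S_ideal_FA[OF q] by blast
  then have f: "f : FS v" by simp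
  have Cf: "C = ?p f" using f0 S_coset_eq[OF q f f0(1)] ff0 by simp
  have "vact q g f - f : SI q v" if "g : CG q" for g
   using C that S_action_eq[OF q v that f] S_coset_eq[OF q vact_FA[OF q that v f] f] unfolding Cf by simp
  then have "f : Inv q v" using f df by (auto simp: Inv_def)
  then show "C : ?p ` Inv q v" using Cf by blast
 next
  fix C assume "C : ?p ` Inv q v"
  then obtain f where f: "f : Inv q v" "C = ?p f" by blast
  then have fF: "f : FS v" and inv: "\<And>g. g : CG q ==> vact q g f - f : SI q v"
   and hom: "\<exists>d>0. \<forall>w\<in>keys f. length w = d" by (auto simp: Inv_def)
  have "f : C" unfolding f(2) by (simp add: coset_iff S_ideal_0[OF q])
  moreover have "C : carrier (S_alg K n q v)" using D(2)[of f] fF f(2) by simp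
  moreover have "S_action K n (\<Gamma> q) q v g C = C" if "g : CG q" for g
   using S_action_eq[OF q v that fF] S_coset_eq[OF q vact_FA[OF q that v fF] fF] inv[OF that] unfolding f(2) by simp
  ultimately show "C : ?L" using hom by blast
 qed
 then show ?thesis by (simp add: invariant_ideal_def)
qed

lemma coinvariant_quotient:
 assumes q: "sgn1 q" and v: "XY v"
 shows "is_quotient K (AS v) (JS q v) (coinvariant_algebra K n (\<Gamma> q) q v) (clS q v)"
 unfolding coinvariant_algebra_def clS_def JS_def relation_ideal_def
 by (rule two_stage_quotient[OF S_alg_quotient[OF q] free_algebra_assoc_algebra _ _ invariant_ideal_eq[OF q v]])
  (use S_rels_FA[OF q] Inv_FA in auto)

lemma H_rels_FA:
 assumes q: "sgn1 q"
 shows "HR q \<subseteq> FH q"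
proof -
 have v: "gen_action n (\<Gamma> q) g (v i) : FH q" if "g : CG q" "XY v" "i < n" for g v i
 proof -
  have "cv v (dm n g i) : K" using GammaD(2)[OF q that(1,3)] roots_K by (auto simp: cv_def)
  moreover have "v (pm n g i) : Hg q" using GammaD(6)[OF q that(1,3)] that(2) by (auto simp: H_gens_def)
  ultimately show ?thesis unfolding gen_action_v[OF q that] by auto
 qed
 have qK: "q : K" using q by auto
 have X: "S_rels n q Xg \<subseteq> FH q" "S_rels n q Yg \<subseteq> FH q"
  using S_rels_FA[OF q] FA_Sg_Hg by blast+
 show ?thesis
  unfolding H_rels_def using X v qK kappa_FA[OF q] FA_Gr_Hg Gamma_closed[OF q] Gamma_nonempty[OF q]
  by (auto simp: Gamma_mult_one H_gens_def intro!: FM_diff FM_single FA_mult)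
qed

lemma H_alg_quotient:
 assumes "sgn1 q"
 shows "is_quotient K (AH q) (genideal (AH q) (HR q))
  (H_alg K n (\<Gamma> q) q (\<kappa> q)) (%f. HI q +>\<^bsub>AH q\<^esub> f)"
 using presented_is_quotient[OF H_rels_FA[OF assms]]
 by (simp add: H_alg_def H_ideal_def relation_ideal_def)

lemma gspan_mono:
 assumes "B \<subseteq> B'" "x : gspan K B"
 shows "x : gspan K B'"
 using assms(2)
proof induction
 case (gspan_base c b)
 then show ?case using assms(1) gspan.gspan_base by blast
qed (auto intro: gspan.intros)

lemma S_ideal_H_ideal:
 assumes q: "sgn1 q" and v: "XY v"
 shows "SI q v \<subseteq> HI q"
proof -
 have "S_rels n q v \<subseteq> HR q" using v by (auto simp: H_rels_def)
 moreover have "lists (Sg v) \<subseteq> lists (Hg q)" using Sg_Hg[OF v] by (rule lists_mono)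
 ultimately have sub: "{single u 1 * r * single w (1::complex) | u r w. u : lists (Sg v) & r : S_rels n q v & w : lists (Sg v)}
  \<subseteq> {single u 1 * r * single w 1 | u r w. u : lists (Hg q) & r : HR q & w : lists (Hg q)}"
  by blast
 show ?thesis
  unfolding S_ideal_def H_ideal_def relation_ideal_eq_gspan[OF S_rels_FA[OF q]] relation_ideal_eq_gspan[OF H_rels_FA[OF q]]
  using gspan_mono[OF sub] by blast
qed

lemma restricted_ideal_eq:
 assumes q: "sgn1 q"
 shows "restricted_ideal K n (\<Gamma> q) q (\<kappa> q) = genideal (H_alg K n (\<Gamma> q) q (\<kappa> q))
  ((%f. HI q +>\<^bsub>AH q\<^esub> f) ` (Inv q Xg \<union> Inv q Yg))"
proof -
 let ?H = "H_alg K n (\<Gamma> q) q (\<kappa> q)"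
 let ?p = "%f. HI q +>\<^bsub>AH q\<^esub> f"
 let ?ind = "induced_map (AH q) (HI q) id"
 let ?s = "%v f. SI q v +>\<^bsub>AS v\<^esub> f"
 note QH = H_alg_quotient[OF q]
 note D = is_quotientD[OF QH]
 interpret H: assoc_algebra "scalars K" ?H by (rule D(1))
 have kerH: "genideal (AH q) (HR q) = HI q"
  by (simp add: H_ideal_def relation_ideal_def)
 have ind: "?ind (?s v f) = ?p f" if v: "XY v" and f: "f : FS v" for v f
 proof -
  interpret F: ring "AH q" by (rule ring_free_algebra)
  have "?p a = ?p f" if "a : ?s v f" for a
  proof -
   have af: "a - f : SI q v" using that coset_iff by blast
   then have "a - f + f : FS v" using f S_ideal_FA[OF q] by blast
   then have a: "a : FH q" using FA_Sg_Hg[OF v] by simp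
   have fH: "f : FH q" using FA_Sg_Hg[OF v f] .
   have "\<ominus>\<^bsub>AH q\<^esub> f = - f"
    by (rule F.minus_equality) (use fH in auto)
   then have "a \<ominus>\<^bsub>AH q\<^esub> f = a - f" by (simp add: a_minus_def)
   then show ?thesis
    using is_quotient_eq[OF QH free_algebra_assoc_algebra, of a f] a fH af S_ideal_H_ideal[OF q v] kerH by auto
  qed
  moreover have "f : ?s v f" by (simp add: coset_iff S_ideal_0[OF q])
  ultimately show ?thesis unfolding induced_map_def id_apply by blast
 qed
 have InvH: "?p ` (Inv q Xg \<union> Inv q Yg) \<subseteq> carrier ?H"
  using D(2) Inv_Hg by (intro image_subsetI) simp
 let ?G = "genideal ?H (?p ` (Inv q Xg \<union> Inv q Yg))"
 interpret G: ideal ?G ?H by (rule H.genideal_ideal[OF InvH])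
 have sub: "?ind ` invariant_ideal K n (\<Gamma> q) q v \<subseteq> ?G" if v: "XY v" for v
 proof -
  note QS = S_alg_quotient[OF q, of v]
  note E = is_quotientD[OF QS]
  interpret S: assoc_algebra "scalars K" "S_alg K n q v" by (rule E(1))
  have U: "ideal {C : carrier (S_alg K n q v). ?ind C : ?G} (S_alg K n q v)"
   by (rule ideal_preimage[OF QS QH free_algebra_assoc_algebra free_algebra_assoc_algebra _ _ _ _ _ G.ideal_axioms])
    (simp_all only: free_algebra_sel ind[OF v], use FA_Sg_Hg[OF v] in blast)
  have "?s v ` Inv q v \<subseteq> {C : carrier (S_alg K n q v). ?ind C : ?G}"
  proof (rule image_subsetI)
   fix f assume f: "f : Inv q v"
   have pf: "?p f : ?G" using H.genideal_self[OF InvH] f v by blast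
   have fF: "f : FS v" using f Inv_FA by blast
   have "?s v f : carrier (S_alg K n q v)" by (rule E(2)) (simp only: free_algebra_sel fF)
   then show "?s v f : {C : carrier (S_alg K n q v). ?ind C : ?G}"
    using pf by (simp only: mem_Collect_eq ind[OF v fF] simp_thms)
  qed
  from S.genideal_minimal[OF U this]
  have "invariant_ideal K n (\<Gamma> q) q v \<subseteq> {C : carrier (S_alg K n q v). ?ind C : ?G}"
   unfolding invariant_ideal_eq[OF q v] .
  then show ?thesis by blast
 qed
 show ?thesis
 proof
  let ?R = "?ind ` (invariant_ideal K n (\<Gamma> q) q Xg \<union> invariant_ideal K n (\<Gamma> q) q Yg)"
  have R: "?R \<subseteq> ?G" using sub by blast
  then have RH: "?R \<subseteq> carrier ?H" using G.Icarr by blast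
  show "restricted_ideal K n (\<Gamma> q) q (\<kappa> q) \<subseteq> ?G"
   unfolding restricted_ideal_def by (rule H.genideal_minimal[OF G.ideal_axioms R])
  have "?p ` (Inv q Xg \<union> Inv q Yg) \<subseteq> ?R"
  proof
   fix x assume "x : ?p ` (Inv q Xg \<union> Inv q Yg)"
   then obtain f v where f: "XY v" "f : Inv q v" "x = ?p f" by auto
   then have fF: "f : FS v" using Inv_FA by blast
   interpret S: assoc_algebra "scalars K" "S_alg K n q v" by (rule is_quotientD(1)[OF S_alg_quotient[OF q]])
   have "?s v ` Inv q v \<subseteq> carrier (S_alg K n q v)"
    using is_quotientD(2)[OF S_alg_quotient[OF q, of v]] Inv_FA by (intro image_subsetI) auto
   from S.genideal_self[OF this] have "?s v f : invariant_ideal K n (\<Gamma> q) q v"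
    unfolding invariant_ideal_eq[OF q f(1)] using f(2) by blast
   then have "?ind (?s v f) : ?R" using f(1) by blast
   then show "x : ?R" using ind[OF f(1) fF] f(3) by simp
  qed
  also have "\<dots> \<subseteq> restricted_ideal K n (\<Gamma> q) q (\<kappa> q)"
   unfolding restricted_ideal_def by (rule H.genideal_self[OF RH])
  finally show "?G \<subseteq> restricted_ideal K n (\<Gamma> q) q (\<kappa> q)"
   unfolding restricted_ideal_def by (intro H.genideal_minimal H.genideal_ideal RH)
 qed
qed

lemma restricted_quotient:
 assumes q: "sgn1 q"
 shows "is_quotient K (AH q) (J q) (restricted_alg K n (\<Gamma> q) q (\<kappa> q)) (clH q)"
 unfolding restricted_alg_def clH_def J_def relation_ideal_def
 by (rule two_stage_quotient[OF H_alg_quotient[OF q] free_algebra_assoc_algebra _ _ restricted_ideal_eq[OF q]])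
  (use H_rels_FA[OF q] Inv_Hg in simp_all)

end

section \<open>The twisted product on the free algebra\<close>

definition sg1 :: "nat set => nat => complex" where
 "sg1 Z i = (if i : Z then -1 else 1)"

definition tg :: "nat => nat set => gen => falg" where
 "tg n Z a = (case a of Xg i => single [Xg i] (sg1 Z i) | Yg i => single [Yg i] (sg1 Z i)
  | Gr h => single [Gr (if h : carrier_mat n n then tm n Z * h * tm n Z else h)] 1)"

definition tact :: "nat => nat set => falg => falg" where
 "tact n Z = lin (%w. prod_list (map (tg n Z) w))"

text \<open>The projection onto the component of weight \<open>L\<close>: the average over \<open>T\<close> against the character.\<close>

definition P :: "nat => nat set => falg => falg" where
 "P n L f = smul (1 / 2 ^ n) (\<Sum>Z\<in>PP n. smul (chi n L Z) (tact n Z f))"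

definition wt :: "nat => nat set => falg => bool" where
 "wt n L f \<longleftrightarrow> (\<forall>Z\<subseteq>{..<n}. tact n Z f = smul (chi n L Z) f)"

definition star :: "nat => falg => falg => falg" where
 "star n f g = (\<Sum>L\<in>PP n. \<Sum>N\<in>PP n. smul (bs n L N) (P n L f * P n N g))"

lemma sg1_simps [simp]: "sg1 Z i * sg1 Z i = 1" "sg1 {} i = 1" "sg1 (sym_diff Z Y) i = sg1 Z i * sg1 Y i"
 by (auto simp: sg1_def)

lemma chi_sg1: "i < n ==> chi n {i} Z = sg1 Z i"
 by (simp add: chi_singleton sg1_def)

lemma tact_add: "tact n Z (f + g) = tact n Z f + tact n Z g"
 and tact_diff: "tact n Z (f - g) = tact n Z f - tact n Z g"
 and tact_smul: "tact n Z (smul c f) = smul c (tact n Z f)"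
 and tact_sum: "tact n Z (\<Sum>i\<in>I. h i) = (\<Sum>i\<in>I. tact n Z (h i))"
 and tact_0 [simp]: "tact n Z 0 = 0"
 by (simp_all add: tact_def lin_simps)

lemma tact_mult: "tact n Z (f * g) = tact n Z f * tact n Z g"
 unfolding tact_def by (rule lin_hom) simp

lemma tact_one [simp]: "tact n Z 1 = 1"
proof -
 have "tact n Z (single [] 1) = 1" by (simp add: tact_def)
 then show ?thesis unfolding single_Nil_one .
qed

lemma tact_prod_list: "tact n Z (prod_list xs) = prod_list (map (tact n Z) xs)"
 by (induction xs) (simp_all add: tact_mult)

lemma tact_gen: "tact n Z (single [a] c) = smul c (tg n Z a)"
 by (simp add: tact_def)

lemma tact_Gr: "h : carrier_mat n n ==> tact n Z (single [Gr h] c) = single [Gr (tm n Z * h * tm n Z)] c"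
 by (simp add: tact_gen tg_def)

lemma tact_tg: "tact n Z (tg n Y a) = tg n (sym_diff Z Y) a"
proof (cases a)
 case (Gr h)
 show ?thesis
 proof (cases "h : carrier_mat n n")
  case True
  have tmc: "\<And>Z. tm n Z : carrier_mat n n" by simp
  have "tm n Z * (tm n Y * h * tm n Y) * tm n Z = (tm n Z * tm n Y) * h * (tm n Y * tm n Z)"
   using True tmc by (simp add: assoc_mult_mat[of _ n n _ n _ n] mult_carrier_mat[of _ n n _ n])
  also have "sym_diff Y Z = sym_diff Z Y" by auto
  then have "(tm n Z * tm n Y) * h * (tm n Y * tm n Z) = tm n (sym_diff Z Y) * h * tm n (sym_diff Z Y)"
   unfolding tm_mult by simp
  finally show ?thesis using True tmc by (simp add: Gr tg_def tact_gen mult_carrier_mat[of _ n n _ n])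
 qed (simp add: Gr tg_def tact_gen)
qed (simp_all add: tg_def tact_gen mult.commute)

lemma tact_tact: "tact n Z (tact n Y f) = tact n (sym_diff Z Y) f"
proof -
 have "tact n Z (tact n Y f) = lin (%w. tact n Z (prod_list (map (tg n Y) w))) f"
  by (simp add: tact_def lin_lin)
 also have "\<dots> = tact n (sym_diff Z Y) f"
  unfolding tact_prod_list map_map o_def tact_tg by (simp add: tact_def)
 finally show ?thesis .
qed

lemma tact_empty [simp]: "tact n {} f = f"
proof -
 have "tg n {} a = single [a] 1" for a
  by (cases a) (simp_all add: tg_def tm_empty)
 then have "prod_list (map (tg n {}) w) = single w 1" for w
  by (induction w) (simp_all add: single_Nil_one)
 then show ?thesis by (simp add: tact_def)
qed

lemma P_add: "P n L (f + g) = P n L f + P n L g"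
 and P_smul: "P n L (smul c f) = smul c (P n L f)"
 by (simp_all add: P_def tact_add tact_smul smul_add sum.distrib smul_sum mult_ac)

lemma P_0 [simp]: "P n L 0 = 0"
 by (simp add: P_def)

lemma wt_P: "wt n L (P n L f)"
 unfolding wt_def
proof (intro allI impI)
 fix Y assume d: "Y \<subseteq> {..<n}"
 have "tact n Y (P n L f) = smul (1 / 2 ^ n) (\<Sum>Z\<in>PP n. smul (chi n L Z) (tact n (sym_diff Y Z) f))"
  by (simp add: P_def tact_smul tact_sum tact_tact)
 also have "(\<Sum>Z\<in>PP n. smul (chi n L Z) (tact n (sym_diff Y Z) f))
   = (\<Sum>Z\<in>PP n. smul (chi n L (sym_diff Y Z)) (tact n Z f))"
 proof (rule sum.reindex_bij_witness[where i = "%Z. sym_diff Y Z" and j = "%Z. sym_diff Y Z"])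
  fix Z assume g: "Z : PP n"
  have e: "sym_diff Y (sym_diff Y Z) = Z" by auto
  show "sym_diff Y (sym_diff Y Z) = Z" "sym_diff Y (sym_diff Y Z) = Z" by (fact e)+
  show "sym_diff Y Z : PP n" "sym_diff Y Z : PP n" using g d by auto
  show "smul (chi n L (sym_diff Y (sym_diff Y Z))) (tact n (sym_diff Y Z) f)
    = smul (chi n L Z) (tact n (sym_diff Y Z) f)" unfolding e ..
 qed
 also have "smul (1 / 2 ^ n) (\<Sum>Z\<in>PP n. smul (chi n L (sym_diff Y Z)) (tact n Z f)) = smul (chi n L Y) (P n L f)"
  unfolding chi_sym_diff P_def by (simp add: smul_sum mult_ac)
 finally show "tact n Y (P n L f) = smul (chi n L Y) (P n L f)" .
qed

lemma P_wt:
 assumes "wt n N f" "L \<subseteq> {..<n}" "N \<subseteq> {..<n}"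
 shows "P n L f = (if L = N then f else 0)"
proof -
 have "(\<Sum>Z\<in>PP n. smul (chi n L Z) (tact n Z f)) = (\<Sum>Z\<in>PP n. smul (chi n L Z * chi n N Z) f)"
  using assms(1) by (intro sum.cong) (auto simp: wt_def)
 also have "\<dots> = smul (if L = N then 2 ^ n else 0) f"
  unfolding smul_sum_left[symmetric] chi_orthogonal2[OF assms(2,3)] ..
 finally show ?thesis by (simp add: P_def)
qed

lemma sum_P: "(\<Sum>L\<in>PP n. P n L f) = f"
proof -
 have "(\<Sum>L\<in>PP n. P n L f) = smul (1 / 2 ^ n) (\<Sum>Z\<in>PP n. smul (\<Sum>L\<in>PP n. chi n Z L) (tact n Z f))"
  unfolding P_def smul_sum[symmetric] smul_sum_left
  by (subst sum.swap) (simp add: chi_commute)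
 also have "(\<Sum>Z\<in>PP n. smul (\<Sum>L\<in>PP n. chi n Z L) (tact n Z f))
   = (\<Sum>Z\<in>PP n. if Z = {} then smul (2 ^ n) f else 0)"
  by (intro sum.cong) (auto simp: chi_orthogonal)
 also have "\<dots> = smul (2 ^ n) f" by (subst sum.delta) auto
 finally show ?thesis by simp
qed

lemma wt_mult: "wt n L f ==> wt n N g ==> wt n (sym_diff L N) (f * g)"
 unfolding wt_def chi_sym_diff tact_mult by (simp add: smul_mult_left smul_mult_right mult.commute[of "chi n N _"])

lemma wt_one [simp]: "wt n {} 1"
 by (simp add: wt_def)

lemma wt_smul: "wt n L f ==> wt n L (smul c f)"
 by (simp add: wt_def tact_smul mult.commute)

lemma star_add_left: "star n (f + f') g = star n f g + star n f' g"
 and star_add_right: "star n f (g + g') = star n f g + star n f g'"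
 and star_smul_left: "star n (smul c f) g = smul c (star n f g)"
 and star_smul_right: "star n f (smul c g) = smul c (star n f g)"
 by (simp_all add: star_def P_add P_smul distrib_left distrib_right smul_add sum.distrib
   smul_mult_left smul_mult_right smul_sum mult_ac)

lemma star_0 [simp]: "star n 0 g = 0" "star n f 0 = 0"
 by (simp_all add: star_def)

lemma star_sum_left: "star n (\<Sum>i\<in>I. h i) g = (\<Sum>i\<in>I. star n (h i) g)"
 by (induction I rule: infinite_finite_induct) (simp_all add: star_add_left)

lemma star_sum_right: "star n g (\<Sum>i\<in>I. h i) = (\<Sum>i\<in>I. star n g (h i))"
 by (induction I rule: infinite_finite_induct) (simp_all add: star_add_right)

lemma star_lin_left: "star n (lin \<phi> f) g = lin (%w. star n (\<phi> w) g) f"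
 by (simp add: lin_def star_sum_left star_smul_left)

lemma star_lin_right: "star n g (lin \<phi> f) = lin (%w. star n g (\<phi> w)) f"
 by (simp add: lin_def star_sum_right star_smul_right)

lemma star_wt:
 assumes "wt n L f" "wt n N g" "L \<subseteq> {..<n}" "N \<subseteq> {..<n}"
 shows "star n f g = smul (bs n L N) (f * g)"
proof -
 have "star n f g = (\<Sum>L'\<in>PP n. \<Sum>N'\<in>PP n. if N' = N then (if L' = L then smul (bs n L N) (f * g) else 0) else 0)"
  unfolding star_def by (intro sum.cong refl) (auto simp: P_wt[OF assms(1) _ assms(3)] P_wt[OF assms(2) _ assms(4)])
 also have "\<dots> = smul (bs n L N) (f * g)"
  using assms by simp
 finally show ?thesis .
qed

lemma star_one [simp]: "star n 1 f = f" "star n f 1 = f"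
proof -
 have "star n 1 (P n L f) = P n L f" "star n (P n L f) 1 = P n L f" if "L \<subseteq> {..<n}" for L
  using that by (simp_all add: star_wt[OF wt_one wt_P] star_wt[OF wt_P wt_one])
 then have "(\<Sum>L\<in>PP n. star n 1 (P n L f)) = (\<Sum>L\<in>PP n. P n L f)"
  "(\<Sum>L\<in>PP n. star n (P n L f) 1) = (\<Sum>L\<in>PP n. P n L f)" by auto
 then show "star n 1 f = f" "star n f 1 = f"
  unfolding star_sum_left[symmetric] star_sum_right[symmetric] sum_P .
qed

lemma star_wt_wt: "wt n L f ==> wt n N g ==> L \<subseteq> {..<n} ==> N \<subseteq> {..<n} ==> wt n (sym_diff L N) (star n f g)"
 by (simp add: star_wt wt_smul wt_mult)

text \<open>A bicharacter is a 2-cocycle.\<close>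

lemma star_assoc: "star n (star n f g) h = star n f (star n g h)"
proof -
 have *: "star n (star n (P n L f) (P n N g)) (P n Z h) = star n (P n L f) (star n (P n N g) (P n Z h))"
  if s: "L \<subseteq> {..<n}" "N \<subseteq> {..<n}" "Z \<subseteq> {..<n}" for L N Z
 proof -
  note w = wt_P[of n L f] wt_P[of n N g] wt_P[of n Z h]
  have s2: "sym_diff L N \<subseteq> {..<n}" "sym_diff N Z \<subseteq> {..<n}" using s by auto
  show ?thesis
   unfolding star_wt[OF star_wt_wt[OF w(1,2) s(1,2)] w(3) s2(1) s(3)] star_wt[OF w(1) star_wt_wt[OF w(2,3) s(2,3)] s(1) s2(2)]
   unfolding star_wt[OF w(1,2) s(1,2)] star_wt[OF w(2,3) s(2,3)] bs_sym_diff
   by (simp add: smul_mult_left smul_mult_right mult_ac)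
 qed
 have "star n (star n (\<Sum>L\<in>PP n. P n L f) (\<Sum>N\<in>PP n. P n N g)) (\<Sum>Z\<in>PP n. P n Z h)
  = star n (\<Sum>L\<in>PP n. P n L f) (star n (\<Sum>N\<in>PP n. P n N g) (\<Sum>Z\<in>PP n. P n Z h))"
  unfolding star_sum_left star_sum_right using * by simp
 then show ?thesis unfolding sum_P .
qed

section \<open>The cocycle\<close>

lemma lin_swap: "lin (%u. lin (%v. \<phi> u v) g) f = lin (%v. lin (%u. \<phi> u v) f) g"
 by (simp add: lin_def smul_sum mult_ac) (rule sum.swap)

lemma monoid_algebra_mult:
 "f \<otimes>\<^bsub>monoid_algebra K M\<^esub> g = lin (%u. lin (%v. single (u \<otimes>\<^bsub>M\<^esub> v) 1) g) f"
 by (simp add: monoid_algebra_def lin_def smul_sum)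

definition tset :: "nat => complex mat => nat set" where
 "tset n t = {i. i < n & t $$ (i, i) = -1}"

lemma tset_tm: "Z \<subseteq> {..<n} ==> tset n (tm n Z) = Z"
 by (auto simp: tset_def tm_def mm_index split: if_splits)

lemma tm_G21: "tm n Z : carrier (G_group 2 1 n)"
proof -
 let ?d = "%j. if j : Z then -1 else (1::complex)"
 have nz: "\<forall>j<n. ?d j ~= 0" by simp
 have "(\<Prod>j<n. ?d j) : unity_roots 2" by (rule unity_roots_prod) (auto simp: unity_roots_def)
 then have "(\<Prod>ij\<in>nonzero_positions n (mm n id ?d). mm n id ?d $$ ij) : unity_roots (2 div 1)"
  unfolding prod_positions_mm[OF permutes_id nz] by simp
 moreover have "monomial_mat n (mm n id ?d)"
  unfolding monomial_mat_iff by (intro exI[of _ id] exI[of _ ?d] conjI permutes_id nz refl)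
 moreover have "\<forall>ij\<in>nonzero_positions n (mm n id ?d). mm n id ?d $$ ij : unity_roots 2"
  unfolding nonzero_positions_mm[OF permutes_id nz] by (auto simp: mm_index unity_roots_def)
 ultimately show ?thesis unfolding tm_def G_group_def by simp
qed

lemma T_group_carrier: "carrier (T_group n) = tm n ` PP n"
proof
 show "carrier (T_group n) \<subseteq> tm n ` PP n"
 proof
  fix t assume "t : carrier (T_group n)"
  then have "t : generate (G_group 2 1 n) ((%i. t_mat n i (- 1)) ` {..<n})" by (simp add: T_group_def)
  then show "t : tm n ` PP n"
  proof induction
   case one
   then show ?case by (auto simp: G_group_def tm_empty[symmetric])
  next
   case (incl h)
   then show ?case by (auto simp: t_mat_tm)
  next
   case (inv h)
   then obtain i where i: "i < n" "h = tm n {i}" by (auto simp: t_mat_tm)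
   have mono: "y = tm n {i}" if y: "y : carrier (G_group 2 1 n)" "h * y = 1\<^sub>m n" for y
   proof -
    have yc: "y : carrier_mat n n" using y(1) by (auto simp: G_group_def monomial_mat_def)
    have "tm n {i} * (h * y) = (tm n {i} * h) * y"
     using yc i by (simp add: assoc_mult_mat[of _ n n _ n _ n])
    also have "\<dots> = y" using yc unfolding i(2) tm_mult by (simp add: tm_empty)
    finally show ?thesis using y(2) right_mult_one_mat[OF tm_carrier] by metis
   qed
   have "inv\<^bsub>G_group 2 1 n\<^esub> h = tm n {i}"
    unfolding m_inv_def
   proof (rule the_equality)
    have "h * tm n {i} = 1\<^sub>m n" unfolding i(2) tm_mult by (simp add: tm_empty)
    then show "tm n {i} : carrier (G_group 2 1 n) & h \<otimes>\<^bsub>G_group 2 1 n\<^esub> tm n {i} = \<one>\<^bsub>G_group 2 1 n\<^esub> & tm n {i} \<otimes>\<^bsub>G_group 2 1 n\<^esub> h = \<one>\<^bsub>G_group 2 1 n\<^esub>"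
     using tm_G21 i by (auto simp: G_group_def)
   qed (use mono in \<open>auto simp: G_group_def\<close>)
   then show ?case using i by auto
  next
   case (eng h1 h2)
   then obtain Z Y where "h1 = tm n Z" "h2 = tm n Y" "Z \<subseteq> {..<n}" "Y \<subseteq> {..<n}" by auto
   moreover from this have "h1 \<otimes>\<^bsub>G_group 2 1 n\<^esub> h2 = tm n (sym_diff Z Y)" by (simp add: G_group_def tm_mult)
   ultimately show ?case by (intro image_eqI[of _ _ "sym_diff Z Y"]) auto
  qed
 qed
 show "tm n ` PP n \<subseteq> carrier (T_group n)"
 proof
  fix t assume "t : tm n ` PP n"
  then obtain Z where g: "t = tm n Z" "Z \<subseteq> {..<n}" by auto
  have "tm n Z : generate (G_group 2 1 n) ((%i. t_mat n i (- 1)) ` {..<n})"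
   using g(2)
  proof (induction Z rule: subset_induct_sym_diff)
   case empty
   show ?case using generate.one[of "G_group 2 1 n"] by (simp add: G_group_def tm_empty)
  next
   case (step Z i)
   have "tm n {i} : generate (G_group 2 1 n) ((%i. t_mat n i (- 1)) ` {..<n})"
    using step by (intro generate.incl) (auto simp: t_mat_tm[symmetric])
   from generate.eng[OF step(3) this] show ?case by (simp add: G_group_def tm_mult)
  qed
  then show "t : carrier (T_group n)" by (simp add: T_group_def g)
 qed
qed

lemma T_group_sel: "mult (T_group n) = (*)" "\<one>\<^bsub>T_group n\<^esub> = 1\<^sub>m n"
 by (simp_all add: T_group_def G_group_def)

lemma T_group_inv: "Z \<subseteq> {..<n} ==> inv\<^bsub>T_group n\<^esub> (tm n Z) = tm n Z"
proof -
 assume g: "Z \<subseteq> {..<n}"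
 show ?thesis
  unfolding m_inv_def T_group_carrier T_group_sel tm_empty[symmetric]
 proof (rule the_equality)
  show "tm n Z : tm n ` PP n & tm n Z * tm n Z = tm n {} & tm n Z * tm n Z = tm n {}"
   using g by (auto simp: tm_mult)
  fix y assume "y : tm n ` PP n & tm n Z * y = tm n {} & y * tm n Z = tm n {}"
  then obtain Y where d: "Y \<subseteq> {..<n}" "y = tm n Y" "tm n (sym_diff Z Y) = tm n {}"
   unfolding tm_mult[symmetric] by auto
  have "sym_diff Z Y = {}" by (rule tm_inj[OF d(3)]) (use g d in auto)
  then show "y = tm n Z" using d by auto
 qed
qed

context subK
begin

lemma kT_kT_sel:
 "carrier (kT_kT K n) = FM K ((%(Z, Y). (tm n Z, tm n Y)) ` (PP n \<times> PP n))"
 "\<one>\<^bsub>kT_kT K n\<^esub> = single (tm n {}, tm n {}) 1"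
 "f \<otimes>\<^bsub>kT_kT K n\<^esub> g = lin (%u. lin (%v. single (fst u * fst v, snd u * snd v) 1) g) f"
proof -
 have "tm n ` PP n \<times> tm n ` PP n = (%(Z, Y). (tm n Z, tm n Y)) ` (PP n \<times> PP n)" by auto
 then show "carrier (kT_kT K n) = FM K ((%(Z, Y). (tm n Z, tm n Y)) ` (PP n \<times> PP n))"
  by (simp add: kT_kT_def monoid_algebra_def free_module_def FM_def DirProd_def T_group_carrier)
 show "\<one>\<^bsub>kT_kT K n\<^esub> = single (tm n {}, tm n {}) 1"
  by (simp add: kT_kT_def monoid_algebra_def free_module_def DirProd_def T_group_sel tm_empty)
 show "f \<otimes>\<^bsub>kT_kT K n\<^esub> g = lin (%u. lin (%v. single (fst u * fst v, snd u * snd v) 1) g) f"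
  unfolding kT_kT_def monoid_algebra_mult by (simp add: DirProd_def T_group_sel case_prod_beta)
qed

lemma kT_kT_comm_monoid: "comm_monoid (kT_kT K n)"
proof -
 let ?T = "(%(Z, Y). (tm n Z, tm n Y)) ` (PP n \<times> PP n)"
 let ?m = "%u v. (fst u * fst v, snd u * snd v) :: complex mat \<times> complex mat"
 have closed: "?m u v : ?T" if uv: "u : ?T" "v : ?T" for u v
 proof -
  obtain a b where u: "u = (tm n a, tm n b)" "a \<subseteq> {..<n}" "b \<subseteq> {..<n}" using uv by auto
  obtain a' b' where v: "v = (tm n a', tm n b')" "a' \<subseteq> {..<n}" "b' \<subseteq> {..<n}" using uv by auto
  show ?thesis unfolding u(1) v(1) fst_conv snd_conv tm_mult
   using u v by (intro image_eqI[of _ _ "(sym_diff a a', sym_diff b b')"]) auto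
 qed
 have comm: "?m u v = ?m v u" if uv: "u : ?T" "v : ?T" for u v
 proof -
  obtain a b where u: "u = (tm n a, tm n b)" using uv by auto
  obtain a' b' where v: "v = (tm n a', tm n b')" using uv by auto
  have "sym_diff a a' = sym_diff a' a" "sym_diff b b' = sym_diff b' b" by auto
  then show ?thesis unfolding u v fst_conv snd_conv tm_mult by simp
 qed
 have assoc: "?m (?m u v) w = ?m u (?m v w)" if uv: "u : ?T" "v : ?T" "w : ?T" for u v w
  using uv by (auto simp: assoc_mult_mat[of _ n n _ n _ n])
 have one: "?m (tm n {}, tm n {}) u = u" if "u : ?T" for u
  using that by (auto simp: tm_mult)
 have mem: "w : ?T" if "f : FM K ?T" "w : keys f" for f w using that by (auto simp: FM_def)
 show ?thesis
 proof (rule comm_monoidI, unfold kT_kT_sel)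
  fix f g h assume f: "f : FM K ?T" and g: "g : FM K ?T" and h: "h : FM K ?T"
  show "lin (%u. lin (%v. single (?m u v) 1) g) f : FM K ?T"
   by (intro FM_lin[OF f] FM_lin[OF g] FM_single closed K_1)
  have "lin (%u. lin (%v. single (?m u v) 1) h) (lin (%u. lin (%v. single (?m u v) 1) g) f)
   = lin (%a. lin (%b. lin (%w. single (?m (?m a b) w) 1) h) g) f"
   by (simp add: lin_lin)
  also have "\<dots> = lin (%a. lin (%b. lin (%w. single (?m a (?m b w)) 1) h) g) f"
  proof -
   have *: "lin (%w. single (?m (?m a b) w) (1::complex)) h = lin (%w. single (?m a (?m b w)) 1) h" if "a : keys f" "b : keys g" for a b
    by (rule lin_cong) (simp only: assoc[OF mem[OF f that(1)] mem[OF g that(2)] mem[OF h]])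
   show ?thesis by (rule lin_cong, rule lin_cong, rule *)
  qed
  also have "\<dots> = lin (%u. lin (%v. single (?m u v) 1) (lin (%u. lin (%v. single (?m u v) 1) h) g)) f"
   by (simp add: lin_lin)
  finally show "lin (%u. lin (%v. single (?m u v) 1) h) (lin (%u. lin (%v. single (?m u v) 1) g) f)
   = lin (%u. lin (%v. single (?m u v) 1) (lin (%u. lin (%v. single (?m u v) 1) h) g)) f" .
  have "lin (%u. lin (%v. single (?m u v) (1::complex)) g) f = lin (%u. lin (%v. single (?m v u) 1) g) f"
   by (intro lin_cong arg_cong[where f = "%x. single x 1"] comm mem[OF f] mem[OF g])
  also have "\<dots> = lin (%u. lin (%v. single (?m u v) 1) f) g" by (rule lin_swap)
  finally show "lin (%u. lin (%v. single (?m u v) 1) g) f = lin (%u. lin (%v. single (?m u v) 1) f) g" .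
  have "lin (%v. single (?m (tm n {}, tm n {}) v) (1::complex)) f = lin (%v. single v 1) f"
   by (intro lin_cong arg_cong[where f = "%x. single x 1"] one mem[OF f])
  then show "lin (%u. lin (%v. single (?m u v) 1) f) (single (tm n {}, tm n {}) 1) = f" by simp
 next
  show "single (tm n {}, tm n {}) 1 : FM K ?T" by (intro FM_single) auto
 qed
qed

text \<open>The evaluation of an element of \<open>kT \<otimes> kT\<close> at a pair of characters. It is multiplicative, which turns the
 product that defines the cocycle into a product of signs.\<close>

definition ev :: "nat => nat set => nat set => (complex mat \<times> complex mat \<Rightarrow>\<^sub>0 complex) => complex" where
 "ev n L N f = (\<Sum>u\<in>keys f. lookup f u * (chi n L (tset n (fst u)) * chi n N (tset n (snd u))))"

lemma ev_lin: "ev n L N f = lookup (lin (%u. single () (chi n L (tset n (fst u)) * chi n N (tset n (snd u)))) f) ()"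
 by (simp add: ev_def lin_def lookup_sum)

lemma ev_mult:
 assumes "f : carrier (kT_kT K n)" "g : carrier (kT_kT K n)"
 shows "ev n L N (f \<otimes>\<^bsub>kT_kT K n\<^esub> g) = ev n L N f * ev n L N g"
proof -
 let ?T = "(%(Z, Y). (tm n Z, tm n Y)) ` (PP n \<times> PP n)"
 let ?c = "%u. chi n L (tset n (fst u)) * chi n N (tset n (snd u))"
 have c: "?c (fst u * fst v, snd u * snd v) = ?c u * ?c v" if uv: "u : ?T" "v : ?T" for u v
 proof -
  obtain a b where u: "u = (tm n a, tm n b)" "a \<subseteq> {..<n}" "b \<subseteq> {..<n}" using uv by auto
  obtain a' b' where v: "v = (tm n a', tm n b')" "a' \<subseteq> {..<n}" "b' \<subseteq> {..<n}" using uv by auto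
  have s: "sym_diff a a' \<subseteq> {..<n}" "sym_diff b b' \<subseteq> {..<n}" using u v by auto
  show ?thesis unfolding u(1) v(1) fst_conv snd_conv tm_mult tset_tm[OF s(1)] tset_tm[OF s(2)]
   tset_tm[OF u(2)] tset_tm[OF u(3)] tset_tm[OF v(2)] tset_tm[OF v(3)] chi_sym_diff by (simp add: mult_ac)
 qed
 have mem: "w : ?T" if "f : FM K ?T" "w : keys f" for f w using that by (auto simp: FM_def)
 have "lin (%u. single () (?c u)) (f \<otimes>\<^bsub>kT_kT K n\<^esub> g) = lin (%u. lin (%v. single () (?c (fst u * fst v, snd u * snd v))) g) f"
  unfolding kT_kT_sel by (simp add: lin_lin)
 also have "\<dots> = lin (%u. lin (%v. single () (?c u * ?c v)) g) f"
 proof (intro lin_cong)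
  fix u v assume uv: "u : keys f" "v : keys g"
  show "single () (?c (fst u * fst v, snd u * snd v)) = single () (?c u * ?c v)"
   by (rule arg_cong[where f = "single ()", OF c[OF mem[OF assms(1)[unfolded kT_kT_sel] uv(1)] mem[OF assms(2)[unfolded kT_kT_sel] uv(2)]]])
 qed
 finally have "ev n L N (f \<otimes>\<^bsub>kT_kT K n\<^esub> g) = lookup (lin (%u. lin (%v. single () (?c u * ?c v)) g) f) ()"
  unfolding ev_lin by simp
 also have "\<dots> = (\<Sum>u\<in>keys f. \<Sum>v\<in>keys g. lookup f u * (lookup g v * (?c u * ?c v)))"
  unfolding lin_def lookup_sum lookup_smul lookup_single_eq sum_distrib_left ..
 also have "\<dots> = ev n L N f * ev n L N g"
  unfolding ev_def sum_product by (intro sum.cong refl) (simp add: mult_ac)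
 finally show ?thesis .
qed

definition fac :: "nat => nat => nat => (complex mat \<times> complex mat \<Rightarrow>\<^sub>0 complex)" where
 "fac n i j = single (tm n {}, tm n {}) (1/2) + single (tm n {i}, tm n {}) (1/2)
  + single (tm n {}, tm n {j}) (1/2) - single (tm n {i}, tm n {j}) (1/2)"

lemma half_K: "1 / 2 : K" "1 / 2 ^ i : K"
 by (auto intro!: K_divide K_power)

lemma fac_carrier: "i < n ==> j < n ==> fac n i j : carrier (kT_kT K n)"
 unfolding kT_kT_sel fac_def using half_K by (intro FM_add FM_diff FM_single) auto

lemma fac_square: "fac n i j \<otimes>\<^bsub>kT_kT K n\<^esub> fac n i j = \<one>\<^bsub>kT_kT K n\<^esub>"
 unfolding kT_kT_sel fac_def
 by (rule poly_mapping_eqI) (simp add: lin_simps tm_mult lookup_add lookup_minus lookup_single when_def)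

lemma ev_fac: "i < n ==> j < n ==> ev n L N (fac n i j) = (if i : L & j : N then -1 else 1)"
 unfolding ev_lin fac_def
 by (simp add: lin_simps lookup_add lookup_minus lookup_single tset_tm chi_commute[of n _ "{_}"] chi_singleton)

lemma cocycle_F_eq: "cocycle_F K n = finprod (kT_kT K n) (%(i, j). fac n i j) {(i, j). j < i & i < n}"
 unfolding cocycle_F_def fac_def t_mat_tm tm_empty ..

lemma finite_pairs: "finite {(i, j). j < i & i < (n::nat)}"
 by (rule finite_subset[of _ "{..<n} \<times> {..<n}"]) auto

lemma cocycle_F_inverse: "inv\<^bsub>kT_kT K n\<^esub> (cocycle_F K n) = cocycle_F K n"
 and cocycle_F_carrier: "cocycle_F K n : carrier (kT_kT K n)"
proof -
 interpret T: comm_monoid "kT_kT K n" by (rule kT_kT_comm_monoid)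
 let ?I = "{(i, j). j < i & i < n}"
 have F: "(%(i, j). fac n i j) : ?I \<rightarrow> carrier (kT_kT K n)" using fac_carrier by auto
 show C: "cocycle_F K n : carrier (kT_kT K n)"
  unfolding cocycle_F_eq by (rule T.finprod_closed[OF F])
 have "cocycle_F K n \<otimes>\<^bsub>kT_kT K n\<^esub> cocycle_F K n
  = finprod (kT_kT K n) (%ij. (case ij of (i, j) => fac n i j) \<otimes>\<^bsub>kT_kT K n\<^esub> (case ij of (i, j) => fac n i j)) ?I"
  unfolding cocycle_F_eq by (rule T.finprod_multf[symmetric, OF F F])
 also have "\<dots> = \<one>\<^bsub>kT_kT K n\<^esub>"
  by (rule T.finprod_one_eqI) (auto simp: fac_square)
 finally show "inv\<^bsub>kT_kT K n\<^esub> (cocycle_F K n) = cocycle_F K n"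
  by (intro T.comm_inv_char C)
qed

text \<open>The cocycle is a bicharacter on the character group of \<open>T\<close>.\<close>

lemma ev_cocycle_F: "ev n L N (cocycle_F K n) = bs n L N"
proof -
 interpret T: comm_monoid "kT_kT K n" by (rule kT_kT_comm_monoid)
 have step: "ev n L N (finprod (kT_kT K n) (%(i, j). fac n i j) I) = (\<Prod>(i, j)\<in>I. if i : L & j : N then -1 else 1)"
  if "finite I" "I \<subseteq> {(i, j). j < i & i < n}" for I
  using that
 proof (induction I rule: finite_induct)
  case empty
  then show ?case by (simp add: kT_kT_sel ev_lin tset_tm)
 next
  case (insert x I)
  obtain i j where x: "x = (i, j)" "j < i" "i < n" using insert by auto
  have F: "(%(i, j). fac n i j) : I \<rightarrow> carrier (kT_kT K n)"
  proof (rule funcsetI)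
   fix y assume "y : I"
   then have "y : {(i, j). j < i & i < n}" using insert.prems by blast
   then show "(case y of (i, j) => fac n i j) : carrier (kT_kT K n)" using fac_carrier by auto
  qed
  have "fac n i j : carrier (kT_kT K n)" using fac_carrier x by simp
  then show ?case
   using insert F x ev_mult[OF _ T.finprod_closed[OF F], of "fac n i j"] by (simp add: T.finprod_insert ev_fac)
 qed
 have "bs n L N = (\<Prod>(i, j)\<in>{..<n} \<times> {..<n}. if j < i & i : L & j : N then -1 else 1)"
  unfolding bs_def by (rule prod.cartesian_product)
 also have "\<dots> = (\<Prod>(i, j)\<in>{(i, j). j < i & i < n}. if i : L & j : N then -1 else 1)"
  by (rule prod.mono_neutral_cong_right) (auto split: if_splits)
 finally show ?thesis unfolding cocycle_F_eq using step[OF finite_pairs order_refl] by simp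
qed

text \<open>Hence the product twisted by the cocycle is \<^const>\<open>star\<close>.\<close>

lemma cocycle_sum_eq_star:
 assumes "F = cocycle_F K n"
 shows "(\<Sum>st\<in>keys F. smul (lookup F st) (tact n (tset n (fst st)) f * tact n (tset n (snd st)) g)) = star n f g"
proof -
 let ?T = "%f g. \<Sum>st\<in>keys F. smul (lookup F st) (tact n (tset n (fst st)) f * tact n (tset n (snd st)) g)"
 have *: "?T (P n L f) (P n N g) = star n (P n L f) (P n N g)" if ab: "L \<subseteq> {..<n}" "N \<subseteq> {..<n}" for L N
 proof -
  have sub: "tset n t \<subseteq> {..<n}" for t by (auto simp: tset_def)
  have "?T (P n L f) (P n N g) = smul (ev n L N F) (P n L f * P n N g)"
   using wt_P[of n L f] wt_P[of n N g] sub
   by (simp add: ev_def smul_sum_left wt_def smul_mult_left smul_mult_right mult_ac)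
  then show ?thesis unfolding assms ev_cocycle_F star_wt[OF wt_P wt_P ab] .
 qed
 have "?T (\<Sum>L\<in>PP n. P n L f) (\<Sum>N\<in>PP n. P n N g) = (\<Sum>L\<in>PP n. \<Sum>N\<in>PP n. ?T (P n L f) (P n N g))"
 proof -
  have "?T (\<Sum>L\<in>PP n. P n L f) (\<Sum>N\<in>PP n. P n N g)
   = (\<Sum>st\<in>keys F. \<Sum>L\<in>PP n. \<Sum>N\<in>PP n. smul (lookup F st) (tact n (tset n (fst st)) (P n L f) * tact n (tset n (snd st)) (P n N g)))"
   by (simp only: tact_sum sum_product smul_sum)
  also have "\<dots> = (\<Sum>L\<in>PP n. \<Sum>st\<in>keys F. \<Sum>N\<in>PP n. smul (lookup F st) (tact n (tset n (fst st)) (P n L f) * tact n (tset n (snd st)) (P n N g)))"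
   by (rule sum.swap)
  also have "\<dots> = (\<Sum>L\<in>PP n. \<Sum>N\<in>PP n. ?T (P n L f) (P n N g))"
   by (intro sum.cong refl sum.swap)
  finally show ?thesis .
 qed
 also have "\<dots> = star n (\<Sum>L\<in>PP n. P n L f) (\<Sum>N\<in>PP n. P n N g)"
  unfolding star_sum_left star_sum_right by (simp add: *) (rule sum.swap)
 finally show ?thesis unfolding sum_P .
qed

end

section \<open>The twisted algebras\<close>

context subK
begin

lemma relI_props:
 assumes R: "R \<subseteq> FA K A"
 shows "relation_ideal K A R \<subseteq> FA K A" "\<And>r. r : R ==> r : relation_ideal K A R" "0 : relation_ideal K A R"
  "\<And>f g. f : relation_ideal K A R ==> g : relation_ideal K A R ==> f + g : relation_ideal K A R"
  "\<And>f g. f : relation_ideal K A R ==> g : relation_ideal K A R ==> f - g : relation_ideal K A R"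
  "\<And>a f. f : relation_ideal K A R ==> a : K ==> smul a f : relation_ideal K A R"
  "\<And>x f. f : relation_ideal K A R ==> x : FA K A ==> x * f : relation_ideal K A R"
  "\<And>x f. f : relation_ideal K A R ==> x : FA K A ==> f * x : relation_ideal K A R"
  "\<And>I h. (\<And>i. i : I ==> h i : relation_ideal K A R) ==> sum h I : relation_ideal K A R"
proof -
 interpret F: ring "free_algebra K A" by (rule ring_free_algebra)
 have R': "R \<subseteq> carrier (free_algebra K A)" using R by simp
 interpret I: ideal "relation_ideal K A R" "free_algebra K A"
  unfolding relation_ideal_def by (rule F.genideal_ideal[OF R'])
 note eq = relation_ideal_eq_gspan[OF R]
 show "relation_ideal K A R \<subseteq> FA K A" using I.a_subset by simp
 show "\<And>r. r : R ==> r : relation_ideal K A R"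
  unfolding relation_ideal_def using F.genideal_self[OF R'] by blast
 show "0 : relation_ideal K A R" unfolding eq by (rule gspan_0)
 show "\<And>f g. f : relation_ideal K A R ==> g : relation_ideal K A R ==> f + g : relation_ideal K A R"
  unfolding eq by (rule gspan_add)
 show "\<And>f g. f : relation_ideal K A R ==> g : relation_ideal K A R ==> f - g : relation_ideal K A R"
  unfolding eq by (rule gspan_diff)
 show "\<And>a f. f : relation_ideal K A R ==> a : K ==> smul a f : relation_ideal K A R"
  unfolding eq by (rule gspan_smul)
 show "\<And>x f. f : relation_ideal K A R ==> x : FA K A ==> x * f : relation_ideal K A R"
  using I.I_l_closed by simp
 show "\<And>x f. f : relation_ideal K A R ==> x : FA K A ==> f * x : relation_ideal K A R"
  using I.I_r_closed by simp
 show "\<And>I h. (\<And>i. i : I ==> h i : relation_ideal K A R) ==> sum h I : relation_ideal K A R"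
  unfolding eq by (rule gspan_sum)
qed

lemma relI_induct [consumes 2, case_names zero add base]:
 assumes R: "R \<subseteq> FA K A" and f: "f : relation_ideal K A R"
  and zero: "Q 0" and add: "\<And>f g. Q f ==> Q g ==> Q (f + g)"
  and base: "\<And>a u r v. a : K ==> u : lists A ==> r : R ==> v : lists A ==> Q (smul a (single u 1 * r * single v 1))"
 shows "Q f"
 using f unfolding relation_ideal_eq_gspan[OF R]
 by induction (use zero add base in blast)+

lemma prod_list_FA: "(\<And>a. a : A ==> \<phi> a : FA K B) ==> w : lists A ==> prod_list (map \<phi> w) : FA K B"
 by (induction w) (auto intro!: FA_mult)

lemma lin_prod_list_FA:
 "(\<And>a. a : A ==> \<phi> a : FA K B) ==> f : FA K A ==> lin (%w. prod_list (map \<phi> w)) f : FA K B"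
 by (intro FM_lin[where S = "lists A"] prod_list_FA)

lemma relI_hom:
 assumes R: "R \<subseteq> FA K A" and R': "R' \<subseteq> FA K B" and \<phi>: "\<And>a. a : A ==> \<phi> a : FA K B"
  and r: "\<And>r. r : R ==> lin (%w. prod_list (map \<phi> w)) r : relation_ideal K B R'"
  and f: "f : relation_ideal K A R"
 shows "lin (%w. prod_list (map \<phi> w)) f : relation_ideal K B R'"
 using R f
proof (induction rule: relI_induct)
 case (base a u r' v)
 note I = relI_props[OF R']
 have hom: "lin (%w. prod_list (map \<phi> w)) (f * g) = lin (%w. prod_list (map \<phi> w)) f * lin (%w. prod_list (map \<phi> w)) g" for f g
  by (rule lin_hom) simp
 have FA: "lin (%w. prod_list (map \<phi> w)) (single w 1) : FA K B" if "w : lists A" for w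
  by (rule lin_prod_list_FA[where A = A], erule \<phi>, rule FM_single[OF that K_1])
 show ?case unfolding lin_smul hom using r[OF base(3)] base(1) FA[OF base(2)] FA[OF base(4)] by (intro I(6,7,8))
next
 case zero
 show ?case using relI_props(3)[OF R'] by simp
next
 case (add f g)
 then show ?case unfolding lin_add by (rule relI_props(4)[OF R'])
qed

lemma is_quotient_sum:
 assumes Q: "is_quotient K (free_algebra K A) I B \<pi>" and "\<And>i. i : S ==> f i : FA K A" "finite S"
 shows "\<pi> (sum f S) = (\<Oplus>\<^bsub>B\<^esub>i\<in>S. \<pi> (f i))"
 using assms(3,2)
proof (induction S rule: finite_induct)
 case empty
 interpret B: assoc_algebra "scalars K" B by (rule is_quotientD(1)[OF Q])
 show ?case using is_quotient_zero[OF Q free_algebra_assoc_algebra] by simp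
next
 case (insert x F)
 interpret B: assoc_algebra "scalars K" B by (rule is_quotientD(1)[OF Q])
 have c: "\<pi> (f i) : carrier B" if "i : insert x F" for i
  using is_quotientD(2)[OF Q, of "f i"] insert.prems[OF that] by simp
 have "sum f F : FA K A" using insert.prems by (intro FM_sum) auto
 then have "\<pi> (f x + sum f F) = \<pi> (f x) \<oplus>\<^bsub>B\<^esub> \<pi> (sum f F)"
  using is_quotientD(4)[OF Q, of "f x" "sum f F"] insert.prems by simp
 then show ?case using insert c by (simp add: B.finsum_insert)
qed

lemma is_quotient_free_eq:
 assumes Q: "is_quotient K (free_algebra K A) I B \<pi>" and "f : FA K A" "g : FA K A"
 shows "\<pi> f = \<pi> g \<longleftrightarrow> f - g : I"
proof -
 interpret F: ring "free_algebra K A" by (rule ring_free_algebra)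
 have "\<ominus>\<^bsub>free_algebra K A\<^esub> g = - g"
  by (rule F.minus_equality) (use assms in auto)
 then show ?thesis
  using is_quotient_eq[OF Q free_algebra_assoc_algebra, of f g] assms by (simp add: a_minus_def)
qed

end

lemma sg1_cancel [simp]: "sg1 Z i * (sg1 Z i * x) = x"
 by (simp flip: mult.assoc)

definition sgw :: "nat set => nat list => complex" where
 "sgw Z u = (\<Prod>i\<leftarrow>u. sg1 Z i)"

lemma sgw_chi: "u : lists {..<n} ==> sgw Z u = chi n (par u) Z"
 by (induction u) (auto simp: sgw_def chi_sym_diff chi_sg1 simp del: Un_iff)

lemma tact_word:
 assumes "XY v"
 shows "tact n Z (single (map v u) a) = single (map v u) (a * sgw Z u)"
proof -
 have "tg n Z (v i) = single [v i] (sg1 Z i)" for i using assms by (auto simp: tg_def)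
 then have "prod_list (map (tg n Z) (map v u)) = single (map v u) (sgw Z u)"
  by (induction u) (simp_all add: sgw_def single_Nil_one)
 then show ?thesis by (simp add: tact_def)
qed

lemma wt_word: "XY v ==> u : lists {..<n} ==> wt n (par u) (single (map v u) a)"
 by (simp add: wt_def tact_word sgw_chi mult.commute[of a])

context cher
begin

lemma conj_Gamma:
 assumes q: "sgn1 q" and g: "g : CG q"
 shows "tm n Z * g * tm n Z : CG q" "pm n (tm n Z * g * tm n Z) = pm n g"
  "j < n ==> dm n (tm n Z * g * tm n Z) j = sg1 Z (pm n g j) * dm n g j * sg1 Z j"
proof -
 note G = GammaD[OF q g]
 let ?d = "%j. sg1 Z (pm n g j) * dm n g j * sg1 Z j"
 have tme: "tm n Z = mm n id (sg1 Z)" by (simp add: tm_def sg1_def[abs_def])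
 have "tm n Z * g * tm n Z = tm n Z * mm n (pm n g) (dm n g) * tm n Z" using G(4) by metis
 also have "\<dots> = mm n (pm n g) ?d"
  unfolding tme by (simp add: mm_mult[OF G(1)] mm_mult[OF permutes_id])
 finally have eq: "tm n Z * g * tm n Z = mm n (pm n g) ?d" .
 have s: "sg1 Z i : Um" for i using minus_1_root by (simp add: sg1_def)
 have d: "?d j : Um" if "j < n" for j using G(2)[OF that] s by (intro unity_roots_mult)
 have "(\<Prod>j<n. sg1 Z (pm n g j)) = (\<Prod>j<n. sg1 Z j)"
  using prod.permute[OF G(1), of "sg1 Z"] by (simp add: o_def)
 moreover have "(\<Prod>j<n. sg1 Z j) * (\<Prod>j<n. sg1 Z j) = 1"
  unfolding prod.distrib[symmetric] by simp
 ultimately have "(\<Prod>j<n. ?d j) = (\<Prod>j<n. dm n g j)"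
  by (simp add: prod.distrib mult_ac)
 then show "tm n Z * g * tm n Z : CG q"
  unfolding eq using G(3) d by (intro Gamma_mm[OF q G(1)]) auto
 have nz: "\<forall>j<n. ?d j ~= 0" using d root_nonzero by blast
 show "pm n (tm n Z * g * tm n Z) = pm n g" unfolding eq by (rule pm_mm[OF G(1) nz])
 show "j < n ==> dm n (tm n Z * g * tm n Z) j = ?d j" unfolding eq by (rule dm_mm[OF G(1) nz])
qed

lemma minus_1_K [simp]: "-1 : K"
 using K_minus[OF K_1] .

lemma sg1_K [simp]: "sg1 Z i : K"
 by (auto simp: sg1_def)

lemma tg_FA:
 assumes q: "sgn1 q" and a: "a : Hg q"
 shows "tg n Z a : FH q"
proof (cases a)
 case (Gr h)
 then have h: "h : CG q" using a by (auto simp: H_gens_def)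
 then show ?thesis using conj_Gamma(1)[OF q h] GammaD(7)[OF q h] Gr
  by (auto simp: tg_def H_gens_def intro!: FM_single)
qed (use a in \<open>auto simp: tg_def H_gens_def intro!: FM_single\<close>)

lemma tact_FA: "sgn1 q ==> f : FH q ==> tact n Z f : FH q"
 unfolding tact_def by (intro lin_prod_list_FA[where A = "Hg q"] tg_FA)

lemma tact_FA_Sg:
 assumes "XY v" "f : FS v"
 shows "tact n Z f : FS v"
 unfolding tact_def
 by (rule lin_prod_list_FA[OF _ assms(2)]) (use assms(1) in \<open>auto simp: tg_def S_gens_def intro!: FM_single\<close>)

lemma chi_K [simp]: "chi n L Z : K" "bs n L Z : K"
 using chi_cases[of n L Z] bs_cases[of n L Z] by auto

lemma P_FA: "sgn1 q ==> f : FH q ==> P n L f : FH q"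
 unfolding P_def by (intro FM_smul FM_sum tact_FA half_K chi_K)

lemma star_FA: "sgn1 q ==> f : FH q ==> g : FH q ==> star n f g : FH q"
 unfolding star_def by (intro FM_smul FM_sum FA_mult P_FA chi_K)

lemma refl_mat_conj:
 assumes q: "sgn1 q" and "i < n" "l < n" "i ~= l" "\<epsilon> : Um"
 shows "tm n Z * refl_mat q n i l \<epsilon> * tm n Z = refl_mat q n i l (\<epsilon> * (sg1 Z i * sg1 Z l))"
proof -
 let ?e = "\<epsilon> * (sg1 Z i * sg1 Z l)"
 have e: "?e : Um" using assms(5) minus_1_root by (auto simp: sg1_def intro: uminus_root)
 have tme: "tm n Z = mm n id (sg1 Z)" by (simp add: tm_def sg1_def[abs_def])
 have perm: "transpose i l permutes {..<n}" using assms by (intro permutes_swap_id) auto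
 show ?thesis
  unfolding refl_mat_Gamma(1)[OF assms] refl_mat_Gamma(1)[OF q assms(2-4) e] tme
  by (simp add: mm_mult[OF perm] mm_mult[OF permutes_id]) 
   (intro mm_cong, use assms in \<open>auto simp: sg1_def transpose_def\<close>)
qed

lemma t_mat_conj: "i < n ==> tm n Z * t_mat n i \<zeta> * tm n Z = t_mat n i \<zeta>"
proof -
 have tme: "tm n Z = mm n id (sg1 Z)" by (simp add: tm_def sg1_def[abs_def])
 show ?thesis unfolding tme t_mat_eq
  by (simp add: mm_mult[OF permutes_id]) (intro mm_cong, auto simp: sg1_def)
qed

lemma roots_scale_sum:
 assumes "s = 1 \<or> s = -1"
 shows "(\<Sum>\<epsilon>\<in>Um. f (\<epsilon> * s) \<epsilon>) = (\<Sum>\<epsilon>\<in>Um. f \<epsilon> (\<epsilon> * s))"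
 by (rule sum.reindex_bij_witness[where i = "%\<epsilon>. \<epsilon> * s" and j = "%\<epsilon>. \<epsilon> * s"])
  (use assms in \<open>auto intro: uminus_root\<close>)

lemma tact_refl_sum:
 assumes q: "sgn1 q" and "i < n" "l < n" "i ~= l"
 shows "tact n Z (\<Sum>\<epsilon>\<in>Um. single [Gr (refl_mat q n i l \<epsilon>)] (F \<epsilon>))
  = (\<Sum>\<epsilon>\<in>Um. single [Gr (refl_mat q n i l \<epsilon>)] (F (\<epsilon> * (sg1 Z i * sg1 Z l))))"
proof -
 have "tact n Z (\<Sum>\<epsilon>\<in>Um. single [Gr (refl_mat q n i l \<epsilon>)] (F \<epsilon>))
  = (\<Sum>\<epsilon>\<in>Um. single [Gr (refl_mat q n i l (\<epsilon> * (sg1 Z i * sg1 Z l)))] (F \<epsilon>))"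
  unfolding tact_sum
  by (intro sum.cong refl) (simp add: tact_Gr refl_mat_conj[OF assms] GammaD(7)[OF q refl_mat_Gamma(2)[OF assms]])
 also have "\<dots> = (\<Sum>\<epsilon>\<in>Um. single [Gr (refl_mat q n i l \<epsilon>)] (F (\<epsilon> * (sg1 Z i * sg1 Z l))))"
  by (rule roots_scale_sum[where f = "%a b. single [Gr (refl_mat q n i l a)] (F b)"]) (auto simp: sg1_def)
 finally show ?thesis .
qed

text \<open>Conjugation by an element of \<open>T\<close> permutes the summands, replacing \<open>\<epsilon>\<close> by \<open>\<plusminus>\<epsilon>\<close>; here \<open>-1\<close> must be an
 \<open>m\<close>-th root of unity.\<close>

lemma tact_kappa:
 assumes q: "sgn1 q" and "i < n" "j < n"
 shows "tact n Z (\<kappa> q i j) = smul (sg1 Z i * sg1 Z j) (\<kappa> q i j)"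
proof (cases "i = j")
 case True
 have "tact n Z (\<Sum>l\<in>{..<n} - {i}. \<Sum>\<epsilon>\<in>Um. single [Gr (refl_mat q n i l \<epsilon>)] c\<^sub>1)
  = (\<Sum>l\<in>{..<n} - {i}. \<Sum>\<epsilon>\<in>Um. single [Gr (refl_mat q n i l \<epsilon>)] c\<^sub>1)"
  unfolding tact_sum[of _ _ _ "{..<n} - {i}"]
  by (intro sum.cong refl) (use tact_refl_sum[OF q assms(2), of _ Z "%_. c\<^sub>1"] in auto)
 moreover have "tact n Z (\<Sum>\<zeta>\<in>Up - {1}. single [Gr (t_mat n i \<zeta>)] (c \<zeta>))
  = (\<Sum>\<zeta>\<in>Up - {1}. single [Gr (t_mat n i \<zeta>)] (c \<zeta>))"
  unfolding tact_sum
  by (intro sum.cong refl) (use assms GammaD(7)[OF q t_mat_Gamma[OF q assms(2)]] in \<open>simp add: tact_Gr t_mat_conj\<close>)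
 ultimately show ?thesis using True by (simp add: kq_def tact_add)
next
 case False
 have "tact n Z (\<kappa> q i j) = (\<Sum>\<epsilon>\<in>Um. single [Gr (refl_mat q n i j \<epsilon>)] (- q * c\<^sub>1 * (\<epsilon> * (sg1 Z i * sg1 Z j))))"
  using False by (simp only: kq_def if_False tact_refl_sum[OF q assms(2,3) False])
 also have "\<dots> = smul (sg1 Z i * sg1 Z j) (\<kappa> q i j)"
  using False by (simp add: kq_def smul_sum mult_ac)
 finally show ?thesis .
qed

lemma tact_v: "XY v ==> tact n Z (single [v i] a) = single [v i] (a * sg1 Z i)"
 using tact_word[of v n Z "[i]" a] by (simp add: sgw_def)

lemma tact_S_rels:
 assumes "r : S_rels n q v" "XY v"
 shows "\<exists>a\<in>K. tact n Z r = smul a r"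
proof -
 obtain i j where r: "r = single [v i, v j] 1 - single [v j, v i] q" using assms by (auto simp: S_rels_def)
 have "tact n Z r = smul (sg1 Z i * sg1 Z j) r"
  unfolding r tact_diff
  using tact_word[OF assms(2), of n Z "[i, j]" 1] tact_word[OF assms(2), of n Z "[j, i]" q]
  by (simp add: sgw_def smul_diff mult_ac)
 then show ?thesis using K_mult[OF sg1_K sg1_K] by blast
qed

lemma tact_H_rels:
 assumes q: "sgn1 q" and r: "r : HR q"
 shows "\<exists>a\<in>K. \<exists>r'\<in>HR q. tact n Z r = smul a r'"
proof -
 let ?c = "%g. tm n Z * g * tm n Z"
 have Gr: "tact n Z (single [Gr g] a) = single [Gr (?c g)] a" if "g : CG q" for g a
  using GammaD(7)[OF q that] by (simp add: tact_Gr)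
 consider (S) v where "XY v" "r : S_rels n q v"
  | (one) "r = single [Gr (1\<^sub>m n)] 1 - single [] 1"
  | (mult) g h where "g : CG q" "h : CG q" "r = single [Gr g, Gr h] 1 - single [Gr (g * h)] 1"
  | (act) g v i where "g : CG q" "XY v" "i < n"
    "r = single [Gr g, v i] 1 - gen_action n (\<Gamma> q) g (v i) * single [Gr g] 1"
  | (comm) i j where "i < n" "j < n" "r = single [Yg i, Xg j] 1 - single [Xg j, Yg i] (if i = j then 1 else q) - \<kappa> q i j"
  using r unfolding H_rels_def Gamma_mult_one free_algebra_sel by blast
 then show ?thesis
 proof cases
  case S
  then have "r : HR q" by (auto simp: H_rels_def)
  then show ?thesis using tact_S_rels[OF S(2,1), of Z] by blast
 next
  case one
  have "?c (1\<^sub>m n) = 1\<^sub>m n" by (simp add: right_mult_one_mat[OF tm_carrier] tm_mult tm_empty)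
  then have "tact n Z r = smul 1 r"
   unfolding one tact_diff Gr[OF Gamma_nonempty[OF q]] single_Nil_one by simp
  then show ?thesis using r K_1 by blast
 next
  case mult
  have cm: "g : carrier_mat n n" "h : carrier_mat n n" "tm n Z : carrier_mat n n"
   using GammaD(7)[OF q] mult by auto
  have tt: "tm n Z * (tm n Z * x) = x" if "x : carrier_mat n n" for x
   using that cm by (simp add: assoc_mult_mat[of _ n n _ n _ n, symmetric] tm_mult tm_empty)
  have "?c g * ?c h = ?c (g * h)"
   using cm by (simp add: assoc_mult_mat[of _ n n _ n _ n] mult_carrier_mat[of _ n n _ n] tt)
  moreover have "tact n Z (single [Gr g, Gr h] 1) = single [Gr (?c g), Gr (?c h)] 1"
   using tact_mult[of n Z "single [Gr g] 1" "single [Gr h] 1"] Gr mult by simp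
  ultimately have "tact n Z r = smul 1 (single [Gr (?c g), Gr (?c h)] 1 - single [Gr (?c g * ?c h)] 1)"
   unfolding mult(3) tact_diff using Gr[OF Gamma_closed(1)[OF q mult(1,2)]] by simp
  moreover have "single [Gr (?c g), Gr (?c h)] 1 - single [Gr (?c g * ?c h)] 1 : HR q"
   unfolding H_rels_def Gamma_mult_one using conj_Gamma(1)[OF q] mult by blast
  ultimately show ?thesis using K_1 by blast
 next
  case act
  note ga = gen_action_v[OF q _ act(2,3)]
  let ?r = "single [Gr (?c g), v i] 1 - gen_action n (\<Gamma> q) (?c g) (v i) * single [Gr (?c g)] 1"
  have "tact n Z (single [Gr g, v i] 1) = single [Gr (?c g), v i] (sg1 Z i)"
   using tact_mult[of n Z "single [Gr g] 1" "single [v i] 1"] Gr[OF act(1)] tact_v[OF act(2)] by simp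
  moreover have "tact n Z (gen_action n (\<Gamma> q) g (v i) * single [Gr g] 1)
   = single [v (pm n g i), Gr (?c g)] (cv v (dm n g i) * sg1 Z (pm n g i))"
   unfolding tact_mult ga[OF act(1)] Gr[OF act(1)] tact_v[OF act(2)] by simp
  moreover have "cv v (sg1 Z k) = sg1 Z k" for k by (simp add: sg1_def)
  ultimately have "tact n Z r = smul (sg1 Z i) ?r"
   unfolding act(4) tact_diff ga[OF conj_Gamma(1)[OF q act(1)]] conj_Gamma(2,3)[OF q act(1)] conj_Gamma(3)[OF q act(1) act(3)]
   by (simp add: smul_diff mult_ac)
  moreover have "?r : HR q"
   unfolding H_rels_def free_algebra_sel using conj_Gamma(1)[OF q act(1)] act by blast
  ultimately show ?thesis using sg1_K by blast
 next
  case comm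
  have "tact n Z (single [Yg i, Xg j] 1) = single [Yg i, Xg j] (sg1 Z i * sg1 Z j)"
   using tact_mult[of n Z "single [Yg i] 1" "single [Xg j] 1"] by (simp add: tact_v)
  moreover have "tact n Z (single [Xg j, Yg i] b) = single [Xg j, Yg i] (b * (sg1 Z i * sg1 Z j))" for b
   using tact_mult[of n Z "single [Xg j] b" "single [Yg i] 1"] by (simp add: tact_v mult_ac)
  ultimately have "tact n Z r = smul (sg1 Z i * sg1 Z j) r"
   unfolding comm(3) tact_diff tact_kappa[OF q comm(1,2)] by (simp add: smul_diff mult_ac)
  then show ?thesis using r K_mult[OF sg1_K sg1_K] by blast
 qed
qed

lemma H_relsI:
 assumes q: "sgn1 q"
 shows "\<And>r. r : HR q ==> r : J q"
  "\<And>f. f : Inv q Xg \<union> Inv q Yg ==> f : J q"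
  "\<And>f. f : HI q ==> f : J q"
proof -
 have R: "HR q \<union> (Inv q Xg \<union> Inv q Yg) \<subseteq> FH q"
  using H_rels_FA[OF q] Inv_Hg by blast
 show "\<And>r. r : HR q ==> r : J q" "\<And>f. f : Inv q Xg \<union> Inv q Yg ==> f : J q"
  unfolding J_def using relI_props(2)[OF R] by blast+
 show "f : J q" if "f : HI q" for f
  using H_rels_FA[OF q] that unfolding H_ideal_def
 proof (induction rule: relI_induct)
  case (base a u r v)
  have "r : J q" unfolding J_def by (rule relI_props(2)[OF R]) (use base in blast)
  then show ?case unfolding J_def using base by (intro relI_props(6,7,8)[OF R] FM_single K_1)
 qed (use relI_props(3,4)[OF R] in \<open>auto simp: J_def\<close>)
qed

lemma J_gens_FA: "sgn1 q ==> HR q \<union> (Inv q Xg \<union> Inv q Yg) \<subseteq> FH q"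
 using H_rels_FA Inv_Hg by blast

lemmas J_props = relI_props[OF J_gens_FA, folded J_def]

lemma relI_tact:
 assumes "R \<subseteq> FA K A" "\<And>a. a : A ==> tg n Z a : FA K A" "\<And>r. r : R ==> tact n Z r : relation_ideal K A R"
  "f : relation_ideal K A R"
 shows "tact n Z f : relation_ideal K A R"
 using relI_hom[OF assms(1,1), of "tg n Z" f] assms(2-4) by (simp add: tact_def)

lemma tact_S_ideal:
 assumes q: "sgn1 q" and v: "XY v" and f: "f : SI q v"
 shows "tact n Z f : SI q v"
 unfolding S_ideal_def
proof (rule relI_tact[OF S_rels_FA[OF q]])
 show "tg n Z a : FS v" if "a : Sg v" for a
  using that v by (auto simp: tg_def S_gens_def intro!: FM_single)
 show "tact n Z r : relation_ideal K (Sg v) (S_rels n q v)" if "r : S_rels n q v" for r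
  using tact_S_rels[OF that v, of Z] relI_props(2,6)[OF S_rels_FA[OF q]] that by force
 show "f : relation_ideal K (Sg v) (S_rels n q v)" using f by (simp add: S_ideal_def)
qed

lemma vact_tact:
 assumes q: "sgn1 q" and v: "XY v" and g: "g : CG q" and f: "f : FS v"
 shows "vact q g (tact n Z f) = tact n Z (vact q (tm n Z * g * tm n Z) f)"
 using f
proof (induction rule: FM_induct)
 case (single w a)
 then obtain u where u: "u : lists {..<n}" "w = map v u" using lists_Sg by blast
 have "wcoef v (tm n Z * g * tm n Z) u * sgw Z (map (pm n g) u) = wcoef v g u * sgw Z u"
  using u(1)
 proof (induction u)
  case (Cons i u)
  have "cv v (sg1 Z k) = sg1 Z k" for k by (simp add: sg1_def)
  moreover have "sg1 Z k * (sg1 Z k * x) = x" for k x by (simp flip: mult.assoc)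
  ultimately show ?case using Cons conj_Gamma(3)[OF q g, of i Z] by (simp add: sgw_def mult_ac)
 qed (simp add: sgw_def)
 then show ?case
  unfolding u(2) tact_word[OF v] vact_word[OF q g v u(1)] vact_word[OF q conj_Gamma(1)[OF q g] v u(1)]
   conj_Gamma(2)[OF q g] by (simp add: mult_ac)
qed (simp_all add: vact_def lin_add tact_add)

lemma tact_keys_Sg:
 assumes v: "XY v" and f: "f : FS v"
 shows "keys (tact n Z f) \<subseteq> keys f"
proof -
 have "keys (tact n Z f) \<subseteq> (\<Union>w\<in>keys f. keys (smul (lookup f w) (prod_list (map (tg n Z) w))))"
  unfolding tact_def lin_def by (rule Poly_Mapping.keys_sum)
 also have "\<dots> \<subseteq> keys f"
 proof (intro UN_least)
  fix w assume w: "w : keys f"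
  then have "w : lists (Sg v)" using f by (auto simp: FM_def)
  then obtain u where u: "w = map v u" using lists_Sg by blast
  have "prod_list (map (tg n Z) w) = single w (sgw Z u)"
   using tact_word[OF v, of n Z u 1] u by (simp add: tact_def)
  then show "keys (smul (lookup f w) (prod_list (map (tg n Z) w))) \<subseteq> keys f" using w by auto
 qed
 finally show ?thesis .
qed

lemma tact_Inv:
 assumes q: "sgn1 q" and v: "XY v" and f: "f : Inv q v"
 shows "tact n Z f : Inv q v"
proof -
 have fF: "f : FS v" using f Inv_FA by blast
 obtain d where d: "d > 0" "\<forall>w\<in>keys f. length w = d" using f by (auto simp: Inv_def)
 have "vact q g (tact n Z f) - tact n Z f : SI q v" if g: "g : CG q" for g
 proof -
  have "vact q g (tact n Z f) - tact n Z f = tact n Z (vact q (tm n Z * g * tm n Z) f - f)"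
   by (simp add: vact_tact[OF q v g fF] tact_diff)
  moreover have "vact q (tm n Z * g * tm n Z) f - f : SI q v"
   using f conj_Gamma(1)[OF q g] by (auto simp: Inv_def)
  ultimately show ?thesis using tact_S_ideal[OF q v] by simp
 qed
 moreover have "\<forall>w\<in>keys (tact n Z f). length w = d" using tact_keys_Sg[OF v fF] d by blast
 ultimately show ?thesis using tact_FA_Sg[OF v fF] d(1) by (auto simp: Inv_def)
qed

lemma tact_H_ideal:
 assumes q: "sgn1 q" and f: "f : HI q"
 shows "tact n Z f : HI q"
 unfolding H_ideal_def
proof (rule relI_tact[OF H_rels_FA[OF q]])
 show "tact n Z r : relation_ideal K (Hg q) (HR q)" if "r : HR q" for r
  using tact_H_rels[OF q that, of Z] relI_props(2,6)[OF H_rels_FA[OF q]] by force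
 show "f : relation_ideal K (Hg q) (HR q)" using f by (simp add: H_ideal_def)
qed (rule tg_FA[OF q])

lemma tact_J:
 assumes q: "sgn1 q" and f: "f : J q"
 shows "tact n Z f : J q"
 unfolding J_def
proof (rule relI_tact[OF J_gens_FA[OF q]], fold J_def)
 show "tact n Z r : J q" if r: "r : HR q \<union> (Inv q Xg \<union> Inv q Yg)" for r
 proof (cases "r : HR q")
  case True
  then show ?thesis using tact_H_rels[OF q True, of Z] J_props(6)[OF q] H_relsI(1)[OF q] by force
 next
  case False
  then show ?thesis using r tact_Inv[OF q] H_relsI(2)[OF q] by blast
 qed
qed (use tg_FA[OF q] f in auto)

lemma P_J: "sgn1 q ==> f : J q ==> P n L f : J q"
 unfolding P_def by (intro J_props(6,9) tact_J half_K chi_K)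

lemma star_J:
 assumes q: "sgn1 q" and "f : J q" "g : FH q"
 shows "star n f g : J q" "star n g f : J q"
 unfolding star_def
 by (intro J_props(9)[OF q] J_props(6)[OF q] J_props(8)[OF q] P_J[OF q] P_FA[OF q] assms chi_K)
  (intro J_props(9)[OF q] J_props(6)[OF q] J_props(7)[OF q] P_J[OF q] P_FA[OF q] assms chi_K)

lemma gen_action_T:
 assumes q: "sgn1 q" and "Z \<subseteq> {..<n}" "a : Hg q"
 shows "gen_action n (T_group n) (tm n Z) a = tg n Z a"
proof -
 have ind: "tm n Z $$ (i, j) = (if i = j then sg1 Z j else 0)" if "i < n" "j < n" for i j
  using that by (simp add: tm_def mm_index sg1_def)
 show ?thesis
 proof (cases a)
  case (Xg i)
  then have i: "i < n" using assms by (auto simp: H_gens_def)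
  show ?thesis unfolding Xg gen_action_def gen.case tg_def
   by (subst sum_single_index[OF i]) (auto simp: ind i)
 next
  case (Yg i)
  then have i: "i < n" using assms by (auto simp: H_gens_def)
  show ?thesis unfolding Yg gen_action_def gen.case tg_def T_group_inv[OF assms(2)]
   by (subst sum_single_index[OF i]) (auto simp: ind i)
 next
  case (Gr h)
  then have "h : carrier_mat n n" using assms GammaD(7)[OF q] by (auto simp: H_gens_def)
  then show ?thesis unfolding Gr gen_action_def gen.case tg_def T_group_inv[OF assms(2)] by simp
 qed
qed

lemma H_coset_eq:
 assumes "sgn1 q" "f : FH q" "h : FH q"
 shows "HI q +>\<^bsub>AH q\<^esub> f
  = HI q +>\<^bsub>AH q\<^esub> h \<longleftrightarrow> f - h : HI q"
 using is_quotient_free_eq[OF H_alg_quotient assms(2,3)] assms(1) by (simp add: H_ideal_def relation_ideal_def)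

lemma clH_eq: "sgn1 q ==> f : FH q ==> h : FH q ==> clH q f = clH q h \<longleftrightarrow> f - h : J q"
 by (rule is_quotient_free_eq[OF restricted_quotient])

lemma T_action_clH:
 assumes q: "sgn1 q" and g: "Z \<subseteq> {..<n}" and f: "f : FH q"
 shows "T_action K n (\<Gamma> q) q (\<kappa> q) (tm n Z) (clH q f) = clH q (tact n Z f)"
proof -
 let ?I = "HI q" and ?R = "restricted_ideal K n (\<Gamma> q) q (\<kappa> q)"
 let ?F = "AH q" and ?H = "H_alg K n (\<Gamma> q) q (\<kappa> q)"
 let ?e = "free_endo K (Hg q) (gen_action n (T_group n) (tm n Z))"
 have endo: "?e h = tact n Z h" if "h : FH q" for h
  unfolding free_endo_eq tact_def
 proof (rule lin_cong)
  fix w assume "w : keys h"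
  then have "w : lists (Hg q)" using that by (auto simp: FM_def)
  then have "map (gen_action n (T_group n) (tm n Z)) w = map (tg n Z) w"
   using gen_action_T[OF q g] by (intro map_cong) auto
  then show "prod_list (map (gen_action n (T_group n) (tm n Z)) w) = prod_list (map (tg n Z) w)"
   by (rule arg_cong[where f = prod_list])
 qed
 have FI: "?I \<subseteq> FH q" unfolding H_ideal_def by (rule relI_props(1)[OF H_rels_FA[OF q]])
 have one: "induced_map ?F ?I ?e (?I +>\<^bsub>?F\<^esub> h) = ?I +>\<^bsub>?F\<^esub> (tact n Z h)" if h: "h : FH q" for h
 proof -
  have "?I +>\<^bsub>?F\<^esub> ?e a = ?I +>\<^bsub>?F\<^esub> tact n Z h" if "a : ?I +>\<^bsub>?F\<^esub> h" for a
  proof -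
   have ah: "a - h : ?I" using that coset_iff by blast
   then have "a - h + h : FH q" using h FI by blast
   then have a: "a : FH q" by simp
   have "tact n Z a - tact n Z h : ?I" using tact_H_ideal[OF q ah, of Z] by (simp add: tact_diff)
   then show ?thesis using H_coset_eq[OF q tact_FA[OF q a] tact_FA[OF q h]] endo[OF a] by simp
  qed
  moreover have "h : ?I +>\<^bsub>?F\<^esub> h"
   by (simp add: coset_iff H_ideal_def relI_props(3)[OF H_rels_FA[OF q]])
  ultimately show ?thesis unfolding induced_map_def by blast
 qed
 note D = is_quotientD[OF H_alg_quotient[OF q]]
 interpret H: assoc_algebra "scalars K" ?H by (rule D(1))
 have idR: "ideal ?R ?H"
  unfolding restricted_ideal_eq[OF q]
  by (rule H.genideal_ideal, rule image_subsetI, rule D(2)) (simp add: Inv_Hg(2))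
 interpret R: ideal ?R ?H by (rule idR)
 have fH: "?I +>\<^bsub>?F\<^esub> f : carrier ?H" using D(2)[of f] f by simp
 have two: "?R +>\<^bsub>?H\<^esub> induced_map ?F ?I ?e C = clH q (tact n Z f)" if C: "C : ?R +>\<^bsub>?H\<^esub> (?I +>\<^bsub>?F\<^esub> f)" for C
 proof -
  have CH: "C : carrier ?H" using C H.a_r_coset_subset_G[OF R.a_subset fH] by blast
  obtain h where h: "h : FH q" "C = ?I +>\<^bsub>?F\<^esub> h" using D(3)[OF CH] by auto
  have "?R +>\<^bsub>?H\<^esub> C = ?R +>\<^bsub>?H\<^esub> (?I +>\<^bsub>?F\<^esub> f)"
   using H.a_repr_independence[OF C fH additive_subgroup.a_subgroup[OF ideal.axioms(1)[OF idR]]] by simp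
  then have "clH q h = clH q f" unfolding clH_def h(2) .
  then have "tact n Z (h - f) : J q" using clH_eq[OF q h(1) f] tact_J[OF q] by blast
  then have "clH q (tact n Z h) = clH q (tact n Z f)"
   using clH_eq[OF q tact_FA[OF q h(1)] tact_FA[OF q f]] by (simp add: tact_diff)
  then show ?thesis unfolding h(2) one[OF h(1)] by (simp add: clH_def)
 qed
 have "?I +>\<^bsub>?F\<^esub> f : ?R +>\<^bsub>?H\<^esub> (?I +>\<^bsub>?F\<^esub> f)"
  using abelian_subgroup.a_rcos_self[OF abelian_subgroupI3[OF ideal.axioms(1)[OF idR] H.abelian_group_axioms] fH] .
 then show ?thesis
  unfolding T_action_def induced_map_def[of ?H] clH_def[of q f] using two by blast
qed

definition Tw :: "complex => (complex, falg set set) module" where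
 "Tw q = cocycle_twist K n (cocycle_F K n) (T_action K n (\<Gamma> q) q (\<kappa> q)) (restricted_alg K n (\<Gamma> q) q (\<kappa> q))"

lemma Tw_sel:
 "carrier (Tw q) = carrier (restricted_alg K n (\<Gamma> q) q (\<kappa> q))"
 "\<one>\<^bsub>Tw q\<^esub> = \<one>\<^bsub>restricted_alg K n (\<Gamma> q) q (\<kappa> q)\<^esub>" "\<zero>\<^bsub>Tw q\<^esub> = \<zero>\<^bsub>restricted_alg K n (\<Gamma> q) q (\<kappa> q)\<^esub>"
 "add (Tw q) = add (restricted_alg K n (\<Gamma> q) q (\<kappa> q))" "smult (Tw q) = smult (restricted_alg K n (\<Gamma> q) q (\<kappa> q))"
 by (simp_all add: Tw_def cocycle_twist_def Let_def)

lemma Tw_mult: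
 assumes q: "sgn1 q" and f: "f : FH q" and g: "g : FH q"
 shows "clH q f \<otimes>\<^bsub>Tw q\<^esub> clH q g = clH q (star n f g)"
proof -
 let ?A = "restricted_alg K n (\<Gamma> q) q (\<kappa> q)"
 let ?F = "cocycle_F K n"
 note QH = restricted_quotient[OF q]
 note D = is_quotientD[OF QH]
 interpret A: assoc_algebra "scalars K" ?A by (rule D(1))
 let ?h = "%st. smul (lookup ?F st) (tact n (tset n (fst st)) f * tact n (tset n (snd st)) g)"
 have FK: "lookup ?F st : K" for st using cocycle_F_carrier[of n] by (cases st) (auto simp: kT_kT_sel FM_def)
 have hFA: "?h st : FH q" for st
  by (intro FM_smul FA_mult tact_FA[OF q] f g FK)
 have "lookup ?F st \<odot>\<^bsub>?A\<^esub> (T_action K n (\<Gamma> q) q (\<kappa> q) (fst st) (clH q f) \<otimes>\<^bsub>?A\<^esub> T_action K n (\<Gamma> q) q (\<kappa> q) (snd st) (clH q g)) = clH q (?h st)"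
  if st: "st : keys ?F" for st
 proof -
  have "st : (%(Z, Y). (tm n Z, tm n Y)) ` (PP n \<times> PP n)"
   using st cocycle_F_carrier[of n] by (auto simp: kT_kT_sel FM_def)
  then obtain Z Y where gd: "st = (tm n Z, tm n Y)" "Z \<subseteq> {..<n}" "Y \<subseteq> {..<n}" by auto
  have "clH q (?h st) = lookup ?F st \<odot>\<^bsub>?A\<^esub> clH q (tact n Z f * tact n Y g)"
   using D(7)[of "lookup ?F st" "tact n Z f * tact n Y g"] FK tact_FA[OF q] f g gd
   by (simp add: tset_tm FA_mult)
  also have "clH q (tact n Z f * tact n Y g) = clH q (tact n Z f) \<otimes>\<^bsub>?A\<^esub> clH q (tact n Y g)"
   using D(5)[of "tact n Z f" "tact n Y g"] tact_FA[OF q] f g by simp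
  finally show ?thesis
   unfolding gd(1) fst_conv snd_conv T_action_clH[OF q gd(2) f] T_action_clH[OF q gd(3) g] by simp
 qed
 then have "clH q f \<otimes>\<^bsub>Tw q\<^esub> clH q g = (\<Oplus>\<^bsub>?A\<^esub>st\<in>keys ?F. clH q (?h st))"
  unfolding Tw_def cocycle_twist_def Let_def cocycle_F_inverse
  by (simp, intro A.finsum_cong') (use D(2) hFA in auto)
 also have "\<dots> = clH q (\<Sum>st\<in>keys ?F. ?h st)"
  by (rule is_quotient_sum[OF QH, symmetric]) (use hFA in auto)
 also have "(\<Sum>st\<in>keys ?F. ?h st) = star n f g"
  by (rule cocycle_sum_eq_star) simp
 finally show ?thesis .
qed

definition twisted_free :: "complex => (complex, falg) module" where
 "twisted_free q = (AH q)\<lparr>mult := star n\<rparr>"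

lemma twisted_free_assoc_algebra:
 assumes q: "sgn1 q"
 shows "assoc_algebra (scalars K) (twisted_free q)"
proof -
 let ?A = "twisted_free q"
 have sel: "carrier ?A = FH q" "\<one>\<^bsub>?A\<^esub> = 1" "\<zero>\<^bsub>?A\<^esub> = 0" "add ?A = (+)" "smult ?A = smul" "mult ?A = star n"
  by (simp_all add: twisted_free_def)
 have ag: "abelian_group ?A"
 proof (rule abelian_groupI; unfold sel)
  fix x assume x: "x : FH q"
  show "\<exists>y\<in>FH q. y + x = 0" using x by (intro bexI[of _ "- x"]) auto
 qed (auto simp: add.assoc add.commute)
 have mon: "Group.monoid ?A"
  by (rule monoidI; unfold sel) (auto simp: star_assoc intro!: star_FA[OF q])
 have ring: "ring ?A"
  by (rule ringI[OF ag mon]; unfold sel) (auto simp: star_add_left star_add_right)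
 have mod: "Module.module (scalars K) ?A"
 proof (rule moduleI[OF _ ag])
  show "cring (scalars K)" by (rule fieldE(1)[OF scalars_field])
 qed (unfold sel scalars_sel, auto simp: smul_add smul_add_left)
 show ?thesis
  by (intro assoc_algebra.intro[OF mod ring] assoc_algebra_axioms.intro; unfold sel)
   (auto simp: star_smul_left star_smul_right)
qed

lemma Tw_assoc_algebra:
 assumes q: "sgn1 q"
 shows "assoc_algebra (scalars K) (Tw q)"
proof (rule assoc_algebra_image[OF twisted_free_assoc_algebra[OF q], where \<pi> = "clH q"])
 note D = is_quotientD[OF restricted_quotient[OF q]]
 show "clH q ` carrier (twisted_free q) = carrier (Tw q)"
  using restricted_quotient[OF q] by (simp add: is_quotient_def twisted_free_def Tw_sel)
 fix a b assume "a : carrier (twisted_free q)" "b : carrier (twisted_free q)"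
 then have ab: "a : FH q" "b : FH q" by (simp_all add: twisted_free_def)
 show "clH q (a \<oplus>\<^bsub>twisted_free q\<^esub> b) = clH q a \<oplus>\<^bsub>Tw q\<^esub> clH q b"
  using D(4)[of a b] ab by (simp add: twisted_free_def Tw_sel)
 show "clH q (a \<otimes>\<^bsub>twisted_free q\<^esub> b) = clH q a \<otimes>\<^bsub>Tw q\<^esub> clH q b"
  unfolding Tw_mult[OF q ab] by (simp add: twisted_free_def)
next
 note D = is_quotientD[OF restricted_quotient[OF q]]
 fix k a assume "k : K" "a : carrier (twisted_free q)"
 then show "clH q (k \<odot>\<^bsub>twisted_free q\<^esub> a) = k \<odot>\<^bsub>Tw q\<^esub> clH q a"
  using D(7)[of k a] by (simp add: twisted_free_def Tw_sel)
next
 show "clH q \<one>\<^bsub>twisted_free q\<^esub> = \<one>\<^bsub>Tw q\<^esub>"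
  using is_quotientD(6)[OF restricted_quotient[OF q]] by (simp add: twisted_free_def Tw_sel)
 show "clH q \<zero>\<^bsub>twisted_free q\<^esub> = \<zero>\<^bsub>Tw q\<^esub>"
  using is_quotient_zero[OF restricted_quotient[OF q] free_algebra_assoc_algebra] by (simp add: twisted_free_def Tw_sel)
qed

end

section \<open>Twisting the group algebra\<close>

lemma chi_image:
 assumes "\<pi> permutes {..<n}" "Z \<subseteq> {..<n}" "Y \<subseteq> {..<n}"
 shows "chi n (\<pi> ` Z) (\<pi> ` Y) = chi n Z Y"
proof -
 have inj: "inj \<pi>" using assms permutes_inj by blast
 have "chi n (\<pi> ` Z) (\<pi> ` Y) = (\<Prod>i\<in>\<pi> ` {..<n}. if i : \<pi> ` Z & i : \<pi> ` Y then -1 else 1)"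
  unfolding chi_def permutes_image[OF assms(1)] ..
 also have "\<dots> = (\<Prod>i<n. if \<pi> i : \<pi> ` Z & \<pi> i : \<pi> ` Y then -1 else 1)"
  by (subst prod.reindex) (use inj in \<open>auto simp: inj_on_def inj_def\<close>)
 finally show ?thesis using inj by (simp add: inj_image_mem_iff chi_def)
qed

lemma chi_prod: "chi n {..<n} Y = (\<Prod>j<n. sg1 Y j)"
 unfolding chi_def sg1_def by (intro prod.cong) auto

lemma sum_Pow_shift:
 fixes F :: "nat set => 'b::comm_monoid_add"
 assumes "\<epsilon> \<subseteq> {..<n}"
 shows "(\<Sum>Y\<in>PP n. F (sym_diff Y \<epsilon>)) = (\<Sum>Y\<in>PP n. F Y)"
proof (rule sum.reindex_bij_witness[where i = "%Z. sym_diff Z \<epsilon>" and j = "%Z. sym_diff Z \<epsilon>"])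
 fix Z assume g: "Z : PP n"
 have e: "sym_diff (sym_diff Z \<epsilon>) \<epsilon> = Z" by auto
 show "sym_diff (sym_diff Z \<epsilon>) \<epsilon> = Z" "sym_diff (sym_diff Z \<epsilon>) \<epsilon> = Z" by (fact e)+
 show "sym_diff Z \<epsilon> : PP n" "sym_diff Z \<epsilon> : PP n" using g assms by auto
 show "F (sym_diff Z \<epsilon>) = F (sym_diff Z \<epsilon>)" ..
qed

lemma sum_Pow_image:
 fixes F :: "nat set => 'b::comm_monoid_add"
 assumes "\<pi> permutes {..<n}"
 shows "(\<Sum>Y\<in>PP n. F (\<pi> ` Y)) = (\<Sum>Y\<in>PP n. F Y)"
proof -
 have "bij_betw (image \<pi>) (PP n) (PP n)"
  using permutes_imp_bij[OF assms] by (rule bij_betw_Pow)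
 then show ?thesis by (rule sum.reindex_bij_betw)
qed

lemma keys_lin_diagonal:
 assumes "\<And>w. w : keys f ==> \<exists>a. \<phi> w = single w a"
 shows "keys (lin \<phi> f) \<subseteq> keys f"
proof -
 have "keys (lin \<phi> f) \<subseteq> (\<Union>w\<in>keys f. keys (smul (lookup f w) (\<phi> w)))"
  unfolding lin_def by (rule Poly_Mapping.keys_sum)
 also have "\<dots> \<subseteq> keys f"
 proof (intro UN_least)
  fix w assume w: "w : keys f"
  with assms obtain a where "\<phi> w = single w a" by blast
  then show "keys (smul (lookup f w) (\<phi> w)) \<subseteq> keys f" using w by auto
 qed
 finally show ?thesis .
qed

lemma P_tact: "P n L (tact n Z f) = tact n Z (P n L f)"
proof -
 have "sym_diff Y Z = sym_diff Z Y" for Y by auto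
 then show ?thesis unfolding P_def tact_smul tact_sum tact_tact by simp
qed

lemma tact_star: "tact n Z (star n f g) = star n (tact n Z f) (tact n Z g)"
 unfolding star_def P_tact by (simp only: tact_sum tact_smul tact_mult)

text \<open>Rewriting of words of length two by the multiplication of the group. It replaces congruences modulo the
 ideal by equations between linear maps; \<open>c3\<close> does the same for moving group elements past \<open>v i\<close>.\<close>

definition c2 :: "falg => falg" where
 "c2 = lin (%w. case w of [Gr a, Gr b] => single [Gr (a * b)] 1 | _ => 0)"

context cher
begin

definition c3 :: "(nat => gen) => nat => falg => falg" where
 "c3 v i = lin (%w. case w of [Gr g, _] => single [v (pm n g i), Gr g] (cv v (dm n g i)) | _ => 0)"

text \<open>The group \<open>G(m,1,n)\<close>, which contains both groups.\<close>

definition GG :: "complex mat set" where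
 "GG = {g. \<exists>\<pi> d. \<pi> permutes {..<n} & (\<forall>j<n. d j : Um) & g = mm n \<pi> d}"

lemma GGI: "\<pi> permutes {..<n} ==> (\<And>j. j < n ==> d j : Um) ==> mm n \<pi> d : GG"
 unfolding GG_def by blast

lemma Gamma_GG: "sgn1 q ==> g : CG q ==> g : GG"
 unfolding GG_def using Gamma_iff by blast

lemma GGD:
 assumes "g : GG"
 shows "pm n g permutes {..<n}" "\<And>j. j < n ==> dm n g j : Um" "g = mm n (pm n g) (dm n g)"
  "g : carrier_mat n n" "\<And>j. j < n ==> dm n g j ~= 0"
proof -
 obtain \<pi> d where pd: "\<pi> permutes {..<n}" "\<forall>j<n. d j : Um" "g = mm n \<pi> d"
  using assms unfolding GG_def by blast
 have nz: "\<forall>j<n. d j ~= 0" using pd(2) root_nonzero by auto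
 have pmg: "pm n g = \<pi>" using pd(3) pm_mm[OF pd(1) nz] by simp
 have dmg: "\<And>j. j < n ==> dm n g j = d j" using pd(3) dm_mm[OF pd(1) nz] by simp
 show "pm n g permutes {..<n}" unfolding pmg by (rule pd(1))
 show "\<And>j. j < n ==> dm n g j : Um" "\<And>j. j < n ==> dm n g j ~= 0" using dmg pd(2) nz by auto
 show "g : carrier_mat n n" using pd(3) by simp
 have "g = mm n \<pi> d" by (rule pd(3))
 also have "\<dots> = mm n (pm n g) (dm n g)" unfolding pmg using dmg by (intro mm_cong) auto
 finally show "g = mm n (pm n g) (dm n g)" .
qed

lemma tm_sg1: "tm n Z = mm n id (sg1 Z)"
 by (simp add: tm_def sg1_def[abs_def])

lemma sg1_root: "sg1 Z i : Um"
 using minus_1_root by (simp add: sg1_def)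

lemma GG_tm:
 assumes g: "g : GG"
 shows "g * tm n Y = mm n (pm n g) (%j. dm n g j * sg1 Y j)" "g * tm n Y : GG" "pm n (g * tm n Y) = pm n g"
  "j < n ==> dm n (g * tm n Y) j = dm n g j * sg1 Y j"
proof -
 note G = GGD[OF g]
 have "g * tm n Y = mm n (pm n g) (dm n g) * tm n Y" using G(3) by metis
 also have "\<dots> = mm n (pm n g) (%j. dm n g j * sg1 Y j)"
  unfolding tm_sg1 by (simp add: mm_mult[OF permutes_id])
 finally show eq: "g * tm n Y = mm n (pm n g) (%j. dm n g j * sg1 Y j)" .
 have r: "dm n g j * sg1 Y j : Um" if "j < n" for j using G(2)[OF that] sg1_root by (rule unity_roots_mult)
 show "g * tm n Y : GG" unfolding eq by (rule GGI[OF G(1) r])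
 have nz: "\<forall>j<n. dm n g j * sg1 Y j ~= 0" using r root_nonzero by blast
 show "pm n (g * tm n Y) = pm n g" unfolding eq by (rule pm_mm[OF G(1) nz])
 show "j < n ==> dm n (g * tm n Y) j = dm n g j * sg1 Y j" unfolding eq by (rule dm_mm[OF G(1) nz])
qed

lemma tm_comm:
 assumes g: "g : GG"
 shows "tm n (pm n g ` Y) * g = g * tm n Y"
proof -
 note G = GGD[OF g]
 have inj: "inj (pm n g)" using G(1) permutes_inj by blast
 have "tm n (pm n g ` Y) * g = tm n (pm n g ` Y) * mm n (pm n g) (dm n g)" using G(3) by metis
 also have "\<dots> = mm n (pm n g) (%j. dm n g j * sg1 Y j)"
  unfolding tm_sg1 mm_mult[OF G(1)] using inj by (intro mm_cong) (auto simp: sg1_def inj_image_mem_iff)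
 also have "\<dots> = g * tm n Y" by (rule GG_tm(1)[OF g, symmetric])
 finally show ?thesis .
qed

lemma GG_tm_tm: "g : GG ==> g * tm n Z * tm n Y = g * tm n (sym_diff Z Y)"
 using GGD(4)[of g] by (simp add: assoc_mult_mat[of _ n n _ n _ n] tm_mult)

lemma GG_conj:
 assumes g: "g : GG"
 shows "tm n (pm n g ` Y) * g * tm n (pm n g ` Y) = g * tm n (sym_diff Y (pm n g ` Y))"
 unfolding tm_comm[OF g] GG_tm_tm[OF g] ..

text \<open>The elements \<open>g e\<^sub>Z\<close>, where \<open>e\<^sub>Z\<close> is the idempotent of \<open>kT\<close> belonging to the character \<open>Z\<close>.\<close>

definition E :: "complex mat => nat set => falg" where
 "E g Z = (\<Sum>Y\<in>PP n. single [Gr (g * tm n Y)] (chi n Z Y / 2 ^ n))"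

definition theta :: "complex mat => falg" where
 "theta g = (\<Sum>Z\<in>PP n. smul (coc n (pm n g) Z) (E g Z))"

abbreviation dw :: "complex mat => nat set => nat set" where "dw g Z \<equiv> sym_diff (pm n g ` Z) Z"

lemma dw_subset: "g : GG ==> Z \<subseteq> {..<n} ==> dw g Z \<subseteq> {..<n}" "g : GG ==> Z \<subseteq> {..<n} ==> pm n g ` Z \<subseteq> {..<n}"
 using permutes_in_image[OF GGD(1), of g] by auto

lemma E_tm:
 assumes g: "g : GG" and e: "\<epsilon> \<subseteq> {..<n}"
 shows "E (g * tm n \<epsilon>) Z = smul (chi n Z \<epsilon>) (E g Z)"
proof -
 have "E (g * tm n \<epsilon>) Z = (\<Sum>Y\<in>PP n. single [Gr (g * tm n (sym_diff Y \<epsilon>))] (chi n Z (sym_diff (sym_diff Y \<epsilon>) \<epsilon>) / 2 ^ n))"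
  unfolding E_def GG_tm_tm[OF g]
 proof (intro sum.cong refl)
  fix Y
  have "sym_diff \<epsilon> Y = sym_diff Y \<epsilon>" "sym_diff (sym_diff Y \<epsilon>) \<epsilon> = Y" by auto
  then show "single [Gr (g * tm n (sym_diff \<epsilon> Y))] (chi n Z Y / 2 ^ n) =
    single [Gr (g * tm n (sym_diff Y \<epsilon>))] (chi n Z (sym_diff (sym_diff Y \<epsilon>) \<epsilon>) / 2 ^ n)" by simp
 qed
 also have "\<dots> = (\<Sum>Y\<in>PP n. single [Gr (g * tm n Y)] (chi n Z (sym_diff Y \<epsilon>) / 2 ^ n))"
  by (rule sum_Pow_shift[OF e])
 also have "\<dots> = smul (chi n Z \<epsilon>) (E g Z)"
  unfolding chi_sym_diff by (simp add: E_def smul_sum mult.commute)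
 finally show ?thesis .
qed

lemma tact_E:
 assumes g: "g : GG" and Y: "Y \<subseteq> {..<n}" and Z: "Z \<subseteq> {..<n}"
 shows "tact n Y (E g Z) = smul (chi n (dw g Z) Y) (E g Z)"
proof -
 note G = GGD[OF g]
 obtain Y' where d': "Y' \<subseteq> {..<n}" "Y = pm n g ` Y'"
  using permutes_image[OF G(1)] Y by (metis subset_imageE)
 have "tact n Y (E g Z) = E (g * tm n (sym_diff Y' Y)) Z"
  unfolding E_def tact_sum
 proof (intro sum.cong refl)
  fix U
  have "tm n Y * (g * tm n U) * tm n Y = g * tm n U * tm n (sym_diff Y' Y)"
   using GG_conj[OF GG_tm(2)[OF g, of U], of Y'] unfolding GG_tm(3)[OF g] d'(2) by simp
  also have "\<dots> = g * tm n (sym_diff Y' Y) * tm n U"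
  proof -
   have "sym_diff U (sym_diff Y' Y) = sym_diff (sym_diff Y' Y) U" by auto
   then show ?thesis unfolding GG_tm_tm[OF g] by simp
  qed
  finally show "tact n Y (single [Gr (g * tm n U)] (chi n Z U / 2 ^ n))
   = single [Gr (g * tm n (sym_diff Y' Y) * tm n U)] (chi n Z U / 2 ^ n)"
   using GGD(4)[OF GG_tm(2)[OF g]] by (simp add: tact_Gr)
 qed
 also have "\<dots> = smul (chi n Z (sym_diff Y' Y)) (E g Z)"
  by (rule E_tm[OF g]) (use d' Y in auto)
 also have "chi n Z (sym_diff Y' Y) = chi n (dw g Z) Y"
  unfolding chi_sym_diff using chi_image[OF G(1) Z d'(1)] d'(2) by simp
 finally show ?thesis .
qed

lemma wt_E: "g : GG ==> Z \<subseteq> {..<n} ==> wt n (dw g Z) (E g Z)"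
 unfolding wt_def using tact_E by blast

lemma sum_E_coef:
 "(\<Sum>Z\<in>PP n. smul (F Z) (E g Z)) = (\<Sum>Y\<in>PP n. single [Gr (g * tm n Y)] ((\<Sum>Z\<in>PP n. F Z * chi n Z Y) / 2 ^ n))"
proof -
 have "(\<Sum>Z\<in>PP n. smul (F Z) (E g Z)) = (\<Sum>Z\<in>PP n. \<Sum>Y\<in>PP n. single [Gr (g * tm n Y)] (F Z * chi n Z Y / 2 ^ n))"
  by (simp add: E_def smul_sum)
 also have "\<dots> = (\<Sum>Y\<in>PP n. \<Sum>Z\<in>PP n. single [Gr (g * tm n Y)] (F Z * chi n Z Y / 2 ^ n))"
  by (rule sum.swap)
 also have "\<dots> = (\<Sum>Y\<in>PP n. single [Gr (g * tm n Y)] ((\<Sum>Z\<in>PP n. F Z * chi n Z Y) / 2 ^ n))"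
 proof (intro sum.cong refl)
  fix Y
  have "(\<Sum>Z\<in>S. single w (h Z)) = single w (\<Sum>Z\<in>S. h Z)" if "finite S" for S :: "nat set set" and w :: "gen list" and h :: "nat set => complex"
   using that by (induction S rule: finite_induct) (simp_all add: single_add)
  then show "(\<Sum>Z\<in>PP n. single [Gr (g * tm n Y)] (F Z * chi n Z Y / 2 ^ n))
   = single [Gr (g * tm n Y)] ((\<Sum>Z\<in>PP n. F Z * chi n Z Y) / 2 ^ n)"
   by (simp add: sum_divide_distrib)
 qed
 finally show ?thesis .
qed

lemma sum_chi_E:
 assumes "g : GG" "\<epsilon> \<subseteq> {..<n}"
 shows "(\<Sum>Z\<in>PP n. smul (chi n \<epsilon> Z) (E g Z)) = single [Gr (g * tm n \<epsilon>)] 1"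
proof -
 have "(\<Sum>Z\<in>PP n. chi n \<epsilon> Z * chi n Z Y) = (if Y = \<epsilon> then 2 ^ n else 0)" if "Y : PP n" for Y
  using chi_orthogonal2[of \<epsilon> n Y] that assms by (auto simp: chi_commute[of n _ Y])
 then have "(\<Sum>Z\<in>PP n. smul (chi n \<epsilon> Z) (E g Z)) = (\<Sum>Y\<in>PP n. if Y = \<epsilon> then single [Gr (g * tm n \<epsilon>)] 1 else 0)"
  unfolding sum_E_coef by (intro sum.cong) auto
 also have "\<dots> = single [Gr (g * tm n \<epsilon>)] 1" using assms by (subst sum.delta) auto
 finally show ?thesis .
qed

lemma sum_E: "g : GG ==> (\<Sum>Z\<in>PP n. E g Z) = single [Gr g] 1"
 using sum_chi_E[of g "{}"] GGD(4)[of g] by (simp add: tm_empty)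

lemma c2_E:
 assumes g: "g : GG" and h: "h : GG" and Z: "Z \<subseteq> {..<n}" and U: "U \<subseteq> {..<n}"
 shows "c2 (E g Z * E h U) = (if Z = pm n h ` U then E (g * h) U else 0)"
proof -
 note H = GGD[OF h]
 have mat: "g * tm n (pm n h ` Y) * (h * tm n Y') = g * h * tm n (sym_diff Y Y')" for Y Y'
 proof -
  have "g * tm n (pm n h ` Y) * (h * tm n Y') = g * (tm n (pm n h ` Y) * h) * tm n Y'"
   using GGD(4)[OF g] H(4) by (simp add: assoc_mult_mat[of _ n n _ n _ n] mult_carrier_mat[of _ n n _ n])
  also have "\<dots> = g * h * (tm n Y * tm n Y')"
   unfolding tm_comm[OF h] using GGD(4)[OF g] H(4) by (simp add: assoc_mult_mat[of _ n n _ n _ n] mult_carrier_mat[of _ n n _ n])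
  finally show ?thesis unfolding tm_mult .
 qed
 have c2s: "c2 (sum F I) = (\<Sum>i\<in>I. c2 (F i))" for F :: "nat set => falg" and I by (simp add: c2_def lin_sum)
 have "c2 (E g Z * E h U) = (\<Sum>Y\<in>PP n. \<Sum>Y'\<in>PP n. single [Gr (g * tm n Y * (h * tm n Y'))] (chi n Z Y / 2 ^ n * (chi n U Y' / 2 ^ n)))"
  unfolding E_def sum_product c2s by (simp add: c2_def)
 also have "\<dots> = (\<Sum>Y\<in>PP n. \<Sum>Y'\<in>PP n. single [Gr (g * tm n (pm n h ` Y) * (h * tm n Y'))] (chi n Z (pm n h ` Y) / 2 ^ n * (chi n U Y' / 2 ^ n)))"
  by (rule sum_Pow_image[OF H(1), symmetric])
 also have "\<dots> = (\<Sum>Y\<in>PP n. \<Sum>Y'\<in>PP n. single [Gr (g * h * tm n (sym_diff Y' Y))] (chi n Z (pm n h ` Y) / 2 ^ n * (chi n U (sym_diff (sym_diff Y' Y) Y) / 2 ^ n)))"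
 proof (intro sum.cong refl)
  fix Y Y' :: "nat set"
  have "sym_diff Y Y' = sym_diff Y' Y" "sym_diff (sym_diff Y' Y) Y = Y'" by auto
  then show "single [Gr (g * tm n (pm n h ` Y) * (h * tm n Y'))] (chi n Z (pm n h ` Y) / 2 ^ n * (chi n U Y' / 2 ^ n))
   = single [Gr (g * h * tm n (sym_diff Y' Y))] (chi n Z (pm n h ` Y) / 2 ^ n * (chi n U (sym_diff (sym_diff Y' Y) Y) / 2 ^ n))"
   unfolding mat by simp
 qed
 also have "\<dots> = (\<Sum>Y\<in>PP n. \<Sum>Y'\<in>PP n. single [Gr (g * h * tm n Y')] (chi n Z (pm n h ` Y) / 2 ^ n * (chi n U (sym_diff Y' Y) / 2 ^ n)))"
  by (intro sum.cong refl sum_Pow_shift) auto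
 also have "\<dots> = (\<Sum>Y\<in>PP n. smul (chi n Z (pm n h ` Y) * chi n U Y / 2 ^ n) (E (g * h) U))"
  unfolding E_def smul_sum chi_sym_diff by (intro sum.cong refl) (simp add: mult_ac)
 also have "\<dots> = (\<Sum>Y\<in>PP n. smul (chi n Z (pm n h ` Y) * chi n (pm n h ` U) (pm n h ` Y) / 2 ^ n) (E (g * h) U))"
  by (intro sum.cong refl) (simp add: chi_image[OF H(1) U])
 also have "\<dots> = (\<Sum>Y\<in>PP n. smul (chi n Z Y * chi n (pm n h ` U) Y / 2 ^ n) (E (g * h) U))"
  by (rule sum_Pow_image[OF H(1)])
 also have "\<dots> = smul ((\<Sum>Y\<in>PP n. chi n Z Y * chi n (pm n h ` U) Y) / 2 ^ n) (E (g * h) U)"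
  by (simp add: smul_sum_left sum_divide_distrib)
 also have "\<dots> = (if Z = pm n h ` U then E (g * h) U else 0)"
  unfolding chi_orthogonal2[OF Z dw_subset(2)[OF h U]] by simp
 finally show ?thesis .
qed

text \<open>Modulo the relations of the group algebra, \<^const>\<open>theta\<close> turns the product of the group into the twisted product.\<close>

lemma c2_theta:
 assumes g: "g : GG" and h: "h : GG" and pgh: "pm n (g * h) = pm n g \<circ> pm n h"
 shows "c2 (star n (theta g) (theta h)) = theta (g * h)"
proof -
 note H = GGD[OF h] and G = GGD[OF g]
 have c2s: "c2 (sum F I) = (\<Sum>i\<in>I. c2 (F i))" "c2 (smul a x) = smul a (c2 x)" for F :: "nat set => falg" and I a x
  by (simp_all add: c2_def lin_sum lin_smul)
 have "star n (theta g) (theta h) = (\<Sum>U\<in>PP n. \<Sum>Z\<in>PP n. smul (coc n (pm n h) U) (smul (coc n (pm n g) Z) (smul (bs n (dw g Z) (dw h U)) (E g Z * E h U))))"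
  unfolding theta_def star_sum_left star_sum_right star_smul_left star_smul_right
  by (intro sum.cong refl) (simp add: smul_sum star_wt[OF wt_E[OF g] wt_E[OF h] dw_subset(1)[OF g] dw_subset(1)[OF h]] mult_ac)
 then have "c2 (star n (theta g) (theta h)) = (\<Sum>U\<in>PP n. \<Sum>Z\<in>PP n.
   smul (coc n (pm n h) U * (coc n (pm n g) Z * bs n (dw g Z) (dw h U))) (c2 (E g Z * E h U)))"
  by (simp only: c2s smul_simps)
 also have "\<dots> = (\<Sum>U\<in>PP n. \<Sum>Z\<in>PP n. if Z = pm n h ` U
  then smul (coc n (pm n h) U * (coc n (pm n g) Z * bs n (dw g Z) (dw h U))) (E (g * h) U) else 0)"
 proof (intro sum.cong refl)
  fix U Z assume e: "U : PP n" "Z : PP n"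
  show "smul (coc n (pm n h) U * (coc n (pm n g) Z * bs n (dw g Z) (dw h U))) (c2 (E g Z * E h U))
   = (if Z = pm n h ` U then smul (coc n (pm n h) U * (coc n (pm n g) Z * bs n (dw g Z) (dw h U))) (E (g * h) U) else 0)"
   unfolding c2_E[OF g h PowD[OF e(2)] PowD[OF e(1)]] by (cases "Z = pm n h ` U") simp_all
 qed
 also have "\<dots> = (\<Sum>U\<in>PP n. smul (coc n (pm n h) U * (coc n (pm n g) (pm n h ` U) * bs n (dw g (pm n h ` U)) (dw h U))) (E (g * h) U))"
 proof (intro sum.cong refl)
  fix U assume "U : PP n"
  then have mem: "pm n h ` U : PP n" using dw_subset(2)[OF h] by auto
  show "(\<Sum>Z\<in>PP n. if Z = pm n h ` U
    then smul (coc n (pm n h) U * (coc n (pm n g) Z * bs n (dw g Z) (dw h U))) (E (g * h) U) else 0)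
   = smul (coc n (pm n h) U * (coc n (pm n g) (pm n h ` U) * bs n (dw g (pm n h ` U)) (dw h U))) (E (g * h) U)"
   by (subst sum.delta) (simp_all only: mem if_True finite_Pow_iff finite_lessThan)
 qed
 also have "\<dots> = theta (g * h)"
  unfolding theta_def pgh
 proof (intro sum.cong refl)
  fix U assume e: "U : PP n"
  show "smul (coc n (pm n h) U * (coc n (pm n g) (pm n h ` U) * bs n (dw g (pm n h ` U)) (dw h U))) (E (g * h) U)
   = smul (coc n (pm n g \<circ> pm n h) U) (E (g * h) U)"
   unfolding coc_comp[OF G(1) H(1) PowD[OF e]] by (simp only: mult_ac)
 qed
 finally show ?thesis .
qed

lemma theta_one: "theta (1\<^sub>m n) = single [Gr (1\<^sub>m n)] 1"
proof -
 have g: "1\<^sub>m n : GG" unfolding mm_one by (rule GGI[OF permutes_id]) simp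
 have "pm n (1\<^sub>m n) = id" unfolding mm_one by (rule pm_mm[OF permutes_id]) simp
 then show ?thesis unfolding theta_def using sum_E[OF g] by simp
qed

lemma theta_id:
 assumes g: "g : GG" "pm n g = id"
 shows "theta g = single [Gr g] 1"
 unfolding theta_def g(2) using sum_E[OF g(1)] by simp

text \<open>The coefficients of \<open>theta\<close> form a character of \<open>T\<close>, so that the sum over the idempotents collapses to the
 product with one \<open>t\<^sub>j\<close>, which turns \<open>s\<close> into \<open>\<sigma>\<close> and conversely.\<close>

lemma theta_refl:
 assumes q: "sgn1 q" and il: "i < n" "l < n" "i ~= l" "\<epsilon> : Um"
 shows "theta (refl_mat q n i l \<epsilon>) = single [Gr (refl_mat (-q) n i l (if l < i then \<epsilon> else - \<epsilon>))] 1"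
proof -
 let ?g = "refl_mat q n i l \<epsilon>"
 let ?j = "min i l"
 note rg = refl_mat_Gamma[OF assms]
 have g: "?g : GG" using Gamma_GG[OF q rg(2)] .
 have perm: "transpose i l permutes {..<n}" using il by (intro permutes_swap_id) auto
 have nz: "\<forall>k<n. (if k = i then inverse \<epsilon> else if k = l then q * \<epsilon> else 1) ~= 0" using q root_nonzero[OF il(4)] by auto
 have pm: "pm n ?g = transpose i l" unfolding rg(1) by (rule pm_mm[OF perm nz])
 have dm: "dm n ?g k = (if k = i then inverse \<epsilon> else if k = l then q * \<epsilon> else 1)" if "k < n" for k
  unfolding rg(1) by (rule dm_mm[OF perm nz that])
 have "coc n (transpose i l) Z = chi n {?j} Z" if "Z : PP n" for Z
 proof (cases "l < i")
  case True
  then show ?thesis using coc_transpose[of l i n Z] il that by (simp add: min_def)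
 next
  case False
  then have "i < l" using il by simp
  then show ?thesis using coc_transpose[of i l n Z] il that by (simp add: min_def transpose_commute)
 qed
 then have "theta ?g = (\<Sum>Z\<in>PP n. smul (chi n {?j} Z) (E ?g Z))"
  unfolding theta_def pm by (intro sum.cong) auto
 also have "\<dots> = single [Gr (?g * tm n {?j})] 1" by (rule sum_chi_E[OF g]) (use il in auto)
 also have "?g * tm n {?j} = refl_mat (-q) n i l (if l < i then \<epsilon> else - \<epsilon>)"
 proof -
  have q': "sgn1 (- q)" using q by auto
  have e: "(if l < i then \<epsilon> else - \<epsilon>) : Um" using il uminus_root by auto
  show ?thesis
   unfolding GG_tm(1)[OF g] pm refl_mat_Gamma(1)[OF q' il(1-3) e]
   using il by (intro mm_cong) (auto simp: dm sg1_def min_def)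
 qed
 finally show ?thesis .
qed

lemma theta_FA:
 assumes q: "sgn1 q" and g: "g : CG q"
 shows "theta g : FA K (Gr ` CG (- q))"
proof -
 note G = GammaD[OF q g] and gG = Gamma_GG[OF q g]
 have q': "sgn1 (- q)" using q by auto
 have "single [Gr (g * tm n Y)] ((\<Sum>Z\<in>PP n. coc n (pm n g) Z * chi n Z Y) / 2 ^ n) : FA K (Gr ` CG (- q))"
  if Y: "Y : PP n" for Y
 proof (cases "of_int (sign (pm n g)) * (\<Prod>j<n. sg1 Y j) = 1")
  case True
  have "sgq (- q) (pm n g) = sgq q (pm n g) * of_int (sign (pm n g))"
   using q by (auto simp: sgq_def sign_def)
  then have "sgq (- q) (pm n g) * (\<Prod>j<n. dm n g j * sg1 Y j)
   = (sgq q (pm n g) * (\<Prod>j<n. dm n g j)) * (of_int (sign (pm n g)) * (\<Prod>j<n. sg1 Y j))"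
   by (simp add: prod.distrib mult_ac)
  then have "sgq (- q) (pm n g) * (\<Prod>j<n. dm n g j * sg1 Y j) : Up"
   unfolding True using G(3) by simp
  then have "g * tm n Y : CG (- q)"
   unfolding GG_tm(1)[OF gG] by (intro Gamma_mm[OF q' G(1)] unity_roots_mult[OF G(2) sg1_root])
  moreover have "(\<Sum>Z\<in>PP n. coc n (pm n g) Z * chi n Z Y) / 2 ^ n : K"
  proof -
   have "coc n (pm n g) Z : K" for Z using coc_square[of n "pm n g" Z] by (metis K_1 minus_1_K square_eq_1_iff)
   then show ?thesis by (intro K_divide K_sum K_mult K_power chi_K K_numeral) 
  qed
  ultimately show ?thesis by (intro FM_single) auto
 next
  case False
  let ?S = "\<Sum>Z\<in>PP n. coc n (pm n g) Z * chi n Z Y"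
  let ?s = "of_int (sign (pm n g)) * (\<Prod>j<n. sg1 Y j) :: complex"
  have "?s * ?s = 1" using chi_square[of n "{..<n}" Y] by (simp add: chi_prod sign_def)
  then have s: "?s = -1" using False by (metis square_eq_1_iff)
  have "?S = (\<Sum>Z\<in>PP n. coc n (pm n g) (sym_diff Z {..<n}) * chi n (sym_diff Z {..<n}) Y)"
   by (rule sum_Pow_shift[symmetric, where F = "%Z. coc n (pm n g) Z * chi n Z Y"]) simp
  also have "\<dots> = (\<Sum>Z\<in>PP n. ?s * (coc n (pm n g) Z * chi n Z Y))"
  proof (intro sum.cong refl)
   fix Z assume Z: "Z : PP n"
   then have "sym_diff Z {..<n} = {..<n} - Z" by auto
   then have "coc n (pm n g) (sym_diff Z {..<n}) = of_int (sign (pm n g)) * coc n (pm n g) Z"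
    using coc_complement[OF G(1)] Z by simp
   then show "coc n (pm n g) (sym_diff Z {..<n}) * chi n (sym_diff Z {..<n}) Y = ?s * (coc n (pm n g) Z * chi n Z Y)"
    unfolding chi_sym_diff chi_prod by (simp only: mult_ac)
  qed
  also have "\<dots> = - ?S" unfolding s by (simp add: sum_negf)
  finally have "?S = 0" by simp
  then show ?thesis by simp
 qed
 then show ?thesis unfolding theta_def sum_E_coef by (rule FM_sum)
qed

lemma tact_theta:
 assumes g: "g : GG" and Y: "Y \<subseteq> {..<n}"
 shows "tact n Y (theta g) = theta (tm n Y * g * tm n Y)"
proof -
 note G = GGD[OF g]
 obtain Y' where d': "Y' \<subseteq> {..<n}" "Y = pm n g ` Y'"
  using permutes_image[OF G(1)] Y by (metis subset_imageE)
 have sd: "sym_diff Y' Y \<subseteq> {..<n}" using d' Y by auto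
 have c: "tm n Y * g * tm n Y = g * tm n (sym_diff Y' Y)" using GG_conj[OF g, of Y'] d' by simp
 have "chi n (dw g Z) Y = chi n Z (sym_diff Y' Y)" if "Z : PP n" for Z
  unfolding chi_sym_diff using chi_image[OF G(1) _ d'(1), of Z] that d'(2) by simp
 then show ?thesis
  unfolding c theta_def GG_tm(3)[OF g] tact_sum tact_smul E_tm[OF g sd]
  by (intro sum.cong refl) (simp add: tact_E[OF g Y])
qed

end

section \<open>The isomorphism with the braided algebra\<close>

lemma sign_subset:
 assumes "\<pi> permutes {..<n}"
 obtains Y where "Y \<subseteq> {..<n::nat}" "(\<Prod>j<n. sg1 Y j) = of_int (sign \<pi>)"
proof (cases "sign \<pi> = 1")
 case True
 show ?thesis by (rule that[of "{}"]) (simp_all add: True)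
next
 case False
 then have s: "sign \<pi> = -1" by (simp add: sign_def split: if_splits)
 have "n ~= 0"
 proof
  assume "n = 0"
  then have "\<pi> = id" using assms by simp
  then show False using False by simp
 qed
 then have "(\<Prod>j<n. sg1 {0} j) = -1" by (simp add: chi_prod[symmetric] chi_commute[of n _ "{0}"] chi_singleton)
 then show ?thesis using \<open>n ~= 0\<close> by (intro that[of "{0}"]) (simp_all add: s)
qed

context cher
begin

definition psi :: "gen => falg" where
 "psi a = (case a of Gr g => theta g | _ => single [a] 1)"

text \<open>The homomorphism from the free algebra to the free algebra with the twisted product.\<close>

definition Psi :: "falg => falg" where
 "Psi = lin (%w. foldr (%a u. star n (psi a) u) w 1)"

lemma Psi_add: "Psi (f + g) = Psi f + Psi g"
 and Psi_diff: "Psi (f - g) = Psi f - Psi g"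
 and Psi_smul: "Psi (smul a f) = smul a (Psi f)"
 and Psi_sum: "Psi (\<Sum>i\<in>I. h i) = (\<Sum>i\<in>I. Psi (h i))"
 and Psi_0 [simp]: "Psi 0 = 0"
 by (simp_all add: Psi_def lin_simps)

lemma Psi_gen: "Psi (single [a] b) = smul b (psi a)"
 by (simp add: Psi_def)

lemma Psi_one [simp]: "Psi 1 = 1"
proof -
 have "Psi (single [] 1) = 1" by (simp add: Psi_def)
 then show ?thesis unfolding single_Nil_one .
qed

lemma Psi_mult: "Psi (f * g) = star n (Psi f) (Psi g)"
proof -
 let ?\<phi> = "%w. foldr (%a u. star n (psi a) u) w 1"
 have app: "?\<phi> (u @ v) = star n (?\<phi> u) (?\<phi> v)" for u v
  by (induction u) (simp_all add: star_assoc)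
 have "star n (lin ?\<phi> f) (lin ?\<phi> g) = lin (%u. lin (%v. star n (?\<phi> u) (?\<phi> v)) g) f"
  by (simp only: star_lin_left) (simp only: star_lin_right)
 then show ?thesis
  unfolding mult_lin[of f g] Psi_def lin_lin lin_single app by simp
qed

lemma psi_FA: "sgn1 q ==> a : Hg q ==> psi a : FH (- q)"
proof (cases a)
 case (Gr g)
 assume "sgn1 q" "a : Hg q"
 then have "theta g : FH (- q)" using Gr by (intro FA_Gr_Hg theta_FA) (auto simp: H_gens_def)
 then show ?thesis by (simp add: psi_def Gr)
qed (auto simp: psi_def H_gens_def intro!: FM_single)

lemma Psi_FA:
 assumes q: "sgn1 q" and f: "f : FH q"
 shows "Psi f : FH (- q)"
proof -
 have q': "sgn1 (- q)" using q by auto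
 have "foldr (%a u. star n (psi a) u) w 1 : FH (- q)" if "w : lists (Hg q)" for w
  using that by (induction w) (auto intro!: star_FA[OF q'] psi_FA[OF q])
 then show ?thesis unfolding Psi_def using f by (intro FM_lin[where S = "lists (Hg q)"])
qed

lemma tact_Psi:
 assumes q: "sgn1 q" and Z: "Z \<subseteq> {..<n}" and f: "f : FH q"
 shows "tact n Z (Psi f) = Psi (tact n Z f)"
proof -
 have gen: "tact n Z (psi a) = Psi (tg n Z a)" if a: "a : Hg q" for a
 proof (cases a)
  case (Gr g)
  then have g: "g : CG q" using a by (auto simp: H_gens_def)
  show ?thesis using tact_theta[OF Gamma_GG[OF q g] Z] GammaD(7)[OF q g] by (simp add: Gr psi_def tg_def Psi_gen)
 qed (simp_all add: psi_def tg_def Psi_gen tact_gen)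
 have word: "tact n Z (Psi (single w 1)) = Psi (tact n Z (single w 1))" if "w : lists (Hg q)" for w
  using that
 proof (induction w)
  case Nil
  then show ?case by (simp add: single_Nil_one)
 next
  case (Cons a w)
  have "single (a # w) (1::complex) = single [a] 1 * single w 1" by simp
  then have "tact n Z (Psi (single (a # w) 1)) = star n (tact n Z (psi a)) (tact n Z (Psi (single w 1)))"
   by (simp only: Psi_mult tact_star Psi_gen smul_simps)
  also have "\<dots> = Psi (tg n Z a * tact n Z (single w 1))"
   using Cons gen by (simp add: Psi_mult)
  also have "\<dots> = Psi (tact n Z (single (a # w) 1))"
   using tact_mult[of n Z "single [a] 1" "single w 1"] by (simp add: tact_gen)
  finally show ?case .
 qed
 show ?thesis
  using f
 proof (induction rule: FM_induct)
  case (single w a)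
  have "single w a = smul a (single w 1)" by simp
  then show ?case using word[OF single(1)] by (simp only: Psi_smul tact_smul)
 qed (simp_all add: Psi_add tact_add)
qed

lemma P_Psi:
 assumes q: "sgn1 q" and f: "f : FH q"
 shows "P n L (Psi f) = Psi (P n L f)"
 unfolding P_def Psi_smul Psi_sum using tact_Psi[OF q _ f] by simp

text \<open>Since the cocycle is its own inverse, a homomorphism to a twist is also a homomorphism from a twist.\<close>

lemma Psi_star:
 assumes q: "sgn1 q" and f: "f : FH q" and g: "g : FH q"
 shows "Psi (star n f g) = Psi f * Psi g"
proof -
 have "Psi (star n f g) = (\<Sum>L\<in>PP n. \<Sum>N\<in>PP n. smul (bs n L N) (star n (P n L (Psi f)) (P n N (Psi g))))"
  unfolding star_def[of n f g] Psi_sum Psi_smul Psi_mult P_Psi[OF q f] P_Psi[OF q g] ..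
 also have "\<dots> = (\<Sum>L\<in>PP n. \<Sum>N\<in>PP n. P n L (Psi f) * P n N (Psi g))"
  by (intro sum.cong refl) (simp add: star_wt[OF wt_P wt_P])
 also have "\<dots> = Psi f * Psi g"
  unfolding sum_product[symmetric] sum_P ..
 finally show ?thesis .
qed

lemma Psi_theta:
 assumes g: "g : GG"
 shows "Psi (theta g) = single [Gr g] 1"
proof -
 have "Psi (E g U) = smul (coc n (pm n g) U) (E g U)" if U: "U : PP n" for U
 proof -
  have "Psi (E g U) = (\<Sum>Y\<in>PP n. smul (chi n U Y / 2 ^ n) (theta (g * tm n Y)))"
   unfolding E_def Psi_sum Psi_gen by (simp add: psi_def)
  also have "\<dots> = (\<Sum>Y\<in>PP n. \<Sum>Z\<in>PP n. smul (chi n U Y * chi n Z Y / 2 ^ n) (smul (coc n (pm n g) Z) (E g Z)))"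
   unfolding theta_def GG_tm(3)[OF g] smul_sum
   by (intro sum.cong refl) (simp add: E_tm[OF g PowD] mult_ac)
  also have "\<dots> = (\<Sum>Z\<in>PP n. \<Sum>Y\<in>PP n. smul (chi n U Y * chi n Z Y / 2 ^ n) (smul (coc n (pm n g) Z) (E g Z)))"
   by (rule sum.swap)
  also have "\<dots> = (\<Sum>Z\<in>PP n. smul ((\<Sum>Y\<in>PP n. chi n U Y * chi n Z Y) / 2 ^ n) (smul (coc n (pm n g) Z) (E g Z)))"
   by (simp only: smul_sum_left sum_divide_distrib)
  also have "\<dots> = (\<Sum>Z\<in>PP n. if Z = U then smul (coc n (pm n g) Z) (E g Z) else 0)"
  proof (intro sum.cong refl)
   fix Z assume "Z : PP n"
   then show "smul ((\<Sum>Y\<in>PP n. chi n U Y * chi n Z Y) / 2 ^ n) (smul (coc n (pm n g) Z) (E g Z))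
    = (if Z = U then smul (coc n (pm n g) Z) (E g Z) else 0)"
    using chi_orthogonal2[OF PowD[OF U], of Z] by auto
  qed
  also have "\<dots> = smul (coc n (pm n g) U) (E g U)" using U by (subst sum.delta) auto
  finally show ?thesis .
 qed
 then have "Psi (theta g) = (\<Sum>Z\<in>PP n. E g Z)"
  unfolding theta_def[of g] Psi_sum Psi_smul by (intro sum.cong refl) (simp add: coc_square)
 then show ?thesis using sum_E[OF g] by simp
qed

text \<open>On a group element the signs \<open>coc\<close> are applied twice, and their squares are \<open>1\<close>.\<close>

lemma Psi_Psi:
 assumes q: "sgn1 q" and f: "f : FH q"
 shows "Psi (Psi f) = f"
proof -
 have q': "sgn1 (- q)" using q by auto
 have gen: "Psi (psi a) = single [a] 1" if a: "a : Hg q" for a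
 proof (cases a)
  case (Gr g)
  then have "g : CG q" using a by (auto simp: H_gens_def)
  then show ?thesis using Psi_theta[OF Gamma_GG[OF q]] by (simp add: Gr psi_def)
 qed (simp_all add: psi_def Psi_gen)
 have word: "Psi (Psi (single w 1)) = single w 1" if "w : lists (Hg q)" for w
  using that
 proof (induction w)
  case Nil
  then show ?case by (simp add: single_Nil_one)
 next
  case (Cons a w)
  have "single (a # w) (1::complex) = single [a] 1 * single w 1" by simp
  then have "Psi (Psi (single (a # w) 1)) = Psi (star n (psi a) (Psi (single w 1)))"
   by (simp only: Psi_mult Psi_gen smul_simps)
  also have "\<dots> = Psi (psi a) * Psi (Psi (single w 1))"
   using Cons by (intro Psi_star[OF q'] psi_FA[OF q] Psi_FA[OF q]) auto
  also have "\<dots> = single (a # w) 1" using Cons gen by simp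
  finally show ?case .
 qed
 show ?thesis
  using f
 proof (induction rule: FM_induct)
  case (single w a)
  have "single w a = smul a (single w 1)" by simp
  then show ?case using word[OF single(1)] by (simp only: Psi_smul)
 qed (simp_all add: Psi_add)
qed

lemma Psi_word:
 assumes v: "XY v" and u: "u : lists {..<n}"
 shows "Psi (single (map v u) a) = single (map v u) (a * eps n u)"
proof -
 have "foldr (%a u. star n (psi a) u) (map v u) 1 = single (map v u) (eps n u)"
  using u
 proof (induction u)
  case (Cons i u)
  have vi: "psi (v i) = single (map v [i]) 1" using v by (auto simp: psi_def)
  have w1: "wt n {i} (single (map v [i]) 1)" using wt_word[OF v, of "[i]" n 1] Cons by simp
  have ps: "par u \<subseteq> {..<n}" using Cons by (intro par_subset) auto
  have "star n (psi (v i)) (single (map v u) (eps n u)) = smul (bs n {i} (par u)) (single (map v [i]) 1 * single (map v u) (eps n u))"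
   unfolding vi by (rule star_wt[OF w1 wt_word[OF v Cons(2)] _ ps]) (use Cons in auto)
  then show ?case using Cons by simp
 qed (simp add: single_Nil_one)
 then show ?thesis by (simp add: Psi_def)
qed

lemma Psi_S_ideal:
 assumes q: "sgn1 q" and v: "XY v" and f: "f : SI q v"
 shows "Psi f : SI (- q) v"
proof -
 have q': "sgn1 (- q)" using q by auto
 show ?thesis
  using f unfolding S_ideal_eq[OF q] S_ideal_eq[OF q'] Psi_def
 proof (rule gspan_image, fold Psi_def)
  fix r assume "r : {single (map v (a @ [i, j] @ b)) 1 - single (map v (a @ [j, i] @ b)) q | a b i j.
  a : lists {..<n} & b : lists {..<n} & i < n & j < n & i ~= j}"
  then obtain a b i j where r: "r = single (map v (a @ [i, j] @ b)) 1 - single (map v (a @ [j, i] @ b)) q"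
   "a : lists {..<n}" "b : lists {..<n}" "i < n" "j < n" "i ~= j" by blast
  have w: "a @ [i, j] @ b : lists {..<n}" "a @ [j, i] @ b : lists {..<n}" using r by auto
  have e: "eps n (a @ [j, i] @ b) = - eps n (a @ [i, j] @ b)" using eps_swap[OF r(6,4,5), of a b] by simp
  have "Psi r = smul (eps n (a @ [i, j] @ b)) (single (map v (a @ [i, j] @ b)) 1 - single (map v (a @ [j, i] @ b)) (- q))"
   unfolding r(1) Psi_diff Psi_word[OF v w(1)] Psi_word[OF v w(2)] e by (simp add: smul_diff mult.commute)
  moreover have "eps n (a @ [i, j] @ b) : K"
   using eps_square[of n "a @ [i, j] @ b"] by (metis K_1 minus_1_K square_eq_1_iff)
  ultimately show "Psi r : gspan K {single (map v (a @ [i, j] @ b)) 1 - single (map v (a @ [j, i] @ b)) (- q) | a b i j.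
  a : lists {..<n} & b : lists {..<n} & i < n & j < n & i ~= j}"
   using r by (auto intro!: gspan_base)
 qed
qed

lemma vact_add: "vact q g (f + h) = vact q g f + vact q g h"
 and vact_diff: "vact q g (f - h) = vact q g f - vact q g h"
 and vact_smul: "vact q g (smul a f) = smul a (vact q g f)"
 and vact_sum: "vact q g (\<Sum>i\<in>I. F i) = (\<Sum>i\<in>I. vact q g (F i))"
 and vact_0 [simp]: "vact q g 0 = 0"
 by (simp_all add: vact_def lin_simps)

lemma S_ideal_smul: "sgn1 q ==> f : SI q v ==> a : K ==> smul a f : SI q v"
 unfolding S_ideal_eq by (rule gspan_smul)

lemma S_ideal_sum: "sgn1 q ==> (\<And>i. i : I ==> F i : SI q v) ==> sum F I : SI q v"
 unfolding S_ideal_eq by (rule gspan_sum)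

lemma P_FA_Sg: "XY v ==> f : FS v ==> P n N f : FS v"
 unfolding P_def by (intro FM_smul FM_sum tact_FA_Sg half_K chi_K)

lemma P_word:
 assumes v: "XY v" and u: "u : lists {..<n}" and N: "N \<subseteq> {..<n}"
 shows "P n N (single (map v u) a) = (if par u = N then single (map v u) a else 0)"
proof -
 have "par u \<subseteq> {..<n}" using u by (intro par_subset) auto
 from P_wt[OF wt_word[OF v u, of a] N this] show ?thesis by (simp only: eq_commute[of N])
qed

lemma vact_P_Inv:
 assumes q: "sgn1 q" and v: "XY v" and f: "f : Inv q v" and g: "g : CG q"
 shows "vact q g (P n N f) - P n N f : SI q v"
proof -
 have "vact q g (P n N f) - P n N f
  = smul (1 / 2 ^ n) (\<Sum>Z\<in>PP n. smul (chi n N Z) (vact q g (tact n Z f) - tact n Z f))"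
  by (simp add: P_def vact_smul vact_sum smul_diff sum_subtractf)
 moreover have "vact q g (tact n Z f) - tact n Z f : SI q v" for Z
  using tact_Inv[OF q v f, of Z] g by (auto simp: Inv_def)
 ultimately show ?thesis by (auto intro!: S_ideal_smul[OF q] S_ideal_sum[OF q] half_K)
qed

lemma vact_tm:
 assumes q: "sgn1 q" and v: "XY v" and t: "tm n Z : CG q" and h: "h : FS v"
 shows "vact q (tm n Z) h = tact n Z h"
 using h
proof (induction rule: FM_induct)
 case (single w a)
 then obtain u where u: "u : lists {..<n}" "w = map v u" using lists_Sg by blast
 have nz: "\<forall>j<n. sg1 Z j ~= 0" by (simp add: sg1_def)
 have dm: "dm n (tm n Z) j = sg1 Z j" if "j < n" for j unfolding tm_sg1 by (rule dm_mm[OF permutes_id nz that])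
 have pm: "pm n (tm n Z) = id" unfolding tm_sg1 by (rule pm_mm[OF permutes_id nz])
 have "cv v (sg1 Z j) = sg1 Z j" for j by (simp add: sg1_def)
 then have "wcoef v (tm n Z) u = sgw Z u" using u(1) by (induction u) (auto simp: sgw_def dm)
 then show ?case unfolding u(2) vact_word[OF q t v u(1)] tact_word[OF v] pm by simp
qed (simp_all add: vact_add tact_add)

lemma tm2_Gamma:
 assumes q: "sgn1 q" and il: "i < n" "l < n" "i ~= l"
 shows "tm n {i, l} : CG q"
proof -
 have "(\<Prod>j<n. sg1 {i, l} j) = (\<Prod>j<n. (if j = i then -1 else 1) * (if j = l then -1 else 1))"
  using il by (intro prod.cong) (auto simp: sg1_def)
 also have "\<dots> = 1" using il by (simp add: prod.distrib)
 finally show ?thesis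
  unfolding tm_sg1 by (intro Gamma_mm[OF q permutes_id sg1_root]) (simp add: sgq_def)
qed

text \<open>On the component of weight \<open>N\<close>, the action of \<open>g\<close> on the twisted side is the action of a translate of \<open>g\<close>
 on the untwisted side, up to a sign.\<close>

lemma vact_Psi_P:
 assumes q: "sgn1 q" and v: "XY v" and g: "g : CG (- q)"
  and h: "g * tm n Y : CG q" and N: "N \<subseteq> {..<n}" and f: "f : FS v"
 shows "vact (- q) g (Psi (P n N f)) = smul (inv_sign n (pm n g) N * chi n N Y) (Psi (vact q (g * tm n Y) (P n N f)))"
 using f
proof (induction rule: FM_induct)
 case (single w a)
 have q': "sgn1 (- q)" using q by auto
 have gG: "g : GG" using Gamma_GG[OF q' g] .
 obtain u where u: "u : lists {..<n}" "w = map v u" using single lists_Sg by blast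
 show ?case
 proof (cases "par u = N")
  case True
  have pu: "map (pm n g) u : lists {..<n}" using u GammaD(6)[OF q' g] by auto
  have wc: "wcoef v (g * tm n Y) u = wcoef v g u * chi n N Y"
  proof -
   have "wcoef v (g * tm n Y) u = wcoef v g u * sgw Y u"
    using u(1)
   proof (induction u)
    case (Cons i u)
    have "cv v (sg1 Y i) = sg1 Y i" by (simp add: sg1_def)
    then show ?case using Cons GG_tm(4)[OF gG, of i Y] by (simp add: sgw_def mult_ac)
   qed (simp add: sgw_def)
   then show ?thesis using sgw_chi[OF u(1)] True by simp
  qed
  have e: "eps n (map (pm n g) u) * eps n u = inv_sign n (pm n g) N"
   using eps_map[OF GammaD(1)[OF q' g], of u] u True by auto
  have "vact (- q) g (Psi (single w a)) = single (map v (map (pm n g) u)) (a * eps n u * wcoef v g u)"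
   unfolding u(2) Psi_word[OF v u(1)] vact_word[OF q' g v u(1)] ..
  moreover have "Psi (vact q (g * tm n Y) (single w a)) = single (map v (map (pm n g) u)) (a * (wcoef v g u * chi n N Y) * eps n (map (pm n g) u))"
   unfolding u(2) vact_word[OF q h v u(1)] GG_tm(3)[OF gG] Psi_word[OF v pu] wc ..
  moreover have "eps n u = inv_sign n (pm n g) N * eps n (map (pm n g) u)"
   unfolding e[symmetric] by (simp add: mult_ac eps_square)
  ultimately show ?thesis
   using P_word[OF v u(1) N, of a] True u(2) by (simp add: mult_ac) (simp flip: mult.assoc)
 next
  case False
  then show ?thesis using P_word[OF v u(1) N, of a] u(2) by simp
 qed
qed (simp_all add: P_add Psi_add vact_add smul_add)

text \<open>Given \<open>g\<close> in one group, \<open>g t\<^sub>Y\<close> lies in the other one if the sign \<open>(-1)\<^bsup>|Y|\<^esup>\<close> is that of the permutation.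
 On the weights \<open>{}\<close> and \<open>{..<n}\<close> the two signs in \<open>vact_Psi_P\<close> cancel for such \<open>Y\<close>, and an invariant has no
 components of other weights.\<close>

lemma Psi_Inv:
 assumes q: "sgn1 q" and v: "XY v" and f: "f : Inv q v"
 shows "Psi f : Inv (- q) v"
proof -
 have q': "sgn1 (- q)" using q by auto
 have fF: "f : FS v" using f Inv_FA by blast
 obtain d where d: "d > 0" "\<forall>w\<in>keys f. length w = d" using f by (auto simp: Inv_def)
 have word: "\<exists>a. foldr (%a u. star n (psi a) u) w 1 = single w a" if w: "w : lists (Sg v)" for w
 proof -
  obtain u where u: "u : lists {..<n}" "w = map v u" using w lists_Sg by blast
  show ?thesis using Psi_word[OF v u(1), of 1] u(2) by (auto simp: Psi_def)
 qed
 have PsiF: "Psi h : FS v" if h: "h : FS v" for h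
  using h
 proof (induction rule: FM_induct)
  case (single w a)
  then obtain u where u: "u : lists {..<n}" "w = map v u" using lists_Sg by blast
  have "eps n u : K" using eps_square[of n u] by (metis K_1 minus_1_K square_eq_1_iff)
  then show ?case unfolding u(2) Psi_word[OF v u(1)] using single u by (auto intro!: FM_single K_mult)
 qed (auto simp: Psi_add)
 have keys: "keys (Psi f) \<subseteq> keys f"
  unfolding Psi_def using word fF by (intro keys_lin_diagonal) (auto simp: FM_def)
 have inv: "vact (- q) g (Psi f) - Psi f : SI (- q) v" if g: "g : CG (- q)" for g
 proof -
  note G = GammaD[OF q' g] and gG = Gamma_GG[OF q' g]
  obtain Y where Y: "Y \<subseteq> {..<n}" "(\<Prod>j<n. sg1 Y j) = of_int (sign (pm n g))" using sign_subset[OF G(1)] .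
  have h: "g * tm n Y : CG q"
  proof -
   have "sgq q (pm n g) * (\<Prod>j<n. dm n g j * sg1 Y j) = sgq (- q) (pm n g) * (\<Prod>j<n. dm n g j)"
    using q by (auto simp: prod.distrib Y(2) sgq_def sign_def)
   then show ?thesis
    unfolding GG_tm(1)[OF gG] using G(3) by (intro Gamma_mm[OF q G(1)] unity_roots_mult[OF G(2) sg1_root]) simp_all
  qed
  have comp: "vact (- q) g (Psi (P n N f)) - Psi (P n N f) : SI (- q) v" if N: "N : PP n" for N
  proof -
   let ?s = "inv_sign n (pm n g) N * chi n N Y"
   have sK: "?s : K" using inv_sign_square[of n "pm n g" N] chi_K by (metis K_1 K_mult minus_1_K square_eq_1_iff)
   have small: "smul (?s - 1) (Psi (P n N f)) : SI (- q) v"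
   proof -
    \<comment> \<open>In the third case \<open>t\<^sub>i t\<^sub>l\<close> acts on the component by \<open>-1\<close>, so the component vanishes.\<close>
    consider "N = {}" | "N = {..<n}" | i l where "i : N" "l \<notin> N" "i < n" "l < n" using N by blast
    then show ?thesis
    proof cases
     case 1
     then show ?thesis using S_ideal_0[OF q'] by simp
    next
     case 2
     have "inv_sign n (pm n g) {..<n} = of_int (sign (pm n g))"
      using coc_full[OF G(1)] permutes_image[OF G(1)] by (simp add: coc_def)
     then have "?s = 1" unfolding 2 chi_prod Y(2) by (simp add: sign_def)
     then show ?thesis using S_ideal_0[OF q'] by simp
    next
     case 3
     let ?t = "tm n {i, l}"
     have il: "i ~= l" using 3 by auto
     have "?t : CG q" by (rule tm2_Gamma[OF q 3(3,4) il])
     then have t: "vact q ?t (P n N f) - P n N f : SI q v" by (rule vact_P_Inv[OF q v f])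
     note vt = vact_tm[OF q v \<open>?t : CG q\<close>]
     have sd: "{i, l} = sym_diff {i} {l}" using il by auto
     have "chi n N {i, l} = -1"
      unfolding sd chi_sym_diff using 3 by (simp add: chi_commute[of n N] chi_singleton)
     then have "vact q ?t (P n N f) = smul (-1) (P n N f)"
      using vt[OF P_FA_Sg[OF v fF]] wt_P[of n N f] 3 by (auto simp: wt_def)
     then have "smul (-2) (P n N f) : SI q v"
      using t smul_diff_left[of "-1" 1 "P n N f"] by simp
     then have "smul (-(1/2)) (smul (-2) (P n N f)) : SI q v"
      by (rule S_ideal_smul[OF q]) (intro K_minus half_K)
     then have "P n N f : SI q v" by simp
     then show ?thesis using Psi_S_ideal[OF q v] sK by (intro S_ideal_smul[OF q']) auto
    qed
   qed
   have "vact (- q) g (Psi (P n N f)) - Psi (P n N f)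
    = smul ?s (Psi (vact q (g * tm n Y) (P n N f) - P n N f)) + smul (?s - 1) (Psi (P n N f))"
    unfolding vact_Psi_P[OF q v g h PowD[OF N] fF] by (simp add: Psi_diff smul_diff smul_diff_left)
   moreover have "smul ?s (Psi (vact q (g * tm n Y) (P n N f) - P n N f)) : SI (- q) v"
    by (rule S_ideal_smul[OF q' Psi_S_ideal[OF q v vact_P_Inv[OF q v f h]] sK])
   ultimately show ?thesis using small by (simp add: S_ideal_add[OF q'])
  qed
  have "vact (- q) g (Psi f) - Psi f = (\<Sum>N\<in>PP n. vact (- q) g (Psi (P n N f)) - Psi (P n N f))"
   unfolding sum_subtractf vact_sum[symmetric] Psi_sum[symmetric] sum_P ..
  then show ?thesis using S_ideal_sum[OF q' comp, of "PP n" "%x. x"] by simp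
 qed
 show ?thesis unfolding Inv_def using PsiF[OF fF] keys d inv by blast
qed

lemma c2_J:
 assumes q: "sgn1 q" and f: "f : FM K {[Gr g, Gr h] | g h. g : CG q & h : CG q}"
 shows "f - c2 f : J q"
 using f
proof (induction rule: FM_induct)
 case (single w a)
 then obtain g h where w: "w = [Gr g, Gr h]" "g : CG q" "h : CG q" by blast
 have "single w a - c2 (single w a) = smul a (single [Gr g, Gr h] 1 - single [Gr (g * h)] 1)"
  by (simp add: w c2_def smul_diff)
 moreover have "single [Gr g, Gr h] 1 - single [Gr (g * h)] 1 : HR q"
  unfolding H_rels_def Gamma_mult_one using w by blast
 ultimately show ?case using single(2) H_relsI(1)[OF q] J_props(6)[OF q] by simp
next
 case (add a b)
 have e: "a + b - c2 (a + b) = (a - c2 a) + (b - c2 b)" by (simp add: c2_def lin_add)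
 show ?case unfolding e by (rule J_props(4)[OF q add(3,4)])
qed (simp add: c2_def J_props(3)[OF q])

lemma c3_J:
 assumes q: "sgn1 q" and v: "XY v" "i < n"
  and f: "f : FM K {[Gr g, v i] | g. g : CG q}"
 shows "f - c3 v i f : J q"
 using f
proof (induction rule: FM_induct)
 case (single w a)
 then obtain g where w: "w = [Gr g, v i]" "g : CG q" by blast
 have "single w a - c3 v i (single w a) = smul a (single [Gr g, v i] 1 - gen_action n (\<Gamma> q) g (v i) * single [Gr g] 1)"
  by (simp add: w c3_def smul_diff gen_action_v[OF q w(2) v])
 moreover have "single [Gr g, v i] 1 - gen_action n (\<Gamma> q) g (v i) * single [Gr g] 1 : HR q"
  unfolding H_rels_def free_algebra_sel using w v by blast
 ultimately show ?case using single(2) H_relsI(1)[OF q] J_props(6)[OF q] by simp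
next
 case (add a b)
 have e: "a + b - c3 v i (a + b) = (a - c3 v i a) + (b - c3 v i b)" by (simp add: c3_def lin_add)
 show ?case unfolding e by (rule J_props(4)[OF q add(3,4)])
qed (simp add: c3_def J_props(3)[OF q])

lemma FM_times:
 assumes "f : FM K S" "g : FM K S'" "\<And>u v. u : S ==> v : S' ==> u @ v : T"
 shows "f * g : FM K T"
 unfolding mult_lin using assms by (intro FM_lin[OF assms(1)] FM_lin[OF assms(2)] FM_single) auto

lemma theta_FM:
 assumes q: "sgn1 q" and g: "g : CG q"
 shows "theta g : FM K {[Gr h] | h. h : CG (- q)}" "P n L (theta g) : FM K {[Gr h] | h. h : CG (- q)}"
proof -
 have q': "sgn1 (- q)" using q by auto
 have "keys (theta g) \<subseteq> {[Gr h] | h. True}"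
 proof -
  have "keys (theta g) \<subseteq> (\<Union>Y\<in>PP n. {[Gr (g * tm n Y)]})"
   unfolding theta_def sum_E_coef
   by (rule order_trans[OF Poly_Mapping.keys_sum]) (auto split: if_splits)
  then show ?thesis by blast
 qed
 then show t: "theta g : FM K {[Gr h] | h. h : CG (- q)}"
  using theta_FA[OF q g] by (fastforce simp: FM_def)
 have "tact n Z f : FM K {[Gr h] | h. h : CG (- q)}" if f: "f : FM K {[Gr h] | h. h : CG (- q)}" for Z f
  using f
 proof (induction rule: FM_induct)
  case (single w a)
  then obtain h where w: "w = [Gr h]" "h : CG (- q)" by blast
  show ?case unfolding w(1) tact_Gr[OF GammaD(7)[OF q' w(2)]] using conj_Gamma(1)[OF q' w(2)] single(2) by (intro FM_single) auto
 qed (auto simp: tact_add)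
 then show "P n L (theta g) : FM K {[Gr h] | h. h : CG (- q)}"
  unfolding P_def using t by (intro FM_smul FM_sum half_K chi_K)
qed

lemma c3_E:
 assumes g: "g : GG" and i: "i < n" and v: "XY v"
 shows "c3 v i (E g Z * single [v i] 1) = smul (cv v (dm n g i)) (single [v (pm n g i)] 1 * E g (sym_diff Z {i}))"
proof -
 have cs: "cv v (sg1 Y i) = sg1 Y i" for Y by (simp add: sg1_def)
 have "c3 v i (E g Z * single [v i] 1) = (\<Sum>Y\<in>PP n. single [v (pm n g i), Gr (g * tm n Y)] (chi n Z Y / 2 ^ n * (cv v (dm n g i) * sg1 Y i)))"
  unfolding E_def sum_distrib_right c3_def lin_sum
  by (intro sum.cong refl) (simp add: GG_tm(3)[OF g] GG_tm(4)[OF g i] cs)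
 also have "\<dots> = smul (cv v (dm n g i)) (single [v (pm n g i)] 1 * E g (sym_diff Z {i}))"
  unfolding E_def sum_distrib_left smul_sum chi_sym_diff
  by (intro sum.cong refl) (simp add: chi_sg1[OF i] mult_ac)
 finally show ?thesis .
qed

text \<open>The step relation of \<^const>\<open>coc\<close> is what makes \<^const>\<open>theta\<close> compatible with the actions on \<open>V\<close> and its dual.\<close>

lemma c3_theta:
 assumes g: "g : GG" and i: "i < n" and v: "XY v"
 shows "c3 v i (star n (theta g) (single [v i] 1)) = smul (cv v (dm n g i)) (star n (single [v (pm n g i)] 1) (theta g))"
proof -
 note G = GGD[OF g]
 have c3s: "c3 v i (sum F I) = (\<Sum>i'\<in>I. c3 v i (F i'))" "c3 v i (smul a x) = smul a (c3 v i x)" for F :: "nat set => falg" and I a x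
  by (simp_all add: c3_def lin_sum lin_smul)
 have pi: "pm n g i < n" using permutes_in_image[OF G(1), of i] i by simp
 have w: "wt n {j} (single [v j] 1)" if "j < n" for j using wt_word[OF v, of "[j]" n 1] that by simp
 have "star n (theta g) (single [v i] 1) = (\<Sum>Z\<in>PP n. smul (coc n (pm n g) Z * bs n (dw g Z) {i}) (E g Z * single [v i] 1))"
  unfolding theta_def star_sum_left star_smul_left
  by (intro sum.cong refl) (subst star_wt[OF wt_E[OF g] w[OF i] dw_subset(1)[OF g]], use i in auto)
 then have "c3 v i (star n (theta g) (single [v i] 1)) = (\<Sum>Z\<in>PP n. smul (coc n (pm n g) Z * bs n (dw g Z) {i})
   (smul (cv v (dm n g i)) (single [v (pm n g i)] 1 * E g (sym_diff Z {i}))))"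
  by (simp only: c3s c3_E[OF g i v])
 also have "\<dots> = (\<Sum>Z\<in>PP n. smul (coc n (pm n g) (sym_diff Z {i}) * bs n (dw g (sym_diff Z {i})) {i})
   (smul (cv v (dm n g i)) (single [v (pm n g i)] 1 * E g (sym_diff (sym_diff Z {i}) {i}))))"
  by (rule sum_Pow_shift[symmetric]) (use i in auto)
 also have "\<dots> = (\<Sum>Z\<in>PP n. smul (cv v (dm n g i)) (smul (coc n (pm n g) Z) (smul (bs n {pm n g i} (dw g Z)) (single [v (pm n g i)] 1 * E g Z))))"
 proof (intro sum.cong refl)
  fix Z
  have inj: "inj (pm n g)" using G(1) permutes_inj by blast
  have e: "sym_diff (sym_diff Z {i}) {i} = Z" by auto
  have "dw g (sym_diff Z {i}) = sym_diff (dw g Z) (sym_diff {pm n g i} {i})"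
  proof -
   have "pm n g ` sym_diff Z {i} = sym_diff (pm n g ` Z) {pm n g i}"
    using image_sym_diff[OF inj, of Z "{i}"] by simp
   then show ?thesis by auto
  qed
  then have "coc n (pm n g) (sym_diff Z {i}) * bs n (dw g (sym_diff Z {i})) {i} = coc n (pm n g) Z * bs n {pm n g i} (dw g Z)"
   unfolding coc_step[OF G(1) i] by (simp only: mult.assoc bs_square mult_1_right)
  then show "smul (coc n (pm n g) (sym_diff Z {i}) * bs n (dw g (sym_diff Z {i})) {i})
   (smul (cv v (dm n g i)) (single [v (pm n g i)] 1 * E g (sym_diff (sym_diff Z {i}) {i})))
   = smul (cv v (dm n g i)) (smul (coc n (pm n g) Z) (smul (bs n {pm n g i} (dw g Z)) (single [v (pm n g i)] 1 * E g Z)))"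
   unfolding e by (simp only: smul_simps mult_ac)
 qed
 also have "\<dots> = smul (cv v (dm n g i)) (star n (single [v (pm n g i)] 1) (theta g))"
  unfolding theta_def star_sum_right star_smul_right smul_sum
  by (intro sum.cong refl) (subst star_wt[OF w[OF pi] wt_E[OF g] _ dw_subset(1)[OF g]], use pi in auto)
 finally show ?thesis .
qed

lemma Psi_kappa:
 assumes q: "sgn1 q" and ij: "i < n" "j < n"
 shows "Psi (\<kappa> q i j) = smul (if j < i then -1 else 1) (\<kappa> (- q) i j)"
proof -
 have reflP: "Psi (single [Gr (refl_mat q n i l \<epsilon>)] a) = single [Gr (refl_mat (- q) n i l (\<epsilon> * (if l < i then 1 else -1)))] a"
  if "l < n" "i ~= l" "\<epsilon> : Um" for l \<epsilon> a
  using theta_refl[OF q ij(1) that] by (simp add: Psi_gen psi_def)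
 have sumP: "Psi (\<Sum>\<epsilon>\<in>Um. single [Gr (refl_mat q n i l \<epsilon>)] (F \<epsilon>))
  = (\<Sum>\<epsilon>\<in>Um. single [Gr (refl_mat (- q) n i l \<epsilon>)] (F (\<epsilon> * (if l < i then 1 else -1))))"
  if l: "l < n" "i ~= l" for l F
  unfolding Psi_sum
  using roots_scale_sum[where f = "%a b. single [Gr (refl_mat (- q) n i l a)] (F b)" and s = "if l < i then 1 else -1"]
  by (simp add: reflP[OF l])
 show ?thesis
 proof (cases "i = j")
  case True
  have "Psi (\<Sum>l\<in>{..<n} - {i}. \<Sum>\<epsilon>\<in>Um. single [Gr (refl_mat q n i l \<epsilon>)] c\<^sub>1)
   = (\<Sum>l\<in>{..<n} - {i}. \<Sum>\<epsilon>\<in>Um. single [Gr (refl_mat (- q) n i l \<epsilon>)] c\<^sub>1)"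
   unfolding Psi_sum[of _ "{..<n} - {i}"] by (intro sum.cong refl) (use sumP[of _ "%_. c\<^sub>1"] in auto)
  moreover have "Psi (\<Sum>\<zeta>\<in>Up - {1}. single [Gr (t_mat n i \<zeta>)] (c \<zeta>))
   = (\<Sum>\<zeta>\<in>Up - {1}. single [Gr (t_mat n i \<zeta>)] (c \<zeta>))"
   unfolding Psi_sum
  proof (intro sum.cong refl)
   fix \<zeta> assume z: "\<zeta> : Up - {1}"
   then have tG: "t_mat n i \<zeta> : CG q" using t_mat_Gamma[OF q ij(1)] by blast
   have "\<forall>k<n. (if k = i then \<zeta> else 1) ~= 0" using z root_nonzero roots_mono by auto
   then have "pm n (t_mat n i \<zeta>) = id" unfolding t_mat_eq by (intro pm_mm[OF permutes_id])
   then show "Psi (single [Gr (t_mat n i \<zeta>)] (c \<zeta>)) = single [Gr (t_mat n i \<zeta>)] (c \<zeta>)"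
    using theta_id[OF Gamma_GG[OF q tG]] by (simp add: Psi_gen psi_def)
  qed
  ultimately show ?thesis using True by (simp add: kq_def Psi_add)
 next
  case False
  have "Psi (\<kappa> q i j) = (\<Sum>\<epsilon>\<in>Um. single [Gr (refl_mat (- q) n i j \<epsilon>)] (- q * c\<^sub>1 * (\<epsilon> * (if j < i then 1 else -1))))"
   using False by (simp only: kq_def if_False sumP[OF ij(2) False])
  also have "\<dots> = smul (if j < i then -1 else 1) (\<kappa> (- q) i j)"
   using False by (auto simp: kq_def smul_sum intro!: sum.cong)
  finally show ?thesis .
 qed
qed

lemma Psi_H_rels:
 assumes q: "sgn1 q" and r: "r : HR q"
 shows "Psi r : J (- q)"
proof -
 have q': "sgn1 (- q)" using q by auto
 note J' = J_props[OF q'] and HJ = H_relsI[OF q']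
 have w: "wt n {j} (single [v j] 1)" if "j < n" "XY v" for j v using wt_word[OF that(2), of "[j]" n 1] that by simp
 have st: "star n (theta g) x : FM K T" if "g : CG q" "\<And>L. P n L x : FM K S" "\<And>h u. h : CG (- q) ==> u : S ==> Gr h # u : T"
  for g x S T
  unfolding star_def using that
  by (intro FM_sum FM_smul chi_K FM_times[OF theta_FM(2)[OF q that(1)] that(2)]) auto
 consider (S) v where "XY v" "r : S_rels n q v"
  | (one) "r = single [Gr (1\<^sub>m n)] 1 - single [] 1"
  | (mult) g h where "g : CG q" "h : CG q" "r = single [Gr g, Gr h] 1 - single [Gr (g * h)] 1"
  | (act) g v i where "g : CG q" "XY v" "i < n"
    "r = single [Gr g, v i] 1 - gen_action n (\<Gamma> q) g (v i) * single [Gr g] 1"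
  | (comm) i j where "i < n" "j < n" "r = single [Yg i, Xg j] 1 - single [Xg j, Yg i] (if i = j then 1 else q) - \<kappa> q i j"
  using r unfolding H_rels_def Gamma_mult_one free_algebra_sel by blast
 then show ?thesis
 proof cases
  case S
  have "r : SI q v" unfolding S_ideal_def by (rule relI_props(2)[OF S_rels_FA[OF q] S(2)])
  then have "Psi r : SI (- q) v" by (rule Psi_S_ideal[OF q S(1)])
  then show ?thesis using S_ideal_H_ideal[OF q' S(1)] HJ(3) by blast
 next
  case one
  have "Psi r = single [Gr (1\<^sub>m n)] 1 - single [] 1"
   unfolding one Psi_diff single_Nil_one by (simp add: Psi_gen psi_def theta_one)
  moreover have "single [Gr (1\<^sub>m n)] 1 - single [] 1 : HR (- q)"
   unfolding H_rels_def Gamma_mult_one by blast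
  ultimately show ?thesis using HJ(1) by simp
 next
  case mult
  have "single [Gr g, Gr h] 1 = single [Gr g] 1 * single [Gr h] (1::complex)" by simp
  then have "Psi r = star n (theta g) (theta h) - theta (g * h)"
   unfolding mult(3) Psi_diff by (simp only: Psi_mult Psi_gen smul_simps psi_def gen.case)
  also have "theta (g * h) = c2 (star n (theta g) (theta h))"
   using c2_theta[OF Gamma_GG[OF q mult(1)] Gamma_GG[OF q mult(2)]] pm_dm_mult(1)[OF q q mult(1,2)] by simp
  also have "star n (theta g) (theta h) - c2 (star n (theta g) (theta h)) : J (- q)"
   by (rule c2_J[OF q'], rule st[OF mult(1) theta_FM(2)[OF q mult(2)]]) blast
  finally show ?thesis .
 next
  case act
  have e: "single [Gr g, v i] 1 = single [Gr g] 1 * single [v i] (1::complex)" by simp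
  have pv: "psi (v j) = single [v j] 1" for j using act(2) by (auto simp: psi_def)
  have ga: "gen_action n (\<Gamma> q) g (v i) = single [v (pm n g i)] (cv v (dm n g i))"
   by (rule gen_action_v[OF q act(1-3)])
  have ss: "star n (single [v k] b) x = smul b (star n (single [v k] 1) x)" for k b x
   using star_smul_left[of n b "single [v k] 1" x] by simp
  have "Psi r = star n (theta g) (single [v i] 1) - smul (cv v (dm n g i)) (star n (single [v (pm n g i)] 1) (theta g))"
   unfolding act(4) e ga Psi_diff Psi_mult Psi_gen pv by (simp add: psi_def ss[of _ "cv v (dm n g i)"])
  also have "smul (cv v (dm n g i)) (star n (single [v (pm n g i)] 1) (theta g)) = c3 v i (star n (theta g) (single [v i] 1))"
   by (rule c3_theta[OF Gamma_GG[OF q act(1)] act(3,2), symmetric])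
  also have "star n (theta g) (single [v i] 1) - c3 v i (star n (theta g) (single [v i] 1)) : J (- q)"
  proof (rule c3_J[OF q' act(2,3)], rule st[OF act(1)])
   show "P n L (single [v i] 1) : FM K {[v i]}" for L
    unfolding P_def using tact_v[OF act(2)] by (intro FM_smul FM_sum half_K chi_K) (auto intro!: FM_single)
  qed auto
  finally show ?thesis .
 next
  case comm
  have s: "star n (single [Yg i] 1) (single [Xg j] 1) = single [Yg i, Xg j] (bs n {i} {j})"
   "star n (single [Xg j] 1) (single [Yg i] 1) = single [Xg j, Yg i] (bs n {j} {i})"
   using star_wt[OF w w, of i Yg j Xg] star_wt[OF w w, of j Xg i Yg] comm by auto
  have e: "single [Yg i, Xg j] 1 = single [Yg i] 1 * single [Xg j] (1::complex)"
   "single [Xg j, Yg i] a = smul a (single [Xg j] 1 * single [Yg i] 1)" for a by simp_all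
  let ?k = "if i = j then 1 else q" and ?s = "if j < i then -1 else (1::complex)"
  have "Psi r = single [Yg i, Xg j] (bs n {i} {j}) - single [Xg j, Yg i] (?k * bs n {j} {i}) - smul ?s (\<kappa> (- q) i j)"
   unfolding comm(3) e Psi_diff Psi_smul Psi_mult Psi_gen Psi_kappa[OF q comm(1,2)]
   by (simp add: psi_def s)
  also have "\<dots> = smul ?s (single [Yg i, Xg j] 1 - single [Xg j, Yg i] (if i = j then 1 else - q) - \<kappa> (- q) i j)"
   using comm by (auto simp: bs_singletons smul_diff)
  also have "\<dots> : J (- q)"
  proof (rule J'(6)[OF HJ(1)])
   show "single [Yg i, Xg j] 1 - single [Xg j, Yg i] (if i = j then 1 else - q) - \<kappa> (- q) i j : HR (- q)"
    unfolding H_rels_def using comm by blast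
  qed simp
  finally show ?thesis .
 qed
qed

lemma Psi_J:
 assumes q: "sgn1 q" and f: "f : J q"
 shows "Psi f : J (- q)"
proof -
 have q': "sgn1 (- q)" using q by auto
 show ?thesis
  using J_gens_FA[OF q] f unfolding J_def[of q]
 proof (induction rule: relI_induct)
  case (base a u r v)
  have "Psi r : J (- q)"
  proof (cases "r : HR q")
   case True
   then show ?thesis by (rule Psi_H_rels[OF q])
  next
   case False
   then show ?thesis using base(3) Psi_Inv[OF q] H_relsI(2)[OF q'] by blast
  qed
  moreover have "Psi (single u 1) : FH (- q)" "Psi (single v 1) : FH (- q)"
   using base by (auto intro!: Psi_FA[OF q])
  ultimately show ?case
   unfolding Psi_smul Psi_mult using base(1) by (intro J_props(6)[OF q'] star_J[OF q'])
 qed (simp_all add: Psi_add J_props(3,4)[OF q'])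
qed

theorem twist_isomorphism:
 assumes q: "sgn1 q"
 shows "\<exists>\<phi>. \<phi> : algebra_iso K (Tw q) (restricted_alg K n (\<Gamma> (- q)) (- q) (\<kappa> (- q)))"
proof -
 have q': "sgn1 (- q)" using q by auto
 let ?A = "restricted_alg K n (\<Gamma> q) q (\<kappa> q)" and ?B = "restricted_alg K n (\<Gamma> (- q)) (- q) (\<kappa> (- q))"
 note QA = restricted_quotient[OF q] and QB = restricted_quotient[OF q']
 note D = is_quotientD[OF QA] and D' = is_quotientD[OF QB]
 define \<phi> where "\<phi> x = clH (- q) (Psi (SOME f. f : FH q & clH q f = x))" for x
 have \<phi>: "\<phi> (clH q f) = clH (- q) (Psi f)" if f: "f : FH q" for f
 proof -
  let ?h = "SOME h. h : FH q & clH q h = clH q f"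
  have h: "?h : FH q & clH q ?h = clH q f" by (rule someI[of _ f]) (use f in blast)
  then have "?h - f : J q" using clH_eq[OF q _ f] by blast
  then have "Psi ?h - Psi f : J (- q)" using Psi_J[OF q] by (simp add: Psi_diff[symmetric])
  then show ?thesis unfolding \<phi>_def using clH_eq[OF q' Psi_FA[OF q] Psi_FA[OF q f]] h by blast
 qed
 have rep: "\<exists>f\<in>FH q. x = clH q f" if "x : carrier ?A" for x using D(3)[OF that] by simp
 have hom: "\<phi> : algebra_hom K (Tw q) ?B"
  unfolding algebra_hom_def
 proof (intro CollectI conjI ballI ring_hom_memI)
  fix x assume "x : carrier (Tw q)"
  then obtain f where f: "f : FH q" "x = clH q f" using rep by (auto simp: Tw_sel)
  then show "\<phi> x : carrier ?B" using D'(2)[of "Psi f"] Psi_FA[OF q f(1)] \<phi>[OF f(1)] by simp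
  show "\<phi> (a \<odot>\<^bsub>Tw q\<^esub> x) = a \<odot>\<^bsub>?B\<^esub> \<phi> x" if a: "a : K" for a
   using D(7)[of a f] D'(7)[of a "Psi f"] f a Psi_FA[OF q f(1)] \<phi>[OF f(1)] \<phi>[of "smul a f"]
   by (simp add: Tw_sel Psi_smul FM_smul)
  fix y assume "y : carrier (Tw q)"
  then obtain h where h: "h : FH q" "y = clH q h" using rep by (auto simp: Tw_sel)
  show "\<phi> (x \<otimes>\<^bsub>Tw q\<^esub> y) = \<phi> x \<otimes>\<^bsub>?B\<^esub> \<phi> y"
   unfolding f(2) h(2) Tw_mult[OF q f(1) h(1)] \<phi>[OF star_FA[OF q f(1) h(1)]] \<phi>[OF f(1)] \<phi>[OF h(1)] Psi_star[OF q f(1) h(1)]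
   using D'(5)[of "Psi f" "Psi h"] Psi_FA[OF q] f h by simp
  show "\<phi> (x \<oplus>\<^bsub>Tw q\<^esub> y) = \<phi> x \<oplus>\<^bsub>?B\<^esub> \<phi> y"
   using D(4)[of f h] D'(4)[of "Psi f" "Psi h"] Psi_FA[OF q] f h \<phi>[OF FM_add[OF f(1) h(1)]] \<phi>[OF f(1)] \<phi>[OF h(1)]
   by (simp add: Tw_sel Psi_add)
 next
  show "\<phi> \<one>\<^bsub>Tw q\<^esub> = \<one>\<^bsub>?B\<^esub>"
   using \<phi>[OF FA_1] D(6) D'(6) by (simp add: Tw_sel)
 qed
 have "bij_betw \<phi> (carrier (Tw q)) (carrier ?B)"
 proof (rule bij_betwI')
  fix x y assume "x : carrier (Tw q)" "y : carrier (Tw q)"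
  then obtain f h where f: "f : FH q" "x = clH q f" and h: "h : FH q" "y = clH q h"
   using rep by (auto simp: Tw_sel) metis
  show "\<phi> x = \<phi> y \<longleftrightarrow> x = y"
  proof
   assume "\<phi> x = \<phi> y"
   then have "Psi f - Psi h : J (- q)"
    unfolding f(2) h(2) \<phi>[OF f(1)] \<phi>[OF h(1)] using clH_eq[OF q' Psi_FA[OF q f(1)] Psi_FA[OF q h(1)]] by blast
   then have "Psi (Psi f) - Psi (Psi h) : J q" using Psi_J[OF q'] by (simp add: Psi_diff[symmetric])
   then show "x = y" unfolding Psi_Psi[OF q f(1)] Psi_Psi[OF q h(1)] f(2) h(2) using clH_eq[OF q f(1) h(1)] by blast
  qed simp
 next
  fix x assume "x : carrier (Tw q)"
  then obtain f where f: "f : FH q" "x = clH q f" using rep by (auto simp: Tw_sel)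
  then show "\<phi> x : carrier ?B" using D'(2)[of "Psi f"] Psi_FA[OF q f(1)] \<phi>[OF f(1)] by simp
 next
  fix y assume "y : carrier ?B"
  then obtain h where h: "h : FH (- q)" "y = clH (- q) h" using D'(3)[of y] by auto
  have Ph: "Psi h : FH q" using Psi_FA[OF q' h(1)] by simp
  have "y = \<phi> (clH q (Psi h))" by (simp only: \<phi>[OF Ph] Psi_Psi[OF q' h(1)] h(2))
  then show "\<exists>x\<in>carrier (Tw q). y = \<phi> x" using D(2)[of "Psi h"] Ph by (auto simp: Tw_sel)
 qed
 then show ?thesis using hom unfolding algebra_iso_def by blast
qed

end

section \<open>A module over the braided algebra\<close>

type_synonym wmod = "(nat list \<times> complex mat \<times> nat list) \<Rightarrow>\<^sub>0 complex"

text \<open>Basis vectors \<open>(u, g, v)\<close> stand for the products \<open>x\<^sub>u g y\<^sub>v\<close>. \<open>XM\<close>, \<open>GM\<close> and \<open>YM\<close> are the operators of left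
 multiplication by generators, and \<open>RM\<close> is right multiplication by a word in the \<open>y\<^sub>i\<close>.\<close>

definition XM :: "nat => wmod => wmod" where
 "XM i = lin (%(u, g, v). single (i # u, g, v) 1)"

definition RM :: "nat list => wmod => wmod" where
 "RM v' = lin (%(u, g, v). single (u, g, v @ v') 1)"

definition qs :: "nat => nat => complex" where
 "qs i j = (if i = j then 1 else -1)"

lemma qs_K [simp]: "qs i i = 1" "i ~= j ==> qs i j = -1"
 by (simp_all add: qs_def)

lemma XM_simps:
 "XM i (x + y) = XM i x + XM i y" "XM i (x - y) = XM i x - XM i y" "XM i (smul a x) = smul a (XM i x)" "XM i 0 = 0"
 "XM i (\<Sum>k\<in>I. F k) = (\<Sum>k\<in>I. XM i (F k))" "XM i (single (u, g, v) a) = single (i # u, g, v) a"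
 by (simp_all add: XM_def lin_simps)

lemma RM_simps:
 "RM w (x + y) = RM w x + RM w y" "RM w (x - y) = RM w x - RM w y" "RM w (smul a x) = smul a (RM w x)" "RM w 0 = 0"
 "RM w (\<Sum>k\<in>I. F k) = (\<Sum>k\<in>I. RM w (F k))" "RM w (single (u, g, v) a) = single (u, g, v @ w) a"
 by (simp_all add: RM_def lin_simps)

lemma wmod_induct [case_names zero add single]:
 assumes "Q 0" "\<And>f g. Q f ==> Q g ==> Q (f + g)" "\<And>u g v a. Q (single (u, g, v) a)"
 shows "Q (f :: wmod)"
proof -
 have "Q (\<Sum>w\<in>I. single w (lookup f w))" for I
  by (induction I rule: infinite_finite_induct) (use assms in auto)
 from this[of "keys f"] show ?thesis by (simp only: sum_single_lookup)
qed

context cher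
begin

abbreviation W :: "complex mat monoid" where "W \<equiv> \<Gamma> (-1)"

lemma m1: "(-1::complex) = 1 \<or> (-1::complex) = -1" by simp

definition GM :: "complex mat => wmod => wmod" where
 "GM w = lin (%(u, g, v). single (map (pm n w) u, w * g, v) (wcoef Xg w u))"

lemma GM_simps:
 "GM w (x + y) = GM w x + GM w y" "GM w (x - y) = GM w x - GM w y" "GM w (smul a x) = smul a (GM w x)" "GM w 0 = 0"
 "GM w (\<Sum>k\<in>I. F k) = (\<Sum>k\<in>I. GM w (F k))"
 "GM w (single (u, g, v) a) = single (map (pm n w) u, w * g, v) (a * wcoef Xg w u)"
 by (simp_all add: GM_def lin_simps)

text \<open>The right-hand side of the relation between \<open>y\<^sub>i\<close> and \<open>x\<^sub>j\<close> is a combination of the reflections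
 indexed by \<open>Rf i\<close>, with coefficients \<open>bc i r * ac i r j\<close>. The pair \<open>(l, \<epsilon>)\<close> stands for
 \<open>\<sigma>\<^sub>i\<^sub>l\<^bsup>(\<epsilon>)\<^esup>\<close> if \<open>l \<noteq> i\<close> and for \<open>t\<^sub>i\<^bsup>(\<epsilon>)\<^esup>\<close> if \<open>l = i\<close>.\<close>

definition Rf :: "nat => (nat \<times> complex) set" where
 "Rf i = ({..<n} - {i}) \<times> Um \<union> {i} \<times> (Up - {1})"

definition rm :: "nat => nat \<times> complex => complex mat" where
 "rm i r = (if fst r = i then t_mat n i (snd r) else refl_mat (-1) n i (fst r) (snd r))"

definition bc :: "nat => nat \<times> complex => complex" where
 "bc i r = (if fst r = i then c (snd r) else c\<^sub>1)"

definition ac :: "nat => nat \<times> complex => nat => complex" where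
 "ac i r j = (if j = i then 1 else if j = fst r then snd r else 0)"

lemma finite_Rf: "finite (Rf i)"
 by (simp add: Rf_def)

lemma kappa_Rf:
 assumes "i < n" "j < n"
 shows "\<kappa> (-1) i j = (\<Sum>r\<in>Rf i. single [Gr (rm i r)] (bc i r * ac i r j))"
proof -
 let ?F = "%r. single [Gr (rm i r)] (bc i r * ac i r j)"
 have "(\<Sum>r\<in>Rf i. ?F r) = (\<Sum>r\<in>({..<n} - {i}) \<times> Um. ?F r) + (\<Sum>r\<in>{i} \<times> (Up - {1}). ?F r)"
  unfolding Rf_def by (rule sum.union_disjoint) auto
 also have "(\<Sum>r\<in>({..<n} - {i}) \<times> Um. ?F r) = (\<Sum>l\<in>{..<n} - {i}. \<Sum>\<epsilon>\<in>Um. ?F (l, \<epsilon>))"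
  by (simp add: sum.cartesian_product)
 also have "(\<Sum>r\<in>{i} \<times> (Up - {1}). ?F r) = (\<Sum>\<zeta>\<in>Up - {1}. ?F (i, \<zeta>))"
  using sum.cartesian_product[of "%a b. ?F (a, b)" "Up - {1}" "{i}"] by simp
 finally have S: "(\<Sum>r\<in>Rf i. ?F r) = (\<Sum>l\<in>{..<n} - {i}. \<Sum>\<epsilon>\<in>Um. ?F (l, \<epsilon>)) + (\<Sum>\<zeta>\<in>Up - {1}. ?F (i, \<zeta>))" .
 show ?thesis
 proof (cases "i = j")
  case True
  show ?thesis unfolding S using True by (simp add: kq_def rm_def bc_def ac_def)
 next
  case False
  have "(\<Sum>l\<in>{..<n} - {i}. \<Sum>\<epsilon>\<in>Um. ?F (l, \<epsilon>))
   = (\<Sum>l\<in>{..<n} - {i}. if l = j then (\<Sum>\<epsilon>\<in>Um. single [Gr (refl_mat (-1) n i j \<epsilon>)] (c\<^sub>1 * \<epsilon>)) else 0)"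
   using False by (intro sum.cong refl) (auto simp: rm_def bc_def ac_def)
  also have "\<dots> = (\<Sum>\<epsilon>\<in>Um. single [Gr (refl_mat (-1) n i j \<epsilon>)] (c\<^sub>1 * \<epsilon>))"
   using False assms by (subst sum.delta) auto
  finally show ?thesis unfolding S using False by (simp add: kq_def bc_def ac_def)
 qed
qed

lemma rm_facts:
 assumes i: "i < n" and r: "r : Rf i"
 shows "rm i r : CG (-1)" "pm n (rm i r) = transpose i (fst r)" "fst r < n"
  "j < n ==> dm n (rm i r) j = (if fst r = i then (if j = i then snd r else 1)
   else if j = i then inverse (snd r) else if j = fst r then - snd r else 1)"
  "snd r ~= 0" "bc i r : K" "snd r : K"
proof -
 have nz: "snd r : Um" using r roots_mono by (auto simp: Rf_def)
 show "snd r ~= 0" using nz root_nonzero by blast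
 show "snd r : K" using nz roots_K by blast
 show "fst r < n" using r i by (auto simp: Rf_def)
 show "bc i r : K" using r c1_K by (auto simp: Rf_def bc_def intro!: c_K)
 have *: "rm i r : CG (-1) & pm n (rm i r) = transpose i (fst r) & (j < n --> dm n (rm i r) j = (if fst r = i then (if j = i then snd r else 1)
   else if j = i then inverse (snd r) else if j = fst r then - snd r else 1))"
 proof (cases "fst r = i")
  case True
  have nz': "\<forall>k<n. (if k = i then snd r else 1) ~= 0" using nz root_nonzero by auto
  show ?thesis
   using t_mat_Gamma[OF m1 i, of "snd r"] r True pm_mm[OF permutes_id nz'] dm_mm[OF permutes_id nz', of j]
   by (auto simp: rm_def t_mat_eq Rf_def)
 next
  case False
  then have il: "fst r < n" "i ~= fst r" "snd r : Um" using r by (auto simp: Rf_def)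
  note R = refl_mat_Gamma[OF m1 i il]
  have perm: "transpose i (fst r) permutes {..<n}" using i il by (intro permutes_swap_id) auto
  have nz': "\<forall>k<n. (if k = i then inverse (snd r) else if k = fst r then -1 * snd r else 1) ~= 0" using nz root_nonzero by auto
  have rm: "rm i r = mm n (transpose i (fst r)) (%k. if k = i then inverse (snd r) else if k = fst r then -1 * snd r else 1)"
   using False R(1) by (simp add: rm_def)
  have "rm i r : CG (-1)" using False R(2) by (simp add: rm_def)
  moreover have "pm n (rm i r) = transpose i (fst r)" unfolding rm by (rule pm_mm[OF perm nz'])
  moreover have "dm n (rm i r) j = (if j = i then inverse (snd r) else if j = fst r then -1 * snd r else 1)" if "j < n"
   unfolding rm by (rule dm_mm[OF perm nz' that])
  ultimately show ?thesis using False by simp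
 qed
 then show "rm i r : CG (-1)" "pm n (rm i r) = transpose i (fst r)"
  "j < n ==> dm n (rm i r) j = (if fst r = i then (if j = i then snd r else 1)
   else if j = i then inverse (snd r) else if j = fst r then - snd r else 1)" by blast+
qed

lemma ac_K: "i < n ==> r : Rf i ==> ac i r j : K"
 using rm_facts(7) by (auto simp: ac_def)

lemma Gamma_eqI:
 assumes q: "sgn1 q" and "g : CG q" "h : CG q" "pm n g = pm n h" "\<And>j. j < n ==> dm n g j = dm n h j"
 shows "g = h"
proof -
 have "g = mm n (pm n g) (dm n g)" by (rule GammaD(4)[OF q assms(2)])
 also have "\<dots> = mm n (pm n h) (dm n h)" using assms(4,5) by (intro mm_cong) auto
 also have "\<dots> = h" by (rule GammaD(4)[OF q assms(3), symmetric])
 finally show ?thesis .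
qed

text \<open>The datum of the reflection conjugated by \<open>g\<close>.\<close>

definition tr :: "complex mat => nat => nat \<times> complex => nat \<times> complex" where
 "tr g i r = (pm n g (fst r), if fst r = i then snd r else snd r * dm n g i * inverse (dm n g (fst r)))"

lemma tr_facts:
 assumes g: "g : CG (-1)" and i: "i < n" and r: "r : Rf i"
 shows "tr g i r : Rf (pm n g i)" "g * rm i r = rm (pm n g i) (tr g i r) * g"
  "bc (pm n g i) (tr g i r) = bc i r"
  "j < n ==> inverse (dm n g i) * dm n g j * ac (pm n g i) (tr g i r) (pm n g j) = ac i r j"
proof -
 note G = GammaD[OF m1 g] and R = rm_facts[OF i r]
 have inj: "pm n g a = pm n g b \<longleftrightarrow> a = b" for a b using permutes_inj[OF G(1)] by (auto dest: injD)
 have nz: "dm n g j ~= 0" if "j < n" for j using G(5) that .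
 show t: "tr g i r : Rf (pm n g i)"
  using r G(2)[OF i] G(2)[OF R(3)] G(6) inj R(3)
  by (auto simp: Rf_def tr_def intro!: unity_roots_mult unity_roots_inverse)
 note R' = rm_facts[OF G(6)[OF i] t]
 show "g * rm i r = rm (pm n g i) (tr g i r) * g"
 proof (rule Gamma_eqI[OF m1 Gamma_closed(1)[OF m1 g R(1)] Gamma_closed(1)[OF m1 R'(1) g]])
  show "pm n (g * rm i r) = pm n (rm (pm n g i) (tr g i r) * g)"
   unfolding pm_dm_mult(1)[OF m1 m1 g R(1)] pm_dm_mult(1)[OF m1 m1 R'(1) g] R(2) R'(2)
   by (auto simp: fun_eq_iff transpose_def inj tr_def)
  fix j assume j: "j < n"
  have tj: "transpose i (fst r) j < n" using i j R(3) by (simp add: transpose_def)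
  show "dm n (g * rm i r) j = dm n (rm (pm n g i) (tr g i r) * g) j"
   unfolding pm_dm_mult(2)[OF m1 m1 g R(1) j] pm_dm_mult(2)[OF m1 m1 R'(1) g j] R(2) R(4)[OF j] R'(4)[OF G(6)[OF j]]
   using nz[OF i] nz[OF R(3)] R(5) by (auto simp: inj tr_def transpose_def field_simps)
 qed
 show "bc (pm n g i) (tr g i r) = bc i r" by (simp add: bc_def tr_def inj)
 show "inverse (dm n g i) * dm n g j * ac (pm n g i) (tr g i r) (pm n g j) = ac i r j" if "j < n"
  using nz[OF i] nz[OF R(3)] nz[OF that] by (auto simp: ac_def tr_def inj field_simps)
qed

lemma tr_bij:
 assumes g: "g : CG (-1)" and i: "i < n"
 shows "bij_betw (tr g i) (Rf i) (Rf (pm n g i))"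
proof -
 note G = GammaD[OF m1 g]
 have inj: "pm n g a = pm n g b \<longleftrightarrow> a = b" for a b using permutes_inj[OF G(1)] by (auto dest: injD)
 have nz: "dm n g j ~= 0" if "j < n" for j using G(5) that .
 have "inj_on (tr g i) (Rf i)"
  using nz[OF i] nz rm_facts(3)[OF i] by (auto simp: inj_on_def tr_def inj split: if_splits)
 moreover have "Rf (pm n g i) \<subseteq> tr g i ` Rf i"
 proof
  fix s assume s: "s : Rf (pm n g i)"
  have "fst s < n" using rm_facts(3)[OF G(6)[OF i] s] .
  then obtain l where l: "l < n" "fst s = pm n g l" using permutes_image[OF G(1)] by (metis imageE lessThan_iff)
  define r where "r = (l, if l = i then snd s else snd s * inverse (dm n g i) * dm n g l)"
  have "r : Rf i"
   using s l G(2)[OF i] G(2)[OF l(1)] by (auto simp: Rf_def r_def inj intro!: unity_roots_mult unity_roots_inverse)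
  moreover have "tr g i r = s" using l nz[OF i] nz[OF l(1)] by (auto simp: tr_def r_def prod_eq_iff field_simps)
  ultimately show "s : tr g i ` Rf i" by blast
 qed
 ultimately show ?thesis using tr_facts(1)[OF g i] by (auto simp: bij_betw_def)
qed

definition kM :: "nat => nat => wmod => wmod" where
 "kM i j x = (\<Sum>r\<in>Rf i. smul (bc i r * ac i r j) (GM (rm i r) x))"

lemma kM_simps:
 "kM i j (f + g) = kM i j f + kM i j g" "kM i j (f - g) = kM i j f - kM i j g" "kM i j (smul a f) = smul a (kM i j f)" "kM i j 0 = 0"
 "kM i j (\<Sum>k\<in>I. F k) = (\<Sum>k\<in>I. kM i j (F k))"
proof -
 show add: "kM i j (f + g) = kM i j f + kM i j g" for f g by (simp add: kM_def GM_simps smul_add sum.distrib)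
 show "kM i j (f - g) = kM i j f - kM i j g" by (simp add: kM_def GM_simps smul_diff sum_subtractf)
 show "kM i j (smul a f) = smul a (kM i j f)" by (simp add: kM_def GM_simps smul_sum mult_ac)
 show z: "kM i j 0 = 0" by (simp add: kM_def GM_simps)
 show "kM i j (\<Sum>k\<in>I. F k) = (\<Sum>k\<in>I. kM i j (F k))"
  by (induction I rule: infinite_finite_induct) (simp_all add: z add)
qed

primrec ym :: "nat => nat list => complex mat => nat list => wmod" where
 "ym i [] g v = single ([], g, inv_into UNIV (pm n g) i # v) (dm n g (inv_into UNIV (pm n g) i))"
| "ym i (j # u) g v = smul (qs i j) (XM j (ym i u g v)) + kM i j (single (u, g, v) 1)"

definition YM :: "nat => wmod => wmod" where
 "YM i = lin (%(u, g, v). ym i u g v)"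

lemma YM_simps:
 "YM i (x + y) = YM i x + YM i y" "YM i (x - y) = YM i x - YM i y" "YM i (smul a x) = smul a (YM i x)" "YM i 0 = 0"
 "YM i (\<Sum>k\<in>I. F k) = (\<Sum>k\<in>I. YM i (F k))" "YM i (single (u, g, v) a) = smul a (ym i u g v)"
 by (simp_all add: YM_def lin_simps)

text \<open>The definition of \<open>y\<^sub>i\<close> is forced by the commutation relation with the \<open>x\<^sub>j\<close>, which therefore holds exactly.\<close>

lemma YM_XM: "YM i (XM j x) = smul (qs i j) (XM j (YM i x)) + kM i j x"
proof (induction x rule: wmod_induct)
 case (single u g v a)
 have "single (u, g, v) a = smul a (single (u, g, v) 1)" by simp
 then have "kM i j (single (u, g, v) a) = smul a (kM i j (single (u, g, v) 1))" by (simp only: kM_simps)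
 then show ?case by (simp add: XM_simps YM_simps smul_add mult_ac)
qed (simp_all add: XM_simps YM_simps kM_simps smul_add)

definition MB :: "(nat list \<times> complex mat \<times> nat list) set" where
 "MB = {(u, g, v). u : lists {..<n} & g : CG (-1) & v : lists {..<n}}"

abbreviation MK :: "wmod set" where "MK \<equiv> FM K MB"

lemma MK_induct [consumes 1, case_names zero add single]:
 assumes "x : MK" "Q 0" "\<And>a b. a : MK ==> b : MK ==> Q a ==> Q b ==> Q (a + b)"
  "\<And>u g v a. u : lists {..<n} ==> g : CG (-1) ==> v : lists {..<n} ==> a : K ==> Q (single (u, g, v) a)"
 shows "Q x"
 using assms(1)
proof (induction rule: FM_induct)
 case (single w a)
 then show ?case using assms(4) by (cases w) (auto simp: MB_def)
qed (use assms in auto)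

lemma XM_MK: "i < n ==> x : MK ==> XM i x : MK"
 by (rotate_tac 1, induction rule: MK_induct) (auto simp: XM_simps MB_def intro!: FM_single)

lemma GM_MK: "g : CG (-1) ==> x : MK ==> GM g x : MK"
proof (rotate_tac 1, induction rule: MK_induct)
 case (single u h v a)
 have "map (pm n g) u : lists {..<n}" using single GammaD(6)[OF m1 single(5)] by auto
 then show ?case using single Gamma_closed(1)[OF m1 single(5,2)] wcoef_K[OF m1 single(5,1), of Xg]
  by (auto simp: GM_simps MB_def intro!: FM_single)
qed (auto simp: GM_simps)

lemma kM_MK: "i < n ==> x : MK ==> kM i j x : MK"
 unfolding kM_def by (intro FM_sum FM_smul K_mult GM_MK) (auto intro: rm_facts ac_K)

lemma YM_MK: "i < n ==> x : MK ==> YM i x : MK"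
proof (rotate_tac 1, induction rule: MK_induct)
 case (single u g v a)
 have "ym i u g v : MK" using single(1)
 proof (induction u)
  case Nil
  note G = GammaD[OF m1 single(2)]
  have k: "inv_into UNIV (pm n g) i < n" using permutes_in_image[OF permutes_inv[OF G(1)], of i] single(5) by simp
  then show ?case using G(2)[OF k] roots_K single by (auto simp: MB_def intro!: FM_single)
 next
  case (Cons j u)
  have "single (u, g, v) 1 : MK" using Cons single by (auto simp: MB_def intro!: FM_single)
  then show ?case using Cons single(5) by (auto simp: qs_def intro!: FM_add FM_smul XM_MK kM_MK)
 qed
 then show ?case using single by (auto simp: YM_simps)
qed (auto simp: YM_simps)

lemma GM_GM: "g : CG (-1) ==> h : CG (-1) ==> x : MK ==> GM g (GM h x) = GM (g * h) x"
proof (rotate_tac 2, induction rule: MK_induct)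
 case (single u k v a)
 note gh = pm_dm_mult[OF m1 m1 single(5,6)]
 have "wcoef Xg h u * wcoef Xg g (map (pm n h) u) = wcoef Xg (g * h) u"
  using single(1) by (induction u) (auto simp: gh(2) mult_ac)
 moreover have "g * (h * k) = g * h * k"
  using GammaD(7)[OF m1 single(5)] GammaD(7)[OF m1 single(6)] GammaD(7)[OF m1 single(2)] by (simp add: assoc_mult_mat[of _ n n _ n _ n])
 ultimately show ?case by (simp add: GM_simps gh(1) mult_ac)
qed (simp_all add: GM_simps)

lemma GM_one: "x : MK ==> GM (1\<^sub>m n) x = x"
proof (induction rule: MK_induct)
 case (single u k v a)
 have nz: "\<forall>j<n. (1::complex) ~= 0" by simp
 have pm: "pm n (1\<^sub>m n) = id" unfolding mm_one by (rule pm_mm[OF permutes_id nz])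
 have dm: "dm n (1\<^sub>m n) j = 1" if "j < n" for j unfolding mm_one by (rule dm_mm[OF permutes_id nz that])
 have "wcoef Xg (1\<^sub>m n) u = 1" using single(1) by (induction u) (auto simp: dm)
 then show ?case using GammaD(7)[OF m1 single(2)] by (simp add: GM_simps pm)
qed (simp_all add: GM_simps)

lemma GM_XM: "GM g (XM i x) = smul (dm n g i) (XM (pm n g i) (GM g x))"
 by (induction x rule: wmod_induct) (simp_all add: GM_simps XM_simps smul_add mult_ac)

lemma GM_kM:
 assumes g: "g : CG (-1)" and ij: "i < n" "j < n" and x: "x : MK"
 shows "GM g (kM i j x) = smul (inverse (dm n g i) * dm n g j) (kM (pm n g i) (pm n g j) (GM g x))"
proof -
 have "GM g (kM i j x) = (\<Sum>r\<in>Rf i. smul (bc i r * ac i r j) (GM (g * rm i r) x))"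
  unfolding kM_def GM_simps by (intro sum.cong refl) (simp add: GM_GM[OF g _ x] rm_facts(1)[OF ij(1)])
 also have "\<dots> = (\<Sum>r\<in>Rf i. smul (inverse (dm n g i) * dm n g j * (bc (pm n g i) (tr g i r) * ac (pm n g i) (tr g i r) (pm n g j))) (GM (rm (pm n g i) (tr g i r)) (GM g x)))"
 proof (intro sum.cong refl)
  fix r assume r: "r : Rf i"
  note T = tr_facts[OF g ij(1) r]
  have "bc i r * ac i r j = inverse (dm n g i) * dm n g j * (bc (pm n g i) (tr g i r) * ac (pm n g i) (tr g i r) (pm n g j))"
   unfolding T(3) T(4)[OF ij(2), symmetric] by (simp only: mult_ac)
  then show "smul (bc i r * ac i r j) (GM (g * rm i r) x) = smul (inverse (dm n g i) * dm n g j * (bc (pm n g i) (tr g i r) * ac (pm n g i) (tr g i r) (pm n g j))) (GM (rm (pm n g i) (tr g i r)) (GM g x))"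
   unfolding T(2) using GM_GM[OF rm_facts(1)[OF GammaD(6)[OF m1 g ij(1)] T(1)] g x] by simp
 qed
 also have "\<dots> = (\<Sum>r\<in>Rf (pm n g i). smul (inverse (dm n g i) * dm n g j * (bc (pm n g i) r * ac (pm n g i) r (pm n g j))) (GM (rm (pm n g i) r) (GM g x)))"
  by (rule sum.reindex_bij_betw[OF tr_bij[OF g ij(1)]])
 finally show ?thesis by (simp add: kM_def smul_sum)
qed

lemma GM_YM:
 assumes g: "g : CG (-1)" and i: "i < n" and x: "x : MK"
 shows "GM g (YM i x) = smul (inverse (dm n g i)) (YM (pm n g i) (GM g x))"
 using x
proof (induction rule: MK_induct)
 case (single u h v a)
 note G = GammaD[OF m1 g] and H = GammaD[OF m1 single(2)]
 have b: "GM g (YM i (single (u, h, v) 1)) = smul (inverse (dm n g i)) (YM (pm n g i) (GM g (single (u, h, v) 1)))"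
  using single(1)
 proof (induction u)
  case Nil
  note gh = pm_dm_mult[OF m1 m1 g single(2)]
  let ?k = "inv_into UNIV (pm n h) i"
  have k: "?k < n" "pm n h ?k = i"
   using permutes_in_image[OF permutes_inv[OF H(1)], of i] i permutes_inverses(1)[OF H(1)] by auto
  have ik: "inv_into UNIV (pm n (g * h)) (pm n g i) = ?k"
  proof -
   have "pm n (g * h) ?k = pm n g i" using gh(1) k by simp
   moreover have "inj (pm n (g * h))" unfolding gh(1) using permutes_inj[OF permutes_compose[OF H(1) G(1)]] .
   ultimately show ?thesis by (metis inv_f_f)
  qed
  have *: "inverse (dm n g i) * (dm n g i * z) = z" for z using G(5)[OF i] by (simp add: mult.assoc[symmetric])
  show ?case using k by (simp add: YM_simps GM_simps ik gh(2)[OF k(1)] *)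
 next
  case (Cons j u)
  have j: "j < n" and u: "u : lists {..<n}" using Cons by auto
  let ?y = "single (u, h, v) (1::complex)"
  have y: "?y : MK" using u single by (auto simp: MB_def intro!: FM_single)
  have s: "single (j # u, h, v) 1 = XM j ?y" by (simp add: XM_simps)
  have qq: "qs (pm n g i) (pm n g j) = qs i j" using permutes_inj[OF G(1)] by (auto simp: qs_def dest: injD)
  have "GM g (YM i (XM j ?y)) = smul (qs i j * dm n g j) (XM (pm n g j) (GM g (YM i ?y))) + GM g (kM i j ?y)"
   unfolding YM_XM by (simp add: GM_simps GM_XM)
  also have "\<dots> = smul (qs i j * dm n g j * inverse (dm n g i)) (XM (pm n g j) (YM (pm n g i) (GM g ?y))) + smul (inverse (dm n g i) * dm n g j) (kM (pm n g i) (pm n g j) (GM g ?y))"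
   using Cons.IH u unfolding GM_kM[OF g i j y] by (simp add: XM_simps mult_ac)
  also have "\<dots> = smul (inverse (dm n g i)) (YM (pm n g i) (GM g (XM j ?y)))"
   unfolding GM_XM YM_simps YM_XM qq by (simp add: smul_add mult_ac)
  finally show ?case unfolding s .
 qed
 have e: "single (u, h, v) a = smul a (single (u, h, v) 1)" by simp
 show ?case unfolding e YM_simps(3) GM_simps(3) b by (simp add: mult.commute)
qed (simp_all add: GM_simps YM_simps smul_add)

text \<open>The vectors that vanish once the words in the \<open>x\<^sub>i\<close> and in the \<open>y\<^sub>i\<close> are read in the algebras \<open>S\<^sub>-\<^sub>1\<close>.\<close>

definition L0 :: "wmod set" where
 "L0 = gspan K ({single (a @ [i, j] @ b, g, v) 1 + single (a @ [j, i] @ b, g, v) 1 | a b i j g v.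
   a : lists {..<n} & b : lists {..<n} & i < n & j < n & i ~= j & g : CG (-1) & v : lists {..<n}}
  \<union> {single (u, g, a @ [i, j] @ b) 1 + single (u, g, a @ [j, i] @ b) 1 | a b i j g u.
   a : lists {..<n} & b : lists {..<n} & i < n & j < n & i ~= j & g : CG (-1) & u : lists {..<n}})"

lemma L0_closed: "0 : L0" "x : L0 ==> y : L0 ==> x + y : L0" "x : L0 ==> a : K ==> smul a x : L0"
 "(\<And>i. i : I ==> F i : L0) ==> sum F I : L0" "x : L0 ==> y : L0 ==> x - y : L0"
 unfolding L0_def by (auto intro: gspan.intros gspan_smul gspan_sum gspan_diff)

lemma L0_X: "a : lists {..<n} ==> b : lists {..<n} ==> i < n ==> j < n ==> i ~= j ==> g : CG (-1) ==> v : lists {..<n}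
 ==> single (a @ [i, j] @ b, g, v) 1 + single (a @ [j, i] @ b, g, v) 1 : L0"
 unfolding L0_def by (rule gspan_base1) blast

lemma L0_Y: "a : lists {..<n} ==> b : lists {..<n} ==> i < n ==> j < n ==> i ~= j ==> g : CG (-1) ==> u : lists {..<n}
 ==> single (u, g, a @ [i, j] @ b) 1 + single (u, g, a @ [j, i] @ b) 1 : L0"
 unfolding L0_def by (rule gspan_base1) blast

lemma L0_induct [consumes 1, case_names zero add smul X Y]:
 assumes "x : L0" "Q 0" "\<And>f g. Q f ==> Q g ==> Q (f + g)" "\<And>a f. a : K ==> Q f ==> Q (smul a f)"
  "\<And>a b i j g v. a : lists {..<n} ==> b : lists {..<n} ==> i < n ==> j < n ==> i ~= j ==> g : CG (-1) ==> v : lists {..<n}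
   ==> Q (single (a @ [i, j] @ b, g, v) 1 + single (a @ [j, i] @ b, g, v) 1)"
  "\<And>a b i j g u. a : lists {..<n} ==> b : lists {..<n} ==> i < n ==> j < n ==> i ~= j ==> g : CG (-1) ==> u : lists {..<n}
   ==> Q (single (u, g, a @ [i, j] @ b) 1 + single (u, g, a @ [j, i] @ b) 1)"
 shows "Q x"
 using assms(1) unfolding L0_def
proof induction
 case (gspan_base a b)
 from gspan_base(2) have "Q b"
 proof (elim UnE CollectE exE conjE)
 qed ((hypsubst, (rule assms(5) assms(6); assumption))+)
 then show ?case using assms(4) gspan_base(1) by blast
qed (use assms(2,3) in auto)

lemma XM_L0: "i < n ==> x : L0 ==> XM i x : L0"
proof (rotate_tac 1, induction rule: L0_induct)
 case (X a b k j g v)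
 then show ?case using L0_X[of "i # a" b k j g v] by (simp add: XM_simps)
next
 case (Y a b k j g u)
 then show ?case using L0_Y[of a b k j g "i # u"] by (simp add: XM_simps)
qed (auto simp: XM_simps intro: L0_closed)

lemma GM_L0: "g : CG (-1) ==> x : L0 ==> GM g x : L0"
proof (rotate_tac 1, induction rule: L0_induct)
 case (X a b k j h v)
 note G = GammaD[OF m1 X(8)]
 have lt: "map (pm n g) u : lists {..<n}" if "u : lists {..<n}" for u using that G(6) by auto
 have ne: "pm n g k ~= pm n g j" using X(5) permutes_inj[OF G(1)] by (auto dest: injD)
 have "GM g (single (a @ [k, j] @ b, h, v) 1 + single (a @ [j, k] @ b, h, v) 1)
  = smul (wcoef Xg g (a @ [k, j] @ b)) (single (map (pm n g) a @ [pm n g k, pm n g j] @ map (pm n g) b, g * h, v) 1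
   + single (map (pm n g) a @ [pm n g j, pm n g k] @ map (pm n g) b, g * h, v) 1)"
  by (simp add: GM_simps smul_add mult_ac)
 moreover have "wcoef Xg g (a @ [k, j] @ b) : K" using X by (intro wcoef_K[OF m1]) auto
 ultimately show ?case
  using L0_X[OF lt[OF X(1)] lt[OF X(2)] G(6)[OF X(3)] G(6)[OF X(4)] ne Gamma_closed(1)[OF m1 X(8,6)] X(7)] L0_closed(3) by simp
next
 case (Y a b k j h u)
 note G = GammaD[OF m1 Y(8)]
 have lt: "map (pm n g) u : lists {..<n}" using Y G(6) by auto
 have "GM g (single (u, h, a @ [k, j] @ b) 1 + single (u, h, a @ [j, k] @ b) 1)
  = smul (wcoef Xg g u) (single (map (pm n g) u, g * h, a @ [k, j] @ b) 1 + single (map (pm n g) u, g * h, a @ [j, k] @ b) 1)"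
  by (simp add: GM_simps smul_add)
 then show ?case
  using L0_Y[OF Y(1-5) Gamma_closed(1)[OF m1 Y(8,6)] lt] L0_closed(3) wcoef_K[OF m1 Y(8,7), of Xg] by simp
qed (auto simp: GM_simps intro: L0_closed)

lemma kM_L0: "i < n ==> x : L0 ==> kM i j x : L0"
 unfolding kM_def by (intro L0_closed(3,4) GM_L0 K_mult) (auto intro: rm_facts ac_K)

lemma XX_L0:
 assumes ij: "i < n" "j < n" "i ~= j" and x: "x : MK"
 shows "XM i (XM j x) + XM j (XM i x) : L0"
 using x
proof (induction rule: MK_induct)
 case (add a b)
 have "XM i (XM j (a + b)) + XM j (XM i (a + b)) = (XM i (XM j a) + XM j (XM i a)) + (XM i (XM j b) + XM j (XM i b))"
  by (simp add: XM_simps)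
 then show ?case using L0_closed(2)[OF add(3,4)] by simp
next
 case (single u g v a)
 have "XM i (XM j (single (u, g, v) a)) + XM j (XM i (single (u, g, v) a)) = smul a (single ([] @ [i, j] @ u, g, v) 1 + single ([] @ [j, i] @ u, g, v) 1)"
  by (simp add: XM_simps smul_add)
 then show ?case using L0_closed(3)[OF L0_X[OF _ single(1) ij single(2,3), of "[]"] single(4)] by simp
qed (simp add: XM_simps L0_closed)

text \<open>The Jacobi identities: the relations between the \<open>x\<^sub>i\<close>, and those between the \<open>y\<^sub>i\<close>, impose no new condition.\<close>

lemma Jacobi_X:
 assumes i: "i < n" and ab: "a < n" "b < n" "a ~= b"
 shows "kM i a (XM b x) + smul (qs i a) (XM a (kM i b x)) + (kM i b (XM a x) + smul (qs i b) (XM b (kM i a x))) = 0"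
proof -
 let ?t = "%r. GM (rm i r) x"
 have "kM i a (XM b x) + smul (qs i a) (XM a (kM i b x)) + (kM i b (XM a x) + smul (qs i b) (XM b (kM i a x)))
  = (\<Sum>r\<in>Rf i. smul (bc i r) (smul (ac i r a * dm n (rm i r) b) (XM (transpose i (fst r) b) (?t r)) + smul (qs i a * ac i r b) (XM a (?t r))
   + (smul (ac i r b * dm n (rm i r) a) (XM (transpose i (fst r) a) (?t r)) + smul (qs i b * ac i r a) (XM b (?t r)))))"
  unfolding kM_def XM_simps smul_sum sum.distrib[symmetric] GM_XM
  by (intro sum.cong refl) (simp add: rm_facts(2)[OF i] smul_add mult_ac)
 also have "\<dots> = 0"
 proof (rule sum.neutral, rule ballI)
  fix r assume r: "r : Rf i"
  note R = rm_facts[OF i r]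
  have "smul (ac i r a * dm n (rm i r) b) (XM (transpose i (fst r) b) (?t r)) + smul (qs i a * ac i r b) (XM a (?t r))
   + (smul (ac i r b * dm n (rm i r) a) (XM (transpose i (fst r) a) (?t r)) + smul (qs i b * ac i r a) (XM b (?t r))) = 0"
   unfolding R(4)[OF ab(1)] R(4)[OF ab(2)] using ab R(5)
   by (auto simp: ac_def qs_def transpose_def smul_minus_left)
  then show "smul (bc i r) (smul (ac i r a * dm n (rm i r) b) (XM (transpose i (fst r) b) (?t r)) + smul (qs i a * ac i r b) (XM a (?t r))
   + (smul (ac i r b * dm n (rm i r) a) (XM (transpose i (fst r) a) (?t r)) + smul (qs i b * ac i r a) (XM b (?t r)))) = 0"
   by simp
 qed
 finally show ?thesis .
qed

lemma sum_Rf_restrict: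
 assumes "i < n" "j < n" "i ~= j" "\<And>r. r : Rf i ==> fst r ~= j ==> F r = (0 :: 'b :: comm_monoid_add)"
 shows "(\<Sum>r\<in>Rf i. F r) = (\<Sum>\<epsilon>\<in>Um. F (j, \<epsilon>))"
proof -
 have "(\<Sum>r\<in>Rf i. F r) = (\<Sum>r\<in>{j} \<times> Um. F r)"
 proof (rule sum.mono_neutral_right[OF finite_Rf])
  show "{j} \<times> Um \<subseteq> Rf i" using assms(2,3) by (auto simp: Rf_def)
  show "\<forall>r\<in>Rf i - {j} \<times> Um. F r = 0"
  proof
   fix r assume r: "r : Rf i - {j} \<times> Um"
   then have "fst r ~= j" using assms(3) by (auto simp: Rf_def)
   then show "F r = 0" using assms(4) r by blast
  qed
 qed
 also have "\<dots> = (\<Sum>\<epsilon>\<in>Um. F (j, \<epsilon>))"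
  using sum.cartesian_product[of "%a b. F (a, b)" "Um" "{j}"] by simp
 finally show ?thesis .
qed

lemma refl_swap:
 assumes "i < n" "j < n" "i ~= j" "\<epsilon> : Um"
 shows "rm j (i, - inverse \<epsilon>) = rm i (j, \<epsilon>)"
proof -
 have r: "(j, \<epsilon>) : Rf i" "(i, - inverse \<epsilon>) : Rf j" using assms unity_roots_inverse uminus_root by (auto simp: Rf_def)
 note R = rm_facts[OF assms(1) r(1)] and S = rm_facts[OF assms(2) r(2)]
 show ?thesis
 proof (rule Gamma_eqI[OF m1 S(1) R(1)])
  show "pm n (rm j (i, - inverse \<epsilon>)) = pm n (rm i (j, \<epsilon>))" unfolding R(2) S(2) by (simp add: transpose_commute)
  show "dm n (rm j (i, - inverse \<epsilon>)) k = dm n (rm i (j, \<epsilon>)) k" if "k < n" for k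
   unfolding R(4)[OF that] S(4)[OF that] using assms(3) by auto
 qed
qed

lemma Jacobi_Y:
 assumes ij: "i < n" "j < n" "i ~= j" and k: "k < n" and x: "x : MK"
 shows "smul (qs j k) (kM i k (YM j x)) + YM j (kM i k x) + (smul (qs i k) (kM j k (YM i x)) + YM i (kM j k x)) = 0"
proof -
 have half: "smul (qs j k) (kM i k (YM j x)) + YM j (kM i k x)
  = (\<Sum>\<epsilon>\<in>Um. smul (c\<^sub>1 * ac i (j, \<epsilon>) k) (smul (- qs j k * inverse \<epsilon>) (YM i (GM (rm i (j, \<epsilon>)) x)) + YM j (GM (rm i (j, \<epsilon>)) x)))"
  if ij: "i < n" "j < n" "i ~= j" for i j
 proof -
  let ?F = "%r. smul (bc i r * ac i r k) (smul (qs j k * inverse (dm n (rm i r) j)) (YM (transpose i (fst r) j) (GM (rm i r) x)) + YM j (GM (rm i r) x))"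
  have "smul (qs j k) (kM i k (YM j x)) + YM j (kM i k x) = (\<Sum>r\<in>Rf i. ?F r)"
   unfolding kM_def YM_simps smul_sum sum.distrib[symmetric]
   by (intro sum.cong refl) (simp add: GM_YM[OF rm_facts(1)[OF ij(1)] ij(2) x] rm_facts(2)[OF ij(1)] smul_add mult_ac)
  also have "\<dots> = (\<Sum>\<epsilon>\<in>Um. ?F (j, \<epsilon>))"
  proof (rule sum_Rf_restrict[OF ij])
   fix r assume r: "r : Rf i" "fst r ~= j"
   have "dm n (rm i r) j = 1" unfolding rm_facts(4)[OF ij(1) r(1) ij(2)] using r ij by auto
   then show "?F r = 0" using r ij by (cases "k = j") (auto simp: ac_def transpose_def qs_def smul_minus_left)
  qed
  also have "\<dots> = (\<Sum>\<epsilon>\<in>Um. smul (c\<^sub>1 * ac i (j, \<epsilon>) k) (smul (- qs j k * inverse \<epsilon>) (YM i (GM (rm i (j, \<epsilon>)) x)) + YM j (GM (rm i (j, \<epsilon>)) x)))"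
  proof (intro sum.cong refl)
   fix \<epsilon> assume e: "\<epsilon> : Um"
   have r: "(j, \<epsilon>) : Rf i" using e ij by (auto simp: Rf_def)
   have "dm n (rm i (j, \<epsilon>)) j = - \<epsilon>" unfolding rm_facts(4)[OF ij(1) r ij(2)] using ij by auto
   then show "?F (j, \<epsilon>) = smul (c\<^sub>1 * ac i (j, \<epsilon>) k) (smul (- qs j k * inverse \<epsilon>) (YM i (GM (rm i (j, \<epsilon>)) x)) + YM j (GM (rm i (j, \<epsilon>)) x))"
    using ij by (simp add: bc_def)
  qed
  finally show ?thesis .
 qed
 have "smul (qs i k) (kM j k (YM i x)) + YM i (kM j k x)
  = (\<Sum>\<epsilon>\<in>Um. smul (c\<^sub>1 * ac j (i, \<epsilon>) k) (smul (- qs i k * inverse \<epsilon>) (YM j (GM (rm j (i, \<epsilon>)) x)) + YM i (GM (rm j (i, \<epsilon>)) x)))"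
  using half[of j i] ij by simp
 also have "\<dots> = (\<Sum>\<epsilon>\<in>Um. smul (c\<^sub>1 * ac j (i, - inverse \<epsilon>) k) (smul (qs i k * \<epsilon>) (YM j (GM (rm i (j, \<epsilon>)) x)) + YM i (GM (rm i (j, \<epsilon>)) x)))"
 proof (rule sum.reindex_bij_witness[where i = "%\<epsilon>. - inverse \<epsilon>" and j = "%\<epsilon>. - inverse \<epsilon>"])
  fix \<epsilon> assume e: "\<epsilon> : Um"
  show "- inverse \<epsilon> : Um" "- inverse \<epsilon> : Um" using e uminus_root unity_roots_inverse by auto
  show "smul (c\<^sub>1 * ac j (i, - inverse (- inverse \<epsilon>)) k) (smul (qs i k * - inverse \<epsilon>) (YM j (GM (rm i (j, - inverse \<epsilon>)) x)) + YM i (GM (rm i (j, - inverse \<epsilon>)) x))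
   = smul (c\<^sub>1 * ac j (i, \<epsilon>) k) (smul (- qs i k * inverse \<epsilon>) (YM j (GM (rm j (i, \<epsilon>)) x)) + YM i (GM (rm j (i, \<epsilon>)) x))"
   using refl_swap[of j i \<epsilon>] ij e by simp
 qed auto
 finally have other: "smul (qs i k) (kM j k (YM i x)) + YM i (kM j k x)
  = (\<Sum>\<epsilon>\<in>Um. smul (c\<^sub>1 * ac j (i, - inverse \<epsilon>) k) (smul (qs i k * \<epsilon>) (YM j (GM (rm i (j, \<epsilon>)) x)) + YM i (GM (rm i (j, \<epsilon>)) x)))" .
 show ?thesis
  unfolding half[OF ij] other sum.distrib[symmetric]
 proof (rule sum.neutral, rule ballI)
  fix \<epsilon> assume e: "\<epsilon> : Um"
  then have nz: "\<epsilon> ~= 0" by (rule root_nonzero)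
  consider "k = i" | "k = j" | "k ~= i" "k ~= j" by blast
  then show "smul (c\<^sub>1 * ac i (j, \<epsilon>) k) (smul (- qs j k * inverse \<epsilon>) (YM i (GM (rm i (j, \<epsilon>)) x)) + YM j (GM (rm i (j, \<epsilon>)) x))
   + smul (c\<^sub>1 * ac j (i, - inverse \<epsilon>) k) (smul (qs i k * \<epsilon>) (YM j (GM (rm i (j, \<epsilon>)) x)) + YM i (GM (rm i (j, \<epsilon>)) x)) = 0"
   by cases (use ij nz in \<open>auto simp: ac_def qs_def smul_add smul_diff smul_minus_left mult.assoc\<close>)
 qed
qed

lemma YM_L0_lift:
 assumes k: "k < n" and z: "z : L0" "YM k z : L0" and a: "a : lists {..<n}"
 shows "foldr XM a z : L0 & YM k (foldr XM a z) : L0"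
 using a
proof (induction a)
 case (Cons j a)
 then have "j < n" "foldr XM a z : L0" "YM k (foldr XM a z) : L0" by auto
 then show ?case using k by (auto simp: YM_XM qs_def intro!: L0_closed(2,3) XM_L0 kM_L0)
qed (use z in simp)

lemma foldr_XM: "foldr XM a (single (u, g, v) b) = single (a @ u, g, v) b" "foldr XM a (x + y) = foldr XM a x + foldr XM a y"
 by (induction a) (simp_all add: XM_simps)

lemma YM_L0: "k < n ==> x : L0 ==> YM k x : L0"
proof (rotate_tac 1, induction rule: L0_induct)
 case (X a b i j g v)
 let ?y = "single (b, g, v) (1::complex)"
 let ?z = "XM i (XM j ?y) + XM j (XM i ?y)"
 have y: "?y : MK" using X by (auto simp: MB_def intro!: FM_single)
 have z: "?z : L0" using XX_L0[OF X(3-5) y] .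
 have "YM k ?z = smul (qs k i * qs k j) (XM i (XM j (YM k ?y)) + XM j (XM i (YM k ?y)))
   + (kM k i (XM j ?y) + smul (qs k i) (XM i (kM k j ?y)) + (kM k j (XM i ?y) + smul (qs k j) (XM j (kM k i ?y))))"
  by (simp add: YM_XM YM_simps XM_simps smul_add mult_ac)
 also have "\<dots> = smul (qs k i * qs k j) (XM i (XM j (YM k ?y)) + XM j (XM i (YM k ?y)))"
  unfolding Jacobi_X[OF X(8) X(3-5)] by simp
 also have "\<dots> : L0" using XX_L0[OF X(3-5) YM_MK[OF X(8) y]] by (rule L0_closed(3)) (auto simp: qs_def)
 finally have "YM k (foldr XM a ?z) : L0" using YM_L0_lift[OF X(8) z _ X(1)] by blast
 then show ?case by (simp only: foldr_XM XM_simps append_Cons append_Nil)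
next
 case (Y a b i j g u)
 let ?z = "single ([], g, a @ [i, j] @ b) 1 + single ([], g, a @ [j, i] @ b) (1::complex)"
 note G = GammaD[OF m1 Y(6)]
 let ?k = "inv_into UNIV (pm n g) k"
 have k: "?k < n" using permutes_in_image[OF permutes_inv[OF G(1)], of k] Y(8) by simp
 have z: "?z : L0" using L0_Y[OF Y(1-6), of "[]"] by simp
 have "YM k ?z = smul (dm n g ?k) (single ([], g, (?k # a) @ [i, j] @ b) 1 + single ([], g, (?k # a) @ [j, i] @ b) 1)"
  by (simp add: YM_simps smul_add)
 also have "\<dots> : L0"
  using L0_Y[of "?k # a" b i j g "[]"] Y k G(2)[OF k] roots_K by (intro L0_closed(3)) auto
 finally have "YM k (foldr XM u ?z) : L0" using YM_L0_lift[OF Y(8) z _ Y(7)] by blast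
 then show ?case by (simp only: foldr_XM append_Nil2)
qed (auto simp: YM_simps intro: L0_closed)

lemma YY_L0:
 assumes ij: "i < n" "j < n" "i ~= j" and x: "x : MK"
 shows "YM i (YM j x) + YM j (YM i x) : L0"
 using x
proof (induction rule: MK_induct)
 case (add a b)
 have "YM i (YM j (a + b)) + YM j (YM i (a + b)) = (YM i (YM j a) + YM j (YM i a)) + (YM i (YM j b) + YM j (YM i b))"
  by (simp add: YM_simps)
 then show ?case using L0_closed(2)[OF add(3,4)] by simp
next
 case (single u g v a)
 note G = GammaD[OF m1 single(2)]
 have "YM i (YM j (single (u, g, v) 1)) + YM j (YM i (single (u, g, v) 1)) : L0"
  using single(1)
 proof (induction u)
  case Nil
  let ?k = "%i. inv_into UNIV (pm n g) i"
  have k: "?k i < n" "?k j < n" using permutes_in_image[OF permutes_inv[OF G(1)]] ij by auto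
  have ne: "?k i ~= ?k j" using ij permutes_inverses(1)[OF G(1)] by metis
  have "YM i (YM j (single ([], g, v) 1)) + YM j (YM i (single ([], g, v) 1))
   = smul (dm n g (?k i) * dm n g (?k j)) (single ([], g, [] @ [?k i, ?k j] @ v) 1 + single ([], g, [] @ [?k j, ?k i] @ v) 1)"
   by (simp add: YM_simps smul_add mult.commute)
  also have "\<dots> : L0"
   using L0_Y[of "[]" v "?k i" "?k j" g "[]"] single k ne G(2)[OF k(1)] G(2)[OF k(2)] roots_K
   by (intro L0_closed(3)) (auto intro!: K_mult)
  finally show ?case .
 next
  case (Cons k u)
  let ?y = "single (u, g, v) (1::complex)"
  have k: "k < n" and u: "u : lists {..<n}" using Cons by auto
  have y: "?y : MK" using u single by (auto simp: MB_def intro!: FM_single)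
  have "YM i (YM j (XM k ?y)) + YM j (YM i (XM k ?y)) = smul (qs j k * qs i k) (XM k (YM i (YM j ?y) + YM j (YM i ?y)))
   + (smul (qs j k) (kM i k (YM j ?y)) + YM j (kM i k ?y) + (smul (qs i k) (kM j k (YM i ?y)) + YM i (kM j k ?y)))"
   by (simp add: YM_XM YM_simps XM_simps smul_add mult_ac)
  also have "\<dots> = smul (qs j k * qs i k) (XM k (YM i (YM j ?y) + YM j (YM i ?y)))"
   unfolding Jacobi_Y[OF ij k y] by simp
  also have "\<dots> : L0"
   using Cons u by (intro L0_closed(3) XM_L0[OF k]) (auto simp: qs_def)
  finally show ?case by (simp add: XM_simps)
 qed
 then have "smul a (YM i (YM j (single (u, g, v) 1)) + YM j (YM i (single (u, g, v) 1))) : L0" using single(4) by (rule L0_closed(3))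
 then show ?case by (simp add: YM_simps smul_add)
qed (simp add: YM_simps L0_closed)

definition opM :: "gen => wmod => wmod" where
 "opM a = (case a of Xg i => XM i | Yg i => YM i | Gr g => GM g)"

definition act :: "falg => wmod => wmod" where
 "act f x = lin (%w. foldr opM w x) f"

lemma opM_simps:
 "opM a (x + y) = opM a x + opM a y" "opM a (smul b x) = smul b (opM a x)" "opM a 0 = 0"
 by (cases a; simp add: opM_def XM_simps YM_simps GM_simps)+

lemma foldr_opM_simps:
 "foldr opM w (x + y) = foldr opM w x + foldr opM w y" "foldr opM w (smul b x) = smul b (foldr opM w x)" "foldr opM w 0 = 0"
 by (induction w) (simp_all add: opM_simps)

lemma foldr_opM_lin: "foldr opM w (lin \<phi> f) = lin (%u. foldr opM w (\<phi> u)) f"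
proof -
 have *: "foldr opM w (\<Sum>i\<in>I. h i) = (\<Sum>i\<in>I. foldr opM w (h i))" for I and h :: "'x => wmod"
  by (induction I rule: infinite_finite_induct) (simp_all add: foldr_opM_simps)
 show ?thesis by (simp add: lin_def foldr_opM_simps *)
qed

lemma act_simps:
 "act (f + g) x = act f x + act g x" "act (f - g) x = act f x - act g x" "act (smul a f) x = smul a (act f x)"
 "act f (x + y) = act f x + act f y" "act f (smul a x) = smul a (act f x)" "act 0 x = 0"
 "act (\<Sum>i\<in>I. h i) x = (\<Sum>i\<in>I. act (h i) x)" "act (single w b) x = smul b (foldr opM w x)"
 by (simp_all add: act_def lin_simps foldr_opM_simps lin_fun_add lin_fun_smul)

lemma act_mult: "act (f * g) x = act f (act g x)"
 unfolding act_def mult_lin[of f g] lin_lin foldr_opM_lin by (simp add: lin_lin)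

lemma foldr_opM_closed:
 assumes "w : lists (Hg (-1))"
 shows "x : MK ==> foldr opM w x : MK" "x : L0 ==> foldr opM w x : L0"
 using assms
 by (induction w) (auto simp: opM_def H_gens_def XM_MK YM_MK GM_MK XM_L0 YM_L0 GM_L0)

lemma act_MK: "f : FH (-1) ==> x : MK ==> act f x : MK"
 unfolding act_def by (rule FM_lin[where S = "lists (Hg (-1))"]) (auto intro: foldr_opM_closed)

lemma act_H_rels:
 assumes r: "r : HR (-1)" and x: "x : MK"
 shows "act r x : L0"
proof -
 consider (S) v i j where "XY v" "r = single [v i, v j] 1 - single [v j, v i] (-1)" "i < n" "j < n" "i ~= j"
  | (one) "r = single [Gr (1\<^sub>m n)] 1 - single [] 1"
  | (mult) g h where "g : CG (-1)" "h : CG (-1)" "r = single [Gr g, Gr h] 1 - single [Gr (g * h)] 1"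
  | (act) g v i where "g : CG (-1)" "XY v" "i < n"
    "r = single [Gr g, v i] 1 - gen_action n W g (v i) * single [Gr g] 1"
  | (comm) i j where "i < n" "j < n" "r = single [Yg i, Xg j] 1 - single [Xg j, Yg i] (if i = j then 1 else -1) - \<kappa> (-1) i j"
  using r unfolding H_rels_def S_rels_def Gamma_mult_one free_algebra_sel by blast
 then show ?thesis
 proof cases
  case S
  then show ?thesis using XX_L0[OF S(3-5) x] YY_L0[OF S(3-5) x] by (auto simp: act_simps opM_def smul_minus_left)
 next
  case one
  then show ?thesis using GM_one[OF x] by (simp add: act_simps opM_def L0_closed)
 next
  case mult
  then show ?thesis using GM_GM[OF mult(1,2) x] by (simp add: act_simps opM_def L0_closed)
 next
  case act
  then have "act r x = 0"
   using GM_XM[of g i x] GM_YM[OF act(1,3) x] by (auto simp: gen_action_v[OF m1 act(1-3)] act_simps opM_def)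
  then show ?thesis by (simp add: L0_closed)
 next
  case comm
  have "act (\<kappa> (-1) i j) x = kM i j x"
   unfolding kappa_Rf[OF comm(1,2)] act_simps kM_def by (simp add: opM_def)
  then have "act r x = 0" unfolding comm(3) using YM_XM[of i j x] by (simp add: act_simps opM_def qs_def)
  then show ?thesis by (simp add: L0_closed)
 qed
qed

text \<open>Hence the braided algebra acts on the quotient by \<^const>\<open>L0\<close>; this is the Poincare-Birkhoff-Witt property.\<close>

lemma act_H_ideal:
 assumes f: "f : HI (-1)" and x: "x : MK"
 shows "act f x : L0"
 using H_rels_FA[OF m1] f unfolding H_ideal_def
proof (induction rule: relI_induct)
 case (base a u r v)
 have "foldr opM v x : MK" using foldr_opM_closed(1)[OF base(4) x] .
 then have "foldr opM u (act r (foldr opM v x)) : L0" by (intro foldr_opM_closed(2)[OF base(2)] act_H_rels[OF base(3)])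
 then show ?case using base(1) by (simp add: act_mult act_simps mult.assoc L0_closed(3))
qed (simp_all add: act_simps L0_closed)

end

section \<open>Normality of invariants\<close>

text \<open>The homomorphism of free algebras with given values on the generators.\<close>

definition hm :: "('a => ('b list \<Rightarrow>\<^sub>0 complex)) => ('a list \<Rightarrow>\<^sub>0 complex) => ('b list \<Rightarrow>\<^sub>0 complex)" where
 "hm \<phi> = lin (%w. prod_list (map \<phi> w))"

lemma hm_simps:
 "hm \<phi> (f + g) = hm \<phi> f + hm \<phi> g" "hm \<phi> (f - g) = hm \<phi> f - hm \<phi> g" "hm \<phi> (smul a f) = smul a (hm \<phi> f)"
 "hm \<phi> 0 = 0" "hm \<phi> (f * g) = hm \<phi> f * hm \<phi> g" "hm \<phi> (single [x] a) = smul a (\<phi> x)" "hm \<phi> 1 = 1"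
proof -
 show "hm \<phi> (f * g) = hm \<phi> f * hm \<phi> g" unfolding hm_def by (rule lin_hom) simp
 have "hm \<phi> (single [] 1) = 1" by (simp add: hm_def)
 then show "hm \<phi> 1 = 1" by (simp only: single_Nil_one)
qed (simp_all add: hm_def lin_simps)

lemma hm_prod_list: "hm \<phi> (prod_list xs) = prod_list (map (hm \<phi>) xs)"
 by (induction xs) (simp_all add: hm_simps)

lemma hm_hm: "hm \<phi> (hm \<psi> f) = hm (%a. hm \<phi> (\<psi> a)) f"
proof -
 have "hm \<phi> (hm \<psi> f) = lin (%w. hm \<phi> (prod_list (map \<psi> w))) f" by (simp add: hm_def lin_lin)
 also have "\<dots> = hm (%a. hm \<phi> (\<psi> a)) f"
  unfolding hm_prod_list map_map o_def hm_def[of "%a. hm \<phi> (\<psi> a)"] ..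
 finally show ?thesis .
qed

lemma prod_list_single: "prod_list (map (%a. single [\<rho> a] (e a)) w) = single (map \<rho> w) (\<Prod>a\<leftarrow>w. e a :: complex)"
 by (induction w) (simp_all add: single_Nil_one)

lemma hm_word: "hm (%a. single [\<rho> a] (e a)) (single w b) = single (map \<rho> w) (b * (\<Prod>a\<leftarrow>w. e a))"
 by (simp add: hm_def prod_list_single)

lemma hm_id: "hm (%a. single [a] 1) f = f"
proof -
 have "prod_list (map (%a. single [a] (1::complex)) w) = single w 1" for w :: "'a list"
  by (induction w) (simp_all add: single_Nil_one)
 then show ?thesis by (simp add: hm_def)
qed

context subK
begin

lemma hm_cong:
 assumes f: "f : FA K A" and "\<And>a. a : A ==> \<phi> a = \<psi> a"
 shows "hm \<phi> f = hm \<psi> f"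
 unfolding hm_def
proof (rule lin_cong)
 fix w assume "w : keys f"
 then have "w : lists A" using f by (auto simp: FM_def)
 then show "prod_list (map \<phi> w) = prod_list (map \<psi> w)" by (induction w) (auto simp: assms(2))
qed

lemmas hm_FA = lin_prod_list_FA[folded hm_def]
lemmas hm_relI = relI_hom[folded hm_def]

end

fun gen_index :: "gen => nat" where
 "gen_index (Xg i) = i" | "gen_index (Yg i) = i" | "gen_index (Gr g) = 0"

abbreviation emb :: "(nat => gen) => nalg => falg" where
 "emb v \<equiv> hm (%j. single [v j] 1)"

abbreviation mo :: "(nat => nat) => (nat => complex) => nalg => nalg" where
 "mo \<rho> e \<equiv> hm (%j. single [\<rho> j] (e j))"

text \<open>\<open>eta i\<close> is the sign rule for moving \<open>x\<^sub>i\<close> or \<open>y\<^sub>i\<close> past a polynomial.\<close>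

abbreviation eta :: "nat => nalg => nalg" where
 "eta i \<equiv> mo (%j. j) (qs i)"

lemma emb_word: "emb v (single w b) = single (map v w) b"
 by (simp add: hm_word map_replicate_const)

lemma qs_sq [simp]: "qs i j * qs i j = 1" "qs i j * (qs i j * x) = x"
 by (simp_all add: qs_def)

lemma eta_eta: "eta i (eta i f) = f"
 by (simp add: hm_hm hm_simps hm_id)

context cher
begin

abbreviation FN :: "nalg set" where "FN \<equiv> FA K {..<n}"

definition NR :: "nalg set" where
 "NR = {single [i, j] 1 + single [j, i] 1 | i j. i < n & j < n & i ~= j}"

text \<open>The relations of \<open>S\<^sub>-\<^sub>1\<close> on words in the indices, which allows to treat the \<open>x\<^sub>i\<close> and the \<open>y\<^sub>i\<close> simultaneously.\<close>

definition NI :: "nalg set" where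
 "NI = relation_ideal K {..<n} NR"

lemma NR_FA: "NR \<subseteq> FN"
 by (auto simp: NR_def intro!: FM_add FM_single)

lemmas NI_props = relI_props[OF NR_FA, folded NI_def]

lemma NI_cong: "f - g : NI ==> g - h : NI ==> f - h : NI"
 using NI_props(4)[of "f - g" "g - h"] by simp

lemma NI_sym: "f - g : NI ==> g - f : NI"
 using NI_props(5)[OF NI_props(3), of "f - g"] by simp

lemma qs_in_K [simp]: "qs i j : K"
 by (simp add: qs_def)

lemma FN_word: "i < n ==> a : K ==> single [i] a : FN"
 by (auto intro!: FM_single)

lemma mo_FN: "(\<And>j. j < n ==> \<rho> j < n) ==> (\<And>j. j < n ==> e j : K) ==> f : FN ==> mo \<rho> e f : FN"
 by (rule hm_FA[where A = "{..<n}"]) (auto intro!: FM_single)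

lemma eta_FN: "f : FN ==> eta i f : FN"
 by (rule mo_FN) auto

lemma swap_NI: "i < n ==> j < n ==> i ~= j ==> single [i, j] 1 + single [j, i] 1 : NI"
 by (rule NI_props(2)) (auto simp: NR_def)

lemma mo_NI:
 assumes "\<rho> permutes {..<n}" "\<And>j. j < n ==> e j : K" "f : NI"
 shows "mo \<rho> e f : NI"
 unfolding NI_def
proof (rule hm_relI[OF NR_FA NR_FA _ _ assms(3)[unfolded NI_def]])
 have lt: "\<rho> j < n" if "j < n" for j using permutes_in_image[OF assms(1), of j] that by simp
 show "single [\<rho> a] (e a) : FN" if "a : {..<n}" for a using that lt assms(2) by (auto intro!: FM_single)
 fix r assume "r : NR"
 then obtain i j where r: "r = single [i, j] 1 + single [j, i] 1" "i < n" "j < n" "i ~= j" by (auto simp: NR_def)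
 have "mo \<rho> e r = smul (e i * e j) (single [\<rho> i, \<rho> j] 1 + single [\<rho> j, \<rho> i] 1)"
  unfolding r(1) hm_simps hm_word by (simp add: smul_add mult.commute)
 also have "\<dots> : NI"
  using lt r assms permutes_inj[OF assms(1)] by (intro NI_props(6) swap_NI K_mult) (auto dest: injD)
 finally show "mo \<rho> e r : relation_ideal K {..<n} NR" by (simp add: NI_def)
qed

lemma eta_NI: "f : NI ==> eta i f : NI"
 using mo_NI[OF permutes_id, of "qs i" f] by (simp add: id_def)

lemma emb_FA: "f : FN ==> emb v f : FS v"
 by (rule hm_FA[where A = "{..<n}"]) (auto simp: S_gens_def intro!: FM_single)

lemma index_emb: "XY v ==> hm (%a. single [gen_index a] 1) (emb v f) = f"
 by (auto simp: hm_hm hm_simps hm_id)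

lemma emb_index:
 assumes "XY v" "f : FS v"
 shows "emb v (hm (%a. single [gen_index a] 1) f) = f" "hm (%a. single [gen_index a] 1) f : FN"
proof -
 have "emb v (hm (%a. single [gen_index a] 1) f) = hm (%a. single [a] 1) f"
  unfolding hm_hm by (rule hm_cong[OF assms(2)]) (use assms(1) in \<open>auto simp: S_gens_def hm_simps\<close>)
 then show "emb v (hm (%a. single [gen_index a] 1) f) = f" by (simp add: hm_id)
 show "hm (%a. single [gen_index a] 1) f : FN"
  by (rule hm_FA[OF _ assms(2)]) (use assms(1) in \<open>auto simp: S_gens_def intro!: FM_single\<close>)
qed

lemma emb_NI_iff:
 assumes v: "XY v"
 shows "emb v f : SI (-1) v \<longleftrightarrow> f : NI"
proof
 assume f: "f : NI"
 show "emb v f : SI (-1) v"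
  unfolding S_ideal_def
 proof (rule hm_relI[OF NR_FA S_rels_FA[OF m1] _ _ f[unfolded NI_def]])
  show "single [v a] 1 : FS v" if "a : {..<n}" for a using that by (auto simp: S_gens_def intro!: FM_single)
  fix r assume "r : NR"
  then obtain i j where r: "r = single [i, j] 1 + single [j, i] 1" "i < n" "j < n" "i ~= j" by (auto simp: NR_def)
  have "emb v r = single [v i, v j] 1 - single [v j, v i] (-1)"
   unfolding r(1) hm_simps emb_word by (simp add: single_uminus)
  then have "emb v r : S_rels n (-1) v" using r by (auto simp: S_rels_def)
  then show "emb v r : relation_ideal K (Sg v) (S_rels n (-1) v)" by (rule relI_props(2)[OF S_rels_FA[OF m1]])
 qed
next
 assume f: "emb v f : SI (-1) v"
 have "hm (%a. single [gen_index a] 1) (emb v f) : NI"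
  unfolding NI_def
 proof (rule hm_relI[OF S_rels_FA[OF m1] NR_FA _ _ f[unfolded S_ideal_def]])
  show "single [gen_index a] 1 : FN" if "a : Sg v" for a using that v by (auto simp: S_gens_def intro!: FM_single)
  fix r assume "r : S_rels n (-1) v"
  then obtain i j where r: "r = single [v i, v j] 1 - single [v j, v i] (-1)" "i < n" "j < n" "i ~= j" by (auto simp: S_rels_def)
  have "hm (%a. single [gen_index a] 1) r = single [i, j] 1 + single [j, i] 1"
   unfolding r(1) hm_simps hm_word using v by (auto simp: single_uminus)
  then show "hm (%a. single [gen_index a] 1) r : relation_ideal K {..<n} NR"
   using swap_NI[OF r(2-4)] by (simp add: NI_def)
 qed
 then show "f : NI" by (simp only: index_emb[OF v])
qed

lemma gen_past: "j < n ==> f : FN ==> single [j] 1 * f - eta j f * single [j] 1 : NI"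
proof (rotate_tac 1, induction rule: FM_induct)
 case (single w a)
 from single(1) have "single [j] 1 * single w 1 - eta j (single w 1) * single [j] 1 : NI"
 proof (induction w)
  case (Cons k w)
  let ?x = "%i. single [i] (1::complex)" and ?w = "single w (1::complex)"
  have k: "k < n" and w: "w : lists {..<n}" using Cons by auto
  have wF: "?w : FN" using w by (auto intro!: FM_single)
  have kw: "single (k # w) 1 = ?x k * ?w" by simp
  have "?x j * ?x k - smul (qs j k) (?x k * ?x j) : NI"
   using swap_NI[OF single(3) k] by (cases "j = k") (simp_all add: smul_minus_left NI_props(3) single_uminus)
  then have "(?x j * ?x k - smul (qs j k) (?x k * ?x j)) * ?w + smul (qs j k) (?x k * (?x j * ?w - eta j ?w * ?x j)) : NI"
   using Cons k wF by (intro NI_props(4,6,7,8) FN_word) auto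
  moreover have "(?x j * ?x k - smul (qs j k) (?x k * ?x j)) * ?w + smul (qs j k) (?x k * (?x j * ?w - eta j ?w * ?x j))
   = ?x j * (?x k * ?w) - eta j (?x k * ?w) * ?x j"
   unfolding hm_simps by (simp add: algebra_simps smul_mult_left smul_diff smul_mult_right del: mult_words) (simp add: smul_mult_left[symmetric])
  ultimately show ?case unfolding kw by simp
 qed (simp add: hm_word NI_props(3) single_Nil_one hm_simps)
 from NI_props(6)[OF this single(2)] show ?case
  by (simp add: hm_word smul_diff mult.commute)
qed (simp_all add: NI_props(3,4) hm_simps distrib_left distrib_right add_diff_add)

text \<open>The data \<open>(l, \<epsilon>)\<close> of a reflection involving the index \<open>i\<close>: \<open>em\<close> are its matrix entries, \<open>vr\<close> spans
 the image of \<open>1 - r\<close> up to signs, and \<open>DD\<close> is the skew derivation with \<open>zr * DD f = \<eta>\<^sub>i(f) vr - vr r(f)\<close>, the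
 analogue of a divided difference (Dunkl) operator.\<close>

definition em :: "nat => nat \<times> complex => nat => complex" where
 "em i r k = (if fst r = i then (if k = i then snd r else 1)
  else if k = i then inverse (snd r) else if k = fst r then - snd r else 1)"

abbreviation mor :: "nat => nat \<times> complex => nalg => nalg" where
 "mor i r \<equiv> mo (transpose i (fst r)) (em i r)"

definition vr :: "nat => nat \<times> complex => nalg" where
 "vr i r = (if fst r = i then single [i] 1 else single [i] 1 + single [fst r] (inverse (snd r)))"

definition zr :: "nat => nat \<times> complex => nalg" where
 "zr i r = (if fst r = i then single [i, i] (1 - snd r) else single [i, i] 1 - single [fst r, fst r] (inverse (snd r) * inverse (snd r)))"

definition okr :: "nat => nat \<times> complex => bool" where
 "okr i r \<longleftrightarrow> i < n & fst r < n & snd r : K & snd r ~= 0 & (fst r = i --> snd r ~= 1)"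

primrec DD :: "nat => nat \<times> complex => nat list => nalg" where
 "DD i r [] = 0"
| "DD i r (k # u) = smul (qs i k) (single [k] 1 * DD i r u) + smul (ac i r k) (mor i r (single u 1))"

lemma okr_facts:
 assumes "okr i r"
 shows "vr i r : FN" "zr i r : FN" "ac i r k : K" "em i r k : K" "f : FN ==> mor i r f : FN"
proof -
 show "vr i r : FN" "zr i r : FN"
  using assms by (auto simp: okr_def vr_def zr_def intro!: FM_single FM_add FM_diff)
 show "ac i r k : K" "em i r k : K" for k using assms by (auto simp: okr_def ac_def em_def)
 then show "f : FN ==> mor i r f : FN"
  using assms by (intro mo_FN) (auto simp: okr_def transpose_def)
qed

lemma DD_FN: "okr i r ==> u : lists {..<n} ==> DD i r u : FN"
 by (induction u) (auto intro!: FM_add FM_smul FA_mult FN_word okr_facts FM_single)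

lemma zr_central:
 assumes "okr i r" "f : FN"
 shows "f * zr i r - zr i r * f : NI"
 using assms(2)
proof (induction rule: FM_induct)
 case (single w a)
 from single(1) have "single w 1 * zr i r - zr i r * single w 1 : NI"
 proof (induction w)
  case (Cons k w)
  have k: "k < n" and wF: "single w 1 : FN" using Cons by (auto intro!: FM_single)
  have "eta k (zr i r) = zr i r" by (simp add: zr_def hm_simps hm_word)
  then have "single [k] 1 * (single w 1 * zr i r - zr i r * single w 1) + (single [k] 1 * zr i r - zr i r * single [k] 1) * single w 1 : NI"
   using Cons gen_past[OF k okr_facts(2)[OF assms(1)]] k wF by (intro NI_props(4,7,8) FN_word) auto
  moreover have kw: "single (k # w) 1 = single [k] 1 * single w (1::complex)" by simp
  ultimately show ?case unfolding kw by (simp add: algebra_simps del: mult_words)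
 qed (simp add: single_Nil_one NI_props(3))
 moreover have "single w a = smul a (single w 1)" by simp
 ultimately show ?case
  using NI_props(6)[OF _ single(2)] by (simp only: smul_mult_left smul_mult_right smul_diff[symmetric])
qed (simp_all add: NI_props(3,4) distrib_left distrib_right add_diff_add)

lemma zr_ac:
 assumes ok: "okr i r" and k: "k < n"
 shows "smul (ac i r k) (zr i r) - (smul (qs i k) (single [k] 1 * vr i r) - vr i r * single [transpose i (fst r) k] (em i r k)) : NI"
proof -
 have swap: "k ~= l ==> l < n ==> a : K ==> single [k, l] a + single [l, k] a : NI" for l a
  using NI_props(6)[OF swap_NI[OF k, of l], of a] by (simp add: smul_add)
 consider "k = i" | "k ~= i" "k = fst r" | "k ~= i" "k ~= fst r" by blast
 then show ?thesis
 proof cases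
  case 1
  then show ?thesis using ok
   by (auto simp: okr_def ac_def em_def vr_def zr_def transpose_def algebra_simps NI_props(3) single_diff single_add smul_add smul_diff)
 next
  case 2
  have e: "snd r * (inverse (snd r) * inverse (snd r)) = inverse (snd r)" using ok by (auto simp: okr_def)
  show ?thesis using ok 2
   by (auto simp: e okr_def ac_def em_def vr_def zr_def transpose_def algebra_simps NI_props(3) single_diff single_add smul_add smul_diff smul_minus_left single_uminus)
 next
  case 3
  have "single [k, i] 1 + single [i, k] 1 : NI" using swap[of i 1] 3 ok by (simp add: okr_def)
  moreover have "single [k, fst r] (inverse (snd r)) + single [fst r, k] (inverse (snd r)) : NI"
   using swap[of "fst r"] 3 ok by (auto simp: okr_def)
  ultimately show ?thesis using 3 NI_props(4)
   by (fastforce simp: ac_def em_def vr_def transpose_def algebra_simps smul_add smul_diff smul_minus_left)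
 qed
qed

text \<open>By induction on words: both sides are skew derivations, and \<open>zr_ac\<close> compares them on the generators.\<close>

lemma zr_DD:
 assumes ok: "okr i r" and f: "f : FN"
 shows "zr i r * lin (DD i r) f - (eta i f * vr i r - vr i r * mor i r f) : NI"
 using f
proof (induction rule: FM_induct)
 case (single w a)
 note F = okr_facts[OF ok]
 from single(1) have "zr i r * DD i r w - (eta i (single w 1) * vr i r - vr i r * mor i r (single w 1)) : NI"
 proof (induction w)
  case (Cons k w)
  let ?x = "single [k] (1::complex)" and ?w = "single w (1::complex)" and ?q = "qs i k"
  have k: "k < n" and w: "w : lists {..<n}" using Cons by auto
  have wF: "?w : FN" using w by (auto intro!: FM_single)
  have kw: "single (k # w) 1 = ?x * ?w" by simp
  let ?y = "single [transpose i (fst r) k] (em i r k)"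
  have "smul ?q (?x * (zr i r * DD i r w - (eta i ?w * vr i r - vr i r * mor i r ?w)))
    + (smul (ac i r k) (zr i r) - (smul ?q (?x * vr i r) - vr i r * ?y)) * mor i r ?w
    - smul ?q ((?x * zr i r - zr i r * ?x) * DD i r w) : NI"
   by (intro NI_props(4,5,6,7,8) zr_ac[OF ok k] zr_central[OF ok] Cons FN_word k DD_FN[OF ok] w F wF qs_in_K) auto
  also have "smul ?q (?x * (zr i r * DD i r w - (eta i ?w * vr i r - vr i r * mor i r ?w)))
    + (smul (ac i r k) (zr i r) - (smul ?q (?x * vr i r) - vr i r * ?y)) * mor i r ?w
    - smul ?q ((?x * zr i r - zr i r * ?x) * DD i r w)
   = zr i r * (smul ?q (?x * DD i r w) + smul (ac i r k) (mor i r ?w)) - (smul ?q ?x * eta i ?w * vr i r - vr i r * (?y * mor i r ?w))"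
   by (simp add: algebra_simps smul_mult_left smul_mult_right smul_add smul_diff del: mult_words smul_simps)
  finally show ?case unfolding kw hm_simps DD.simps by simp
 qed (simp add: single_Nil_one hm_simps NI_props(3))
 moreover have "single w a = smul a (single w 1)" "lin (DD i r) (single w 1) = DD i r w" by simp_all
 ultimately show ?case
  using NI_props(6)[OF _ single(2)] by (simp only: lin_smul hm_simps smul_mult_left smul_mult_right smul_diff[symmetric])
next
 case (add f g)
 from NI_props(4)[OF add(3,4)] show ?case by (simp add: lin_add hm_simps algebra_simps)
qed (simp add: NI_props(3) hm_simps)

text \<open>Sorting the letters and recording the sign of the sorting permutation computes normal forms modulo \<^const>\<open>NI\<close>.\<close>

definition nf :: "nalg => nalg" where
 "nf = lin (%w. single (sort w) (eps n w * eps n (sort w)))"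

lemma eps_K [simp]: "eps n u : K"
 by (induction u) auto

lemma eps_nonzero: "eps n u ~= 0"
 using eps_square[of n u] by auto

lemma sort_mset: "sort u = sort w \<longleftrightarrow> mset u = mset w"
 by (metis mset_sort properties_for_sort sorted_sort)

lemma nf_NI:
 assumes "f : NI"
 shows "nf f = 0"
 using NR_FA assms[unfolded NI_def]
proof (induction rule: relI_induct)
 case (base a u r v)
 then obtain i j where r: "r = single [i, j] 1 + single [j, i] 1" "i < n" "j < n" "i ~= j" by (auto simp: NR_def)
 have "sort (u @ i # j # v) = sort (u @ j # i # v)" by (simp add: sort_mset add_mset_commute)
 moreover have "eps n (u @ i # j # v) = - eps n (u @ j # i # v)" using r by (intro eps_swap)
 ultimately show ?case
  by (simp add: r(1) nf_def lin_simps algebra_simps single_uminus)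
qed (simp_all add: nf_def lin_simps)

lemma sort_NI:
 assumes "a : lists {..<n}" "w : lists {..<n}"
 shows "single (a @ w) (eps n (a @ w)) - single (a @ sort w) (eps n (a @ sort w)) : NI"
proof -
 have swap: "single (a @ i # j # b) (eps n (a @ i # j # b)) - single (a @ j # i # b) (eps n (a @ j # i # b)) : NI"
  if "a : lists {..<n}" "b : lists {..<n}" "i < n" "j < n" for a b i j
 proof (cases "i = j")
  case False
  have "smul (eps n (a @ i # j # b)) (single a 1 * (single [i, j] 1 + single [j, i] 1) * single b 1) : NI"
   using that False by (intro NI_props(6,7,8) swap_NI FM_single eps_K) auto
  moreover have "eps n (a @ j # i # b) = - eps n (a @ i # j # b)" using that False by (intro eps_swap) auto
  ultimately show ?thesis by (simp add: algebra_simps smul_add single_uminus)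
 qed (simp add: NI_props(3))
 have ins: "single (a @ j # s) (eps n (a @ j # s)) - single (a @ insort j s) (eps n (a @ insort j s)) : NI"
  if "a : lists {..<n}" "s : lists {..<n}" "j < n" for a s j
  using that
 proof (induction s arbitrary: a)
  case (Cons k s)
  show ?case
  proof (cases "j \<le> k")
   case False
   have "single ((a @ [k]) @ j # s) (eps n ((a @ [k]) @ j # s)) - single ((a @ [k]) @ insort j s) (eps n ((a @ [k]) @ insort j s)) : NI"
    using Cons by (intro Cons.IH) auto
   from NI_cong[OF swap[of a s j k] this[simplified]] show ?thesis using False Cons by simp
  qed (simp add: NI_props(3))
 qed (simp add: NI_props(3))
 show ?thesis using assms
 proof (induction w arbitrary: a)
  case (Cons j w)
  have "single ((a @ [j]) @ w) (eps n ((a @ [j]) @ w)) - single ((a @ [j]) @ sort w) (eps n ((a @ [j]) @ sort w)) : NI"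
   using Cons by (intro Cons.IH) auto
  moreover have "sort w : lists {..<n}" using Cons by (auto simp: in_lists_conv_set)
  ultimately show ?case using NI_cong ins[of a "sort w" j] Cons by simp
 qed (simp add: NI_props(3))
qed

lemma nf_cong: "f : FN ==> nf f : FN & f - nf f : NI"
proof (induction rule: FM_induct)
 case (single w a)
 have "smul (a * eps n w) (single w (eps n w) - single (sort w) (eps n (sort w))) : NI"
  using sort_NI[of "[]" w] single by (intro NI_props(6) K_mult) auto
 moreover have "sort w : lists {..<n}" using single by (auto simp: in_lists_conv_set)
 ultimately show ?case using single
  by (auto simp: nf_def smul_diff mult.assoc eps_square intro!: FM_single K_mult)
next
 case (add f g)
 then show ?case using NI_props(4)[of "f - nf f" "g - nf g"] by (auto simp: nf_def lin_add algebra_simps intro!: FM_add)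
qed (simp add: nf_def NI_props(3))

lemma lookup_lin: "lookup (lin \<phi> f) w = (\<Sum>u\<in>keys f. lookup f u * lookup (\<phi> u) w)"
 by (simp add: lin_def lookup_sum)

text \<open>\<^const>\<open>zr\<close> is not a zero divisor: multiplying it with a combination of sorted words, the words with the largest
 number of letters \<open>i\<close> cannot cancel.\<close>

lemma zr_regular:
 assumes ok: "okr i r" and h: "h : FN" and zh: "zr i r * h : NI"
 shows "h : NI"
proof (rule ccontr)
 assume hN: "h \<notin> NI"
 define g where "g = nf h"
 have g: "g : FN" "h - g : NI" using nf_cong[OF h] by (auto simp: g_def)
 have "zr i r * h - zr i r * (h - g) : NI" by (rule NI_props(5)[OF zh NI_props(7)[OF g(2) okr_facts(2)[OF ok]]])
 then have "nf (zr i r * g) = 0" by (intro nf_NI) (simp add: algebra_simps)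
 moreover obtain b b' l where z: "zr i r = single [i, i] b - single [l, l] b'" "b ~= 0" "b' = 0 \<or> l ~= i"
 proof (cases "fst r = i")
  case True
  then show ?thesis using that[of "1 - snd r" i 0] ok by (simp add: zr_def okr_def)
 next
  case False
  then show ?thesis using that[of 1 "fst r"] by (simp add: zr_def)
 qed
 moreover have "(single [i, i] b - single [l, l] b') * g = lin (%w. single (i # i # w) b - single (l # l # w) b') g"
  using lin_mult_right[of "single [i, i] b - single [l, l] b'" "%w. single w 1" g] by (simp add: algebra_simps)
 ultimately have zero: "lin (%w. single (sort (i # i # w)) (b * (eps n (i # i # w) * eps n (sort (i # i # w))))
   - single (sort (l # l # w)) (b' * (eps n (l # l # w) * eps n (sort (l # l # w))))) g = 0"
  by (simp add: nf_def lin_lin lin_simps del: sort_key_simps eps.simps)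
 have "g ~= 0" using g(2) hN by auto
 then have ne: "keys g ~= {}" by simp
 have sorted: "sorted w" if "w : keys g" for w
 proof -
  have "keys g \<subseteq> (\<Union>w\<in>keys h. keys (smul (lookup h w) (single (sort w) (eps n w * eps n (sort w)))))"
   unfolding g_def nf_def lin_def by (rule Poly_Mapping.keys_sum)
  then show ?thesis using that by (auto split: if_splits)
 qed
 define M where "M = Max ((%w. count (mset w) i) ` keys g)"
 have "M : (%w. count (mset w) i) ` keys g" unfolding M_def using ne by (intro Max_in) auto
 then obtain w where w: "w : keys g" "count (mset w) i = M" by auto
 have max: "count (mset u) i \<le> M" if "u : keys g" for u unfolding M_def using that by (intro Max_ge) auto
 let ?t = "sort (i # i # w)"
 have t1: "sort (i # i # u) = ?t \<longleftrightarrow> u = w" if "u : keys g" for u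
  using sorted[OF that] sorted[OF w(1)] by (auto simp only: sort_mset mset.simps add_mset_add_mset_same_iff dest: properties_for_sort[of u w] sorted_sort_id)
 have t2: "sort (l # l # u) ~= ?t" if "u : keys g" "l ~= i" for u
 proof
  assume "sort (l # l # u) = ?t"
  then have "count (mset (l # l # u)) i = count (mset (i # i # w)) i" by (simp only: sort_mset)
  then show False using max[OF that(1)] that(2) w(2) by simp
 qed
 have "lookup (lin (%w. single (sort (i # i # w)) (b * (eps n (i # i # w) * eps n (sort (i # i # w))))
   - single (sort (l # l # w)) (b' * (eps n (l # l # w) * eps n (sort (l # l # w))))) g) ?t
  = (\<Sum>u\<in>keys g. if u = w then lookup g w * (b * (eps n (i # i # w) * eps n ?t)) else 0)"
  unfolding lookup_lin
 proof (intro sum.cong refl)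
  fix u assume u: "u : keys g"
  have A: "lookup (single (sort (l # l # u)) (b' * (eps n (l # l # u) * eps n (sort (l # l # u))))) ?t = 0"
   using z(3) t2[OF u] by (auto simp: lookup_single when_def simp del: sort_key_simps eps.simps)
  have B: "lookup (single (sort (i # i # u)) x) ?t = (if u = w then x else 0)" for x
   using t1[OF u] by (simp add: lookup_single when_def del: sort_key_simps)
  show "lookup g u * lookup (single (sort (i # i # u)) (b * (eps n (i # i # u) * eps n (sort (i # i # u))))
   - single (sort (l # l # u)) (b' * (eps n (l # l # u) * eps n (sort (l # l # u))))) ?t
   = (if u = w then lookup g w * (b * (eps n (i # i # w) * eps n ?t)) else 0)"
   unfolding lookup_minus A B by simp
 qed
 also have "\<dots> = lookup g w * (b * (eps n (i # i # w) * eps n ?t))" using w(1) by (simp add: sum.delta)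
 finally show False
  unfolding zero using w(1) z(2) eps_nonzero by (simp add: in_keys_iff del: sort_key_simps eps.simps)
qed

text \<open>If \<open>f\<close> is invariant, then \<open>vr f = \<eta>\<^sub>i(f) vr\<close>, so that \<open>zr * DD f\<close> vanishes.\<close>

lemma DD_invariant:
 assumes ok: "okr i r" and f: "f : FN" and inv: "mor i r f - f : NI" "eta i f - eta (fst r) f : NI"
 shows "lin (DD i r) f : NI"
proof -
 let ?l = "fst r" and ?e = "inverse (snd r)"
 note F = okr_facts[OF ok]
 have il: "i < n" "?l < n" "?e : K" using ok by (auto simp: okr_def)
 have "vr i r * f - eta i f * vr i r : NI"
 proof (cases "?l = i")
  case False
  have "(single [i] 1 * f - eta i f * single [i] 1) + smul ?e ((single [?l] 1 * f - eta ?l f * single [?l] 1) - (eta i f - eta ?l f) * single [?l] 1) : NI"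
   using il f by (intro NI_props(4)[OF gen_past NI_props(6)[OF NI_props(5)[OF gen_past NI_props(8)[OF inv(2) FN_word]]]]) auto
  also have "(single [i] 1 * f - eta i f * single [i] 1) + smul ?e ((single [?l] 1 * f - eta ?l f * single [?l] 1) - (eta i f - eta ?l f) * single [?l] 1)
   = (single [i] 1 + smul ?e (single [?l] 1)) * f - eta i f * (single [i] 1 + smul ?e (single [?l] 1))"
   by (simp add: algebra_simps smul_diff smul_mult_left smul_mult_right del: smul_simps)
  finally show ?thesis using False by (simp add: vr_def)
 qed (use gen_past[OF il(1) f] in \<open>simp add: vr_def\<close>)
 then have "(zr i r * lin (DD i r) f - (eta i f * vr i r - vr i r * mor i r f))
   - (vr i r * f - eta i f * vr i r) - vr i r * (mor i r f - f) : NI"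
  by (intro NI_props(5)[OF NI_props(5)[OF zr_DD[OF ok f]] NI_props(7)[OF inv(1) F(1)]])
 then have "zr i r * lin (DD i r) f : NI" by (simp add: algebra_simps)
 moreover have "lin (DD i r) f : FN" by (rule FM_lin[OF f DD_FN[OF ok]])
 ultimately show ?thesis by (rule zr_regular[OF ok, rotated])
qed

lemma vact_hm: "vact q g = hm (gen_action n (\<Gamma> q) g)"
 by (simp add: vact_def hm_def)

lemma tact_hm: "tact n \<gamma> = hm (tg n \<gamma>)"
 by (simp add: tact_def hm_def)

abbreviation gact :: "(nat => gen) => complex mat => nalg => nalg" where
 "gact v g \<equiv> mo (pm n g) (%j. cv v (dm n g j))"

lemma vact_emb:
 assumes v: "XY v" and g: "g : CG (-1)" and f: "f : FN"
 shows "vact (-1) g (emb v f) = emb v (gact v g f)"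
 unfolding vact_hm hm_hm
 by (rule hm_cong[OF f]) (use gen_action_v[OF m1 g v] in \<open>auto simp: hm_simps\<close>)

lemma InvD:
 assumes "f : Inv q v"
 shows "f : FS v" "\<exists>d>0. \<forall>w\<in>keys f. length w = d" "g : CG q ==> vact q g f - f : SI q v"
 using assms unfolding Inv_def by (elim CollectE conjE; simp)+

definition INV :: "(nat => gen) => nalg set" where
 "INV v = {f : FN. emb v f : Inv (-1) v}"

lemma INV_FN: "f : INV v ==> f : FN"
 by (simp add: INV_def)

lemma INV_gact:
 assumes v: "XY v" and f: "f : INV v" and g: "g : CG (-1)"
 shows "gact v g f - f : NI"
proof -
 have "vact (-1) g (emb v f) - emb v f : SI (-1) v" using f g InvD(3) by (simp add: INV_def)
 then show ?thesis unfolding vact_emb[OF v g INV_FN[OF f]] hm_simps(2)[symmetric] emb_NI_iff[OF v] .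
qed

lemma INV_eta:
 assumes v: "XY v" and f: "f : INV v"
 shows "eta i f : INV v"
proof -
 define F where "F = emb v f"
 have F: "F : Inv (-1) v" "F : FS v" using f emb_FA by (auto simp: INV_def F_def)
 from InvD(2)[OF F(1)] obtain d where d: "d > 0" "\<forall>w\<in>keys F. length w = d" by blast
 have "emb v (eta i f) = hm (%a. single [a] (qs i (gen_index a))) F"
  using v by (auto simp: F_def hm_hm hm_simps)
 also have "\<dots> = smul ((-1) ^ d) (tact n {i} F)"
  unfolding hm_def tact_def lin_fun_smul[symmetric]
 proof (rule lin_cong)
  fix w assume w: "w : keys F"
  then have "w : lists (Sg v)" using F(2) by (auto simp: FM_def)
  then obtain u where u: "w = map v u" using lists_Sg by blast
  have "prod_list (map (%a. single [a] (qs i (gen_index a))) (map v u)) = smul ((-1) ^ length u) (prod_list (map (tg n {i}) (map v u)))"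
   using v by (induction u) (auto simp: tg_def qs_def sg1_def smul_mult_left smul_mult_right single_uminus smul_minus smul_minus_left)
  then show "prod_list (map (%a. single [a] (qs i (gen_index a))) w) = smul ((-1) ^ d) (prod_list (map (tg n {i}) w))"
   using d w u by auto
 qed
 also have "\<dots> : Inv (-1) v"
 proof -
  have t: "tact n {i} F : Inv (-1) v" by (rule tact_Inv[OF m1 v F(1)])
  from InvD(2)[OF this] obtain e where e: "e > 0" "\<forall>w\<in>keys (tact n {i} F). length w = e" by blast
  have "\<forall>w\<in>keys (smul ((-1) ^ d) (tact n {i} F)). length w = e"
   by (rule ballI) (rule bspec[OF e(2) subsetD[OF keys_smul]])
  moreover have "smul ((-1) ^ d) (tact n {i} F) : FS v"
   by (rule FM_smul[OF K_power[OF minus_1_K] InvD(1)[OF t]])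
  moreover have "vact (-1) g (smul ((-1) ^ d) (tact n {i} F)) - smul ((-1) ^ d) (tact n {i} F) : SI (-1) v" if "g : CG (-1)" for g
   unfolding vact_smul smul_diff[symmetric]
   by (rule S_ideal_smul[OF m1 InvD(3)[OF t that] K_power[OF minus_1_K]])
  ultimately show ?thesis using e(1) unfolding Inv_def by blast
 qed
 finally show ?thesis using eta_FN[OF INV_FN[OF f]] by (simp add: INV_def)
qed

lemma INV_eta_eq:
 assumes v: "XY v" and f: "f : INV v" and il: "i < n" "l < n"
 shows "eta i f - eta l f : NI"
proof (cases "i = l")
 case False
 have F: "emb v f : Inv (-1) v" "emb v f : FS v" using f emb_FA by (auto simp: INV_def)
 have "emb v (eta i (eta l f)) = tact n {i, l} (emb v f)"
  unfolding tact_hm hm_hm using v False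
  by (intro arg_cong[where f = "%\<phi>. hm \<phi> f"] ext) (auto simp: hm_simps tg_def qs_def sg1_def)
 also have "\<dots> = vact (-1) (tm n {i, l}) (emb v f)"
  using vact_tm[OF m1 v tm2_Gamma[OF m1 il False] F(2)] by simp
 finally have "emb v (eta i (eta l f) - f) : SI (-1) v"
  using InvD(3)[OF F(1) tm2_Gamma[OF m1 il False]] by (simp add: hm_simps)
 from eta_NI[OF this[unfolded emb_NI_iff[OF v]], of i] have "eta l f - eta i f : NI"
  by (simp only: hm_simps eta_eta)
 then show ?thesis by (rule NI_sym)
qed (simp add: NI_props(3))

text \<open>The data of the reflection in its action on the \<open>y\<^sub>j\<close>, up to conjugation with \<open>t\<^sub>i\<close>.\<close>

definition du :: "nat => nat \<times> complex => nat \<times> complex" where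
 "du i r = (fst r, if fst r = i then inverse (snd r) else - inverse (snd r))"

lemma okr_Rf:
 assumes "i < n" "r : Rf i"
 shows "okr i r" "okr i (du i r)"
 using rm_facts(3,5,7)[OF assms] assms by (auto simp: okr_def du_def Rf_def intro!: K_inverse K_minus)

lemma gact_rm:
 assumes "i < n" "r : Rf i" "f : FN"
 shows "gact Xg (rm i r) f = mor i r f" "eta i (gact Yg (rm i r) (eta i f)) = mor i (du i r) f"
proof -
 note R = rm_facts[OF assms(1,2)]
 show "gact Xg (rm i r) f = mor i r f"
  using R by (intro hm_cong[OF assms(3)]) (auto simp: em_def)
 show "eta i (gact Yg (rm i r) (eta i f)) = mor i (du i r) f"
  unfolding hm_hm using R by (intro hm_cong[OF assms(3)]) (auto simp: em_def du_def hm_simps qs_def transpose_def)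
qed

lemma INV_DD:
 assumes i: "i < n" and r: "r : Rf i"
 shows "f : INV Xg ==> lin (DD i r) f : NI" "f : INV Yg ==> lin (DD i (du i r)) f : NI"
proof -
 note R = rm_facts[OF i r]
 assume f: "f : INV Xg"
 show "lin (DD i r) f : NI"
  using INV_gact[OF _ f R(1)] INV_eta_eq[OF _ f i R(3)] gact_rm(1)[OF i r INV_FN[OF f]]
  by (intro DD_invariant[OF okr_Rf(1)[OF i r] INV_FN[OF f]]) auto
next
 note R = rm_facts[OF i r]
 assume f: "f : INV Yg"
 have "eta i (gact Yg (rm i r) (eta i f) - eta i f) : NI"
  by (intro eta_NI INV_gact[OF _ INV_eta[OF _ f] R(1)]) auto
 then have "mor i (du i r) f - f : NI" unfolding hm_simps eta_eta gact_rm(2)[OF i r INV_FN[OF f]] .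
 then show "lin (DD i (du i r)) f : NI"
  using INV_eta_eq[OF _ f i R(3)]
  by (intro DD_invariant[OF okr_Rf(2)[OF i r] INV_FN[OF f]]) (auto simp: du_def)
qed

lemma act_emb:
 "act (emb v (single [k] 1 * f)) x = opM (v k) (act (emb v f) x)" "act (emb v 1) x = x"
 "act (emb v 0) x = 0" "act (emb v (f + g)) x = act (emb v f) x + act (emb v g) x"
 "act (emb v (smul a f)) x = smul a (act (emb v f) x)"
proof -
 have "act (single [] 1) x = x" by (simp add: act_simps)
 then show "act (emb v 1) x = x" by (simp only: hm_simps single_Nil_one)
qed (simp_all add: hm_simps act_mult act_simps)

lemma mo_simps:
 fixes \<phi> :: "nat => nalg"
 shows "hm \<phi> (f + g) = hm \<phi> f + hm \<phi> g" "hm \<phi> (smul a f) = smul a (hm \<phi> f)" "hm \<phi> 0 = 0" "hm \<phi> 1 = 1"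
 by (rule hm_simps)+

lemma emb_Hg: "XY v ==> f : FN ==> emb v f : FH (-1)"
 using emb_FA FA_Sg_Hg by blast

lemma act_emb_MK: "XY v ==> f : FN ==> x : MK ==> act (emb v f) x : MK"
 by (intro act_MK emb_Hg)

lemma FN_induct [consumes 1, case_names zero add smul one gen]:
 assumes "f : FN" "Q 0" "\<And>a b. a : FN ==> b : FN ==> Q a ==> Q b ==> Q (a + b)"
  "\<And>a f. f : FN ==> a : K ==> Q f ==> Q (smul a f)" "Q 1"
  "\<And>k w. k < n ==> w : lists {..<n} ==> single w 1 : FN ==> Q (single w 1) ==> Q (single [k] 1 * single w 1)"
 shows "Q f"
 using assms(1)
proof (induction rule: FM_induct)
 case (single w a)
 from single(1) have "Q (single w 1)"
 proof (induction w)
  case (Cons k w)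
  then show ?case using assms(6)[of k w] by (auto intro!: FM_single)
 qed (use assms(5) in \<open>simp add: single_Nil_one\<close>)
 from assms(4)[OF _ single(2) this] single(1) show ?case by (auto intro!: FM_single)
qed (use assms in auto)

lemma GM_act:
 assumes g: "g : CG (-1)" and v: "XY v" and x: "x : MK" and f: "f : FN"
 shows "GM g (act (emb v f) x) = act (emb v (gact v g f)) (GM g x)"
 using f
proof (induction rule: FN_induct)
 case (gen k w)
 have A: "GM g (opM (v k) (act (emb v (single w 1)) x)) = smul (cv v (dm n g k)) (opM (v (pm n g k)) (GM g (act (emb v (single w 1)) x)))"
  using v GM_XM GM_YM[OF g gen(1) act_emb_MK[OF v gen(3) x]] by (auto simp: opM_def)
 have B: "gact v g (single [k] 1 * single w 1) = smul (cv v (dm n g k)) (single [pm n g k] 1 * gact v g (single w 1))"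
  unfolding hm_simps by (simp add: smul_mult_left[symmetric])
 show ?case unfolding B act_emb(1,5) A gen(4) ..
qed (simp_all add: act_emb mo_simps GM_simps)

lemma lin_DD_gen: "lin (DD i r) (single [k] 1 * single w 1) = smul (qs i k) (single [k] 1 * lin (DD i r) (single w 1)) + smul (ac i r k) (mor i r (single w 1))"
 by simp

lemma lin_DD_one: "lin (DD i r) 1 = 0"
proof -
 have "lin (DD i r) (single [] 1) = 0" by simp
 then show ?thesis by (simp only: single_Nil_one)
qed

lemma eta_gen: "eta i (single [k] 1 * f) = smul (qs i k) (single [k] 1 * eta i f)"
 unfolding hm_simps by (simp add: smul_mult_left[symmetric])

text \<open>How the \<open>y\<^sub>i\<close> move past polynomials in the \<open>x\<^sub>j\<close>, and polynomials in the \<open>y\<^sub>j\<close> past the \<open>x\<^sub>i\<close>.\<close>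

lemma YM_act_X:
 assumes i: "i < n" and x: "x : MK" and f: "f : FN"
 shows "YM i (act (emb Xg f) x) = act (emb Xg (eta i f)) (YM i x) + (\<Sum>r\<in>Rf i. smul (bc i r) (act (emb Xg (lin (DD i r) f)) (GM (rm i r) x)))"
 using f
proof (induction rule: FN_induct)
 case (gen k w)
 let ?X = "act (emb Xg (single w 1)) x"
 have "kM i k ?X = (\<Sum>r\<in>Rf i. smul (bc i r) (smul (ac i r k) (act (emb Xg (mor i r (single w 1))) (GM (rm i r) x))))"
  unfolding kM_def
 proof (intro sum.cong refl)
  fix r assume r: "r : Rf i"
  have "GM (rm i r) ?X = act (emb Xg (mor i r (single w 1))) (GM (rm i r) x)"
   unfolding gact_rm(1)[OF i r gen(3), symmetric] by (rule GM_act[OF rm_facts(1)[OF i r] _ x gen(3)]) simp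
  then show "smul (bc i r * ac i r k) (GM (rm i r) ?X) = smul (bc i r) (smul (ac i r k) (act (emb Xg (mor i r (single w 1))) (GM (rm i r) x)))"
   by simp
 qed
 then show ?case
  unfolding act_emb eta_gen lin_DD_gen
  by (simp add: opM_def YM_XM gen(4) XM_simps smul_add sum.distrib smul_sum mult_ac del: mult_words)
qed (simp_all add: act_emb mo_simps lin_DD_one YM_simps lin_simps smul_add sum.distrib smul_sum mult_ac)

text \<open>The commutator of \<open>y\<^sub>k\<close> and \<open>x\<^sub>j\<close>, rewritten as a sum over the reflections through \<open>j\<close> instead of \<open>k\<close>.\<close>

lemma kM_dual:
 assumes j: "j < n" and k: "k < n"
 shows "kM k j x = (\<Sum>r\<in>Rf j. smul (bc j r * ac j (du j r) k) (GM (rm j r) x))"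
proof (cases "k = j")
 case True
 then show ?thesis by (simp add: kM_def ac_def)
next
 case False
 have "kM k j x = (\<Sum>\<epsilon>\<in>Um. smul (c\<^sub>1 * \<epsilon>) (GM (rm k (j, \<epsilon>)) x))"
  unfolding kM_def using False j k by (subst sum_Rf_restrict[of k j]) (auto simp: ac_def bc_def)
 also have "\<dots> = (\<Sum>\<epsilon>\<in>Um. smul (c\<^sub>1 * - inverse \<epsilon>) (GM (rm j (k, \<epsilon>)) x))"
 proof (rule sum.reindex_bij_witness[where i = "%\<epsilon>. - inverse \<epsilon>" and j = "%\<epsilon>. - inverse \<epsilon>"])
  fix \<epsilon> assume e: "\<epsilon> : Um"
  show "- inverse \<epsilon> : Um" "- inverse \<epsilon> : Um" using e uminus_root unity_roots_inverse by auto
  show "smul (c\<^sub>1 * - inverse (- inverse \<epsilon>)) (GM (rm j (k, - inverse \<epsilon>)) x) = smul (c\<^sub>1 * \<epsilon>) (GM (rm k (j, \<epsilon>)) x)"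
   using refl_swap[of k j \<epsilon>] False j k e by simp
 qed auto
 also have "\<dots> = (\<Sum>r\<in>Rf j. smul (bc j r * ac j (du j r) k) (GM (rm j r) x))"
  using False j k by (subst sum_Rf_restrict[of j k]) (auto simp: ac_def bc_def du_def)
 finally show ?thesis .
qed

lemma act_Y_XM:
 assumes j: "j < n" and x: "x : MK" and f: "f : FN"
 shows "act (emb Yg f) (XM j x) = XM j (act (emb Yg (eta j f)) x) + (\<Sum>r\<in>Rf j. smul (bc j r) (act (emb Yg (eta j (lin (DD j (du j r)) f))) (GM (rm j r) x)))"
 using f
proof (induction rule: FN_induct)
 case (gen k w)
 define s where "s = (\<Prod>i\<leftarrow>w. qs j i)"
 have sw: "eta j (single w 1) = smul s (single w 1)" by (simp add: hm_word s_def)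
 let ?X = "act (emb Yg (single w 1)) x"
 have sX: "act (emb Yg (eta j (single w 1))) x = smul s ?X" unfolding sw act_emb(5) ..
 have k: "smul s (kM k j ?X) = (\<Sum>r\<in>Rf j. smul (bc j r) (smul (ac j (du j r) k) (act (emb Yg (eta j (mor j (du j r) (single w 1)))) (GM (rm j r) x))))"
  unfolding kM_dual[OF j gen(1)] smul_sum
 proof (intro sum.cong refl)
  fix r assume r: "r : Rf j"
  have "eta j (mor j (du j r) (single w 1)) = smul s (gact Yg (rm j r) (single w 1))"
   unfolding gact_rm(2)[OF j r gen(3), symmetric] eta_eta sw hm_simps ..
  then show "smul s (smul (bc j r * ac j (du j r) k) (GM (rm j r) ?X))
   = smul (bc j r) (smul (ac j (du j r) k) (act (emb Yg (eta j (mor j (du j r) (single w 1)))) (GM (rm j r) x)))"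
   using GM_act[OF rm_facts(1)[OF j r] _ x gen(3), of Yg] by (simp add: act_emb mult_ac)
 qed
 have "act (emb Yg (single [k] 1 * single w 1)) (XM j x)
  = YM k (smul s (XM j ?X)) + (\<Sum>r\<in>Rf j. smul (bc j r) (YM k (act (emb Yg (eta j (lin (DD j (du j r)) (single w 1)))) (GM (rm j r) x))))"
  unfolding act_emb gen(4) by (simp add: opM_def YM_simps sX XM_simps)
 also have "YM k (smul s (XM j ?X)) = smul (qs j k) (XM j (YM k (smul s ?X))) + smul s (kM k j ?X)"
  by (simp add: YM_simps YM_XM smul_add XM_simps mult_ac) (simp add: qs_def eq_commute)
 finally show ?case
  unfolding k eta_gen lin_DD_gen act_emb mo_simps
  by (simp add: sX act_emb opM_def YM_simps XM_simps smul_add sum.distrib eta_gen mo_simps mult_ac add_ac del: mult_words)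
qed (simp_all add: act_emb mo_simps lin_DD_one XM_simps lin_simps smul_add sum.distrib smul_sum mult_ac)

lemma act_NI:
 assumes v: "XY v" and "f : NI" "x : MK"
 shows "act (emb v f) x : L0"
proof (rule act_H_ideal[OF _ assms(3)])
 have "emb v f : SI (-1) v" using assms(2) emb_NI_iff[OF v] by blast
 then show "emb v f : HI (-1)" using S_ideal_H_ideal[OF m1 v] by blast
qed

lemma act_NI_diff:
 assumes "XY v" "f - g : NI" "x : MK" "act (emb v g) x : U" "\<And>a b. a : U ==> b : L0 ==> a + b : U"
 shows "act (emb v f) x : U"
 using assms(5)[OF assms(4) act_NI[OF assms(1-3)]] by (simp add: hm_simps act_simps)

text \<open>Right multiplication by a polynomial in the \<open>y\<^sub>i\<close>; it commutes with the action of the algebra.\<close>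

definition RR :: "nalg => wmod => wmod" where
 "RR f x = lin (%w. RM w x) f"

text \<open>The span of the elements which vanish in the tensor product of the coinvariant algebras with the group algebra.\<close>

definition NN :: "wmod set" where
 "NN = gspan K (L0 \<union> {act (emb Xg f) x | f x. f : INV Xg & x : MK} \<union> {RR f x | f x. f : INV Yg & x : MK})"

lemma NN_closed: "0 : NN" "x : NN ==> y : NN ==> x + y : NN" "x : NN ==> a : K ==> smul a x : NN"
 "(\<And>i. i : I ==> F i : NN) ==> sum F I : NN"
 unfolding NN_def by (auto intro: gspan.intros gspan_smul gspan_sum)

lemma NN_base: "x : L0 ==> x : NN" "f : INV Xg ==> x : MK ==> act (emb Xg f) x : NN"
 "f : INV Yg ==> x : MK ==> RR f x : NN"
 unfolding NN_def by (rule gspan_base1; blast)+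

lemma RM_op:
 "RM w (XM i x) = XM i (RM w x)" "RM w (GM g x) = GM g (RM w x)" "RM w (YM i x) = YM i (RM w x)"
proof -
 show X: "RM w (XM i x) = XM i (RM w x)" for i x by (induction x rule: wmod_induct) (simp_all add: RM_simps XM_simps)
 show G: "RM w (GM g x) = GM g (RM w x)" for g x by (induction x rule: wmod_induct) (simp_all add: RM_simps GM_simps)
 have "RM w (ym i u g v) = ym i u g (v @ w)" for i u g v
  by (induction u) (simp_all add: RM_simps X kM_def G)
 then show "RM w (YM i x) = YM i (RM w x)" by (induction x rule: wmod_induct) (simp_all add: RM_simps YM_simps)
qed

lemma opM_RR: "opM a (RR f x) = RR f (opM a x)"
proof -
 have "opM a (RM w x) = RM w (opM a x)" for w by (cases a) (simp_all add: opM_def RM_op)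
 then show ?thesis using foldr_opM_lin[of "[a]" "%w. RM w x" f] by (simp add: RR_def)
qed

lemma opM_NN:
 assumes a: "a : Hg (-1)" and x: "x : NN"
 shows "opM a x : NN"
 using x[unfolded NN_def]
proof (induction)
 case gspan_0
 show ?case by (simp add: opM_simps NN_closed)
next
 case (gspan_base b y)
 consider (L) "y : L0" | (X) f x where "y = act (emb Xg f) x" "f : INV Xg" "x : MK"
  | (Y) f x where "y = RR f x" "f : INV Yg" "x : MK" using gspan_base(2) by blast
 then have "opM a y : NN"
 proof cases
  case L
  show ?thesis by (rule NN_base(1)) (use foldr_opM_closed(2)[of "[a]" y] a L in auto)
 next
  case X
  note f = INV_FN[OF X(2)]
  have opx: "opM a x : MK" using foldr_opM_closed(1)[of "[a]" x] a X(3) by auto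
  note add = NN_closed(2)[OF _ NN_base(1)]
  consider (x) i where "a = Xg i" "i < n" | (y) i where "a = Yg i" "i < n" | (g) g where "a = Gr g" "g : CG (-1)"
   using a by (auto simp: H_gens_def)
  then show ?thesis
  proof cases
   case x
   have "act (emb Xg (single [i] 1 * f)) x : NN"
   proof (rule act_NI_diff[OF _ gen_past[OF x(2) f] X(3) _ add])
    have "act (emb Xg (eta i f * single [i] 1)) x = act (emb Xg (eta i f)) (opM a x)"
     by (simp add: hm_simps act_mult act_simps x(1))
    then show "act (emb Xg (eta i f * single [i] 1)) x : NN"
     using NN_base(2)[OF INV_eta[OF _ X(2)] opx] by simp
   qed auto
   then show ?thesis by (simp add: act_emb x X(1))
  next
   case y
   have "smul (bc i r) (act (emb Xg (lin (DD i r) f)) (GM (rm i r) x)) : NN" if r: "r : Rf i" for r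
    using act_NI[OF _ INV_DD(1)[OF y(2) r X(2)] GM_MK[OF rm_facts(1)[OF y(2) r] X(3)]] rm_facts(6)[OF y(2) r]
    by (intro NN_closed(3) NN_base(1)) auto
   moreover have "act (emb Xg (eta i f)) (YM i x) : NN"
    by (rule NN_base(2)[OF INV_eta[OF _ X(2)]]) (use opx in \<open>simp_all add: y opM_def\<close>)
   ultimately show ?thesis
    unfolding X(1) y(1) opM_def gen.case YM_act_X[OF y(2) X(3) f] by (intro NN_closed(2,4))
  next
   case g
   show ?thesis
    unfolding X(1) g(1) opM_def gen.case GM_act[OF g(2) insertI1 X(3) f]
    by (rule act_NI_diff[OF insertI1 INV_gact[OF insertI1 X(2) g(2)] GM_MK[OF g(2) X(3)] NN_base(2)[OF X(2) GM_MK[OF g(2) X(3)]] add])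
  qed
 next
  case Y
  have opx: "opM a x : MK" using foldr_opM_closed(1)[of "[a]" x] a Y(3) by auto
  show ?thesis unfolding Y(1) opM_RR by (rule NN_base(3)[OF Y(2) opx])
 qed
 then show ?case unfolding opM_simps using gspan_base(1) by (rule NN_closed(3))
next
 case (gspan_add x y)
 then show ?case unfolding opM_simps by (intro NN_closed(2))
qed

text \<open>The image of the unit of the algebra.\<close>

abbreviation un :: wmod where "un \<equiv> single ([], 1\<^sub>m n, []) 1"

abbreviation Ty :: "nalg => wmod" where
 "Ty \<equiv> lin (%v. single ([], 1\<^sub>m n, v) 1)"

lemma one_W: "1\<^sub>m n : CG (-1)"
 by (rule Gamma_nonempty[OF m1])

lemma one_pm_dm: "pm n (1\<^sub>m n) = id" "j < n ==> dm n (1\<^sub>m n) j = 1"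
proof -
 have nz: "\<forall>j<n. (1::complex) ~= 0" by simp
 show "pm n (1\<^sub>m n) = id" "j < n ==> dm n (1\<^sub>m n) j = 1"
  unfolding mm_one by (rule pm_mm[OF permutes_id nz], rule dm_mm[OF permutes_id nz])
qed

lemma act_Ty: "f : FN ==> act (emb Yg f) (Ty h) = Ty (f * h)"
proof (induction rule: FN_induct)
 case (gen k w)
 have "YM k (Ty h) = Ty (single [k] 1 * h)" for h
 proof -
  have "YM k (lin \<phi> h) = lin (%v. YM k (\<phi> v)) h" for \<phi> :: "nat list => wmod"
   using foldr_opM_lin[of "[Yg k]" \<phi> h] by (simp add: opM_def)
  moreover have "single [k] 1 * h = lin (%v. single (k # v) 1) h"
   using lin_mult_right[of "single [k] 1" "%w. single w 1" h] by simp
  ultimately show ?thesis using gen(1) by (simp add: lin_lin YM_simps one_pm_dm inv_id)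
 qed
 then show ?case unfolding act_emb gen(4) by (simp add: opM_def mult.assoc del: mult_words)
qed (simp_all add: act_emb mo_simps lin_simps distrib_right smul_mult_left)

lemma Ty_NI:
 assumes "f : NI"
 shows "Ty f : L0"
 using NR_FA assms[unfolded NI_def]
proof (induction rule: relI_induct)
 case (base a u r v)
 then obtain i j where r: "r = single [i, j] 1 + single [j, i] 1" "i < n" "j < n" "i ~= j" by (auto simp: NR_def)
 show ?case
  using L0_closed(3)[OF L0_Y[OF base(2,4) r(2-4) one_W, of "[]"] base(1)]
  by (simp add: r(1) distrib_left distrib_right lin_simps smul_add)
qed (auto simp: lin_simps intro: L0_closed)

lemma INV_Y_past:
 assumes "f : INV Yg" "v : lists {..<n}"
 shows "\<exists>f'\<in>INV Yg. f * single v 1 - single v 1 * f' : NI"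
 using assms(2,1)
proof (induction v arbitrary: f)
 case (Cons j v)
 have e: "eta j f : INV Yg" using INV_eta[OF _ Cons(4)] by simp
 then obtain f' where f': "f' : INV Yg" "eta j f * single v 1 - single v 1 * f' : NI" using Cons by blast
 have v: "single v 1 : FN" using Cons by (auto intro!: FM_single)
 have "f * single [j] 1 - single [j] 1 * eta j f : NI"
  using NI_sym[OF gen_past[OF _ INV_FN[OF e], of j]] Cons(1) by (simp add: eta_eta)
 from NI_props(4)[OF NI_props(8)[OF this v] NI_props(7)[OF f'(2) FN_word]]
 have "(f * single [j] 1 - single [j] 1 * eta j f) * single v 1 + single [j] 1 * (eta j f * single v 1 - single v 1 * f') : NI"
  using Cons(1) by simp
 moreover have "single (j # v) 1 = single [j] 1 * single v (1::complex)" by simp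
 ultimately have "f * single (j # v) 1 - single (j # v) 1 * f' : NI" by (simp add: algebra_simps del: mult_words)
 then show ?case using f'(1) by blast
next
 case Nil
 then show ?case by (intro bexI[of _ f]) (simp_all add: single_Nil_one NI_props(3))
qed

text \<open>An invariant in the \<open>y\<^sub>i\<close> moves to the right past the \<open>x\<^sub>j\<close> without remainder, then past group elements, and
 finally past the \<open>y\<^sub>j\<close> up to signs.\<close>

lemma act_Y_NN:
 assumes "f : INV Yg" "x : MK"
 shows "act (emb Yg f) x : NN"
 using assms(2)
proof (induction rule: MK_induct)
 case (single u g v a)
 from single(1) assms(1) have "act (emb Yg f) (single (u, g, v) 1) : NN"
 proof (induction u arbitrary: f)
  case Nil
  let ?y = "single ([], 1\<^sub>m n, v) (1::complex)" and ?x = "single ([], g, v) (1::complex)"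
  have MK: "?y : MK" "?x : MK" using single one_W by (auto simp: MB_def intro!: FM_single)
  \<comment> \<open>The claim is proved for the vector without \<open>g\<close> first, then transported by the action of \<open>g\<close>.\<close>
  have gy: "GM g ?y = ?x" using GammaD(7)[OF m1 single(2)] by (simp add: GM_simps)
  obtain f' where f': "f' : INV Yg" "f * single v 1 - single v 1 * f' : NI" using INV_Y_past[OF Nil(1) single(3)] by blast
  have "Ty (f * single v 1) = Ty (f * single v 1 - single v 1 * f') + RR f' ?y"
  proof -
   have "single v 1 * f' = lin (%w. single (v @ w) 1) f'"
    using lin_mult_right[of "single v 1" "%w. single w 1" f'] by simp
   then have "Ty (single v 1 * f') = RR f' ?y" by (simp add: RR_def lin_lin RM_simps)
   then show ?thesis by (simp add: lin_simps)
  qed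
  then have "Ty (f * single v 1) : NN"
   using NN_closed(2)[OF NN_base(1)[OF Ty_NI[OF f'(2)]] NN_base(3)[OF f'(1) MK(1)]] by simp
  moreover have "act (emb Yg f) ?y = Ty (f * single v 1)" using act_Ty[OF INV_FN[OF Nil(1)], of "single v 1"] by simp
  ultimately have "opM (Gr g) (act (emb Yg f) ?y) : NN" using single(2) by (intro opM_NN) (auto simp: H_gens_def)
  moreover have "opM (Gr g) (act (emb Yg f) ?y) = act (emb Yg (gact Yg g f)) ?x"
   unfolding opM_def gen.case using GM_act[OF single(2) _ MK(1) INV_FN[OF Nil(1)], of Yg] gy by simp
  ultimately have b: "act (emb Yg (gact Yg g f)) ?x : NN" by simp
  show ?case
   by (rule act_NI_diff[OF _ NI_sym[OF INV_gact[OF _ Nil(1) single(2)]] MK(2) b NN_closed(2)[OF _ NN_base(1)]]) auto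
 next
  case (Cons j u)
  let ?x = "single (u, g, v) (1::complex)"
  have j: "j < n" and u: "u : lists {..<n}" using Cons by auto
  have x: "?x : MK" using u single by (auto simp: MB_def intro!: FM_single)
  have e: "eta j f : INV Yg" using INV_eta[OF _ Cons(4)] by simp
  have "opM (Xg j) (act (emb Yg (eta j f)) ?x) : NN"
   using j by (intro opM_NN Cons.IH[OF e]) (auto simp: H_gens_def)
  moreover have "smul (bc j r) (act (emb Yg (eta j (lin (DD j (du j r)) f))) (GM (rm j r) ?x)) : NN" if r: "r : Rf j" for r
   using act_NI[OF _ eta_NI[OF INV_DD(2)[OF j r Cons(4)]] GM_MK[OF rm_facts(1)[OF j r] x], of Yg j] rm_facts(6)[OF j r]
   by (intro NN_closed(3) NN_base(1)) auto
  moreover have "single (j # u, g, v) 1 = XM j ?x" by (simp add: XM_simps)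
  ultimately show ?case
   unfolding opM_def gen.case by (simp only: act_Y_XM[OF j x INV_FN[OF Cons(4)]]) (intro NN_closed(2,4))
 qed
 from NN_closed(3)[OF this single(4)] show ?case unfolding act_simps(5)[symmetric] by simp
qed (simp_all add: NN_closed act_simps(4) act_def[of _ 0] foldr_opM_simps)

text \<open>Both invariant ideals being normal in the braided algebra, its restricted quotient is
 not smaller than the tensor product of the three subalgebras.\<close>

lemma act_J:
 assumes f: "f : J (-1)"
 shows "act f un : NN"
 using J_gens_FA[OF m1] f unfolding J_def
proof (induction rule: relI_induct)
 case (base a u r v)
 have un: "un : MK" using one_W by (auto simp: MB_def intro!: FM_single)
 have x: "foldr opM v un : MK" by (rule foldr_opM_closed(1)[OF base(4) un])
 have inv: "act r x : NN" if "XY v" "r : Inv (-1) v" "x : MK" for v x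
 proof -
  note e = emb_index[OF that(1) InvD(1)[OF that(2)]]
  have "hm (%a. single [gen_index a] 1) r : INV v" using e that(2) by (simp add: INV_def)
  then show ?thesis using NN_base(2)[of _ x] act_Y_NN[of _ x] that e(1) by (metis insertE singletonD)
 qed
 have "act r (foldr opM v un) : NN"
  using base(3) act_H_rels[OF _ x] inv[OF _ _ x] NN_base(1) by blast
 then have "foldr opM u (act r (foldr opM v un)) : NN"
  using base(2) by (induction u) (auto intro: opM_NN)
 then show ?case using base(1) by (simp add: act_mult act_simps mult.assoc NN_closed(3))
qed (simp_all add: act_simps NN_closed)

end

section \<open>Tensor products\<close>

context subK
begin

lemma free_module_sel [simp]:
 "carrier (free_module K S) = FM K S" "\<zero>\<^bsub>free_module K S\<^esub> = 0" "add (free_module K S) = (+)" "smult (free_module K S) = smul"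
 by (auto simp: free_module_def FM_def smul_def[abs_def])

definition kclosed :: "(complex, 'a) module => bool" where
 "kclosed M \<longleftrightarrow> (\<forall>a\<in>carrier M. \<forall>b\<in>carrier M. a \<oplus>\<^bsub>M\<^esub> b : carrier M) & (\<forall>c\<in>K. \<forall>a\<in>carrier M. c \<odot>\<^bsub>M\<^esub> a : carrier M)"

text \<open>Tensor products are quotients of free modules by the span of the bilinearity relations; \<open>tp\<close> is the
 quotient map.\<close>

definition tU :: "(complex, 'a) module => (complex, 'b) module => ('a \<times> 'b \<Rightarrow>\<^sub>0 complex) set" where
 "tU M N = gspan K (tensor_relations K M N)"

definition tp :: "(complex, 'a) module => (complex, 'b) module => ('a \<times> 'b \<Rightarrow>\<^sub>0 complex) => ('a \<times> 'b \<Rightarrow>\<^sub>0 complex) set" where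
 "tp M N f = {x. x - f : tU M N}"

lemma tensor_relations_FM:
 assumes "kclosed M" "kclosed N"
 shows "tensor_relations K M N \<subseteq> FM K (carrier M \<times> carrier N)"
 using assms unfolding tensor_relations_def kclosed_def by (auto intro!: FM_diff FM_single)

lemma tensor_submodule_eq:
 assumes "kclosed M" "kclosed N"
 shows "tensor_submodule K M N = tU M N"
proof
 let ?F = "free_module K (carrier M \<times> carrier N)"
 have sub: "tU M N \<subseteq> FM K (carrier M \<times> carrier N)"
  unfolding tU_def by (rule gspan_FM[OF tensor_relations_FM[OF assms]])
 have "submodule (tU M N) (scalars K) ?F"
 proof (rule submodule.intro)
  show "subgroup (tU M N) (add_monoid ?F)"
  proof (rule subgroup.intro)
   fix x assume x: "x : tU M N"
   then have "x : FM K (carrier M \<times> carrier N)" using sub by blast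
   then have "inv\<^bsub>add_monoid ?F\<^esub> x = - x"
    unfolding m_inv_def by (intro the_equality) (simp_all add: FM_minus eq_neg_iff_add_eq_0)
   then show "inv\<^bsub>add_monoid ?F\<^esub> x : tU M N" using x gspan_minus by (simp add: tU_def)
  qed (use sub in \<open>simp_all add: tU_def gspan_0 gspan_add\<close>)
  show "submodule_axioms (tU M N) (scalars K) ?F"
   by (rule submodule_axioms.intro) (simp add: tU_def gspan_smul)
 qed
 moreover have "tensor_relations K M N \<subseteq> tU M N" by (auto simp: tU_def intro: gspan_base1)
 ultimately show "tensor_submodule K M N \<subseteq> tU M N" unfolding tensor_submodule_def by blast
 show "tU M N \<subseteq> tensor_submodule K M N"
  unfolding tensor_submodule_def
 proof (intro subsetI InterI)
  fix x U assume x: "x : tU M N" and "U : {U. submodule U (scalars K) ?F & tensor_relations K M N \<subseteq> U}"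
  then have U: "submodule U (scalars K) ?F" and RU: "tensor_relations K M N \<subseteq> U" by auto
  note g = submodule.axioms(1)[OF U]
  show "x : U" using x unfolding tU_def
  proof induction
   case gspan_0
   show ?case using subgroup.one_closed[OF g] by simp
  next
   case (gspan_base c b)
   then show ?case using submodule.smult_closed[OF U, of c b] RU by auto
  next
   case (gspan_add x y)
   then show ?case using subgroup.m_closed[OF g, of x y] by simp
  qed
 qed
qed

lemma tU_closed: "0 : tU M N" "x : tU M N ==> y : tU M N ==> x + y : tU M N" "x : tU M N ==> c : K ==> smul c x : tU M N"
 "x : tU M N ==> y : tU M N ==> x - y : tU M N"
 unfolding tU_def by (auto intro: gspan.intros gspan_smul gspan_diff)

lemma tp_eq: "tp M N f = tp M N g \<longleftrightarrow> f - g : tU M N"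
proof
 assume "tp M N f = tp M N g"
 moreover have "f : tp M N f" by (simp add: tp_def tU_closed)
 ultimately show "f - g : tU M N" by (auto simp: tp_def)
next
 assume fg: "f - g : tU M N"
 have "x - f : tU M N \<longleftrightarrow> x - g : tU M N" for x
  using tU_closed(2)[of "x - f" M N "f - g"] tU_closed(4)[of "x - g" M N "f - g"] fg by auto
 then show "tp M N f = tp M N g" by (simp add: tp_def)
qed

lemma tp_coset:
 assumes "kclosed M" "kclosed N"
 shows "tensor_submodule K M N +>\<^bsub>free_module K (carrier M \<times> carrier N)\<^esub> f = tp M N f"
proof -
 have "x : tp M N f \<longleftrightarrow> (\<exists>h\<in>tU M N. x = h + f)" for x by (auto simp: tp_def intro!: bexI[of _ "x - f"])
 then show ?thesis unfolding tensor_submodule_eq[OF assms] a_r_coset_def' by auto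
qed

lemma tensor_sel:
 assumes "kclosed M" "kclosed N"
 shows "carrier (tensor K M N) = tp M N ` FM K (carrier M \<times> carrier N)"
  "tp M N f \<oplus>\<^bsub>tensor K M N\<^esub> tp M N g = tp M N (f + g)"
  "c : K ==> c \<odot>\<^bsub>tensor K M N\<^esub> tp M N f = tp M N (smul c f)"
  "pure_tensor K M N a b = tp M N (single (a, b) 1)"
proof -
 note C = tp_coset[OF assms]
 show "carrier (tensor K M N) = tp M N ` FM K (carrier M \<times> carrier N)"
  by (auto simp: tensor_def quotient_algebra_def FactRing_def A_RCOSETS_def' C)
 have "(\<Union>h\<in>tp M N f. \<Union>k\<in>tp M N g. {h + k}) = tp M N (f + g)"
 proof (rule subset_antisym; rule subsetI)
  fix x assume "x : (\<Union>h\<in>tp M N f. \<Union>k\<in>tp M N g. {h + k})"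
  then obtain y z where yz: "y - f : tU M N" "z - g : tU M N" "x = y + z" by (auto simp: tp_def)
  show "x : tp M N (f + g)" using tU_closed(2)[OF yz(1,2)] by (simp add: tp_def yz(3) algebra_simps)
 next
  fix x assume x: "x : tp M N (f + g)"
  have "f : tp M N f" "x - f : tp M N g" using x by (simp_all add: tp_def tU_closed diff_diff_eq)
  then show "x : (\<Union>h\<in>tp M N f. \<Union>k\<in>tp M N g. {h + k})"
   by (intro UN_I[of f] UN_I[of "x - f"]) simp_all
 qed
 then show "tp M N f \<oplus>\<^bsub>tensor K M N\<^esub> tp M N g = tp M N (f + g)"
  by (simp add: tensor_def quotient_algebra_def FactRing_def set_add_def')
 show "c \<odot>\<^bsub>tensor K M N\<^esub> tp M N f = tp M N (smul c f)" if "c : K"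
 proof -
  have "tp M N (smul c h) = tp M N (smul c f)" if h: "h : tp M N f" for h
   unfolding tp_eq smul_diff[symmetric] using h \<open>c : K\<close> by (auto simp: tp_def intro: tU_closed)
  moreover have "tp M N f ~= {}" using tU_closed(1) by (auto simp: tp_def intro!: exI[of _ f])
  ultimately have "(\<Union>h\<in>tp M N f. tp M N (smul c h)) = tp M N (smul c f)" by (intro SUP_eq_const)
  then show ?thesis by (simp only: tensor_def quotient_algebra_def C module.simps free_module_sel)
 qed
 show "pure_tensor K M N a b = tp M N (single (a, b) 1)"
  by (simp add: pure_tensor_def C)
qed

lemma tensor_kclosed:
 assumes "kclosed M" "kclosed N"
 shows "kclosed (tensor K M N)"
 unfolding kclosed_def tensor_sel(1)[OF assms] by (auto simp: tensor_sel(2,3)[OF assms])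

lemma pure_carrier:
 assumes "kclosed M" "kclosed N" "a : carrier M" "b : carrier N"
 shows "pure_tensor K M N a b : carrier (tensor K M N)"
 unfolding tensor_sel[OF assms(1,2)] using assms(3,4) by auto

lemma pure_bilinear:
 assumes MN: "kclosed M" "kclosed N" and a: "a : carrier M" "a' : carrier M" and b: "b : carrier N" "b' : carrier N" and c: "c : K"
 shows "pure_tensor K M N (a \<oplus>\<^bsub>M\<^esub> a') b = pure_tensor K M N a b \<oplus>\<^bsub>tensor K M N\<^esub> pure_tensor K M N a' b"
  "pure_tensor K M N a (b \<oplus>\<^bsub>N\<^esub> b') = pure_tensor K M N a b \<oplus>\<^bsub>tensor K M N\<^esub> pure_tensor K M N a b'"
  "pure_tensor K M N (c \<odot>\<^bsub>M\<^esub> a) b = c \<odot>\<^bsub>tensor K M N\<^esub> pure_tensor K M N a b"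
  "pure_tensor K M N a (c \<odot>\<^bsub>N\<^esub> b) = c \<odot>\<^bsub>tensor K M N\<^esub> pure_tensor K M N a b"
proof -
 note R = gspan_base1[of _ "tensor_relations K M N", folded tU_def]
 have "single (a \<oplus>\<^bsub>M\<^esub> a', b) 1 - single (a, b) 1 - single (a', b) 1 : tU M N"
  by (rule R, unfold tensor_relations_def, rule UnI1, rule UnI1, rule UnI1) (use a b in blast)
 then show "pure_tensor K M N (a \<oplus>\<^bsub>M\<^esub> a') b = pure_tensor K M N a b \<oplus>\<^bsub>tensor K M N\<^esub> pure_tensor K M N a' b"
  unfolding tensor_sel[OF MN] tp_eq by (simp only: diff_diff_eq)
 have "single (a, b \<oplus>\<^bsub>N\<^esub> b') 1 - single (a, b) 1 - single (a, b') 1 : tU M N"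
  by (rule R, unfold tensor_relations_def, rule UnI1, rule UnI1, rule UnI2) (use a b in blast)
 then show "pure_tensor K M N a (b \<oplus>\<^bsub>N\<^esub> b') = pure_tensor K M N a b \<oplus>\<^bsub>tensor K M N\<^esub> pure_tensor K M N a b'"
  unfolding tensor_sel[OF MN] tp_eq by (simp only: diff_diff_eq)
 have "single (c \<odot>\<^bsub>M\<^esub> a, b) 1 - single (a, b) c : tU M N"
  by (rule R, unfold tensor_relations_def, rule UnI1, rule UnI2) (use a b c in blast)
 then show "pure_tensor K M N (c \<odot>\<^bsub>M\<^esub> a) b = c \<odot>\<^bsub>tensor K M N\<^esub> pure_tensor K M N a b"
  unfolding tensor_sel(4)[OF MN] tensor_sel(3)[OF MN c] tp_eq by simp
 have "single (a, c \<odot>\<^bsub>N\<^esub> b) 1 - single (a, b) c : tU M N"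
  by (rule R, unfold tensor_relations_def, rule UnI2) (use a b c in blast)
 then show "pure_tensor K M N a (c \<odot>\<^bsub>N\<^esub> b) = c \<odot>\<^bsub>tensor K M N\<^esub> pure_tensor K M N a b"
  unfolding tensor_sel(4)[OF MN] tensor_sel(3)[OF MN c] tp_eq by simp
qed

text \<open>A form of spanning which yields an induction rule without reference to a zero vector: zero is reached as the
 multiple of any vector by \<open>c = 0\<close>.\<close>

definition spanned :: "(complex, 'a) module => 'a set => bool" where
 "spanned M S \<longleftrightarrow> S \<subseteq> carrier M & (\<forall>U. (\<forall>a\<in>U. \<forall>b\<in>U. a : carrier M --> b : carrier M --> a \<oplus>\<^bsub>M\<^esub> b : U)
  & (\<forall>c\<in>K. \<forall>a\<in>carrier M. a : U \<or> c = 0 --> c \<odot>\<^bsub>M\<^esub> a : U) & S \<subseteq> U --> carrier M \<subseteq> U)"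

lemma spanned_induct:
 assumes "spanned M S" "x : carrier M" "\<And>a b. a : carrier M ==> b : carrier M ==> Q a ==> Q b ==> Q (a \<oplus>\<^bsub>M\<^esub> b)"
  "\<And>c a. c : K ==> a : carrier M ==> Q a \<or> c = 0 ==> Q (c \<odot>\<^bsub>M\<^esub> a)" "\<And>s. s : S ==> Q s"
 shows "Q x"
proof -
 from assms(1)[unfolded spanned_def, THEN conjunct2, rule_format, of "Collect Q"]
 moreover have "S \<subseteq> Collect Q" using assms(5) by blast
 ultimately have "carrier M \<subseteq> Collect Q" using assms(3,4) by simp
 then show ?thesis using assms(2) by blast
qed

lemma spanned_tensor:
 assumes MN: "kclosed M" "kclosed N" and S: "spanned M S" and T: "spanned N T"
 shows "spanned (tensor K M N) ((%(a, b). pure_tensor K M N a b) ` (S \<times> T))"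
proof -
 let ?P = "tensor K M N" and ?p = "pure_tensor K M N"
 have sub: "S \<subseteq> carrier M" "T \<subseteq> carrier N" using S T by (simp_all add: spanned_def)
 note pc = pure_carrier[OF MN]
 show ?thesis
  unfolding spanned_def
 proof (intro conjI allI impI)
  show "(%(a, b). ?p a b) ` (S \<times> T) \<subseteq> carrier ?P" using sub pc by auto
  fix U
  assume A: "(\<forall>a\<in>U. \<forall>b\<in>U. a : carrier ?P --> b : carrier ?P --> a \<oplus>\<^bsub>?P\<^esub> b : U)
   & (\<forall>c\<in>K. \<forall>a\<in>carrier ?P. a : U \<or> c = 0 --> c \<odot>\<^bsub>?P\<^esub> a : U) & (%(a, b). ?p a b) ` (S \<times> T) \<subseteq> U"
  have uadd: "x \<oplus>\<^bsub>?P\<^esub> y : U" if "x : U" "y : U" "x : carrier ?P" "y : carrier ?P" for x y using A that by blast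
  have smu: "c \<odot>\<^bsub>?P\<^esub> x : U" if "x : U \<or> c = 0" "c : K" "x : carrier ?P" for c x using A that by blast
  have 1: "?p a b : U" if a: "a : carrier M" and b: "b : T" for a b
  proof (rule spanned_induct[OF S a])
   have bN: "b : carrier N" using b sub by blast
   show "?p (x \<oplus>\<^bsub>M\<^esub> y) b : U" if "x : carrier M" "y : carrier M" "?p x b : U" "?p y b : U" for x y
    unfolding pure_bilinear(1)[OF MN that(1,2) bN bN K_0] using that pc bN by (intro uadd)
   show "?p (c \<odot>\<^bsub>M\<^esub> x) b : U" if "c : K" "x : carrier M" "?p x b : U \<or> c = 0" for c x
    unfolding pure_bilinear(3)[OF MN that(2,2) bN bN that(1)] using that pc bN by (intro smu)
   show "?p x b : U" if "x : S" for x using A that b by auto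
  qed
  have 2: "?p a b : U" if a: "a : carrier M" and b: "b : carrier N" for a b
  proof (rule spanned_induct[OF T b])
   show "?p a (x \<oplus>\<^bsub>N\<^esub> y) : U" if "x : carrier N" "y : carrier N" "?p a x : U" "?p a y : U" for x y
    unfolding pure_bilinear(2)[OF MN a a that(1,2) K_0] using that pc a by (intro uadd)
   show "?p a (c \<odot>\<^bsub>N\<^esub> x) : U" if "c : K" "x : carrier N" "?p a x : U \<or> c = 0" for c x
    unfolding pure_bilinear(4)[OF MN a a that(2,2) that(1)] using that pc a by (intro smu)
   show "?p a x : U" if "x : T" for x using 1[OF a that] .
  qed
  show "carrier ?P \<subseteq> U"
  proof
   fix z assume "z : carrier ?P"
   then obtain f where f: "f : FM K (carrier M \<times> carrier N)" "z = tp M N f" unfolding tensor_sel[OF MN] by blast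
   note C = tensor_sel(1)[OF MN]
   have "tp M N f : U & tp M N f : carrier ?P"
    using f(1)
   proof (induction rule: FM_induct)
    case zero
    have "tp M N 0 : carrier ?P" unfolding C by blast
    then show ?case using smu[of "tp M N 0" 0] tensor_sel(3)[OF MN K_0, of 0] by simp
   next
    case (add x y)
    have "tp M N (x + y) : carrier ?P" unfolding C using add(1,2) by blast
    then show ?case using uadd[of "tp M N x" "tp M N y"] add(3,4)
     by (simp add: tensor_sel(2)[OF MN])
   next
    case (single w c)
    then obtain a b where w: "w = (a, b)" "a : carrier M" "b : carrier N" by (cases w) auto
    have "c \<odot>\<^bsub>?P\<^esub> ?p a b = tp M N (single w c)" unfolding tensor_sel(4)[OF MN] tensor_sel(3)[OF MN single(2)] by (simp add: w(1))
    moreover have "tp M N (single w c) : carrier ?P" unfolding C using single by blast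
    ultimately show ?case using smu[of "?p a b" c] 2[OF w(2,3)] pc[OF w(2,3)] single(2) by simp
   qed
   then show "z : U" using f(2) by simp
  qed
 qed
qed

lemma assoc_kclosed: "assoc_algebra (scalars K) M ==> kclosed M"
 unfolding kclosed_def by (auto simp: assoc_algebra_def abelian_monoid.a_closed[OF abelian_group.axioms(1)] ring.is_abelian_group Module.module.smult_closed[of "scalars K"])

lemma quotient_spanned:
 assumes Q: "is_quotient K (free_algebra K A) I B \<pi>"
 shows "spanned B ((%w. \<pi> (single w 1)) ` lists A)"
 unfolding spanned_def
proof (intro conjI allI impI)
 note D = is_quotientD[OF Q, simplified]
 show "(%w. \<pi> (single w 1)) ` lists A \<subseteq> carrier B" using D(2) by (auto intro!: FM_single)
 fix U
 assume U: "(\<forall>a\<in>U. \<forall>b\<in>U. a : carrier B --> b : carrier B --> a \<oplus>\<^bsub>B\<^esub> b : U)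
   & (\<forall>c\<in>K. \<forall>a\<in>carrier B. a : U \<or> c = 0 --> c \<odot>\<^bsub>B\<^esub> a : U) & (%w. \<pi> (single w 1)) ` lists A \<subseteq> U"
 have "\<pi> f : U" if "f : FA K A" for f
  using that
 proof (induction rule: FM_induct)
  case zero
  show ?case using U D(2)[of 0] D(7)[of 0 0] by (metis FM_0 K_0 smul_simps(1))
 next
  case (add f g)
  then show ?case using U D(2) D(4) by simp
 next
  case (single w c)
  then have "single w 1 : FA K A" by auto
  moreover have "\<pi> (single w 1) : U" using U single(1) by blast
  ultimately show ?case using U D(2)[of "single w 1"] D(7)[of c "single w 1"] single by auto
 qed
 then show "carrier B \<subseteq> U" using D(3) by blast
qed

end

context cher
begin

text \<open>Maps which are linear modulo the defining ideal of the restricted algebra.\<close>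

definition jlin :: "(complex, 'a) module => ('a => falg) => bool" where
 "jlin M r \<longleftrightarrow> (\<forall>a\<in>carrier M. r a : FH (-1)) & (\<forall>a\<in>carrier M. \<forall>b\<in>carrier M. r (a \<oplus>\<^bsub>M\<^esub> b) - (r a + r b) : J (-1))
  & (\<forall>c\<in>K. \<forall>a\<in>carrier M. r (c \<odot>\<^bsub>M\<^esub> a) - smul c (r a) : J (-1))"

lemmas Jm = J_props[OF m1]

lemma J_trans: "f - g : J (-1) ==> g - h : J (-1) ==> f - h : J (-1)"
 using Jm(4)[of "f - g" "g - h"] by simp

lemma J_sym: "f - g : J (-1) ==> g - f : J (-1)"
 using Jm(5)[OF Jm(3), of "f - g"] by simp

text \<open>The universal property of the tensor product, for a bilinear map given by a product of representatives.\<close>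

lemma tensor_jlin:
 assumes MN: "kclosed M" "kclosed N" and r: "jlin M r" and s: "jlin N s"
 shows "\<exists>t. jlin (tensor K M N) t & (\<forall>a\<in>carrier M. \<forall>b\<in>carrier N. t (pure_tensor K M N a b) - r a * s b : J (-1))"
proof -
 define L where "L = lin (%(a, b). r a * s b)"
 define t where "t z = L (SOME f. f : FM K (carrier M \<times> carrier N) & z = tp M N f)" for z
 have L: "L (f + g) = L f + L g" "L (f - g) = L f - L g" "L (smul c f) = smul c (L f)" "L (single (a, b) c) = smul c (r a * s b)" "L 0 = 0"
  for f g a b c by (simp_all add: L_def lin_simps)
 have rs: "r a : FH (-1)" "s b : FH (-1)" if "a : carrier M" "b : carrier N" for a b
  using r s that by (simp_all add: jlin_def)
 have LF: "L f : FH (-1)" if "f : FM K (carrier M \<times> carrier N)" for f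
  unfolding L_def by (rule FM_lin[OF that]) (auto intro!: FA_mult rs)
 have base: "L x : J (-1)" if "x : tensor_relations K M N" for x
  using that unfolding tensor_relations_def
 proof (elim UnE CollectE exE conjE)
  fix a a' b assume *: "x = single (a \<oplus>\<^bsub>M\<^esub> a', b) 1 - single (a, b) 1 - single (a', b) 1" "a : carrier M" "a' : carrier M" "b : carrier N"
  have "(r (a \<oplus>\<^bsub>M\<^esub> a') - (r a + r a')) * s b : J (-1)"
   using r * rs by (intro Jm(8)) (simp_all add: jlin_def)
  then show ?thesis unfolding *(1) L by (simp add: algebra_simps)
 next
  fix a b b' assume *: "x = single (a, b \<oplus>\<^bsub>N\<^esub> b') 1 - single (a, b) 1 - single (a, b') 1" "a : carrier M" "b : carrier N" "b' : carrier N"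
  have "r a * (s (b \<oplus>\<^bsub>N\<^esub> b') - (s b + s b')) : J (-1)"
   using s * rs by (intro Jm(7)) (simp_all add: jlin_def)
  then show ?thesis unfolding *(1) L by (simp add: algebra_simps)
 next
  fix a b c assume *: "x = single (c \<odot>\<^bsub>M\<^esub> a, b) 1 - single (a, b) c" "a : carrier M" "b : carrier N" "c : K"
  have "(r (c \<odot>\<^bsub>M\<^esub> a) - smul c (r a)) * s b : J (-1)"
   using r * rs by (intro Jm(8)) (simp_all add: jlin_def)
  then show ?thesis unfolding *(1) L by (simp add: algebra_simps smul_mult_left)
 next
  fix a b c assume *: "x = single (a, c \<odot>\<^bsub>N\<^esub> b) 1 - single (a, b) c" "a : carrier M" "b : carrier N" "c : K"
  have "r a * (s (c \<odot>\<^bsub>N\<^esub> b) - smul c (s b)) : J (-1)"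
   using s * rs by (intro Jm(7)) (simp_all add: jlin_def)
  then show ?thesis unfolding *(1) L by (simp add: algebra_simps smul_mult_right)
 qed
 have LU: "L x : J (-1)" if "x : tU M N" for x
  using that unfolding tU_def
  by induction (simp_all only: L Jm(3) Jm(4) Jm(6) base)
 have t: "t (tp M N f) - L f : J (-1)" "t (tp M N f) : FH (-1)" if f: "f : FM K (carrier M \<times> carrier N)" for f
 proof -
  have "\<exists>g. g : FM K (carrier M \<times> carrier N) & tp M N f = tp M N g" using f by blast
  from someI_ex[OF this] obtain g where g: "g : FM K (carrier M \<times> carrier N)" "tp M N f = tp M N g" "t (tp M N f) = L g"
   unfolding t_def by blast
  have "L (g - f) : J (-1)" using LU g(2) tp_eq[of M N g f] by simp
  then show "t (tp M N f) - L f : J (-1)" unfolding g(3) L .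
  show "t (tp M N f) : FH (-1)" unfolding g(3) by (rule LF[OF g(1)])
 qed
 have "jlin (tensor K M N) t"
  unfolding jlin_def tensor_sel(1)[OF MN]
 proof (intro conjI ballI; (elim imageE; hypsubst)?)
  fix f g assume f: "f : FM K (carrier M \<times> carrier N)" and g: "g : FM K (carrier M \<times> carrier N)"
  have "(t (tp M N (f + g)) - L (f + g)) - (t (tp M N f) - L f) - (t (tp M N g) - L g) : J (-1)"
   by (intro Jm(5)[OF Jm(5)[OF t(1) t(1)] t(1)] FM_add f g)
  then show "t (tp M N f \<oplus>\<^bsub>tensor K M N\<^esub> tp M N g) - (t (tp M N f) + t (tp M N g)) : J (-1)"
   unfolding tensor_sel(2)[OF MN] L by (simp add: algebra_simps)
 next
  fix c f assume c: "c : K" and f: "f : FM K (carrier M \<times> carrier N)"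
  have "(t (tp M N (smul c f)) - L (smul c f)) - smul c (t (tp M N f) - L f) : J (-1)"
   by (intro Jm(5)[OF t(1) Jm(6)[OF t(1)]] FM_smul f c)
  then show "t (c \<odot>\<^bsub>tensor K M N\<^esub> tp M N f) - smul c (t (tp M N f)) : J (-1)"
   unfolding tensor_sel(3)[OF MN c] L by (simp add: algebra_simps smul_diff)
 qed (rule t(2))
 moreover have "t (pure_tensor K M N a b) - r a * s b : J (-1)" if "a : carrier M" "b : carrier N" for a b
 proof -
  have "single (a, b) 1 : FM K (carrier M \<times> carrier N)" using that by auto
  from t(1)[OF this] show ?thesis unfolding tensor_sel(4)[OF MN] L by simp
 qed
 ultimately show ?thesis by blast
qed

end

section \<open>The triangular decomposition\<close>

lemma lin_if_Nil: "lin (%w. if w = [] then y else 0) f = smul (lookup f []) y"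
proof -
 have "lin (%w. if w = [] then y else 0) f = (\<Sum>w\<in>keys f. if w = [] then smul (lookup f []) y else 0)"
  unfolding lin_def by (intro sum.cong refl) auto
 also have "\<dots> = smul (lookup f []) y" by (auto simp: sum.delta in_keys_iff)
 finally show ?thesis .
qed

lemma hm_zero:
 fixes f :: "'a list \<Rightarrow>\<^sub>0 complex"
 shows "hm (%_. 0) f = (smul (lookup f []) 1 :: 'b list \<Rightarrow>\<^sub>0 complex)"
proof -
 have *: "prod_list (map (%_. 0) w) = (if w = [] then 1 else 0 :: 'b list \<Rightarrow>\<^sub>0 complex)" for w :: "'a list"
  by (cases w) simp_all
 show ?thesis unfolding hm_def * lin_if_Nil ..
qed

lemma emb_lin: "emb v f = lin (%w. single (map v w) 1) f"
 by (simp add: hm_def prod_list_single map_replicate_const)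

context cher
begin

lemma J_lin: "f : FM K S ==> (\<And>w. w : S ==> \<phi> w : J (-1)) ==> lin \<phi> f : J (-1)"
 unfolding lin_def by (intro Jm(9) Jm(6)) (auto simp: FM_def)

lemma JS_gens: "S_rels n (-1) v \<union> Inv (-1) v \<subseteq> FS v"
 using S_rels_FA[OF m1] Inv_FA by blast

lemmas JSm = relI_props[OF JS_gens, folded JS_def]

lemma JS_J:
 assumes v: "XY v" and f: "f : JS (-1) v"
 shows "f : J (-1)"
 using JS_gens f unfolding JS_def
proof (induction rule: relI_induct)
 case (base a u r w)
 have "S_rels n (-1) v \<subseteq> HR (-1)" using v by (auto simp: H_rels_def)
 then have "r : J (-1)" using base(3) v H_relsI(1,2)[OF m1] by blast
 moreover have "u : lists (Hg (-1))" "w : lists (Hg (-1))" using base lists_mono[OF Sg_Hg[OF v]] by blast+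
 ultimately show ?case using base(1) by (intro Jm(6,7,8) FM_single K_1)
qed (simp_all add: Jm)

lemma S_ideal_JS:
 assumes "f : SI (-1) v"
 shows "f : JS (-1) v"
 using S_rels_FA[OF m1] assms unfolding S_ideal_def
proof (induction rule: relI_induct)
 case (base a u r w)
 then show ?case by (intro JSm(6,7,8) FM_single K_1 JSm(2)) auto
qed (simp_all add: JSm)

definition JN :: "(nat => gen) => nalg set" where
 "JN v = {h : FN. emb v h : JS (-1) v}"

lemma map_Sg: "u : lists {..<n} ==> map v u : lists (Sg v)"
 unfolding lists_Sg by blast

lemma JN_I:
 assumes v: "XY v"
 shows "f : NI ==> f : JN v" "f : INV v ==> u : lists {..<n} ==> f * single u 1 : JN v"
  "f : INV v ==> u : lists {..<n} ==> single u 1 * f : JN v"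
proof -
 show "f : JN v" if "f : NI"
  using that NI_props(1) S_ideal_JS emb_NI_iff[OF v, of f] by (auto simp: JN_def)
 assume f: "f : INV v" and u: "u : lists {..<n}"
 have "emb v f : JS (-1) v" using f by (intro JSm(2)) (auto simp: INV_def)
 moreover have "single (map v u) 1 : FS v" using map_Sg[OF u] by auto
 moreover have "single u 1 : FN" using u by auto
 ultimately show "f * single u 1 : JN v" "single u 1 * f : JN v"
  using INV_FN[OF f] by (simp_all add: JN_def hm_simps(5) emb_word FA_mult JSm(7,8))
qed

text \<open>Invariants have positive degree, so the ideal does not contain constants.\<close>

lemma JN_const: "h : JN v ==> lookup h [] = 0"
proof -
 have "hm (%_. 0) f = (0 :: falg)" if "f : JS (-1) v" for f
  using JS_gens that unfolding JS_def
 proof (induction rule: relI_induct)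
  case (base a u r w)
  have "lookup r [] = 0"
  proof (cases "r : Inv (-1) v")
   case True
   from InvD(2)[OF this] have "[] \<notin> keys r" by auto
   then show ?thesis by (simp add: in_keys_iff)
  next
   case False
   then show ?thesis using base(3) by (auto simp: S_rels_def lookup_minus lookup_single)
  qed
  then show ?case by (simp add: hm_simps(3,5) hm_zero[of r])
 qed (simp_all add: hm_simps(1,4))
 moreover assume "h : JN v"
 ultimately have "hm (%_. 0) (emb v h) = (0 :: falg)" by (simp add: JN_def)
 moreover have "hm (%_. 0) (emb v h) = (hm (%_. 0) h :: falg)" by (simp add: hm_hm hm_simps(6))
 ultimately have "smul (lookup h []) 1 = (0 :: falg)" by (simp add: hm_zero)
 then have "lookup (smul (lookup h []) (single [] 1 :: falg)) [] = 0" unfolding single_Nil_one by simp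
 then show "lookup h [] = 0" by simp
qed

lemma act_X_word: "act (emb Xg f) (single (u, g, v) a) = lin (%w. single (w @ u, g, v) a) f"
proof -
 have "foldr opM (map Xg w) x = foldr XM w x" for w x by (induction w) (simp_all add: opM_def)
 then show ?thesis by (simp add: emb_lin act_def lin_lin foldr_XM)
qed

text \<open>To define a linear map on the tensor product it suffices to give it on the basis of words, provided that it
 vanishes on the ideals of the two outer factors.\<close>

lemma NN_lin:
 assumes Z: "0 : Z" "\<And>x y. x : Z ==> y : Z ==> x + y : Z" "\<And>a x. a : K ==> x : Z ==> smul a x : Z"
  and X: "\<And>h g v. h : JN Xg ==> g : CG (-1) ==> v : lists {..<n} ==> lin (%w. Q (w, g, v)) h : Z"
  and Y: "\<And>h u g. h : JN Yg ==> u : lists {..<n} ==> g : CG (-1) ==> lin (%w. Q (u, g, w)) h : Z"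
  and x: "x : NN"
 shows "lin Q x : Z"
proof -
 have swap: "single (a @ [i, j] @ b) 1 + single (a @ [j, i] @ b) 1 : JN v"
  if "a : lists {..<n}" "b : lists {..<n}" "i < n" "j < n" "i ~= j" "XY v" for a b i j v
 proof -
  have "single a 1 * (single [i, j] 1 + single [j, i] 1) * single b 1 : NI"
   using that by (intro NI_props(7,8) swap_NI FM_single K_1)
  then show ?thesis using JN_I(1)[OF that(6)] by (simp add: distrib_left distrib_right)
 qed
 have L: "lin Q y : Z" if "y : L0" for y
  using that
 proof (induction rule: L0_induct)
  case (X a b i j g v)
  from assms(4)[OF swap[OF X(1-5)] X(6,7)] show ?case by (simp add: lin_add)
 next
  case (Y a b i j g u)
  from assms(5)[OF swap[OF Y(1-5)] Y(7,6)] show ?case by (simp add: lin_add)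
 qed (simp_all add: lin_simps Z)
 have A: "lin Q (act (emb Xg f) y) : Z" if f: "f : INV Xg" and y: "y : MK" for f y
  using y
 proof (induction rule: MK_induct)
  case (single u g v a)
  have "f * single u 1 = lin (%w. single (w @ u) 1) f"
   using lin_mult_left[of "%w. single w 1" f "single u 1"] by simp
  then have "lin Q (act (emb Xg f) (single (u, g, v) a)) = smul a (lin (%w. Q (w, g, v)) (f * single u 1))"
   by (simp add: act_X_word lin_lin lin_fun_smul)
  then show ?case using single assms(4)[OF JN_I(2)[OF _ f single(1)] single(2,3)] by (simp add: Z)
 qed (simp_all add: act_simps(4) act_def[of _ 0] foldr_opM_simps lin_add Z)
 have B: "lin Q (RR f y) : Z" if f: "f : INV Yg" and y: "y : MK" for f y
  using y
 proof (induction rule: MK_induct)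
  case (single u g v a)
  have "single v 1 * f = lin (%w. single (v @ w) 1) f"
   using lin_mult_right[of "single v 1" "%w. single w 1" f] by simp
  then have "lin Q (RR f (single (u, g, v) a)) = smul a (lin (%w. Q (u, g, w)) (single v 1 * f))"
   by (simp add: RR_def RM_simps lin_lin lin_fun_smul)
  then show ?case using single assms(5)[OF JN_I(3)[OF _ f single(3)] single(1,2)] by (simp add: Z)
 qed (simp_all add: RR_def RM_simps lin_fun_add lin_add Z)
 show ?thesis
  using x[unfolded NN_def]
 proof induction
  case (gspan_base b y)
  have "lin Q y : Z" using gspan_base(2) L A B by blast
  then show ?case using gspan_base(1) Z by (simp add: lin_smul)
 qed (simp_all add: lin_add Z)
qed

text \<open>Normal forms: \<open>Wd\<close> reads a vector of the module as an element of the algebra.\<close>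

definition Wd :: "wmod => falg" where
 "Wd = lin (%(u, g, v). single (map Xg u @ Gr g # map Yg v) 1)"

lemma Wd_simps: "Wd (x + y) = Wd x + Wd y" "Wd (x - y) = Wd x - Wd y" "Wd (smul a x) = smul a (Wd x)" "Wd 0 = 0"
 "Wd (\<Sum>i\<in>I. F i) = (\<Sum>i\<in>I. Wd (F i))" "Wd (single (u, g, v) a) = single (map Xg u @ Gr g # map Yg v) a"
 by (simp_all add: Wd_def lin_simps)

lemma Wd_XM: "Wd (XM i x) = single [Xg i] 1 * Wd x"
 by (induction x rule: wmod_induct) (simp_all add: Wd_simps XM_simps distrib_left)

lemma gens_Hg: "XY v ==> i < n ==> single [v i] a : FH (-1) \<longleftrightarrow> a : K" 
 "g : CG (-1) ==> single [Gr g] 1 : FH (-1)"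
 by (auto simp: H_gens_def FM_def lookup_single when_def split: if_splits)

lemma word_Hg: "u : lists {..<n} ==> XY v ==> map v u : lists (Hg (-1))"
 by (auto simp: H_gens_def)

lemma Wd_FA: "x : MK ==> Wd x : FH (-1)"
 unfolding Wd_def by (rule FM_lin) (auto simp: MB_def H_gens_def intro!: FM_single)

lemma relations_J:
 shows "g : CG (-1) ==> XY v ==> i < n ==> single [Gr g] 1 * single [v i] 1 - smul (cv v (dm n g i)) (single [v (pm n g i)] 1 * single [Gr g] 1) : J (-1)"
  "i < n ==> j < n ==> single [Yg i] 1 * single [Xg j] 1 - smul (qs i j) (single [Xg j] 1 * single [Yg i] 1) - \<kappa> (-1) i j : J (-1)"
  "g : CG (-1) ==> h : CG (-1) ==> single [Gr g] 1 * single [Gr h] 1 - single [Gr (g * h)] 1 : J (-1)"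
  "single [Gr (1\<^sub>m n)] 1 - 1 : J (-1)"
proof -
 note R = H_relsI(1)[OF m1]
 show "single [Gr g] 1 * single [v i] 1 - smul (cv v (dm n g i)) (single [v (pm n g i)] 1 * single [Gr g] 1) : J (-1)"
  if "g : CG (-1)" "XY v" "i < n"
 proof -
  have "single [Gr g, v i] 1 - gen_action n W g (v i) * single [Gr g] 1 : J (-1)"
   by (rule R, unfold H_rels_def free_algebra_sel, rule UnI1, rule UnI2) (use that in blast)
  then show ?thesis by (simp add: gen_action_v[OF m1 that])
 qed
 show "single [Yg i] 1 * single [Xg j] 1 - smul (qs i j) (single [Xg j] 1 * single [Yg i] 1) - \<kappa> (-1) i j : J (-1)" if "i < n" "j < n"
 proof -
  have "single [Yg i, Xg j] 1 - single [Xg j, Yg i] (if i = j then 1 else -1) - \<kappa> (-1) i j : J (-1)"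
   by (rule R, unfold H_rels_def, rule UnI2) (use that in blast)
  then show ?thesis by (simp add: qs_def)
 qed
 show "single [Gr g] 1 * single [Gr h] 1 - single [Gr (g * h)] 1 : J (-1)" if "g : CG (-1)" "h : CG (-1)"
 proof -
  have "single [Gr g, Gr h] 1 - single [Gr (g * h)] 1 : J (-1)"
   by (rule R, unfold H_rels_def Gamma_mult_one, rule UnI1, rule UnI1, rule UnI2) (use that in blast)
  then show ?thesis by simp
 qed
 show "single [Gr (1\<^sub>m n)] 1 - 1 : J (-1)"
  unfolding single_Nil_one[symmetric]
  by (rule R, unfold H_rels_def Gamma_mult_one, rule UnI1, rule UnI1, rule UnI1, rule UnI2) blast
qed

lemma XM_induct [consumes 1, case_names zero add smul base XM]:
 assumes "x : MK" "Q 0" "\<And>a b. a : MK ==> b : MK ==> Q a ==> Q b ==> Q (a + b)" "\<And>a x. a : K ==> x : MK ==> Q x ==> Q (smul a x)"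
  "\<And>g v. g : CG (-1) ==> v : lists {..<n} ==> single ([], g, v) 1 : MK ==> Q (single ([], g, v) 1)"
  "\<And>i x. i < n ==> x : MK ==> Q x ==> Q (XM i x)"
 shows "Q x"
 using assms(1)
proof (induction rule: MK_induct)
 case (single u g v a)
 have mk: "single (u, g, v) 1 : MK" if "u : lists {..<n}" for u using that single by (auto simp: MB_def intro!: FM_single)
 from single(1) have "Q (single (u, g, v) 1)"
 proof (induction u)
  case (Cons i u)
  then show ?case using assms(6)[of i "single (u, g, v) 1"] mk by (auto simp: XM_simps)
 qed (use assms(5) single mk in auto)
 from assms(4)[OF single(4) mk[OF single(1)] this] show ?case by simp
qed (use assms in auto)

lemma Wd_GM:
 assumes g: "g : CG (-1)" and x: "x : MK"
 shows "single [Gr g] 1 * Wd x - Wd (GM g x) : J (-1)"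
 using x
proof (induction rule: XM_induct)
 case (base h v)
 have "(single [Gr g] 1 * single [Gr h] 1 - single [Gr (g * h)] 1) * single (map Yg v) 1 : J (-1)"
  by (intro Jm(8) relations_J(3) g base FM_single word_Hg) auto
 then show ?case by (simp add: Wd_simps GM_simps left_diff_distrib)
next
 case (XM i x)
 note G = GammaD(2,6)[OF m1 g XM(1)]
 have "(single [Gr g] 1 * single [Xg i] 1 - smul (cv Xg (dm n g i)) (single [Xg (pm n g i)] 1 * single [Gr g] 1)) * Wd x
  + smul (dm n g i) (single [Xg (pm n g i)] 1 * (single [Gr g] 1 * Wd x - Wd (GM g x))) : J (-1)"
  by (intro Jm(4)[OF Jm(8)[OF relations_J(1)] Jm(6)[OF Jm(7)]] g XM Wd_FA) (use G roots_K in \<open>auto simp: gens_Hg\<close>)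
 also have "(single [Gr g] 1 * single [Xg i] 1 - smul (cv Xg (dm n g i)) (single [Xg (pm n g i)] 1 * single [Gr g] 1)) * Wd x
  + smul (dm n g i) (single [Xg (pm n g i)] 1 * (single [Gr g] 1 * Wd x - Wd (GM g x)))
  = single [Gr g] 1 * Wd (XM i x) - Wd (GM g (XM i x))"
  unfolding GM_XM Wd_simps Wd_XM by (simp add: algebra_simps smul_diff smul_mult_left smul_mult_right del: mult_words)
 finally show ?case .
next
 case (add a b)
 from Jm(4)[OF add(3,4)] show ?case by (simp add: Wd_simps GM_simps algebra_simps)
next
 case (smul a x)
 from Jm(6)[OF smul(3,1)] show ?case by (simp add: Wd_simps GM_simps smul_diff smul_mult_right)
qed (simp add: Wd_simps GM_simps Jm)

lemma Wd_kM:
 assumes "i < n" "j < n" and x: "x : MK"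
 shows "\<kappa> (-1) i j * Wd x - Wd (kM i j x) : J (-1)"
proof -
 have "(\<Sum>r\<in>Rf i. smul (bc i r * ac i r j) (single [Gr (rm i r)] 1 * Wd x - Wd (GM (rm i r) x))) : J (-1)"
  by (intro Jm(9) Jm(6) Wd_GM x K_mult rm_facts ac_K assms)
 then show ?thesis
  by (simp add: kappa_Rf[OF assms(1,2)] kM_def Wd_simps smul_diff sum_subtractf sum_distrib_right smul_mult_left[symmetric])
qed

lemma Wd_YM:
 assumes i: "i < n" and x: "x : MK"
 shows "single [Yg i] 1 * Wd x - Wd (YM i x) : J (-1)"
 using x
proof (induction rule: XM_induct)
 case (base h v)
 note G = GammaD[OF m1 base(1)]
 let ?k = "inv_into UNIV (pm n h) i"
 have k: "?k < n" "pm n h ?k = i"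
  using permutes_in_image[OF permutes_inv[OF G(1)], of i] i permutes_inverses(1)[OF G(1)] by auto
 have d: "dm n h ?k * inverse (dm n h ?k) = 1" using G(5)[OF k(1)] by simp
 have "smul (dm n h ?k) (single [Gr h] 1 * single [Yg ?k] 1 - smul (cv Yg (dm n h ?k)) (single [Yg (pm n h ?k)] 1 * single [Gr h] 1)) * single (map Yg v) 1 : J (-1)"
  using G(2)[OF k(1)] roots_K by (intro Jm(8) Jm(6) relations_J(1) base k FM_single word_Hg) auto
 then have "- (smul (dm n h ?k) (single [Gr h] 1 * single [Yg ?k] 1 - smul (cv Yg (dm n h ?k)) (single [Yg (pm n h ?k)] 1 * single [Gr h] 1)) * single (map Yg v) 1) : J (-1)"
  using Jm(5)[OF Jm(3)] by fastforce
 then show ?case using d k(2) by (simp add: Wd_simps YM_simps left_diff_distrib smul_diff)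
next
 case (XM j x)
 have "(single [Yg i] 1 * single [Xg j] 1 - smul (qs i j) (single [Xg j] 1 * single [Yg i] 1) - \<kappa> (-1) i j) * Wd x
  + smul (qs i j) (single [Xg j] 1 * (single [Yg i] 1 * Wd x - Wd (YM i x))) + (\<kappa> (-1) i j * Wd x - Wd (kM i j x)) : J (-1)"
  by (intro Jm(4)[OF Jm(4)[OF Jm(8)[OF relations_J(2)] Jm(6)[OF Jm(7)]] Wd_kM] i XM Wd_FA) (use XM in \<open>auto simp: gens_Hg\<close>)
 also have "(single [Yg i] 1 * single [Xg j] 1 - smul (qs i j) (single [Xg j] 1 * single [Yg i] 1) - \<kappa> (-1) i j) * Wd x
  + smul (qs i j) (single [Xg j] 1 * (single [Yg i] 1 * Wd x - Wd (YM i x))) + (\<kappa> (-1) i j * Wd x - Wd (kM i j x))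
  = single [Yg i] 1 * Wd (XM j x) - Wd (YM i (XM j x))"
  unfolding YM_XM Wd_simps Wd_XM by (simp add: algebra_simps smul_diff smul_mult_left smul_mult_right del: mult_words)
 finally show ?case .
next
 case (add a b)
 from Jm(4)[OF add(3,4)] show ?case by (simp add: Wd_simps YM_simps algebra_simps)
next
 case (smul a x)
 from Jm(6)[OF smul(3,1)] show ?case by (simp add: Wd_simps YM_simps smul_diff smul_mult_right)
qed (simp add: Wd_simps YM_simps Jm)

lemma un_MK: "un : MK"
 using one_W by (auto simp: MB_def intro!: FM_single)

lemma normal_form:
 assumes "f : FH (-1)"
 shows "f - Wd (act f un) : J (-1)"
 using assms
proof (induction rule: FM_induct)
 case (single w a)
 have op: "single [b] 1 * Wd x - Wd (opM b x) : J (-1)" if b: "b : Hg (-1)" and x: "x : MK" for b x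
  using b Wd_GM[OF _ x] Wd_YM[OF _ x] by (auto simp: H_gens_def opM_def Wd_XM Jm)
 from single(1) have "single w 1 - Wd (foldr opM w un) : J (-1)"
 proof (induction w)
  case Nil
  show ?case using J_sym[OF relations_J(4)] by (simp add: Wd_simps single_Nil_one)
 next
  case (Cons b w)
  have "single [b] 1 * (single w 1 - Wd (foldr opM w un)) + (single [b] 1 * Wd (foldr opM w un) - Wd (opM b (foldr opM w un))) : J (-1)"
   using Cons(1) foldr_opM_closed(1)[OF Cons(2) un_MK] Cons(3) by (intro Jm(4) Jm(7) op FM_single) auto
  then show ?case by (simp add: right_diff_distrib)
 qed
 from Jm(6)[OF this single(2)] show ?case by (simp add: act_simps Wd_simps smul_diff)
next
 case (add f g)
 from Jm(4)[OF add(3,4)] show ?case by (simp add: act_simps Wd_simps algebra_simps)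
qed (simp add: act_simps Wd_simps Jm)

text \<open>A basis vector is the result of applying its own word to \<open>un\<close>, so normal forms are unique.\<close>

lemma act_Wd: "x : MK ==> act (Wd x) un = x"
proof (induction rule: MK_induct)
 case (single u g v a)
 have Y: "foldr opM (map Yg v) un = single ([], 1\<^sub>m n, v) 1"
  using single(3) by (induction v) (auto simp: opM_def YM_simps one_pm_dm inv_id)
 have X: "foldr opM (map Xg u) x = foldr XM u x" for x by (induction u) (simp_all add: opM_def)
 show ?case
  using GammaD(7)[OF m1 single(2)] by (simp add: Wd_simps act_simps Y X opM_def GM_simps foldr_XM)
qed (simp_all add: Wd_simps act_simps)

abbreviation XA :: "(complex, falg set set) module" where "XA \<equiv> coinvariant_algebra K n W (-1) Xg"
abbreviation YA :: "(complex, falg set set) module" where "YA \<equiv> coinvariant_algebra K n W (-1) Yg"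
abbreviation GA :: "(complex, complex mat \<Rightarrow>\<^sub>0 complex) module" where "GA \<equiv> monoid_algebra K W"
abbreviation HA :: "(complex, falg set set) module" where "HA \<equiv> restricted_alg K n W (-1) (\<kappa> (-1))"

lemma GA_sel: "carrier GA = FM K (CG (-1))" "\<zero>\<^bsub>GA\<^esub> = 0" "add GA = (+)" "smult GA = smul" "\<one>\<^bsub>GA\<^esub> = single (1\<^sub>m n) 1"
 "b \<otimes>\<^bsub>GA\<^esub> b' = lin (%g. lin (%h. single (g * h) 1) b') b"
 using free_module_sel[of "CG (-1)"]
 by (simp_all add: monoid_algebra_def Gamma_mult_one lin_def smul_sum mult.commute free_module_def)

definition rG :: "(complex mat \<Rightarrow>\<^sub>0 complex) => falg" where
 "rG = lin (%g. single [Gr g] 1)"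

lemma GA_kclosed: "kclosed GA"
 by (auto simp: kclosed_def GA_sel)

lemma GA_spanned: "spanned GA ((%g. single g 1) ` CG (-1))"
 unfolding spanned_def GA_sel
proof (intro conjI allI impI subsetI)
 show "x : FM K (CG (-1))" if "x : (%g. single g 1) ` CG (-1)" for x using that by auto
 fix U f
 assume U: "(\<forall>a\<in>U. \<forall>b\<in>U. a : FM K (CG (-1)) --> b : FM K (CG (-1)) --> a + b : U)
   & (\<forall>c\<in>K. \<forall>a\<in>FM K (CG (-1)). a : U \<or> c = 0 --> smul c a : U) & (%g. single g 1) ` CG (-1) \<subseteq> U"
 assume "f : FM K (CG (-1))"
 then show "f : U"
 proof (induction rule: FM_induct)
  case zero
  show ?case using U FM_0[of "CG (-1)"] K_0 by (metis smul_simps(1))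
 next
  case (single g c)
  then have "single g 1 : FM K (CG (-1))" "single g 1 : U" using U by auto
  then have "smul c (single g 1) : U" using U single(2) by blast
  then show ?case by simp
 qed (use U in blast)
qed

lemma rG_simps: "rG (f + f') = rG f + rG f'" "rG (f - f') = rG f - rG f'" "rG (smul a f) = smul a (rG f)" "rG (single g a) = single [Gr g] a"
 by (simp_all add: rG_def lin_simps)

lemma rG_FA: "b : FM K (CG (-1)) ==> rG b : FH (-1)"
 unfolding rG_def by (rule FM_lin) (auto simp: H_gens_def intro!: FM_single)

lemma rG_jlin: "jlin GA rG"
 by (simp add: jlin_def GA_sel rG_FA rG_simps Jm)

lemma rG_mult:
 assumes "b : FM K (CG (-1))" "b' : FM K (CG (-1))"
 shows "rG (b \<otimes>\<^bsub>GA\<^esub> b') - rG b * rG b' : J (-1)"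
proof -
 have "lin (%g. lin (%h. single [Gr g] 1 * single [Gr h] 1 - single [Gr (g * h)] 1) b') b : J (-1)"
  by (intro J_lin[OF assms(1)] J_lin[OF assms(2)] relations_J(3))
 moreover have "lin (%g. lin (%h. single [Gr g] 1 * single [Gr h] 1 - single [Gr (g * h)] 1) b') b = rG b * rG b' - rG (b \<otimes>\<^bsub>GA\<^esub> b')"
  unfolding GA_sel rG_def lin_mult_left unfolding lin_mult_right by (simp add: lin_fun_diff lin_lin)
 ultimately show ?thesis using J_sym by simp
qed

text \<open>A choice of representatives, linear modulo \<open>J\<close> only.\<close>

definition rS :: "(nat => gen) => falg set set => falg" where
 "rS v x = (SOME f. f : FS v & x = clS (-1) v f)"

abbreviation SA :: "(nat => gen) => (complex, falg set set) module" where "SA v \<equiv> coinvariant_algebra K n W (-1) v"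

lemmas SD = is_quotientD[OF coinvariant_quotient[OF m1], simplified free_algebra_sel]
lemmas HD = is_quotientD[OF restricted_quotient[OF m1], simplified free_algebra_sel]

lemma clS_eq: "XY v ==> f : FS v ==> g : FS v ==> clS (-1) v f = clS (-1) v g \<longleftrightarrow> f - g : JS (-1) v"
 by (rule is_quotient_free_eq[OF coinvariant_quotient[OF m1]])

lemma rS:
 assumes v: "XY v"
 shows "x : carrier (SA v) ==> rS v x : FS v & clS (-1) v (rS v x) = x"
  "f : FS v ==> rS v (clS (-1) v f) - f : JS (-1) v"
proof -
 have *: "rS v x : FS v & x = clS (-1) v (rS v x)" if "x : carrier (SA v)" for x
  unfolding rS_def by (rule someI_ex) (use SD(3)[OF v that] in blast)
 then show "x : carrier (SA v) ==> rS v x : FS v & clS (-1) v (rS v x) = x" by metis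
 show "f : FS v ==> rS v (clS (-1) v f) - f : JS (-1) v"
  using *[of "clS (-1) v f"] SD(2)[OF v, of f] clS_eq[OF v, of "rS v (clS (-1) v f)" f] by simp
qed

lemma rS_jlin:
 assumes v: "XY v"
 shows "jlin (SA v) (rS v)"
 unfolding jlin_def
proof (intro conjI ballI)
 note R = rS(1)[OF v]
 fix a assume a: "a : carrier (SA v)"
 show "rS v a : FH (-1)" using R[OF a] FA_Sg_Hg[OF v] by blast
 fix b assume b: "b : carrier (SA v)"
 have "a \<oplus>\<^bsub>SA v\<^esub> b = clS (-1) v (rS v a + rS v b)" using SD(4)[OF v, of "rS v a" "rS v b"] R[OF a] R[OF b] by simp
 then show "rS v (a \<oplus>\<^bsub>SA v\<^esub> b) - (rS v a + rS v b) : J (-1)"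
  using rS(2)[OF v, of "rS v a + rS v b"] R[OF a] R[OF b] JS_J[OF v] by (simp add: FM_add)
next
 note R = rS(1)[OF v]
 fix c a assume c: "c : K" and a: "a : carrier (SA v)"
 have "c \<odot>\<^bsub>SA v\<^esub> a = clS (-1) v (smul c (rS v a))" using SD(7)[OF v c, of "rS v a"] R[OF a] by simp
 then show "rS v (c \<odot>\<^bsub>SA v\<^esub> a) - smul c (rS v a) : J (-1)"
  using rS(2)[OF v, of "smul c (rS v a)"] R[OF a] c JS_J[OF v] by (simp add: FM_smul)
qed

lemma clH_rS: "XY v ==> f : FS v ==> clH (-1) (rS v (clS (-1) v f)) = clH (-1) f"
 using rS[of v] JS_J[of v] FA_Sg_Hg[of v] SD(2)[of v f] by (subst clH_eq[OF m1]) auto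

lemma S_hom:
 assumes v: "XY v"
 shows "(%x. clH (-1) (rS v x)) : algebra_hom K (SA v) HA"
proof -
 note R = rS(1)[OF v]
 have c: "clH (-1) (rS v (clS (-1) v f)) = clH (-1) f" "f : FH (-1)" if "f : FS v" for f
  using clH_rS[OF v that] FA_Sg_Hg[OF v that] by auto
 have "(%x. clH (-1) (rS v x)) : Ring.ring_hom (SA v) HA"
 proof (rule ring_hom_memI)
  fix x y assume x: "x : carrier (SA v)" and y: "y : carrier (SA v)"
  obtain f g where f: "f : FS v" "x = clS (-1) v f" and g: "g : FS v" "y = clS (-1) v g"
   using SD(3)[OF v x] SD(3)[OF v y] by blast
  show "clH (-1) (rS v x) : carrier HA" unfolding f(2) using c[OF f(1)] HD(2) by simp
  have "x \<otimes>\<^bsub>SA v\<^esub> y = clS (-1) v (f * g)" using SD(5)[OF v f(1) g(1)] f g by simp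
  then show "clH (-1) (rS v (x \<otimes>\<^bsub>SA v\<^esub> y)) = clH (-1) (rS v x) \<otimes>\<^bsub>HA\<^esub> clH (-1) (rS v y)"
   unfolding f(2) g(2) using c[OF f(1)] c[OF g(1)] c(1)[OF FA_mult[OF f(1) g(1)]] HD(5)[of f g] by simp
  have "x \<oplus>\<^bsub>SA v\<^esub> y = clS (-1) v (f + g)" using SD(4)[OF v f(1) g(1)] f g by simp
  then show "clH (-1) (rS v (x \<oplus>\<^bsub>SA v\<^esub> y)) = clH (-1) (rS v x) \<oplus>\<^bsub>HA\<^esub> clH (-1) (rS v y)"
   unfolding f(2) g(2) using c[OF f(1)] c[OF g(1)] c(1)[OF FM_add[OF f(1) g(1)]] HD(4)[of f g] by simp
 next
  show "clH (-1) (rS v \<one>\<^bsub>SA v\<^esub>) = \<one>\<^bsub>HA\<^esub>" using SD(6)[OF v] HD(6) c(1)[of 1] by simp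
 qed
 moreover have "clH (-1) (rS v (a \<odot>\<^bsub>SA v\<^esub> x)) = a \<odot>\<^bsub>HA\<^esub> clH (-1) (rS v x)" if a: "a : K" and x: "x : carrier (SA v)" for a x
 proof -
  obtain f where f: "f : FS v" "x = clS (-1) v f" using SD(3)[OF v x] by blast
  have "a \<odot>\<^bsub>SA v\<^esub> x = clS (-1) v (smul a f)" using SD(7)[OF v a f(1)] f by simp
  then show ?thesis
   unfolding f(2) using c[OF f(1)] c(1)[OF FM_smul[OF a f(1)]] HD(7)[OF a, of f] by simp
 qed
 ultimately show ?thesis unfolding algebra_hom_def by simp
qed

lemma G_hom: "(%b. clH (-1) (rG b)) : algebra_hom K GA HA"
proof -
 have "(%b. clH (-1) (rG b)) : Ring.ring_hom GA HA"
 proof (rule ring_hom_memI)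
  fix x y assume x: "x : carrier GA" and y: "y : carrier GA"
  note r = rG_FA[OF x[unfolded GA_sel]] rG_FA[OF y[unfolded GA_sel]]
  show "clH (-1) (rG x) : carrier HA" using r HD(2) by simp
  have "x \<otimes>\<^bsub>GA\<^esub> y : FM K (CG (-1))"
   unfolding GA_sel using x y Gamma_closed(1)[OF m1] by (intro FM_lin[where S = "CG (-1)"] FM_single) (auto simp: GA_sel)
  from clH_eq[OF m1 rG_FA[OF this] FA_mult[OF r]] show "clH (-1) (rG (x \<otimes>\<^bsub>GA\<^esub> y)) = clH (-1) (rG x) \<otimes>\<^bsub>HA\<^esub> clH (-1) (rG y)"
   using rG_mult x y HD(5)[OF r] by (simp add: GA_sel(1))
  show "clH (-1) (rG (x \<oplus>\<^bsub>GA\<^esub> y)) = clH (-1) (rG x) \<oplus>\<^bsub>HA\<^esub> clH (-1) (rG y)"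
   using HD(4)[OF r] by (simp add: GA_sel rG_simps)
 next
  have "single [Gr (1\<^sub>m n)] 1 : FH (-1)" using one_W gens_Hg by blast
  then show "clH (-1) (rG \<one>\<^bsub>GA\<^esub>) = \<one>\<^bsub>HA\<^esub>"
   using relations_J(4) clH_eq[OF m1, of "single [Gr (1\<^sub>m n)] 1" 1] HD(6) by (simp add: GA_sel rG_simps)
 qed
 then show ?thesis unfolding algebra_hom_def using HD(7) rG_FA by (simp add: GA_sel rG_simps)
qed

text \<open>Evaluating at the vector \<open>un\<close> shows that the three subalgebras embed into the restricted algebra.\<close>

lemma J_Sg:
 assumes v: "XY v" and f: "f : J (-1)" "f : FS v"
 shows "f : JS (-1) v"
proof -
 obtain h where h: "h : FN" "emb v h = f" using emb_index[OF v f(2)] by blast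
 note N = act_J[OF f(1), folded h(2)]
 show ?thesis
 proof (cases "v = Xg")
  case True
  let ?Q = "%(u, g :: complex mat, w :: nat list). if w = [] then single (map Xg u) 1 else (0 :: falg)"
  have "lin ?Q (act (emb v h) un) : JS (-1) Xg"
  proof (rule NN_lin[OF _ _ _ _ _ N])
   show "lin (%w. ?Q (w, g, v)) h : JS (-1) Xg" if "h : JN Xg" for h g v
    using that by (cases "v = []") (simp_all add: JSm JN_def emb_lin)
   show "lin (%w. ?Q (u, g, w)) h : JS (-1) Xg" if "h : JN Yg" for h u g
    using JN_const[OF that] by (simp add: lin_if_Nil JSm)
  qed (simp_all add: JSm)
  moreover have "lin ?Q (act (emb v h) un) = f" unfolding h(2)[symmetric] True act_X_word by (simp add: lin_lin emb_lin)
  ultimately show ?thesis using True by simp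
 next
  case False
  then have vY: "v = Yg" using v by simp
  let ?Q = "%(u :: nat list, g :: complex mat, w). if u = [] then single (map Yg w) 1 else (0 :: falg)"
  have "lin ?Q (act (emb v h) un) : JS (-1) Yg"
  proof (rule NN_lin[OF _ _ _ _ _ N])
   show "lin (%w. ?Q (u, g, w)) h : JS (-1) Yg" if "h : JN Yg" for h g u
    using that by (cases "u = []") (simp_all add: JSm JN_def emb_lin)
   show "lin (%w. ?Q (w, g, v)) h : JS (-1) Yg" if "h : JN Xg" for h v g
    using JN_const[OF that] by (simp add: lin_if_Nil JSm)
  qed (simp_all add: JSm)
  moreover have "act (emb Yg h) un = Ty h" using act_Ty[OF h(1), of 1] by (simp flip: single_Nil_one) (simp add: single_Nil_one)
  then have "lin ?Q (act (emb v h) un) = f" using h(2) by (simp add: vY lin_lin emb_lin)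
  ultimately show ?thesis using vY by simp
 qed
qed

lemma J_G:
 assumes b: "b : FM K (CG (-1))" and "rG b : J (-1)"
 shows "b = 0"
proof -
 let ?Q = "%(u :: nat list, g :: complex mat, w :: nat list). if u = [] then if w = [] then single g 1 else 0 else (0 :: complex mat \<Rightarrow>\<^sub>0 complex)"
 have "lin ?Q (act (rG b) un) : {0}"
 proof (rule NN_lin[OF _ _ _ _ _ act_J[OF assms(2)]])
  show "lin (%w. ?Q (u, g, w)) h : {0}" if "h : JN Yg" for h g u
   using JN_const[OF that] by (cases "u = []") (simp_all add: lin_if_Nil)
  show "lin (%w. ?Q (w, g, v)) h : {0}" if "h : JN Xg" for h v g
   using JN_const[OF that] by (simp add: lin_if_Nil)
 qed simp_all
 moreover have "lin ?Q (act (rG b) un) = lin (%g. single g 1) b"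
  unfolding act_def rG_def lin_lin
 proof (rule lin_cong)
  fix g assume "g : keys b"
  then have "g : carrier_mat n n" using b GammaD(7)[OF m1] by (auto simp: FM_def)
  then show "lin (%w. lin ?Q (foldr opM w un)) (single [Gr g] 1) = single g 1" by (simp add: opM_def GM_simps)
 qed
 ultimately show ?thesis by simp
qed

lemma image_pairE: "s : (%(a, b). f a b) ` (S \<times> T) ==> \<exists>a\<in>S. \<exists>b\<in>T. s = f a b"
 by auto

text \<open>A linear map from the coinvariant algebra to a tensor product, known on words, vanishes on the ideal.\<close>

lemma tp_lin:
 assumes MN: "kclosed M" "kclosed N" and v: "XY v"
  and add: "\<And>a b. a : carrier (SA v) ==> b : carrier (SA v) ==> q (a \<oplus>\<^bsub>SA v\<^esub> b) = q a \<oplus>\<^bsub>tensor K M N\<^esub> q b"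
  and smu: "\<And>c a. c : K ==> a : carrier (SA v) ==> q (c \<odot>\<^bsub>SA v\<^esub> a) = c \<odot>\<^bsub>tensor K M N\<^esub> q a"
  and word: "\<And>w. w : lists {..<n} ==> q (clS (-1) v (single (map v w) 1)) = tp M N (single (k w) 1)"
  and h: "h : JN v"
 shows "lin (%w. single (k w) 1) h : tU M N"
proof -
 let ?c = "clS (-1) v"
 note D = SD(2)[OF v] SD(4)[OF v] SD(7)[OF v]
 have zero: "q (?c 0) = tp M N 0"
 proof -
  have "?c (smul 0 1) = 0 \<odot>\<^bsub>SA v\<^esub> ?c 1" using D(3)[OF K_0, of 1] by simp
  then have "q (?c 0) = 0 \<odot>\<^bsub>tensor K M N\<^esub> tp M N (single (k []) 1)"
   using smu[OF K_0 D(1)[OF FA_1]] word[of "[]"] by (simp add: single_Nil_one)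
  then show ?thesis by (simp add: tensor_sel(3)[OF MN K_0])
 qed
 have "tp M N (lin (%w. single (k w) 1) f) = q (?c (emb v f))" if "f : FN" for f
  using that
 proof (induction rule: FM_induct)
  case (add f g)
  then show ?case
   using assms(4)[OF D(1) D(1), of "emb v f" "emb v g"] D(2)[of "emb v f" "emb v g"] emb_FA
   by (simp add: lin_add hm_simps tensor_sel(2)[OF MN, symmetric])
 next
  case (single w a)
  have w: "single (map v w) 1 : FS v" using map_Sg[OF single(1)] by auto
  have "?c (single (map v w) a) = a \<odot>\<^bsub>SA v\<^esub> ?c (single (map v w) 1)" using D(3)[OF single(2) w] by simp
  then have "q (?c (single (map v w) a)) = tp M N (smul a (single (k w) 1))"
   using smu[OF single(2) D(1)[OF w]] word[OF single(1)] by (simp add: tensor_sel(3)[OF MN single(2)])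
  then show ?case by (simp add: emb_word)
 qed (simp add: hm_simps zero)
 moreover have "?c (emb v h) = ?c 0" using h emb_FA clS_eq[OF v, of "emb v h" 0] by (auto simp: JN_def)
 ultimately have "tp M N (lin (%w. single (k w) 1) h) = tp M N 0" using h zero by (simp add: JN_def)
 then show ?thesis by (simp add: tp_eq)
qed

text \<open>The inverse of the multiplication map applies an element to \<open>un\<close> and reads the result in the tensor product;
 this is well defined on the restricted algebra because \<open>J\<close> maps into \<open>NN\<close>.\<close>

theorem triangular:
 shows "triangular_decomposition K HA XA GA YA (%x. clH (-1) (rS Xg x)) (%b. clH (-1) (rG b)) (%y. clH (-1) (rS Yg y))"
proof -
 let ?AB = "tensor K XA GA"
 let ?T = "tensor K ?AB YA"
 define cx where "cx u = clS (-1) Xg (single (map Xg u) 1)" for u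
 define cy where "cy u = clS (-1) Yg (single (map Yg u) 1)" for u
 \<comment> \<open>\<open>Q\<close> reads basis vectors as pure tensors; \<open>Phi\<close>, its extension, is the inverse of the multiplication map.\<close>
 define Q :: "nat list \<times> complex mat \<times> nat list => _" where
  "Q = (%(u, g, v). single (pure_tensor K XA GA (cx u) (single g 1), cy v) (1::complex))"
 define Phi where "Phi x = tp ?AB YA (lin Q x)" for x
 have kX: "kclosed XA" and kY: "kclosed YA" using SD(1) assoc_kclosed by blast+
 note kAB = tensor_kclosed[OF kX GA_kclosed]
 note T = tensor_sel[OF kAB kY]
 obtain r where r: "jlin ?AB r" "\<And>a b. a : carrier XA ==> b : carrier GA ==> r (pure_tensor K XA GA a b) - rS Xg a * rG b : J (-1)"
  using tensor_jlin[OF kX GA_kclosed rS_jlin rG_jlin] by auto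
 obtain t where t: "jlin ?T t" "\<And>a b. a : carrier ?AB ==> b : carrier YA ==> t (pure_tensor K ?AB YA a b) - r a * rS Yg b : J (-1)"
  using tensor_jlin[OF kAB kY r(1) rS_jlin] by auto
 define mu where "mu z = clH (-1) (t z)" for z
 note tF = t(1)[unfolded jlin_def, THEN conjunct1, rule_format]
 have rSF: "rS Xg a : FH (-1)" "rS Yg b : FH (-1)" if "a : carrier XA" "b : carrier YA" for a b
  using rS_jlin[of Xg] rS_jlin[of Yg] that by (simp_all add: jlin_def)
 have mu_add: "mu (x \<oplus>\<^bsub>?T\<^esub> y) = mu x \<oplus>\<^bsub>HA\<^esub> mu y" if xy: "x : carrier ?T" "y : carrier ?T" for x y
 proof -
  have "x \<oplus>\<^bsub>?T\<^esub> y : carrier ?T" using tensor_kclosed[OF kAB kY] xy by (simp add: kclosed_def)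
  then have "mu (x \<oplus>\<^bsub>?T\<^esub> y) = clH (-1) (t x + t y)"
   unfolding mu_def using tF xy t(1) by (subst clH_eq[OF m1]) (auto simp: jlin_def)
  then show ?thesis using HD(4)[OF tF[OF xy(1)] tF[OF xy(2)]] by (simp add: mu_def)
 qed
 have mu_smul: "mu (a \<odot>\<^bsub>?T\<^esub> x) = a \<odot>\<^bsub>HA\<^esub> mu x" if a: "a : K" and x: "x : carrier ?T" for a x
 proof -
  have "a \<odot>\<^bsub>?T\<^esub> x : carrier ?T" using tensor_kclosed[OF kAB kY] a x by (simp add: kclosed_def)
  then have "mu (a \<odot>\<^bsub>?T\<^esub> x) = clH (-1) (smul a (t x))"
   unfolding mu_def using tF a x t(1) by (subst clH_eq[OF m1]) (auto simp: jlin_def)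
  then show ?thesis using HD(7)[OF a tF[OF x]] by (simp add: mu_def)
 qed
 have mu_pure: "mu (pure_tensor K ?AB YA (pure_tensor K XA GA a b) y) = clH (-1) (rS Xg a * rG b * rS Yg y)"
  if a: "a : carrier XA" and b: "b : carrier GA" and y: "y : carrier YA" for a b y
 proof -
  note p = pure_carrier[OF kX GA_kclosed a b]
  have F: "rS Xg a * rG b * rS Yg y : FH (-1)"
   using rSF a y rG_FA b by (intro FA_mult) (auto simp: GA_sel)
  have "t (pure_tensor K ?AB YA (pure_tensor K XA GA a b) y) - rS Xg a * rG b * rS Yg y : J (-1)"
  proof (rule J_trans[OF t(2)[OF p y]])
   have "(r (pure_tensor K XA GA a b) - rS Xg a * rG b) * rS Yg y : J (-1)" by (rule Jm(8)[OF r(2)[OF a b] rSF(2)[OF a y]])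
   then show "r (pure_tensor K XA GA a b) * rS Yg y - rS Xg a * rG b * rS Yg y : J (-1)" by (simp add: left_diff_distrib)
  qed
  then show ?thesis unfolding mu_def using clH_eq[OF m1 tF[OF pure_carrier[OF kAB kY p y]] F] by blast
 qed
 have cX: "cx u : carrier XA" "cy u : carrier YA" if "u : lists {..<n}" for u
  unfolding cx_def cy_def using map_Sg[OF that] by (auto intro!: SD(2) FM_single)
 have Gc: "single g 1 : carrier GA" if "g : CG (-1)" for g using that by (auto simp: GA_sel)
 have Phi_simps: "Phi (x + y) = Phi x \<oplus>\<^bsub>?T\<^esub> Phi y" "a : K ==> Phi (smul a x) = a \<odot>\<^bsub>?T\<^esub> Phi x" for x y a
  unfolding Phi_def by (simp_all add: lin_simps T)
 have Phi_carrier: "Phi x : carrier ?T" if "x : MK" for x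
  unfolding Phi_def T(1)
 proof (rule imageI, rule FM_lin[OF that])
  fix w assume "w : MB"
  then obtain u g v where w: "w = (u, g, v)" "u : lists {..<n}" "g : CG (-1)" "v : lists {..<n}" by (auto simp: MB_def)
  show "Q w : FM K (carrier ?AB \<times> carrier YA)"
   unfolding Q_def w(1) prod.case using pure_carrier[OF kX GA_kclosed cX(1)[OF w(2)] Gc[OF w(3)]] cX(2)[OF w(4)]
   by (intro FM_single) auto
 qed
 have Phi_base: "Phi (single (u, g, v) 1) = pure_tensor K ?AB YA (pure_tensor K XA GA (cx u) (single g 1)) (cy v)" for u g v
  by (simp add: Phi_def T Q_def)
 have mu_Phi: "mu (Phi x) = clH (-1) (Wd x)" if "x : MK" for x
  using that
 proof (induction rule: MK_induct)
  case zero
  have "Phi 0 = 0 \<odot>\<^bsub>?T\<^esub> Phi 0" using Phi_simps(2)[of 0 0] by simp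
  then have "mu (Phi 0) = 0 \<odot>\<^bsub>HA\<^esub> mu (Phi 0)" using mu_smul[OF K_0 Phi_carrier[OF FM_0]] by simp
  also have "\<dots> = clH (-1) (smul 0 (t (Phi 0)))" using HD(7)[OF K_0 tF[OF Phi_carrier[OF FM_0]]] by (simp add: mu_def)
  finally show ?case by (simp add: Wd_simps)
 next
  case (add a b)
  then show ?case
   using mu_add[OF Phi_carrier[OF add(1)] Phi_carrier[OF add(2)]] HD(4)[OF Wd_FA[OF add(1)] Wd_FA[OF add(2)]]
   by (simp add: Phi_simps Wd_simps)
 next
  case (single u g v a)
  let ?b = "single (u, g, v) (1::complex)"
  have b: "?b : MK" using single by (auto simp: MB_def intro!: FM_single)
  have R: "rS Xg (cx u) - single (map Xg u) 1 : J (-1)" "rS Yg (cy v) - single (map Yg v) 1 : J (-1)"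
   unfolding cx_def cy_def using map_Sg single by (auto intro!: JS_J[OF _ rS(2)] FM_single)
  note F = rSF[OF cX(1)[OF single(1)] cX(2)[OF single(3)]]
  have G: "single [Gr g] 1 : FH (-1)" using single gens_Hg by blast
  have M: "single (map Xg u) 1 : FH (-1)" using word_Hg[OF single(1), of Xg] by auto
  have "(rS Xg (cx u) - single (map Xg u) 1) * (single [Gr g] 1 * rS Yg (cy v))
    + (single (map Xg u) 1 * single [Gr g] 1) * (rS Yg (cy v) - single (map Yg v) 1) : J (-1)"
   by (rule Jm(4)[OF Jm(8)[OF R(1) FA_mult[OF G F(2)]] Jm(7)[OF R(2) FA_mult[OF M G]]])
  also have "(rS Xg (cx u) - single (map Xg u) 1) * (single [Gr g] 1 * rS Yg (cy v))
    + (single (map Xg u) 1 * single [Gr g] 1) * (rS Yg (cy v) - single (map Yg v) 1)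
   = rS Xg (cx u) * rG (single g 1) * rS Yg (cy v) - Wd ?b"
   by (simp add: rG_simps Wd_simps algebra_simps del: mult_words) simp
  finally have "mu (Phi ?b) = clH (-1) (Wd ?b)"
   unfolding Phi_base mu_pure[OF cX(1)[OF single(1)] Gc[OF single(2)] cX(2)[OF single(3)]]
   using clH_eq[OF m1 _ Wd_FA[OF b]] FA_mult[OF FA_mult[OF F(1) G] F(2)] by (simp add: rG_simps)
  moreover have e: "single (u, g, v) a = smul a ?b" by simp
  ultimately show ?case
   unfolding e Phi_simps(2)[OF single(4)] mu_smul[OF single(4) Phi_carrier[OF b]] Wd_simps(3)
   using HD(7)[OF single(4) Wd_FA[OF b]] by simp
 qed
 have Phi_surj: "\<exists>x\<in>MK. z = Phi x" if z: "z : carrier ?T" for z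
 proof (rule spanned_induct[OF spanned_tensor[OF kAB kY spanned_tensor[OF kX GA_kclosed
     quotient_spanned[OF coinvariant_quotient[OF m1]] GA_spanned] quotient_spanned[OF coinvariant_quotient[OF m1]]] z])
  show "\<exists>x\<in>MK. a \<oplus>\<^bsub>?T\<^esub> b = Phi x" if ab: "\<exists>x\<in>MK. a = Phi x" "\<exists>x\<in>MK. b = Phi x" for a b
  proof -
   obtain x y where "x : MK" "a = Phi x" "y : MK" "b = Phi y" using ab by blast
   then show ?thesis by (intro bexI[of _ "x + y"] FM_add) (simp_all only: Phi_simps(1))
  qed
  show "\<exists>x\<in>MK. c \<odot>\<^bsub>?T\<^esub> a = Phi x" if c: "c : K" and a: "a : carrier ?T" and ca: "(\<exists>x\<in>MK. a = Phi x) \<or> c = 0" for c a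
  proof (cases "c = 0")
   case True
   obtain f where "a = tp ?AB YA f" using a unfolding T(1) by blast
   then have "c \<odot>\<^bsub>?T\<^esub> a = Phi 0" using True by (simp add: T(3)[OF K_0] Phi_def)
   then show ?thesis by blast
  next
   case False
   then obtain x where "x : MK" "a = Phi x" using ca by blast
   then show ?thesis by (intro bexI[of _ "smul c x"] FM_smul c) (simp_all only: Phi_simps(2)[OF c])
  qed
  fix s
  assume "s : (%(a, b). pure_tensor K ?AB YA a b) ` (((%(a, b). pure_tensor K XA GA a b) `
   ((%w. clS (-1) Xg (single w 1)) ` lists (Sg Xg) \<times> (%g. single g 1) ` CG (-1))) \<times> (%w. clS (-1) Yg (single w 1)) ` lists (Sg Yg))"
  from image_pairE[OF this] obtain e y where e: "e : (%(a, b). pure_tensor K XA GA a b) `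
   ((%w. clS (-1) Xg (single w 1)) ` lists (Sg Xg) \<times> (%g. single g 1) ` CG (-1))"
   "y : (%w. clS (-1) Yg (single w 1)) ` lists (Sg Yg)" "s = pure_tensor K ?AB YA e y" by (elim bexE)
  from image_pairE[OF e(1)] e(2) obtain w g w' where *: "w : lists (Sg Xg)" "g : CG (-1)" "w' : lists (Sg Yg)"
   "s = pure_tensor K ?AB YA (pure_tensor K XA GA (clS (-1) Xg (single w 1)) (single g 1)) (clS (-1) Yg (single w' 1))"
   unfolding e(3) by (elim bexE imageE) simp
  obtain u v where uv: "u : lists {..<n}" "w = map Xg u" "v : lists {..<n}" "w' = map Yg v"
   using *(1,3) unfolding lists_Sg by blast
  have "single (u, g, v) 1 : MK" using uv *(2) by (auto simp: MB_def intro!: FM_single)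
  moreover have "s = Phi (single (u, g, v) 1)" unfolding Phi_base *(4) cx_def cy_def uv ..
  ultimately show "\<exists>x\<in>MK. s = Phi x" by blast
 qed simp_all
 have Phi_NN: "lin Q x : tU ?AB YA" if "x : NN" for x
 proof (rule NN_lin[OF tU_closed(1,2) tU_closed(3) _ _ that])
  fix h g and v :: "nat list" assume h: "h : JN Xg" and g: "g : CG (-1)" and v: "v : lists {..<n}"
  show "lin (%w. Q (w, g, v)) h : tU ?AB YA"
   unfolding Q_def prod.case
  proof (rule tp_lin[OF kAB kY _ _ _ _ h, where q = "%a. pure_tensor K ?AB YA (pure_tensor K XA GA a (single g 1)) (cy v)"])
   note p = pure_carrier[OF kX GA_kclosed _ Gc[OF g]] and y = cX(2)[OF v]
   show "pure_tensor K ?AB YA (pure_tensor K XA GA (a \<oplus>\<^bsub>XA\<^esub> b) (single g 1)) (cy v)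
    = pure_tensor K ?AB YA (pure_tensor K XA GA a (single g 1)) (cy v) \<oplus>\<^bsub>?T\<^esub> pure_tensor K ?AB YA (pure_tensor K XA GA b (single g 1)) (cy v)"
    if "a : carrier XA" "b : carrier XA" for a b
    unfolding pure_bilinear(1)[OF kX GA_kclosed that Gc[OF g] Gc[OF g] K_0] pure_bilinear(1)[OF kAB kY p[OF that(1)] p[OF that(2)] y y K_0] ..
   show "pure_tensor K ?AB YA (pure_tensor K XA GA (c \<odot>\<^bsub>XA\<^esub> a) (single g 1)) (cy v)
    = c \<odot>\<^bsub>?T\<^esub> pure_tensor K ?AB YA (pure_tensor K XA GA a (single g 1)) (cy v)"
    if "c : K" "a : carrier XA" for c a
    unfolding pure_bilinear(3)[OF kX GA_kclosed that(2,2) Gc[OF g] Gc[OF g] that(1)] pure_bilinear(3)[OF kAB kY p[OF that(2)] p[OF that(2)] y y that(1)] ..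
  qed (simp_all add: T cx_def)
 next
  fix h g and u :: "nat list" assume h: "h : JN Yg" and u: "u : lists {..<n}" and g: "g : CG (-1)"
  show "lin (%w. Q (u, g, w)) h : tU ?AB YA"
   unfolding Q_def prod.case
  proof (rule tp_lin[OF kAB kY _ _ _ _ h, where q = "pure_tensor K ?AB YA (pure_tensor K XA GA (cx u) (single g 1))"])
   note p = pure_carrier[OF kX GA_kclosed cX(1)[OF u] Gc[OF g]]
   show "pure_tensor K ?AB YA (pure_tensor K XA GA (cx u) (single g 1)) (a \<oplus>\<^bsub>YA\<^esub> b)
    = pure_tensor K ?AB YA (pure_tensor K XA GA (cx u) (single g 1)) a \<oplus>\<^bsub>?T\<^esub> pure_tensor K ?AB YA (pure_tensor K XA GA (cx u) (single g 1)) b"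
    if "a : carrier YA" "b : carrier YA" for a b
    by (rule pure_bilinear(2)[OF kAB kY p p that K_0])
   show "pure_tensor K ?AB YA (pure_tensor K XA GA (cx u) (single g 1)) (c \<odot>\<^bsub>YA\<^esub> a)
    = c \<odot>\<^bsub>?T\<^esub> pure_tensor K ?AB YA (pure_tensor K XA GA (cx u) (single g 1)) a"
    if "c : K" "a : carrier YA" for c a
    by (rule pure_bilinear(4)[OF kAB kY p p that(2,2) that(1)])
  qed (simp_all add: T cy_def)
 qed simp_all
 have "mu : linear_iso K ?T HA"
 proof -
  have "inj_on mu (carrier ?T)"
  proof (rule inj_onI)
   fix z z' assume z: "z : carrier ?T" "z' : carrier ?T" "mu z = mu z'"
   obtain x x' where x: "x : MK" "z = Phi x" "x' : MK" "z' = Phi x'" using Phi_surj[OF z(1)] Phi_surj[OF z(2)] by blast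
   have "Wd (x - x') : J (-1)"
    using z(3) clH_eq[OF m1 Wd_FA[OF x(1)] Wd_FA[OF x(3)]] by (simp add: x mu_Phi Wd_simps)
   from act_J[OF this] have "x - x' : NN" using act_Wd[OF FM_diff[OF x(1,3)]] by simp
   from Phi_NN[OF this] show "z = z'" unfolding x Phi_def tp_eq lin_diff .
  qed
  moreover have "mu ` carrier ?T = carrier HA"
  proof (rule subset_antisym; rule subsetI)
   show "y : carrier HA" if "y : mu ` carrier ?T" for y using that tF HD(2) by (auto simp: mu_def)
   fix y assume "y : carrier HA"
   then obtain f where f: "f : FH (-1)" "y = clH (-1) f" using HD(3) by blast
   have x: "act f un : MK" by (rule act_MK[OF f(1) un_MK])
   have "y = mu (Phi (act f un))"
    unfolding mu_Phi[OF x] f(2) using clH_eq[OF m1 f(1) Wd_FA[OF x]] normal_form[OF f(1)] by simp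
   then show "y : mu ` carrier ?T" using Phi_carrier[OF x] by blast
  qed
  ultimately show ?thesis using mu_add mu_smul by (simp add: linear_iso_def bij_betw_def)
 qed
 moreover have pur: "\<forall>a\<in>carrier XA. \<forall>b\<in>carrier GA. \<forall>y\<in>carrier YA. mu (pure_tensor K ?AB YA (pure_tensor K XA GA a b) y)
   = clH (-1) (rS Xg a) \<otimes>\<^bsub>HA\<^esub> clH (-1) (rG b) \<otimes>\<^bsub>HA\<^esub> clH (-1) (rS Yg y)"
 proof (intro ballI)
  fix a b y assume a: "a : carrier XA" and b: "b : carrier GA" and y: "y : carrier YA"
  note F = rSF[OF a y] rG_FA[OF b[unfolded GA_sel]]
  show "mu (pure_tensor K ?AB YA (pure_tensor K XA GA a b) y)
   = clH (-1) (rS Xg a) \<otimes>\<^bsub>HA\<^esub> clH (-1) (rG b) \<otimes>\<^bsub>HA\<^esub> clH (-1) (rS Yg y)"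
   unfolding mu_pure[OF a b y] HD(5)[OF FA_mult[OF F(1,3)] F(2)] HD(5)[OF F(1,3)] ..
 qed
 have inj: "inj_on (%x. clH (-1) (rS v x)) (carrier (SA v))" if v: "XY v" for v
 proof (rule inj_onI)
  fix x y assume xy: "x : carrier (SA v)" "y : carrier (SA v)" "clH (-1) (rS v x) = clH (-1) (rS v y)"
  note x = rS(1)[OF v xy(1)] and y = rS(1)[OF v xy(2)]
  note F = x[THEN conjunct1] y[THEN conjunct1]
  have "rS v x - rS v y : J (-1)" using xy(3) clH_eq[OF m1 FA_Sg_Hg[OF v F(1)] FA_Sg_Hg[OF v F(2)]] by simp
  from J_Sg[OF v this FM_diff[OF F]] show "x = y" using clS_eq[OF v F] x y by simp
 qed
 moreover have "inj_on (%b. clH (-1) (rG b)) (carrier GA)"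
 proof (rule inj_onI)
  fix x y assume xy: "x : carrier GA" "y : carrier GA" "clH (-1) (rG x) = clH (-1) (rG y)"
  then have xy': "x : FM K (CG (-1))" "y : FM K (CG (-1))" by (simp_all add: GA_sel)
  have "rG (x - y) : J (-1)" using xy(3) clH_eq[OF m1 rG_FA[OF xy'(1)] rG_FA[OF xy'(2)]] by (simp add: rG_simps)
  from J_G[OF FM_diff[OF xy'] this] show "x = y" by simp
 qed
 ultimately show ?thesis
  unfolding triangular_decomposition_def using pur S_hom[of Xg] S_hom[of Yg] G_hom inj[of Xg] inj[of Yg]
  by (intro conjI bexI[of _ mu]) simp_all
qed

end

theorem theorem6p1:
  fixes m p n :: nat and K :: "complex set"
    and c\<^sub>1 :: complex and c :: "complex \<Rightarrow> complex"
  defines "G \<equiv> G_group m p n"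
    and "W \<equiv> mu_G_group m p n"
  defines "\<kappa> \<equiv> kappa_G m p n (- c\<^sub>1) (\<lambda>\<zeta>. - c \<zeta>)"
    and "\<kappa>' \<equiv> kappa_W m p n c\<^sub>1 c"
  defines "Twist \<equiv> cocycle_twist K n (cocycle_F K n) (T_action K n G 1 \<kappa>) (restricted_alg K n G 1 \<kappa>)"
    and "H \<equiv> restricted_alg K n W (- 1) \<kappa>'"
  assumes "m > 0" "p > 0" "n > 0" "p dvd m" "even m"
    and "subfield K (ring_of_type_algebra :: complex ring)"
    and "unity_roots m \<subseteq> K"
    and "c\<^sub>1 \<in> K"
    and "\<And>\<zeta>. \<zeta> \<in> unity_roots (m div p) - {1} \<Longrightarrow> c \<zeta> \<in> K"
  shows "assoc_algebra (scalars K) Twist \<and> assoc_algebra (scalars K) H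
      \<and> (\<exists>\<phi>. \<phi> \<in> algebra_iso K Twist H)
      \<and> (\<exists>\<alpha> \<beta> \<gamma>.
            triangular_decomposition K H
              (coinvariant_algebra K n W (- 1) Xg) (monoid_algebra K W) (coinvariant_algebra K n W (- 1) Yg)
              \<alpha> \<beta> \<gamma>
          \<and> (\<forall>i<n. \<alpha> (coinvariant_class K n W (- 1) Xg i) = restricted_class K n W (- 1) \<kappa>' (Xg i))
          \<and> (\<forall>g\<in>carrier W. \<beta> (Poly_Mapping.single g 1) = restricted_class K n W (- 1) \<kappa>' (Gr g))
          \<and> (\<forall>i<n. \<gamma> (coinvariant_class K n W (- 1) Yg i) = restricted_class K n W (- 1) \<kappa>' (Yg i)))"
proof -
 interpret C: cher K m p n c\<^sub>1 c
  by (rule cher.intro[OF subK.intro cher_axioms.intro]) (fact assms)+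
 have W: "W = Gq (-1) m p n" and G: "G = Gq 1 m p n" by (simp_all add: W_def G_def Gq_def)
 have k: "\<kappa>' = kq (-1) m p n c\<^sub>1 c" "\<kappa> = kq 1 m p n c\<^sub>1 c" by (simp_all add: \<kappa>_def \<kappa>'_def kappa_G_eq kappa_W_eq)
 have one: "(1::complex) = 1 \<or> (1::complex) = -1" by simp
 have T: "Twist = C.Tw 1" by (simp add: Twist_def C.Tw_def G k)
 have cl: "coinvariant_class K n W (- 1) v i = C.clS (-1) v (single [v i] 1)"
  "restricted_class K n W (- 1) \<kappa>' a = C.clH (-1) (single [a] 1)" for v i a
  by (simp_all add: coinvariant_class_def restricted_class_def C.clS_def C.clH_def W k)
 have S: "single [v i] 1 \<in> FM K (lists (S_gens n v))" if "i < n" for v i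
  using that by (auto simp: S_gens_def intro!: C.FM_single)
 show ?thesis
 proof (intro conjI)
  show "assoc_algebra (scalars K) Twist" unfolding T by (rule C.Tw_assoc_algebra[OF one])
  show "assoc_algebra (scalars K) H" unfolding H_def W k by (rule C.HD(1))
  show "\<exists>\<phi>. \<phi> \<in> algebra_iso K Twist H" unfolding T H_def W k using C.twist_isomorphism[OF one] by simp
  show "\<exists>\<alpha> \<beta> \<gamma>. triangular_decomposition K H
       (coinvariant_algebra K n W (- 1) Xg) (monoid_algebra K W) (coinvariant_algebra K n W (- 1) Yg) \<alpha> \<beta> \<gamma>
     \<and> (\<forall>i<n. \<alpha> (coinvariant_class K n W (- 1) Xg i) = restricted_class K n W (- 1) \<kappa>' (Xg i))
     \<and> (\<forall>g\<in>carrier W. \<beta> (Poly_Mapping.single g 1) = restricted_class K n W (- 1) \<kappa>' (Gr g))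
     \<and> (\<forall>i<n. \<gamma> (coinvariant_class K n W (- 1) Yg i) = restricted_class K n W (- 1) \<kappa>' (Yg i))"
   unfolding cl
   by (rule exI[of _ "\<lambda>x. C.clH (-1) (C.rS Xg x)"], rule exI[of _ "\<lambda>b. C.clH (-1) (C.rG b)"], rule exI[of _ "\<lambda>x. C.clH (-1) (C.rS Yg x)"])
    (use C.triangular S in \<open>auto simp: H_def W k C.clH_rS C.rG_simps\<close>)
 qed
qed

end
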